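(* Let $k\ge1$, $\boldsymbol h\in\mathrm{ord}_p(\mathcal O_{\mathcal K}\setminus\{0\})^k$ and $\boldsymbol d,\boldsymbol e\in\mathbb Z^k$ with $\boldsymbol e\ge\boldsymbol d$. There is a unique isomorphism of $\mathcal O_{\mathcal K}[[\Gamma]]\otimes_{\mathcal O_{\mathcal K}}\mathcal K$-modules $$I_{\boldsymbol h}^{[\boldsymbol d,\boldsymbol e]}\xrightarrow{\sim}\mathcal D_{\boldsymbol h}^{[\boldsymbol d,\boldsymbol e]}(\Gamma,\mathcal K)$$ such that the image $\mu_s$ of each $s=(s_{\boldsymbol m})_{\boldsymbol m\in\mathbb Z_{\ge0}^k}\in I_{\boldsymbol h}^{[\boldsymbol d,\boldsymbol e]}$ is characterized by $$\kappa(\tilde s_{\boldsymbol m_\kappa})=\int_\Gamma\prod_{j=1}^k(\chi_j^{w_{\kappa,j}}\phi_{\kappa,j})(x_j)\,d\mu_s\qquad\text{for every }\kappa\in\mathfrak X_{\mathcal O_{\mathcal K}[[\Gamma]]}^{[\boldsymbol d,\boldsymbol e]},$$ where $\tilde s_{\boldsymbol m_\kappa}\in\mathcal O_{\mathcal K}[[\Gamma]]\otimes_{\mathcal O_{\mathcal K}}\mathcal K$ is a lift of $s_{\boldsymbol m_\kappa}$. In addition, via this isomorphism, $$\{\mu\in\mathcal D_{\boldsymbol h}^{[\boldsymbol d,\boldsymbol e]}(\Gamma,\mathcal K)\mid v_{\boldsymbol h}^{[\boldsymbol d,\boldsymbol e]}(\mu)\ge c^{[\boldsymbol d,\boldsymbol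 e]}\}\subset\big(I_{\boldsymbol h}^{[\boldsymbol d,\boldsymbol e]}\big)^0\subset\{\mu\in\mathcal D_{\boldsymbol h}^{[\boldsymbol d,\boldsymbol e]}(\Gamma,\mathcal K)\mid v_{\boldsymbol h}^{[\boldsymbol d,\boldsymbol e]}(\mu)\ge0\},$$ where $c^{[\boldsymbol d,\boldsymbol e]}=\sum_{i=1}^kc^{[d_i,e_i]}$ with $c^{[d_i,e_i]}=\mathrm{ord}_p((e_i-d_i)!)+2(e_i-d_i)+\lfloor\frac{e_i-d_i+1}{p-1}\rfloor+1$ if $d_i<e_i$ and $c^{[d_i,e_i]}=0$ if $d_i=e_i$.
   Context: $p$ is a prime, $\mathrm{ord}_p$ is the valuation on $\mathbb C_p$ with $\mathrm{ord}_p(p)=1$, $\mathcal K\subset\mathbb C_p$ is a complete subfield with ring of integers $\mathcal O_{\mathcal K}$. $\langle\boldsymbol a,\boldsymbol b\rangle_k=\sum a_ib_i$; the order on $\mathbb Z^k$ is componentwise; $[\boldsymbol d,\boldsymbol e]=\{\boldsymbol i\in\mathbb Z^k:\boldsymbol d\le\boldsymbol i\le\boldsymbol e\}$. For $x\in\mathrm{ord}_p(\mathcal K^\times)$, $p^{x}$ denotes an element of $\mathcal K$ of valuation $x$ (the choice is irrelevant). For $1\le i\le k$, $\Gamma_i$ is a $p$-adic Lie group with a continuous character $\chi_i:\Gamma_i\to\mathbb Q_p^\times$ inducing $\Gamma_i\cong1+2p\mathbb Z_p$; $\gamma_i$ is a topological generator, $u_i=\chi_i(\gamma_i)$; $\Gamma=\Gamma_1\times\cdots\times\Gamma_k$;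 $[\cdot]:\Gamma\to\mathcal O_{\mathcal K}[[\Gamma]]^\times$ is tautological. $(\Omega_{\boldsymbol m}^{[\boldsymbol d,\boldsymbol e]})$ is the ideal of $\mathcal O_{\mathcal K}[[\Gamma]]$ generated by $\prod_{j=d_i}^{e_i}([\gamma_i]^{p^{m_i}}-u_i^{jp^{m_i}})$, $1\le i\le k$. $I_{\boldsymbol h}^{[\boldsymbol d,\boldsymbol e]}$ is the set of $(s_{\boldsymbol m})_{\boldsymbol m}\in\varprojlim_{\boldsymbol m\in\mathbb Z_{\ge0}^k}\big(\mathcal O_{\mathcal K}[[\Gamma]]/(\Omega_{\boldsymbol m}^{[\boldsymbol d,\boldsymbol e]})\otimes_{\mathcal O_{\mathcal K}}\mathcal K\big)$ with $(p^{\langle\boldsymbol h,\boldsymbol m\rangle_k}s_{\boldsymbol m})_{\boldsymbol m}\in\big(\prod_{\boldsymbol m}\mathcal O_{\mathcal K}[[\Gamma]]/(\Omega_{\boldsymbol m}^{[\boldsymbol d,\boldsymbol e]})\big)\otimes_{\mathcal O_{\mathcal K}}\mathcal K$, and $(I_{\boldsymbol h}^{[\boldsymbol d,\boldsymbol e]})^0$ the subset with $(p^{\langle\boldsymbol h,\boldsymbol m\rangle_k}s_{\boldsymbol m})_{\boldsymbol m}\in\prod_{\boldsymbol m}\mathcal O_{\mathcal K}[[\Gamma]]/(\Omega_{\boldsymbol m}^{[\boldsymbol d,\boldsymbol e]})$. $C^{[\boldsymbol d,\boldsymbol e]}(\Gamma,\mathcal O_{\mathcal K})$ is the $\mathcal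 O_{\mathcal K}$-module of functions $f:\Gamma\to\mathcal O_{\mathcal K}$ such that $(\prod_i\chi_i(x_i)^{-d_i})f(x)$ is, locally on $\Gamma$, of the form $P(\chi_1(x_1),\dots,\chi_k(x_k))$ with $P\in\mathcal O_{\mathcal K}[X_1,\dots,X_k]$ of degree $\le e_i-d_i$ in $X_i$ for all $i$. For $\mu\in\mathrm{Hom}_{\mathcal O_{\mathcal K}}(C^{[\boldsymbol d,\boldsymbol e]}(\Gamma,\mathcal O_{\mathcal K}),\mathcal K)$ put $$v_{\boldsymbol h}^{[\boldsymbol d,\boldsymbol e]}(\mu)=\inf_{\boldsymbol a\in\Gamma,\,\boldsymbol m\in\mathbb Z_{\ge0}^k,\,\boldsymbol i\in[\boldsymbol d,\boldsymbol e]}\Big\{\mathrm{ord}_p\Big(\int_{\boldsymbol a\Gamma^{p^{\boldsymbol m}}}\prod_{j=1}^k(\chi_j(x_j)-\chi_j(a_j))^{i_j-d_j}\chi_j(x_j)^{d_j}\,d\mu\Big)+\langle\boldsymbol h-(\boldsymbol i-\boldsymbol d),\boldsymbol m\rangle_k\Big\},$$ with $\boldsymbol a\Gamma^{p^{\boldsymbol m}}=\prod_ja_j\Gamma_j^{p^{m_j}}$, and $\mathcal D_{\boldsymbol h}^{[\boldsymbol d,\boldsymbol e]}(\Gamma,\mathcal K)=\{\mu: v_{\boldsymbol h}^{[\boldsymbol d,\boldsymbol e]}(\mu)>-\infty\}$. The algebra $\mathcal O_{\mathcal K}[[\Gamma]]$ is identified with $\mathrm{Hom}_{\mathcal O_{\mathcal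 K}}(C(\Gamma,\mathcal O_{\mathcal K}),\mathcal O_{\mathcal K})$ ($C$ = continuous functions; $[a]$ corresponds to the Dirac measure at $a$) and acts on $\mathcal D_{\boldsymbol h}^{[\boldsymbol d,\boldsymbol e]}(\Gamma,\mathcal K)$ by convolution $\int f\,d(\lambda*\mu)=\int\big(\int f(xy)\,d\lambda(x)\big)d\mu(y)$. $\mathfrak X_{\mathcal O_{\mathcal K}[[\Gamma]]}^{[\boldsymbol d,\boldsymbol e]}$ is the set of continuous $\mathcal O_{\mathcal K}$-algebra homomorphisms $\kappa:\mathcal O_{\mathcal K}[[\Gamma]]\to\overline{\mathcal K}$ with $\kappa([\boldsymbol x])=\prod_i\chi_i(x_i)^{w_{\kappa,i}}\phi_{\kappa,i}(x_i)$, where $\boldsymbol w_\kappa\in[\boldsymbol d,\boldsymbol e]$ and each $\phi_{\kappa,i}$ is a finite order character of $\Gamma_i$; $\boldsymbol m_\kappa=(m_{\kappa,1},\dots,m_{\kappa,k})$ with $m_{\kappa,i}$ the smallest $m\ge 0$ such that $\phi_{\kappa,i}$ factors through $\Gamma_i/\Gamma_i^{p^m}$. $\kappa$ and $\mu$ are extended linearly. *)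

theory Defs
  imports
    "HOL-Analysis.Analysis"
    "HOL-Algebra.Subrings"
    "HOL-Algebra.QuotRing"
    "HOL-Algebra.Module"
    "HOL-Algebra.Product_Groups"
    "HOL-Algebra.Free_Abelian_Groups"
begin

section \<open>The field of p-adic complex numbers\<close>

definition Q_p :: "'c::{field_char_0, topological_space} set" where
  "Q_p = closure (range of_rat)"

definition alg_closure_of :: "'c::field set \<Rightarrow> 'c set" where
  "alg_closure_of F = {x. \<exists>f. f \<noteq> 0 \<and> (\<forall>n. poly.coeff f n \<in> F) \<and> poly f x = 0}"

text \<open>The following conditions say that the type is the completion of an algebraic closure of the
  \<open>p\<close>-adic numbers, with its normalised valuation and the induced metric; they
  determine the pair (field, valuation) up to a value-preserving isomorphism.\<close>

locale padic_complex_numbers =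
  fixes p :: nat
    and ord :: "'c::{alg_closed_field, field_char_0, complete_space} \<Rightarrow> ereal"
  assumes prime_p: "prime p"
    and ord_infty: "\<And>x. ord x = \<infinity> \<longleftrightarrow> x = 0"
    and ord_not_minf: "\<And>x. ord x \<noteq> -\<infinity>"
    and ord_mult: "\<And>x y. ord (x * y) = ord x + ord y"
    and ord_add: "\<And>x y. min (ord x) (ord y) \<le> ord (x + y)"
    and ord_p: "ord (of_nat p) = 1"
    and dist_ord: "\<And>x y. x \<noteq> y \<Longrightarrow> dist x y = real p powr (- real_of_ereal (ord (x - y)))"
    and dense: "closure (alg_closure_of Q_p) = (UNIV :: 'c set)"


section \<open>Tensor products\<close>

definition tensor_relations ::
  "('r, 'u) ring_scheme \<Rightarrow> ('r, 'm, 'v) module_scheme \<Rightarrow> ('r, 'n, 'w) module_scheme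
    \<Rightarrow> (('m \<times> 'n) \<Rightarrow>\<^sub>0 int) set" where
  "tensor_relations R M N =
     {frag_of (x \<oplus>\<^bsub>M\<^esub> x', y) - frag_of (x, y) - frag_of (x', y) | x x' y.
        x \<in> carrier M \<and> x' \<in> carrier M \<and> y \<in> carrier N} \<union>
     {frag_of (x, y \<oplus>\<^bsub>N\<^esub> y') - frag_of (x, y) - frag_of (x, y') | x y y'.
        x \<in> carrier M \<and> y \<in> carrier N \<and> y' \<in> carrier N} \<union>
     {frag_of (r \<odot>\<^bsub>M\<^esub> x, y) - frag_of (x, r \<odot>\<^bsub>N\<^esub> y) | r x y.
        r \<in> carrier R \<and> x \<in> carrier M \<and> y \<in> carrier N}"

text \<open>The tensor product as an abelian group; its group operation is written multiplicatively.\<close>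

definition tensor ::
  "('r, 'u) ring_scheme \<Rightarrow> ('r, 'm, 'v) module_scheme \<Rightarrow> ('r, 'n, 'w) module_scheme
    \<Rightarrow> (('m \<times> 'n) \<Rightarrow>\<^sub>0 int) set monoid" where
  "tensor R M N =
     (let F = free_Abelian_group (carrier M \<times> carrier N)
      in F Mod generate F (tensor_relations R M N))"

definition pure_tensor ::
  "('r, 'u) ring_scheme \<Rightarrow> ('r, 'm, 'v) module_scheme \<Rightarrow> ('r, 'n, 'w) module_scheme
    \<Rightarrow> 'm \<Rightarrow> 'n \<Rightarrow> (('m \<times> 'n) \<Rightarrow>\<^sub>0 int) set" where
  "pure_tensor R M N x y =
     (let F = free_Abelian_group (carrier M \<times> carrier N)
      in generate F (tensor_relations R M N) #>\<^bsub>F\<^esub> frag_of (x, y))"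

text \<open>The homomorphism into \<open>H\<close> induced, via the universal property, by a balanced
  biadditive map \<open>b\<close>.\<close>

definition tensor_lift ::
  "('r, 'u) ring_scheme \<Rightarrow> ('r, 'm, 'v) module_scheme \<Rightarrow> ('r, 'n, 'w) module_scheme
    \<Rightarrow> ('h, 'z) monoid_scheme \<Rightarrow> ('m \<Rightarrow> 'n \<Rightarrow> 'h) \<Rightarrow> (('m \<times> 'n) \<Rightarrow>\<^sub>0 int) set \<Rightarrow> 'h" where
  "tensor_lift R M N H b =
     (THE f. f \<in> extensional (carrier (tensor R M N)) \<and> f \<in> hom (tensor R M N) H \<and>
        (\<forall>x\<in>carrier M. \<forall>y\<in>carrier N. f (pure_tensor R M N x y) = b x y))"


section \<open>Auxiliary algebra\<close>

text \<open>A set \<open>S\<close> of scalars closed under the ring operations of the ambient field, as a ring and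
  as a module over any smaller such set.\<close>

definition scalars :: "'c::field set \<Rightarrow> ('c, 'c) module" where
  "scalars S = \<lparr>carrier = S, monoid.mult = (*), one = 1, ring.zero = 0, add = (+), smult = (*)\<rparr>"

definition quot_algebra :: "('r, 'a) module \<Rightarrow> 'a set \<Rightarrow> ('r, 'a set) module" where
  "quot_algebra R J =
     \<lparr>carrier = carrier (R Quot J), monoid.mult = monoid.mult (R Quot J), one = \<one>\<^bsub>R Quot J\<^esub>,
      ring.zero = \<zero>\<^bsub>R Quot J\<^esub>, add = add (R Quot J),
      smult = (\<lambda>c X. (J +>\<^bsub>R\<^esub> (c \<odot>\<^bsub>R\<^esub> \<one>\<^bsub>R\<^esub>)) \<otimes>\<^bsub>R Quot J\<^esub> X)\<rparr>"

definition product_module :: "('i \<Rightarrow> ('r, 'm) module) \<Rightarrow> ('r, 'i \<Rightarrow> 'm) module" where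
  "product_module M =
     \<lparr>carrier = {f. \<forall>i. f i \<in> carrier (M i)},
      monoid.mult = (\<lambda>f g i. f i \<otimes>\<^bsub>M i\<^esub> g i), one = (\<lambda>i. \<one>\<^bsub>M i\<^esub>),
      ring.zero = (\<lambda>i. \<zero>\<^bsub>M i\<^esub>), add = (\<lambda>f g i. f i \<oplus>\<^bsub>M i\<^esub> g i),
      smult = (\<lambda>c f i. c \<odot>\<^bsub>M i\<^esub> f i)\<rparr>"

definition module_iso ::
  "('r, 'u) ring_scheme \<Rightarrow> ('r, 'm, 'v) module_scheme \<Rightarrow> ('r, 'n, 'w) module_scheme
    \<Rightarrow> ('m \<Rightarrow> 'n) set" where
  "module_iso R M N =
     {f \<in> carrier M \<rightarrow>\<^sub>E carrier N. bij_betw f (carrier M) (carrier N) \<and>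
        (\<forall>x\<in>carrier M. \<forall>y\<in>carrier M. f (x \<oplus>\<^bsub>M\<^esub> y) = f x \<oplus>\<^bsub>N\<^esub> f y) \<and>
        (\<forall>r\<in>carrier R. \<forall>x\<in>carrier M. f (r \<odot>\<^bsub>M\<^esub> x) = r \<odot>\<^bsub>N\<^esub> f x)}"

definition topological_group :: "'g monoid \<Rightarrow> 'g topology \<Rightarrow> bool" where
  "topological_group G T \<longleftrightarrow> group G \<and> topspace T = carrier G \<and>
     continuous_map (prod_topology T T) T (\<lambda>(x, y). x \<otimes>\<^bsub>G\<^esub> y) \<and>
     continuous_map T T (m_inv G)"


section \<open>The data\<close>

text \<open>The finite index type \<open>'k\<close> plays the role of \<open>{1, \<dots>, k}\<close>.\<close>

record ('c, 'k, 'g) datum =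
  prm :: nat
  ordp :: "'c \<Rightarrow> ereal"
  fld :: "'c set"
  Gam :: "'k \<Rightarrow> 'g monoid"
  Gtop :: "'k \<Rightarrow> 'g topology"
  chi :: "'k \<Rightarrow> 'g \<Rightarrow> 'c"
  gam :: "'k \<Rightarrow> 'g"

definition val_ring :: "('c, 'k, 'g) datum \<Rightarrow> 'c set" where
  "val_ring A = {x \<in> fld A. 0 \<le> ordp A x}"

definition Z_p :: "('c::{field_char_0, topological_space}, 'k, 'g) datum \<Rightarrow> 'c set" where
  "Z_p A = {x \<in> Q_p. 0 \<le> ordp A x}"

text \<open>The analytic structure of each factor is not recorded: it is determined by the topological
  group, which the character identifies with \<open>1 + 2p\<int>\<^sub>p\<close>.\<close>

definition is_datum ::
  "('c::{alg_closed_field, field_char_0, complete_space}, 'k::finite, 'g) datum \<Rightarrow> bool" where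
  "is_datum A \<longleftrightarrow>
     padic_complex_numbers (prm A) (ordp A) \<and>
     subfield (fld A) (scalars UNIV) \<and> complete (fld A) \<and>
     (\<forall>i. topological_group (Gam A i) (Gtop A i) \<and>
        chi A i \<in> hom (Gam A i) (scalars UNIV) \<and>
        homeomorphic_map (Gtop A i)
          (top_of_set {1 + 2 * of_nat (prm A) * z | z. z \<in> Z_p A}) (chi A i) \<and>
        gam A i \<in> carrier (Gam A i) \<and>
        Gtop A i closure_of generate (Gam A i) {gam A i} = carrier (Gam A i))"

definition Gprod :: "('c, 'k, 'g) datum \<Rightarrow> ('k \<Rightarrow> 'g) monoid" where
  "Gprod A = product_group UNIV (Gam A)"

definition Gprod_top :: "('c, 'k, 'g) datum \<Rightarrow> ('k \<Rightarrow> 'g) topology" where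
  "Gprod_top A = product_topology (Gtop A) UNIV"

definition inner_k :: "('k::finite \<Rightarrow> real) \<Rightarrow> ('k \<Rightarrow> nat) \<Rightarrow> real" where
  "inner_k h m = (\<Sum>i\<in>UNIV. h i * real (m i))"

definition p_power :: "('c, 'k, 'g) datum \<Rightarrow> real \<Rightarrow> 'c" where
  "p_power A x = (SOME c. c \<in> fld A \<and> ordp A c = ereal x)"


section \<open>Functionals and the Iwasawa algebra\<close>

type_synonym ('c, 'k, 'g) functional = "(('k \<Rightarrow> 'g) \<Rightarrow> 'c) \<Rightarrow> 'c"

text \<open>Functions on the group, and functionals on a space \<open>C\<close> of functions, are \<open>undefined\<close> outside
  the group and outside \<open>C\<close>, respectively.\<close>

definition cts :: "('c::{field, topological_space}, 'k, 'g) datum \<Rightarrow> (('k \<Rightarrow> 'g) \<Rightarrow> 'c) set" where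
  "cts A = {f \<in> carrier (Gprod A) \<rightarrow>\<^sub>E val_ring A. continuous_map (Gprod_top A) euclidean f}"

definition functionals ::
  "('c::field, 'k, 'g) datum \<Rightarrow> (('k \<Rightarrow> 'g) \<Rightarrow> 'c) set \<Rightarrow> 'c set
    \<Rightarrow> ('c, ('c, 'k, 'g) functional) module" where
  "functionals A C S =
     \<lparr>carrier = {\<mu> \<in> C \<rightarrow>\<^sub>E S.
        (\<forall>f\<in>C. \<forall>g\<in>C. \<mu> (\<lambda>x\<in>carrier (Gprod A). f x + g x) = \<mu> f + \<mu> g) \<and>
        (\<forall>c\<in>val_ring A. \<forall>f\<in>C. \<mu> (\<lambda>x\<in>carrier (Gprod A). c * f x) = c * \<mu> f)},
      monoid.mult = undefined, one = undefined,
      ring.zero = (\<lambda>f\<in>C. 0), add = (\<lambda>\<mu> \<nu>. \<lambda>f\<in>C. \<mu> f + \<nu> f), smult = (\<lambda>c \<mu>. \<lambda>f\<in>C. c * \<mu> f)\<rparr>"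

definition convolution ::
  "('c, 'k, 'g) datum \<Rightarrow> (('k \<Rightarrow> 'g) \<Rightarrow> 'c) set
    \<Rightarrow> ('c, 'k, 'g) functional \<Rightarrow> ('c, 'k, 'g) functional \<Rightarrow> ('c, 'k, 'g) functional" where
  "convolution A C l \<mu> =
     (\<lambda>f\<in>C. \<mu> (\<lambda>y\<in>carrier (Gprod A). l (\<lambda>x\<in>carrier (Gprod A). f (x \<otimes>\<^bsub>Gprod A\<^esub> y))))"

definition dirac ::
  "('c::{field, topological_space}, 'k, 'g) datum \<Rightarrow> ('k \<Rightarrow> 'g) \<Rightarrow> ('c, 'k, 'g) functional" where
  "dirac A a = (\<lambda>f\<in>cts A. f a)"

definition Iwasawa ::
  "('c::{field, topological_space}, 'k, 'g) datum \<Rightarrow> ('c, ('c, 'k, 'g) functional) module" where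
  "Iwasawa A = (functionals A (cts A) (val_ring A))
     \<lparr>monoid.mult := convolution A (cts A), one := dirac A \<one>\<^bsub>Gprod A\<^esub>\<rparr>"

text \<open>The topology of pointwise convergence, which is the projective limit topology of
  \<open>O[[\<Gamma>]] = lim O[\<Gamma>/U]\<close>, each \<open>O[\<Gamma>/U]\<close> carrying its valuation topology.\<close>

definition Iwasawa_top ::
  "('c::{field, topological_space}, 'k, 'g) datum \<Rightarrow> ('c, 'k, 'g) functional topology" where
  "Iwasawa_top A =
     subtopology (product_topology (\<lambda>_. euclidean) (cts A)) (carrier (Iwasawa A))"


section \<open>The module of compatible systems\<close>

definition Omega_gen ::
  "('c::{field, topological_space}, 'k, 'g) datum \<Rightarrow> ('k \<Rightarrow> int) \<Rightarrow> ('k \<Rightarrow> int) \<Rightarrow> ('k \<Rightarrow> nat)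
    \<Rightarrow> 'k \<Rightarrow> ('c, 'k, 'g) functional" where
  "Omega_gen A d e m i =
     (\<Otimes>\<^bsub>Iwasawa A\<^esub>j\<in>{d i..e i}.
        (dirac A (\<one>\<^bsub>Gprod A\<^esub>(i := gam A i)) [^]\<^bsub>Iwasawa A\<^esub> (prm A ^ m i))
        \<ominus>\<^bsub>Iwasawa A\<^esub>
        ((chi A i (gam A i) powi (j * int (prm A ^ m i))) \<odot>\<^bsub>Iwasawa A\<^esub> \<one>\<^bsub>Iwasawa A\<^esub>))"

definition Omega ::
  "('c::{field, topological_space}, 'k, 'g) datum \<Rightarrow> ('k \<Rightarrow> int) \<Rightarrow> ('k \<Rightarrow> int) \<Rightarrow> ('k \<Rightarrow> nat)
    \<Rightarrow> ('c, 'k, 'g) functional set" where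
  "Omega A d e m = Idl\<^bsub>Iwasawa A\<^esub> (range (Omega_gen A d e m))"

definition Iw_quot ::
  "('c::{field, topological_space}, 'k, 'g) datum \<Rightarrow> ('k \<Rightarrow> int) \<Rightarrow> ('k \<Rightarrow> int) \<Rightarrow> ('k \<Rightarrow> nat)
    \<Rightarrow> ('c, ('c, 'k, 'g) functional set) module" where
  "Iw_quot A d e m = quot_algebra (Iwasawa A) (Omega A d e m)"

text \<open>Base change \<open>M \<otimes> K\<close> of a module over the ring of integers, and its functoriality.\<close>

type_synonym ('m, 'c) tensored = "(('m \<times> 'c) \<Rightarrow>\<^sub>0 int) set"

definition tens :: "('c::field, 'k, 'g) datum \<Rightarrow> ('c, 'm) module \<Rightarrow> ('m, 'c) tensored monoid" where
  "tens A M = tensor (scalars (val_ring A)) M (scalars (fld A))"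

definition ptens :: "('c::field, 'k, 'g) datum \<Rightarrow> ('c, 'm) module \<Rightarrow> 'm \<Rightarrow> 'c \<Rightarrow> ('m, 'c) tensored" where
  "ptens A M = pure_tensor (scalars (val_ring A)) M (scalars (fld A))"

definition tlift ::
  "('c::field, 'k, 'g) datum \<Rightarrow> ('c, 'm) module \<Rightarrow> ('h, 'z) monoid_scheme \<Rightarrow> ('m \<Rightarrow> 'c \<Rightarrow> 'h)
    \<Rightarrow> ('m, 'c) tensored \<Rightarrow> 'h" where
  "tlift A M H b = tensor_lift (scalars (val_ring A)) M (scalars (fld A)) H b"

definition tmap ::
  "('c::field, 'k, 'g) datum \<Rightarrow> ('c, 'm) module \<Rightarrow> ('c, 'n) module \<Rightarrow> ('m \<Rightarrow> 'n)
    \<Rightarrow> ('m, 'c) tensored \<Rightarrow> ('n, 'c) tensored" where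
  "tmap A M N f = tlift A M (tens A N) (\<lambda>x c. ptens A N (f x) c)"

definition tscale ::
  "('c::field, 'k, 'g) datum \<Rightarrow> ('c, 'm) module \<Rightarrow> 'c \<Rightarrow> ('m, 'c) tensored \<Rightarrow> ('m, 'c) tensored" where
  "tscale A M a = tlift A M (tens A M) (\<lambda>x c. ptens A M x (a * c))"

text \<open>If \<open>act\<close> is an action of the Iwasawa algebra on \<open>M\<close>, this is the action of its base change on
  \<open>M \<otimes> K\<close>, given by \<open>(l \<otimes> a) (x \<otimes> c) = act l x \<otimes> a c\<close>.\<close>

definition taction ::
  "('c::{field, topological_space}, 'k, 'g) datum \<Rightarrow> ('c, 'm) module
    \<Rightarrow> (('c, 'k, 'g) functional \<Rightarrow> 'm \<Rightarrow> 'm)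
    \<Rightarrow> (('c, 'k, 'g) functional, 'c) tensored \<Rightarrow> ('m, 'c) tensored \<Rightarrow> ('m, 'c) tensored" where
  "taction A M act t u =
     tlift A (Iwasawa A) (tens A M)
       (\<lambda>l a. tlift A M (tens A M) (\<lambda>x c. ptens A M (act l x) (a * c)) u) t"

definition IwasawaK ::
  "('c::{field, topological_space}, 'k, 'g) datum
    \<Rightarrow> (('c, 'k, 'g) functional, 'c) tensored ring" where
  "IwasawaK A =
     \<lparr>carrier = carrier (tens A (Iwasawa A)),
      monoid.mult = taction A (Iwasawa A) (monoid.mult (Iwasawa A)),
      one = ptens A (Iwasawa A) \<one>\<^bsub>Iwasawa A\<^esub> 1,
      ring.zero = \<one>\<^bsub>tens A (Iwasawa A)\<^esub>,
      add = monoid.mult (tens A (Iwasawa A))\<rparr>"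

type_synonym ('c, 'k, 'g) system =
  "('k \<Rightarrow> nat) \<Rightarrow> (('c, 'k, 'g) functional set, 'c) tensored"

definition proj_limit ::
  "('c::{field, topological_space}, 'k, 'g) datum \<Rightarrow> ('k \<Rightarrow> int) \<Rightarrow> ('k \<Rightarrow> int)
    \<Rightarrow> ('c, 'k, 'g) system set" where
  "proj_limit A d e =
     {s. (\<forall>m. s m \<in> carrier (tens A (Iw_quot A d e m))) \<and>
         (\<forall>m m'. m \<le> m' \<longrightarrow>
            tmap A (Iw_quot A d e m') (Iw_quot A d e m)
              (\<lambda>X. Omega A d e m <+>\<^bsub>Iwasawa A\<^esub> X) (s m') = s m)}"

definition rescaled ::
  "('c::{field, topological_space}, 'k::finite, 'g) datum \<Rightarrow> ('k \<Rightarrow> int) \<Rightarrow> ('k \<Rightarrow> int)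
    \<Rightarrow> ('k \<Rightarrow> real) \<Rightarrow> ('c, 'k, 'g) system \<Rightarrow> ('c, 'k, 'g) system" where
  "rescaled A d e h s = (\<lambda>m. tscale A (Iw_quot A d e m) (p_power A (inner_k h m)) (s m))"

text \<open>Membership in \<open>(\<Prod> M\<^sub>m) \<otimes> K\<close> and in \<open>\<Prod> M\<^sub>m\<close> of an element of \<open>\<Prod> (M\<^sub>m \<otimes> K)\<close> refers to the
  images of the canonical maps.\<close>

definition I_set ::
  "('c::{field, topological_space}, 'k::finite, 'g) datum \<Rightarrow> ('k \<Rightarrow> int) \<Rightarrow> ('k \<Rightarrow> int)
    \<Rightarrow> ('k \<Rightarrow> real) \<Rightarrow> ('c, 'k, 'g) system set" where
  "I_set A d e h =
     {s \<in> proj_limit A d e.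
        \<exists>t \<in> carrier (tens A (product_module (Iw_quot A d e))).
          rescaled A d e h s =
            (\<lambda>m. tmap A (product_module (Iw_quot A d e)) (Iw_quot A d e m) (\<lambda>y. y m) t)}"

definition I0_set ::
  "('c::{field, topological_space}, 'k::finite, 'g) datum \<Rightarrow> ('k \<Rightarrow> int) \<Rightarrow> ('k \<Rightarrow> int)
    \<Rightarrow> ('k \<Rightarrow> real) \<Rightarrow> ('c, 'k, 'g) system set" where
  "I0_set A d e h =
     {s \<in> I_set A d e h.
        \<exists>y \<in> carrier (product_module (Iw_quot A d e)).
          rescaled A d e h s = (\<lambda>m. ptens A (Iw_quot A d e m) (y m) 1)}"

definition I_module ::
  "('c::{field, topological_space}, 'k::finite, 'g) datum \<Rightarrow> ('k \<Rightarrow> int) \<Rightarrow> ('k \<Rightarrow> int)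
    \<Rightarrow> ('k \<Rightarrow> real)
    \<Rightarrow> ((('c, 'k, 'g) functional, 'c) tensored, ('c, 'k, 'g) system) module" where
  "I_module A d e h =
     \<lparr>carrier = I_set A d e h, monoid.mult = undefined, one = undefined,
      ring.zero = (\<lambda>m. \<one>\<^bsub>tens A (Iw_quot A d e m)\<^esub>),
      add = (\<lambda>s s' m. s m \<otimes>\<^bsub>tens A (Iw_quot A d e m)\<^esub> s' m),
      smult = (\<lambda>t s m. taction A (Iw_quot A d e m)
        (\<lambda>l X. (Omega A d e m +>\<^bsub>Iwasawa A\<^esub> l) \<otimes>\<^bsub>Iw_quot A d e m\<^esub> X) t (s m))\<rparr>"


section \<open>Admissible distributions\<close>

text \<open>\<open>P\<close> is the coefficient family of a polynomial of degree at most \<open>e i - d i\<close> in the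
  \<open>i\<close>-th variable.\<close>

definition C_fun ::
  "('c::{field, topological_space}, 'k::finite, 'g) datum \<Rightarrow> ('k \<Rightarrow> int) \<Rightarrow> ('k \<Rightarrow> int)
    \<Rightarrow> (('k \<Rightarrow> 'g) \<Rightarrow> 'c) set" where
  "C_fun A d e =
     {f \<in> carrier (Gprod A) \<rightarrow>\<^sub>E val_ring A.
        \<forall>a\<in>carrier (Gprod A). \<exists>U. openin (Gprod_top A) U \<and> a \<in> U \<and>
          (\<exists>P :: ('k \<Rightarrow> nat) \<Rightarrow> 'c. range P \<subseteq> val_ring A \<and>
             (\<forall>x\<in>U. (\<Prod>i\<in>UNIV. chi A i (x i) powi (- d i)) * f x =
                (\<Sum>n | \<forall>i. int (n i) \<le> e i - d i. P n * (\<Prod>i\<in>UNIV. chi A i (x i) ^ n i))))}"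

definition p_coset ::
  "('c, 'k, 'g) datum \<Rightarrow> ('k \<Rightarrow> 'g) \<Rightarrow> ('k \<Rightarrow> nat) \<Rightarrow> ('k \<Rightarrow> 'g) set" where
  "p_coset A a m =
     {x. \<forall>j. \<exists>g\<in>carrier (Gam A j). x j = a j \<otimes>\<^bsub>Gam A j\<^esub> (g [^]\<^bsub>Gam A j\<^esub> (prm A ^ m j))}"

definition test_fun ::
  "('c::field, 'k::finite, 'g) datum \<Rightarrow> ('k \<Rightarrow> int) \<Rightarrow> ('k \<Rightarrow> 'g) \<Rightarrow> ('k \<Rightarrow> nat) \<Rightarrow> ('k \<Rightarrow> int)
    \<Rightarrow> ('k \<Rightarrow> 'g) \<Rightarrow> 'c" where
  "test_fun A d a m i =
     (\<lambda>x\<in>carrier (Gprod A). if x \<in> p_coset A a m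
        then \<Prod>j\<in>UNIV. (chi A j (x j) - chi A j (a j)) powi (i j - d j) * chi A j (x j) powi d j
        else 0)"

definition v_adm ::
  "('c::field, 'k::finite, 'g) datum \<Rightarrow> ('k \<Rightarrow> int) \<Rightarrow> ('k \<Rightarrow> int) \<Rightarrow> ('k \<Rightarrow> real)
    \<Rightarrow> ('c, 'k, 'g) functional \<Rightarrow> ereal" where
  "v_adm A d e h \<mu> =
     (INF (a, m, i) \<in> carrier (Gprod A) \<times> UNIV \<times> {d..e}.
        ordp A (\<mu> (test_fun A d a m i)) + ereal (inner_k (\<lambda>j. h j - real_of_int (i j - d j)) m))"

definition D_set ::
  "('c::{field, topological_space}, 'k::finite, 'g) datum \<Rightarrow> ('k \<Rightarrow> int) \<Rightarrow> ('k \<Rightarrow> int)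
    \<Rightarrow> ('k \<Rightarrow> real) \<Rightarrow> ('c, 'k, 'g) functional set" where
  "D_set A d e h =
     {\<mu> \<in> carrier (functionals A (C_fun A d e) (fld A)). v_adm A d e h \<mu> > -\<infinity>}"

definition D_module ::
  "('c::{field, topological_space}, 'k::finite, 'g) datum \<Rightarrow> ('k \<Rightarrow> int) \<Rightarrow> ('k \<Rightarrow> int)
    \<Rightarrow> ('k \<Rightarrow> real)
    \<Rightarrow> ((('c, 'k, 'g) functional, 'c) tensored, ('c, 'k, 'g) functional) module" where
  "D_module A d e h =
     \<lparr>carrier = D_set A d e h, monoid.mult = undefined, one = undefined,
      ring.zero = (\<lambda>f\<in>C_fun A d e. 0), add = (\<lambda>\<mu> \<nu>. \<lambda>f\<in>C_fun A d e. \<mu> f + \<nu> f),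
      smult = (\<lambda>t \<mu>. tlift A (Iwasawa A) (add_monoid (functionals A (C_fun A d e) (fld A)))
        (\<lambda>l c. \<lambda>f\<in>C_fun A d e. c * convolution A (C_fun A d e) l \<mu> f) t)\<rparr>"


section \<open>Interpolation\<close>

definition finite_order_character ::
  "('c::{field, topological_space}, 'k, 'g) datum \<Rightarrow> 'k \<Rightarrow> ('g \<Rightarrow> 'c) \<Rightarrow> bool" where
  "finite_order_character A i \<phi> \<longleftrightarrow>
     \<phi> \<in> hom (Gam A i) (scalars UNIV) \<and> continuous_map (Gtop A i) euclidean \<phi> \<and>
     (\<exists>n>0. \<forall>x\<in>carrier (Gam A i). \<phi> x ^ n = 1)"

definition char_level :: "('c::one, 'k, 'g) datum \<Rightarrow> ('k \<Rightarrow> 'g \<Rightarrow> 'c) \<Rightarrow> 'k \<Rightarrow> nat" where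
  "char_level A \<phi> i =
     (LEAST m. \<forall>x\<in>carrier (Gam A i). \<phi> i (x [^]\<^bsub>Gam A i\<^esub> (prm A ^ m)) = 1)"

definition char_fun ::
  "('c::field, 'k::finite, 'g) datum \<Rightarrow> ('k \<Rightarrow> int) \<Rightarrow> ('k \<Rightarrow> 'g \<Rightarrow> 'c) \<Rightarrow> ('k \<Rightarrow> 'g) \<Rightarrow> 'c" where
  "char_fun A w \<phi> = (\<lambda>x\<in>carrier (Gprod A). \<Prod>i\<in>UNIV. chi A i (x i) powi w i * \<phi> i (x i))"

text \<open>\<open>\<kappa>\<close> is an arithmetic point; the exponents \<open>w\<close> and the characters \<open>\<phi>\<close> are determined by \<open>\<kappa>\<close>.\<close>

definition arith_point ::
  "('c::{field, topological_space}, 'k::finite, 'g) datum \<Rightarrow> ('k \<Rightarrow> int) \<Rightarrow> ('k \<Rightarrow> int)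
    \<Rightarrow> (('c, 'k, 'g) functional \<Rightarrow> 'c) \<Rightarrow> ('k \<Rightarrow> int) \<Rightarrow> ('k \<Rightarrow> 'g \<Rightarrow> 'c) \<Rightarrow> bool" where
  "arith_point A d e \<kappa> w \<phi> \<longleftrightarrow>
     \<kappa> \<in> ring_hom (Iwasawa A) (scalars (alg_closure_of (fld A))) \<and>
     (\<forall>c\<in>val_ring A. \<forall>l\<in>carrier (Iwasawa A). \<kappa> (c \<odot>\<^bsub>Iwasawa A\<^esub> l) = c * \<kappa> l) \<and>
     continuous_map (Iwasawa_top A) euclidean \<kappa> \<and>
     w \<in> {d..e} \<and> (\<forall>i. finite_order_character A i (\<phi> i)) \<and>
     (\<forall>x\<in>carrier (Gprod A). \<kappa> (dirac A x) = char_fun A w \<phi> x)"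

definition point_ext ::
  "('c::{field, topological_space}, 'k, 'g) datum \<Rightarrow> (('c, 'k, 'g) functional \<Rightarrow> 'c)
    \<Rightarrow> (('c, 'k, 'g) functional, 'c) tensored \<Rightarrow> 'c" where
  "point_ext A \<kappa> = tlift A (Iwasawa A) (add_monoid (scalars UNIV)) (\<lambda>l c. c * \<kappa> l)"

text \<open>The linear extension of a functional to linear combinations of functions in \<open>C_fun A d e\<close> with
  coefficients in the algebraic closure of \<open>fld A\<close>.\<close>

definition integral_ext ::
  "('c::{field, topological_space}, 'k::finite, 'g) datum \<Rightarrow> ('k \<Rightarrow> int) \<Rightarrow> ('k \<Rightarrow> int)
    \<Rightarrow> ('c, 'k, 'g) functional \<Rightarrow> (('k \<Rightarrow> 'g) \<Rightarrow> 'c) \<Rightarrow> 'c" where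
  "integral_ext A d e \<mu> f =
     (THE v. \<exists>(n::nat) c g. (\<forall>j<n. c j \<in> alg_closure_of (fld A) \<and> g j \<in> C_fun A d e) \<and>
        f = (\<lambda>x\<in>carrier (Gprod A). \<Sum>j<n. c j * g j x) \<and> v = (\<Sum>j<n. c j * \<mu> (g j)))"

definition interpolates ::
  "('c::{field, topological_space}, 'k::finite, 'g) datum \<Rightarrow> ('k \<Rightarrow> int) \<Rightarrow> ('k \<Rightarrow> int)
    \<Rightarrow> ('c, 'k, 'g) system \<Rightarrow> ('c, 'k, 'g) functional \<Rightarrow> bool" where
  "interpolates A d e s \<mu> \<longleftrightarrow>
     (\<forall>\<kappa> w \<phi>. arith_point A d e \<kappa> w \<phi> \<longrightarrow>
        (\<forall>t \<in> carrier (tens A (Iwasawa A)).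
           tmap A (Iwasawa A) (Iw_quot A d e (char_level A \<phi>))
             (\<lambda>l. Omega A d e (char_level A \<phi>) +>\<^bsub>Iwasawa A\<^esub> l) t = s (char_level A \<phi>)
           \<longrightarrow> point_ext A \<kappa> t = integral_ext A d e \<mu> (char_fun A w \<phi>)))"

definition interpolating_isos ::
  "('c::{field, topological_space}, 'k::finite, 'g) datum \<Rightarrow> ('k \<Rightarrow> int) \<Rightarrow> ('k \<Rightarrow> int)
    \<Rightarrow> ('k \<Rightarrow> real) \<Rightarrow> (('c, 'k, 'g) system \<Rightarrow> ('c, 'k, 'g) functional) set" where
  "interpolating_isos A d e h =
     {\<Psi> \<in> module_iso (IwasawaK A) (I_module A d e h) (D_module A d e h).
        \<forall>s \<in> I_set A d e h. interpolates A d e s (\<Psi> s)}"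

definition c_const ::
  "('c::field_char_0, 'k::finite, 'g) datum \<Rightarrow> ('k \<Rightarrow> int) \<Rightarrow> ('k \<Rightarrow> int) \<Rightarrow> ereal" where
  "c_const A d e =
     (\<Sum>i\<in>UNIV. if d i < e i
        then ordp A (fact (nat (e i - d i))) +
          ereal (2 * real_of_int (e i - d i)
            + real_of_int \<lfloor>real_of_int (e i - d i + 1) / (real (prm A) - 1)\<rfloor> + 1)
        else 0)"

end

theory Submission
  imports Defs
begin

text \<open>Write \<open>W m\<close> for the space of continuous functions on \<open>\<Gamma>\<close> that are killed, in every coordinate \<open>i\<close>, by
  the product over \<open>d i \<le> j \<le> e i\<close> of the operators
  \<open>f \<mapsto> f(\<gamma>\<^sub>i\<^bsup>p^m\<^esup> \<cdot>) - u\<^sub>i\<^bsup>j p^m\<^esup> f\<close>. These operators are convolution with the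
  generators of the ideal \<open>\<Omega>\<^sub>m\<close>. Along powers of \<open>\<gamma>\<^sub>i\<close> a function in \<open>W m\<close> satisfies a
  linear recurrence with unit coefficients, so it is determined by its values at the finitely many
  points \<open>\<gamma>\<^sup>r\<close> with \<open>r\<close> in a box, these values are arbitrary elements of \<open>O\<close>, and the basis dual
  to these evaluations consists of products of Lagrange interpolation polynomials in the
  characters (\<open>E_W\<close>, \<open>E_gpow\<close>, \<open>W_expand\<close>). Interpolation splits off \<open>W m\<close> inside all continuous
  functions, one coordinate at a time, and the operators are surjective on continuous functions
  because difference equations can be solved by summation; hence \<open>\<Omega>\<^sub>m\<close> is exactly the annihilator of
  \<open>W m\<close> (\<open>Omega_eq_Ann\<close>), and the quotient \<open>O[[\<Gamma>]]/\<Omega>\<^sub>m \<otimes> K\<close> pairs faithfully with \<open>W m\<close>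
  (\<open>pairing_inj\<close>).

  The spaces \<open>W m\<close> increase with \<open>m\<close>, their union contains every locally polynomial function, and
  each of them is contained in the locally polynomial functions up to a bounded denominator.
  A compatible system \<open>s\<close> therefore defines a functional \<open>mu s\<close>, by pairing \<open>s m\<close> with a function
  for any \<open>m\<close> that is large enough, and it is determined by it (\<open>mu_inj\<close>). Conversely a distribution
  has values on the basis of \<open>W m\<close>, and these values are the coefficients of a combination of
  Dirac measures representing the component \<open>s m\<close> (\<open>mu_surj\<close>). The correspondence is linear over \<open>O[[\<Gamma>]] \<otimes> K\<close>,
  because multiplication by \<open>l\<close> on either side amounts to averaging the function by \<open>l\<close> first.

  The growth conditions correspond for the following reason. A test function of exponent \<open>i\<close> on a
  coset of \<open>\<Gamma>\<^bsup>p^m\<^esup>\<close> belongs to \<open>W m\<close> and is divisible by \<open>p\<close> to the power \<open>\<langle>i - d, m\<rangle>\<close>,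
  so integral systems give \<open>v \<ge> 0\<close>. In the other direction a basis function of
  \<open>W m\<close> is expanded in the test functions around its node; the denominators are, apart from powers
  of \<open>p\<^sup>m\<close>, differences of nodes, which contribute at most the valuation of \<open>(e - d)!\<close> and of
  \<open>(2p)\<^bsup>e - d\<^esup>\<close> (\<open>lagrange_test\<close>). This is bounded by the constant in the theorem.

  For the interpolation property, a character \<open>\<chi>\<^sup>w \<phi>\<close> of level at most \<open>m\<close> is a combination of
  functions in \<open>W m\<close> with roots of unity as coefficients. Summing values on them gives a continuous
  homomorphism \<open>kap\<close> on \<open>O[[\<Gamma>]]\<close>, and by density of the Dirac measures this is the only
  arithmetic point with these exponents and characters. So both sides of the interpolation formula
  are the same finite sum for \<open>mu s\<close> (\<open>interpolates_mu\<close>). Finally the characters of level at most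
  \<open>N\<close> separate the cosets of level \<open>N\<close>, by Fourier inversion on the finite quotient, so that a
  distribution is determined by its integrals against arithmetic characters
  (\<open>interpolates_unique\<close>). This gives uniqueness of the isomorphism and of the image of each system.\<close>

section \<open>The valuation and its topology\<close>

context padic_complex_numbers
begin

lemma ord_zero [simp]: "ord 0 = \<infinity>"
  using ord_infty by simp

lemma ord_finite: "x \<noteq> 0 \<Longrightarrow> \<exists>r. ord x = ereal r"
  using ord_infty ord_not_minf by (cases "ord x") auto

lemma ord_one [simp]: "ord 1 = 0"
proof -
  obtain r where r: "ord 1 = ereal r" using ord_finite[of 1] by auto
  have "ord (1 * 1) = ord 1 + ord 1" by (rule ord_mult)
  then show ?thesis using r by (simp add: zero_ereal_def)
qed

lemma ord_minus [simp]: "ord (- x) = ord x"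
proof -
  obtain r where r: "ord (-1) = ereal r" using ord_finite[of "-1"] by auto
  have "ord ((-1) * (-1)) = ord (-1) + ord (-1)" by (rule ord_mult)
  then have "r = 0" using r by (simp add: zero_ereal_def)
  then show ?thesis using ord_mult[of "-1" x] r by (simp add: zero_ereal_def)
qed

lemma ord_power: "ord x = ereal r \<Longrightarrow> ord (x ^ n) = ereal (real n * r)"
  by (induction n) (auto simp: ord_mult algebra_simps zero_ereal_def)

lemma ord_inverse: "x \<noteq> 0 \<Longrightarrow> ord (inverse x) = - ord x"
proof -
  assume x: "x \<noteq> 0"
  obtain r s where rs: "ord x = ereal r" "ord (inverse x) = ereal s"
    using ord_finite[OF x] ord_finite[of "inverse x"] x by auto
  have "ord (x * inverse x) = 0" using x by simp
  then show ?thesis using rs by (simp add: ord_mult zero_ereal_def)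
qed

lemma ord_divide: "y \<noteq> 0 \<Longrightarrow> ord (x / y) = ord x - ord y"
  by (simp add: divide_inverse ord_mult ord_inverse minus_ereal_def)

lemma ord_diff: "min (ord x) (ord y) \<le> ord (x - y)"
  using ord_add[of x "-y"] by simp

lemma ord_prod: "ord (\<Prod>i\<in>I. f i) = (\<Sum>i\<in>I. ord (f i))"
  by (induction I rule: infinite_finite_induct) (auto simp: ord_mult)

lemma ord_sum_ge: "(\<And>i. i \<in> I \<Longrightarrow> c \<le> ord (f i)) \<Longrightarrow> c \<le> ord (\<Sum>i\<in>I. f i)"
proof (induction I rule: infinite_finite_induct)
  case (insert x F)
  then show ?case using ord_add[of "f x" "sum f F"] by (auto simp: min_def split: if_splits intro: order_trans)
qed auto

text \<open>The strict case of the ultrametric inequality.\<close>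

lemma ord_perturb: "ord x < ord (y - x) \<Longrightarrow> ord y = ord x"
proof -
  assume a: "ord x < ord (y - x)"
  have 1: "min (ord x) (ord (y - x)) \<le> ord y" using ord_add[of x "y - x"] by simp
  have 2: "min (ord y) (ord (y - x)) \<le> ord x" using ord_diff[of y "y - x"] by simp
  show ?thesis using a 1 2 by (auto simp: min_def split: if_splits)
qed

lemma p_gt_1: "p > 1" using prime_p prime_gt_1_nat by blast
lemma p_pos [simp]: "p > 0" using p_gt_1 by simp
lemma p_nonzero [simp]: "p \<noteq> 0" using p_pos by blast

text \<open>Smallness is measured by natural numbers only: \<open>sm N x\<close> says that \<open>p\<^sup>N\<close> divides \<open>x\<close>. Every
  statement about open sets, limits and continuity below is reduced to this relation.\<close>

definition sm :: "nat \<Rightarrow> 'c \<Rightarrow> bool" where "sm N x \<longleftrightarrow> ereal (real N) \<le> ord x"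

lemma sm_0 [simp]: "sm N 0" by (simp add: sm_def)
lemma sm_1 [simp]: "sm 0 1" by (simp add: sm_def)
lemma sm_minus [simp]: "sm N (- x) \<longleftrightarrow> sm N x" by (simp add: sm_def)
lemma sm_add: "sm N x \<Longrightarrow> sm N y \<Longrightarrow> sm N (x + y)"
  using ord_add[of x y] by (auto simp: sm_def min_def split: if_splits intro: order_trans)
lemma sm_diff: "sm N x \<Longrightarrow> sm N y \<Longrightarrow> sm N (x - y)"
  using sm_add[of N x "-y"] by simp
lemma sm_commute: "sm N (x - y) \<Longrightarrow> sm N (y - x)"
  using sm_minus[of N "x - y"] by simp
lemma sm_trans: "sm N (x - y) \<Longrightarrow> sm N (y - z) \<Longrightarrow> sm N (x - z)"
  using sm_add[of N "x - y" "y - z"] by simp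
lemma sm_sum: "(\<And>i. i \<in> I \<Longrightarrow> sm N (f i)) \<Longrightarrow> sm N (\<Sum>i\<in>I. f i)"
  unfolding sm_def by (rule ord_sum_ge)
lemma sm_mult: "sm a x \<Longrightarrow> sm b y \<Longrightarrow> sm (a + b) (x * y)"
proof -
  assume "sm a x" "sm b y"
  then have "ereal (real a) + ereal (real b) \<le> ord x + ord y" unfolding sm_def by (rule add_mono)
  then show ?thesis by (simp add: sm_def ord_mult)
qed
lemma sm_mult1: "sm a x \<Longrightarrow> sm 0 y \<Longrightarrow> sm a (x * y)" using sm_mult[of a x 0 y] by simp
lemma sm_mult2: "sm 0 x \<Longrightarrow> sm a y \<Longrightarrow> sm a (x * y)" using sm_mult[of 0 x a y] by simp
lemma sm_mono: "sm a x \<Longrightarrow> b \<le> a \<Longrightarrow> sm b x"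
  unfolding sm_def by (meson dual_order.trans ereal_less_eq(3) of_nat_le_iff)
lemma sm_power: "sm 0 x \<Longrightarrow> sm 0 (x ^ n)" by (induction n) (auto intro: sm_mult1)
lemma sm_prod: "(\<And>i. i \<in> I \<Longrightarrow> sm 0 (f i)) \<Longrightarrow> sm 0 (\<Prod>i\<in>I. f i)"
  by (induction I rule: infinite_finite_induct) (auto intro: sm_mult1)

lemma sm0_nat [simp]: "sm 0 (of_nat n)"
  by (induction n) (auto intro: sm_add)
lemma sm0_int [simp]: "sm 0 (of_int n)"
  by (cases n rule: int_cases2) auto
lemma ord_p_pow: "ord (of_nat p ^ N) = ereal (real N)"
  using ord_power[of "of_nat p" 1 N] ord_p by (simp add: one_ereal_def)

lemma sm_p_pow [simp]: "sm N (of_nat p ^ N)" by (simp add: sm_def ord_p_pow)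

lemma sm_iff: "sm N x \<longleftrightarrow> sm 0 (x / of_nat p ^ N)"
proof (cases "x = 0")
  case False
  then obtain r where "ord x = ereal r" using ord_finite by auto
  then show ?thesis by (simp add: sm_def ord_divide ord_p_pow)
qed auto

lemma sm_dvd: "int p ^ N dvd a \<Longrightarrow> sm N (of_int a)"
proof -
  assume "int p ^ N dvd a"
  then obtain b where "a = int p ^ N * b" by blast
  then show ?thesis using sm_mult1[OF sm_p_pow sm0_int[of b]] by simp
qed

lemma ord_of_int_unit: "\<not> int p dvd a \<Longrightarrow> ord (of_int a) = 0"
proof -
  assume a: "\<not> int p dvd a"
  then have "coprime (int p) a" using prime_p by (simp add: prime_imp_coprime)
  then obtain x y where xy: "x * int p + y * a = 1"
    by (metis bezout_int coprime_imp_gcd_eq_1)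
  then have "(of_int x :: 'c) * of_nat p + of_int y * of_int a = 1"
    by (metis of_int_1 of_int_add of_int_mult of_int_of_nat_eq)
  then have e: "1 - (of_int y * of_int a :: 'c) = of_int x * of_nat p" by (simp add: algebra_simps)
  have "ord (of_nat p * of_int x) \<ge> 1"
    using sm_mult1[OF sm_p_pow[of 1] sm0_int[of x]] by (simp add: sm_def one_ereal_def)
  then have 1: "ord (1 - (of_int y * of_int a :: 'c)) \<ge> 1" using e by (simp add: mult.commute)
  show ?thesis
  proof (rule antisym)
    show "0 \<le> ord (of_int a)" using sm0_int[of a] by (simp add: sm_def zero_ereal_def)
    show "ord (of_int a) \<le> 0"
    proof (rule ccontr)
      assume "\<not> ord (of_int a) \<le> 0"
      then have "0 < ord (of_int a)" by simp
      moreover have "0 \<le> ord (of_int y)" using sm0_int[of y] by (simp add: sm_def zero_ereal_def)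
      ultimately have "0 < ord (of_int y * of_int a)"
        unfolding ord_mult by (metis add.commute add_nonneg_pos)
      then have "0 < min (ord (1 - (of_int y * of_int a :: 'c))) (ord (of_int y * of_int a))"
        using 1 by (auto intro: less_le_trans[of 0 1])
      also have "\<dots> \<le> ord (1::'c)"
        using ord_add[of "1 - (of_int y * of_int a)" "of_int y * of_int a"] by (simp del: min_less_iff_conj)
      finally have "0 < ord (1::'c)" .
      then show False by simp
    qed
  qed
qed

text \<open>The valuation restricts to the \<open>p\<close>-adic valuation of the integers: an integer prime to \<open>p\<close> is a
  unit by Bezout's identity.\<close>

lemma sm_of_int_iff: "sm N (of_int a) \<longleftrightarrow> int p ^ N dvd a"
proof
  show "int p ^ N dvd a" if "sm N (of_int a)"
    using that
  proof (induction N arbitrary: a)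
    case (Suc N)
    have "int p dvd a"
    proof (rule ccontr)
      assume "\<not> int p dvd a"
      then have "ord (of_int a) = 0" by (rule ord_of_int_unit)
      then show False using Suc.prems by (simp add: sm_def zero_ereal_def)
    qed
    then obtain b where b: "a = int p * b" by blast
    have "sm N (of_int b)"
      using Suc.prems unfolding sm_iff[of N] sm_iff[of "Suc N"] b by simp
    then show ?case using Suc.IH b by simp
  qed simp
qed (rule sm_dvd)

lemma sm_zero_all: "(\<And>N. sm N x) \<Longrightarrow> x = 0"
proof (rule ccontr)
  assume a: "\<And>N. sm N x" "x \<noteq> 0"
  then obtain r where r: "ord x = ereal r" using ord_finite by auto
  obtain N where "r < real N" using reals_Archimedean2 by blast
  then show False using a(1)[of N] r by (simp add: sm_def)
qed

lemma sm_eqI: "(\<And>N. sm N (x - y)) \<Longrightarrow> x = y"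
  using sm_zero_all[of "x - y"] by simp

lemma dist_le_iff: "dist x y \<le> real p powr (- real N) \<longleftrightarrow> sm N (x - y)"
proof (cases "x = y")
  case False
  then obtain r where r: "ord (x - y) = ereal r" using ord_finite[of "x - y"] by auto
  show ?thesis using p_gt_1 False by (simp add: dist_ord r sm_def)
qed simp

lemma p_powr_small: "e > 0 \<Longrightarrow> \<exists>N. real p powr (- real N) < e"
proof -
  assume e: "e > 0"
  obtain N where "1 / e < real p ^ N" using real_arch_pow[of "real p" "1 / e"] p_gt_1 by auto
  then have "real p powr (- real N) < e" using e p_pos
    by (simp add: powr_minus powr_realpow field_simps)
  then show ?thesis by blast
qed

lemma dist_small: "e > 0 \<Longrightarrow> \<exists>N. \<forall>x y. sm N (x - y) \<longrightarrow> dist x y < e"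
  using p_powr_small[of e] dist_le_iff by (meson le_less_trans)

lemma p_powr_pos: "real p powr (- real N) > 0" using p_pos by simp

lemma open_iff_sm: "open U \<longleftrightarrow> (\<forall>x\<in>U. \<exists>N. \<forall>y. sm N (y - x) \<longrightarrow> y \<in> U)"
proof
  assume "open U"
  then show "\<forall>x\<in>U. \<exists>N. \<forall>y. sm N (y - x) \<longrightarrow> y \<in> U"
    unfolding open_dist using dist_small by meson
next
  assume a: "\<forall>x\<in>U. \<exists>N. \<forall>y. sm N (y - x) \<longrightarrow> y \<in> U"
  show "open U" unfolding open_dist
  proof
    fix x assume "x \<in> U"
    then obtain N where "\<forall>y. sm N (y - x) \<longrightarrow> y \<in> U" using a by blast
    then show "\<exists>e>0. \<forall>y. dist y x < e \<longrightarrow> y \<in> U"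
      using p_powr_pos[of N] dist_le_iff less_imp_le by meson
  qed
qed

lemma tendsto_iff_sm: "(X \<longlongrightarrow> L) F \<longleftrightarrow> (\<forall>N. \<forall>\<^sub>F n in F. sm N (X n - L))"
proof
  assume a: "(X \<longlongrightarrow> L) F"
  show "\<forall>N. \<forall>\<^sub>F n in F. sm N (X n - L)"
  proof
    fix N
    have "\<forall>\<^sub>F n in F. dist (X n) L < real p powr (- real N)"
      using a p_powr_pos[of N] unfolding tendsto_iff by blast
    then show "\<forall>\<^sub>F n in F. sm N (X n - L)" by (rule eventually_mono) (metis dist_le_iff less_imp_le)
  qed
next
  assume a: "\<forall>N. \<forall>\<^sub>F n in F. sm N (X n - L)"
  show "(X \<longlongrightarrow> L) F" unfolding tendsto_iff
  proof safe
    fix e :: real assume "e > 0"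
    then obtain N where N: "\<forall>x y. sm N (x - y) \<longrightarrow> dist x y < e" using dist_small by blast
    have "\<forall>\<^sub>F n in F. sm N (X n - L)" using a by (rule spec)
    then show "\<forall>\<^sub>F n in F. dist (X n) L < e" by (rule eventually_mono) (use N in blast)
  qed
qed

lemma open_sm: "open {y. sm N (y - x)}"
  unfolding open_iff_sm
proof safe
  fix z assume z: "sm N (z - x)"
  show "\<exists>N'. \<forall>y. sm N' (y - z) \<longrightarrow> y \<in> {y. sm N (y - x)}"
    using sm_trans z by blast
qed

lemma closed_sm: "closed {y. sm N (y - x)}"
  unfolding closed_def open_iff_sm
proof (rule ballI)
  fix z assume z: "z \<in> - {y. sm N (y - x)}"
  show "\<exists>N'. \<forall>y. sm N' (y - z) \<longrightarrow> y \<in> - {y. sm N (y - x)}"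
    using sm_trans[of N z _ x] sm_commute z by (intro exI[of _ N]) blast
qed

lemma geometric_factor: "(v::'c) ^ r - 1 = (v - 1) * (\<Sum>i<r. v ^ i)"
  by (rule power_diff_1_eq)

lemma sm_one_power: "sm N (v - 1) \<Longrightarrow> sm 0 v \<Longrightarrow> sm N (v ^ r - 1)"
  unfolding geometric_factor by (rule sm_mult1, assumption, rule sm_sum, rule sm_power)

lemma sm0_of_one: "sm N (v - 1) \<Longrightarrow> sm 0 v"
  using sm_add[of 0 "v - 1" 1] sm_mono[of N _ 0] by simp

text \<open>For \<open>v\<close> close to \<open>1\<close> the sum is congruent to \<open>r\<close>, a unit.\<close>

lemma ord_sum_unit:
  assumes "sm 1 (v - 1)" "\<not> p dvd r" shows "ord (\<Sum>i<r. v ^ i) = 0"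
proof -
  have "sm 1 (\<Sum>i<r. (v ^ i - 1))" using assms by (intro sm_sum sm_one_power sm0_of_one) auto
  then have 1: "sm 1 ((\<Sum>i<r. v ^ i) - of_nat r)" by (simp add: sum_subtractf)
  have 2: "ord (of_nat r) = 0" using ord_of_int_unit[of "int r"] assms(2) by simp
  show ?thesis using ord_perturb[of "of_nat r" "\<Sum>i<r. v ^ i"] 1 2
    by (auto simp: sm_def one_ereal_def[symmetric] less_le_trans[of 0 1])
qed

text \<open>Modulo \<open>p\<^sup>2\<close> the sum is \<open>p + 2 p z (0 + \<dots> + (p - 1))\<close>; the last sum is \<open>p (p - 1) / 2\<close>, and the factor
  \<open>2\<close> that comes with \<open>z\<close> makes this work for \<open>p = 2\<close> as well.\<close>

lemma ord_sum_p:
  assumes "sm 0 z" "v = 1 + of_nat (2 * p) * z" shows "ord (\<Sum>i<p. v ^ i) = 1"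
proof -
  have s: "sm 1 (of_nat (2 * p) * z)"
    using sm_mult1[OF sm_mult1[OF sm_p_pow[of 1] sm0_nat[of 2]] assms(1)] by (simp add: mult_ac)
  have v0: "sm 0 v" using s sm0_of_one[of 1 v] assms(2) by simp
  have e: "sm 2 (v ^ i - 1 - of_nat (2 * p * i) * z)" for i
  proof (induction i)
    case (Suc i)
    have "sm (1 + 1) ((of_nat (2 * p) * z) * (of_nat i * (of_nat (2 * p) * z)))"
      by (rule sm_mult[OF s sm_mult2[OF _ s]]) simp
    then have 1: "sm 2 ((of_nat (2 * p) * z) * (of_nat (2 * p * i) * z))" by (simp add: mult_ac numeral_2_eq_2)
    have "v ^ Suc i - 1 - of_nat (2 * p * Suc i) * z =
      v * (v ^ i - 1 - of_nat (2 * p * i) * z) + (of_nat (2 * p) * z) * (of_nat (2 * p * i) * z)"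
      unfolding assms(2) by (simp add: algebra_simps)
    then show ?case using sm_add[OF sm_mult2[OF v0 Suc] 1] by simp
  qed simp
  have "sm 2 (\<Sum>i<p. (v ^ i - 1 - of_nat (2 * p * i) * z))" by (intro sm_sum e)
  then have 1: "sm 2 ((\<Sum>i<p. v ^ i) - of_nat p - (\<Sum>i<p. of_nat (2 * p * i) * z))"
    by (simp add: sum_subtractf)
  have g: "2 * (\<Sum>i<p. i) = p * (p - 1)"
    by (induction p) (auto simp: algebra_simps)
  have "(\<Sum>i<p. of_nat (2 * p * i) * z) = of_nat (p * (2 * (\<Sum>i<p. i))) * z"
    by (simp add: sum_distrib_left sum_distrib_right mult_ac)
  also have "\<dots> = of_nat p ^ 2 * (of_nat (p - 1) * z)" unfolding g by (simp add: power2_eq_square mult_ac)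
  finally have "sm 2 (\<Sum>i<p. of_nat (2 * p * i) * z)"
    using assms(1) by (auto intro!: sm_mult1)
  from sm_add[OF 1 this] have 2: "sm 2 ((\<Sum>i<p. v ^ i) - of_nat p)" by simp
  have "ord (of_nat p) < ord ((\<Sum>i<p. v ^ i) - of_nat p)"
    using 2 ord_p by (auto simp: sm_def one_ereal_def intro: less_le_trans[of _ "ereal 2"])
  from ord_perturb[OF this] show ?thesis using ord_p by simp
qed

text \<open>Powering is an isometry up to the exponent: factors prime to \<open>p\<close> in the exponent do not change
  the distance to \<open>1\<close> (\<open>ord_sum_unit\<close>), and each factor \<open>p\<close> divides it by \<open>p\<close> (\<open>ord_sum_p\<close>).\<close>

lemma ord_power_minus_one:
  assumes "sm 0 z" "v = 1 + of_nat (2 * p) * z"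
  shows "ord (v ^ r - 1) = ord (v - 1) + ord (of_nat r)"
  using assms
proof (induction r arbitrary: v z rule: less_induct)
  case (less r)
  have s: "sm 1 (v - 1)"
    using sm_mult1[OF sm_mult1[OF sm_p_pow[of 1] sm0_nat[of 2]] less.prems(1)] less.prems(2) by (simp add: mult_ac)
  show ?case
  proof (cases "p dvd r \<and> r > 0")
    case True
    then obtain t where t: "r = p * t" by auto
    then have tr: "t < r" using True p_gt_1 by auto
    let ?S = "\<Sum>i<p. v ^ i"
    have vp: "v ^ p - 1 = (v - 1) * ?S" by (rule geometric_factor)
    have "ord (v ^ r - 1) = ord ((v ^ p) ^ t - 1)" by (simp add: t power_mult)
    also have "\<dots> = ord (v ^ p - 1) + ord (of_nat t)"
    proof (rule less.IH[OF tr])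
      show "sm 0 (z * ?S)" using less.prems(1) sm0_of_one[OF s] by (auto intro!: sm_mult1 sm_sum sm_power)
      show "v ^ p = 1 + of_nat (2 * p) * (z * ?S)" using vp less.prems(2) by (simp add: algebra_simps)
    qed
    also have "\<dots> = ord (v - 1) + (1 + ord (of_nat t))"
      unfolding vp ord_mult ord_sum_p[OF less.prems] by (simp add: add.assoc)
    also have "1 + ord (of_nat t) = ord (of_nat r)" unfolding t of_nat_mult ord_mult ord_p ..
    finally show ?thesis .
  next
    case False
    show ?thesis
    proof (cases "r = 0")
      case True
      then show ?thesis using ord_not_minf[of "v - 1"] by simp
    next
      case nz: False
      then have "\<not> p dvd r" using False by simp
      from ord_sum_unit[OF s this] ord_of_int_unit[of "int r"] this show ?thesis
        unfolding geometric_factor ord_mult by simp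
    qed
  qed
qed

end

context padic_complex_numbers
begin

text \<open>The units \<open>1 + 2 p z\<close> become additive coordinates after division by \<open>2 p\<close>, which has valuation \<open>1\<close>
  or \<open>2\<close> according to the prime.\<close>

definition tp :: 'c where "tp = of_nat (2 * p)"

lemma tp_nz [simp]: "tp \<noteq> 0" by (simp add: tp_def)

lemma sm_tp: "sm 1 tp"
  using sm_mult1[OF sm_p_pow[of 1] sm0_nat[of 2]] by (simp add: tp_def mult.commute)

lemma ord_tp: "\<exists>r. ord tp = ereal r \<and> 1 \<le> r \<and> r \<le> 2 \<and> (p \<noteq> 2 \<longrightarrow> r = 1)"
proof (cases "p = 2")
  case True
  then have "tp = of_nat p * of_nat p" unfolding tp_def by simp
  then have "ord tp = ereal 2" using ord_p by (simp add: ord_mult one_ereal_def)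
  then show ?thesis using True by simp
next
  case False
  then have "\<not> int p dvd 2" using prime_p
    by (metis int_dvd_int_iff of_nat_numeral primes_dvd_imp_eq two_is_prime_nat)
  from ord_of_int_unit[OF this] have "ord (of_nat 2 * of_nat p) = 1"
    unfolding ord_mult by (simp add: ord_p)
  then show ?thesis unfolding tp_def by (simp add: one_ereal_def)
qed

lemma sm_div_tp: "sm (N + 2) x \<Longrightarrow> sm N (x / tp)"
proof -
  assume a: "sm (N + 2) x"
  obtain r where r: "ord tp = ereal r" "r \<le> 2" using ord_tp by auto
  have "ereal (real N) \<le> ord x - ereal r"
    using a r(2) by (cases "ord x") (auto simp: sm_def)
  then show ?thesis by (simp add: sm_def ord_divide r)
qed

lemma sm_of_div_tp: "sm N (x / tp) \<Longrightarrow> sm (Suc N) x"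
  using sm_mult[OF sm_tp, of N "x / tp"] by simp

text \<open>In an ultrametric space it suffices that consecutive terms approach each other; the limit is as
  close to each term as the next term is.\<close>

lemma sm_complete:
  assumes "\<And>M. sm M (X (Suc M) - X M)"
  shows "\<exists>L. X \<longlonglongrightarrow> L \<and> (\<forall>M. sm M (L - X M))"
proof -
  have *: "sm M (X (M + k) - X M)" for M k
  proof (induction k)
    case (Suc k)
    have "sm M (X (Suc (M + k)) - X (M + k))" using sm_mono[OF assms[of "M + k"], of M] by simp
    from sm_trans[OF this Suc] show ?case by simp
  qed simp
  have "Cauchy X"
  proof (rule metric_CauchyI)
    fix e :: real assume "e > 0"
    then obtain N where N: "\<forall>x y. sm N (x - y) \<longrightarrow> dist x y < e" using dist_small by blast
    show "\<exists>M. \<forall>m\<ge>M. \<forall>n\<ge>M. dist (X m) (X n) < e"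
    proof (intro exI[of _ N] allI impI)
      fix m n assume "m \<ge> N" "n \<ge> N"
      then have "sm N (X m - X N)" "sm N (X N - X n)"
        using *[of N "m - N"] sm_commute[OF *[of N "n - N"]] by auto
      then show "dist (X m) (X n) < e" using N sm_trans by blast
    qed
  qed
  then obtain L where L: "X \<longlonglongrightarrow> L" using Cauchy_convergent_iff convergent_def by blast
  have "sm M (L - X M)" for M
  proof -
    have "\<forall>\<^sub>F n in sequentially. sm M (X n - L)" using L tendsto_iff_sm by blast
    then obtain n where n: "n \<ge> M" "sm M (X n - L)"
      unfolding eventually_sequentially by (meson linear)
    have "sm M (X n - X M)" using *[of M "n - M"] n by simp
    then show ?thesis using sm_trans[OF sm_commute[OF n(2)]] by blast
  qed
  then show ?thesis using L by blast
qed

end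

lemma cring_scalars:
  assumes "0 \<in> S" "1 \<in> S" "\<And>x y. x \<in> S \<Longrightarrow> y \<in> S \<Longrightarrow> x + y \<in> S"
    "\<And>x y. x \<in> S \<Longrightarrow> y \<in> S \<Longrightarrow> x * y \<in> S" "\<And>x. x \<in> S \<Longrightarrow> - x \<in> S"
  shows "cring (scalars (S::'c::field set))"
proof (rule cringI)
  show "abelian_group (scalars S)"
  proof (rule abelian_groupI)
    fix x assume "x \<in> carrier (scalars S)"
    then show "\<exists>y\<in>carrier (scalars S). y \<oplus>\<^bsub>scalars S\<^esub> x = \<zero>\<^bsub>scalars S\<^esub>"
      using assms(5) by (intro bexI[of _ "-x"]) (auto simp: scalars_def)
  qed (auto simp: scalars_def assms algebra_simps)
  show "Group.comm_monoid (scalars S)"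
    by (rule comm_monoidI) (auto simp: scalars_def assms algebra_simps)
qed (auto simp: scalars_def algebra_simps)

lemma field_scalars_UNIV: "field (scalars (UNIV :: 'c::field set))"
proof -
  interpret cring "scalars (UNIV :: 'c set)" by (rule cring_scalars) auto
  show ?thesis
  proof (rule cring_fieldI2)
    fix a :: 'c assume "a \<in> carrier (scalars UNIV)" "a \<noteq> \<zero>\<^bsub>scalars UNIV\<^esub>"
    then show "\<exists>b\<in>carrier (scalars UNIV). a \<otimes>\<^bsub>scalars UNIV\<^esub> b = \<one>\<^bsub>scalars UNIV\<^esub>"
      by (intro bexI[of _ "inverse a"]) (auto simp: scalars_def)
  qed (auto simp: scalars_def)
qed

lemma subfield_scalars_closed:
  assumes "subfield F (scalars (UNIV :: 'c::field set))"
  shows "0 \<in> F" "1 \<in> F" "\<And>x y. x \<in> F \<Longrightarrow> y \<in> F \<Longrightarrow> x + y \<in> F"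
    "\<And>x y. x \<in> F \<Longrightarrow> y \<in> F \<Longrightarrow> x * y \<in> F" "\<And>x. x \<in> F \<Longrightarrow> - x \<in> F"
    "\<And>x. x \<in> F \<Longrightarrow> inverse x \<in> F"
proof -
  interpret field "scalars (UNIV :: 'c set)" by (rule field_scalars_UNIV)
  note s = subringE[OF subfieldE(1)[OF assms]]
  have neg: "\<ominus>\<^bsub>scalars UNIV\<^esub> x = - x" for x :: 'c
    by (rule minus_equality) (auto simp: scalars_def)
  show z: "0 \<in> F" "1 \<in> F" and "\<And>x y. x \<in> F \<Longrightarrow> y \<in> F \<Longrightarrow> x + y \<in> F"
    "\<And>x y. x \<in> F \<Longrightarrow> y \<in> F \<Longrightarrow> x * y \<in> F" "\<And>x. x \<in> F \<Longrightarrow> - x \<in> F"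
    using s neg by (auto simp: scalars_def)
  show "inverse x \<in> F" if "x \<in> F" for x
  proof (cases "x = 0")
    case False
    then have "x \<in> F - {\<zero>\<^bsub>scalars UNIV\<^esub>}" using that by (simp add: scalars_def)
    from subfield_m_inv[OF assms this]
    have a: "inv\<^bsub>scalars UNIV\<^esub> x \<in> F" "x * inv\<^bsub>scalars UNIV\<^esub> x = 1" by (auto simp: scalars_def)
    then have "inv\<^bsub>scalars UNIV\<^esub> x = inverse x" by (metis inverse_unique)
    then show ?thesis using a by simp
  qed (simp add: z)
qed

section \<open>The factors of the group\<close>

locale pdatum =
  fixes A :: "('c::{alg_closed_field, field_char_0, complete_space}, 'k::finite, 'g) datum"
  assumes datum: "is_datum A"

sublocale pdatum \<subseteq> padic_complex_numbers "prm A" "ordp A"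
  using datum by (simp add: is_datum_def)

context pdatum
begin

abbreviation "K \<equiv> fld A"
abbreviation "OK \<equiv> val_ring A"
abbreviation "cG i \<equiv> carrier (Gam A i)"
abbreviation "G \<equiv> carrier (Gprod A)"

lemma subfield_K: "subfield K (scalars UNIV)" using datum by (simp add: is_datum_def)

lemmas K_closed = subfield_scalars_closed[OF subfield_K]
lemmas K_0 [simp] = K_closed(1)
lemmas K_1 [simp] = K_closed(2)
lemmas K_add = K_closed(3)
lemmas K_mult = K_closed(4)
lemmas K_minus = K_closed(5)
lemmas K_inverse = K_closed(6)
lemma K_diff: "x \<in> K \<Longrightarrow> y \<in> K \<Longrightarrow> x - y \<in> K" using K_add[of x "-y"] K_minus by simp
lemma K_divide: "x \<in> K \<Longrightarrow> y \<in> K \<Longrightarrow> x / y \<in> K" by (simp add: divide_inverse K_mult K_inverse)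
lemma K_power: "x \<in> K \<Longrightarrow> x ^ n \<in> K" by (induction n) (auto intro: K_mult)
lemma K_powi: "x \<in> K \<Longrightarrow> x powi n \<in> K" by (auto simp: power_int_def K_power K_inverse)
lemma K_sum: "(\<And>i. i \<in> I \<Longrightarrow> f i \<in> K) \<Longrightarrow> sum f I \<in> K"
  by (induction I rule: infinite_finite_induct) (auto intro: K_add)
lemma K_prod: "(\<And>i. i \<in> I \<Longrightarrow> f i \<in> K) \<Longrightarrow> prod f I \<in> K"
  by (induction I rule: infinite_finite_induct) (auto intro: K_mult)
lemma K_nat [simp]: "of_nat n \<in> K" by (induction n) (auto intro: K_add)
lemma K_int [simp]: "of_int n \<in> K" by (cases n rule: int_cases2) (auto intro: K_minus)
lemma K_rat: "of_rat r \<in> K" by (cases r) (simp add: of_rat_rat K_divide)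

lemma closed_K: "closed K" using datum by (simp add: is_datum_def complete_eq_closed)

lemma Q_p_sub_K: "Q_p \<subseteq> K"
  unfolding Q_p_def using closed_K K_rat by (intro closure_minimal) auto

lemma OK_iff: "x \<in> OK \<longleftrightarrow> x \<in> K \<and> sm 0 x"
  by (simp add: val_ring_def sm_def zero_ereal_def)

lemma OK_0 [simp]: "0 \<in> OK" and OK_1 [simp]: "1 \<in> OK" by (auto simp: OK_iff)
lemma OK_K: "x \<in> OK \<Longrightarrow> x \<in> K" by (simp add: OK_iff)
lemma OK_sm: "x \<in> OK \<Longrightarrow> sm 0 x" by (simp add: OK_iff)
lemma OK_add: "x \<in> OK \<Longrightarrow> y \<in> OK \<Longrightarrow> x + y \<in> OK" by (simp add: OK_iff K_add sm_add)
lemma OK_mult: "x \<in> OK \<Longrightarrow> y \<in> OK \<Longrightarrow> x * y \<in> OK" by (simp add: OK_iff K_mult sm_mult1)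
lemma OK_minus: "x \<in> OK \<Longrightarrow> - x \<in> OK" by (simp add: OK_iff K_minus)
lemma OK_diff: "x \<in> OK \<Longrightarrow> y \<in> OK \<Longrightarrow> x - y \<in> OK" by (simp add: OK_iff K_diff sm_diff)
lemma OK_power: "x \<in> OK \<Longrightarrow> x ^ n \<in> OK" by (simp add: OK_iff K_power sm_power)
lemma OK_sum: "(\<And>i. i \<in> I \<Longrightarrow> f i \<in> OK) \<Longrightarrow> sum f I \<in> OK" by (simp add: OK_iff K_sum sm_sum)
lemma OK_prod: "(\<And>i. i \<in> I \<Longrightarrow> f i \<in> OK) \<Longrightarrow> prod f I \<in> OK" by (simp add: OK_iff K_prod sm_prod)
lemma OK_nat [simp]: "of_nat n \<in> OK" by (simp add: OK_iff)
lemma OK_div_ppow: "x \<in> K \<Longrightarrow> x / of_nat (prm A) ^ N \<in> OK \<longleftrightarrow> sm N x"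
  using sm_iff[of N x] K_divide[OF _ K_power[OF K_nat]] by (auto simp: OK_iff)

lemma cring_OK: "cring (scalars OK)"
  by (rule cring_scalars) (auto intro: OK_add OK_mult OK_minus)

abbreviation "U1 \<equiv> {1 + 2 * of_nat (prm A) * z | z. z \<in> Z_p A}"

text \<open>With the division by \<open>2 p\<close>, the classes of \<open>near i M\<close> are the cosets of the \<open>p\<^sup>M\<close>-th powers.\<close>

definition "near i M x y \<longleftrightarrow> sm M ((chi A i x - chi A i y) / tp)"

definition "uu i = chi A i (gam A i)"

lemma factor:
  shows tgroup: "topological_group (Gam A i) (Gtop A i)"
    and chi_hom: "chi A i \<in> hom (Gam A i) (scalars UNIV)"
    and chi_homeo: "homeomorphic_map (Gtop A i) (top_of_set U1) (chi A i)"
    and gam_in [simp]: "gam A i \<in> cG i"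
    and gam_dense: "Gtop A i closure_of generate (Gam A i) {gam A i} = cG i"
  using datum by (auto simp: is_datum_def)

lemma group_Gam: "group (Gam A i)" and topspace_Gtop: "topspace (Gtop A i) = cG i"
  using tgroup by (auto simp: topological_group_def)

lemma mult_in [simp]: "x \<in> cG i \<Longrightarrow> y \<in> cG i \<Longrightarrow> x \<otimes>\<^bsub>Gam A i\<^esub> y \<in> cG i"
  using group_Gam by (meson group.is_monoid monoid.m_closed)
lemma one_in [simp]: "\<one>\<^bsub>Gam A i\<^esub> \<in> cG i"
  using group_Gam by (meson group.is_monoid monoid.one_closed)
lemma pow_in [simp]: "x \<in> cG i \<Longrightarrow> x [^]\<^bsub>Gam A i\<^esub> (n::nat) \<in> cG i"
  using group_Gam by (meson group.is_monoid monoid.nat_pow_closed)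

lemma chi_mult: "x \<in> cG i \<Longrightarrow> y \<in> cG i \<Longrightarrow> chi A i (x \<otimes>\<^bsub>Gam A i\<^esub> y) = chi A i x * chi A i y"
  using chi_hom by (auto simp: hom_def scalars_def)

lemma chi_form: "x \<in> cG i \<Longrightarrow> \<exists>z. z \<in> Z_p A \<and> chi A i x = 1 + tp * z"
  using homeomorphic_imp_surjective_map[OF chi_homeo[of i]] topspace_Gtop[of i]
  by (auto simp: tp_def set_eq_iff image_iff mult.assoc)

lemma chi_surj: "w \<in> U1 \<Longrightarrow> \<exists>x\<in>cG i. chi A i x = w"
  using homeomorphic_imp_surjective_map[OF chi_homeo[of i]] topspace_Gtop[of i]
  by (metis (no_types, lifting) imageE topspace_euclidean_subtopology)

lemma chi_inj: "x \<in> cG i \<Longrightarrow> y \<in> cG i \<Longrightarrow> chi A i x = chi A i y \<Longrightarrow> x = y"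
  using homeomorphic_imp_injective_map[OF chi_homeo[of i]] topspace_Gtop[of i] by (auto dest: inj_onD)

lemma chi_near_one: "x \<in> cG i \<Longrightarrow> sm 0 ((chi A i x - 1) / tp)"
  using chi_form[of x i] by (auto simp: Z_p_def sm_def zero_ereal_def)

lemma chi_sm: "x \<in> cG i \<Longrightarrow> sm 1 (chi A i x - 1)"
  using sm_of_div_tp[OF chi_near_one] by simp

lemma ord_chi: "x \<in> cG i \<Longrightarrow> ordp A (chi A i x) = 0"
  using ord_perturb[of 1 "chi A i x"] chi_sm[of x i]
  by (auto simp: sm_def one_ereal_def[symmetric] less_le_trans[of 0 1])

lemma chi_nz [simp]: "x \<in> cG i \<Longrightarrow> chi A i x \<noteq> 0"
  using ord_chi[of x i] by auto

lemma chi_K: "x \<in> cG i \<Longrightarrow> chi A i x \<in> K"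
proof -
  assume "x \<in> cG i"
  then obtain z where z: "z \<in> Q_p" "chi A i x = 1 + tp * z" using chi_form by (auto simp: Z_p_def)
  then show ?thesis using Q_p_sub_K unfolding tp_def by (auto simp del: of_nat_mult intro!: K_add K_mult)
qed

lemma chi_OK: "x \<in> cG i \<Longrightarrow> chi A i x \<in> OK"
  using chi_K ord_chi by (auto simp: val_ring_def)

lemma ord_powi: "ordp A x = 0 \<Longrightarrow> ordp A (x powi n) = 0"
proof -
  assume a: "ordp A x = 0"
  then have "x \<noteq> 0" by auto
  have *: "ordp A (x ^ k) = 0" for k using ord_power[of x 0 k] a by (simp add: zero_ereal_def)
  show ?thesis using \<open>x \<noteq> 0\<close> * by (auto simp: power_int_def power_inverse ord_inverse)
qed

lemma ord_chi_powi: "x \<in> cG i \<Longrightarrow> ordp A (chi A i x powi n) = 0"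
  by (simp add: ord_powi ord_chi)

lemma chi_powi_OK: "x \<in> cG i \<Longrightarrow> chi A i x powi n \<in> OK"
  using chi_K ord_chi_powi K_powi by (auto simp: val_ring_def)

lemma chi_one: "chi A i \<one>\<^bsub>Gam A i\<^esub> = 1"
proof -
  have "chi A i (\<one>\<^bsub>Gam A i\<^esub> \<otimes>\<^bsub>Gam A i\<^esub> \<one>\<^bsub>Gam A i\<^esub>) = chi A i \<one>\<^bsub>Gam A i\<^esub> * chi A i \<one>\<^bsub>Gam A i\<^esub>"
    by (rule chi_mult) auto
  moreover have "\<one>\<^bsub>Gam A i\<^esub> \<otimes>\<^bsub>Gam A i\<^esub> \<one>\<^bsub>Gam A i\<^esub> = \<one>\<^bsub>Gam A i\<^esub>"
    using group_Gam by (simp add: group.is_monoid monoid.l_one)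
  ultimately show ?thesis using chi_nz[OF one_in[of i]] by simp
qed

lemma Gam_pow_Suc: "x [^]\<^bsub>Gam A i\<^esub> Suc n = x [^]\<^bsub>Gam A i\<^esub> n \<otimes>\<^bsub>Gam A i\<^esub> x"
  by (simp add: nat_pow_def)

lemma chi_pow: "x \<in> cG i \<Longrightarrow> chi A i (x [^]\<^bsub>Gam A i\<^esub> (n::nat)) = chi A i x ^ n"
  by (induction n) (auto simp: chi_one Gam_pow_Suc chi_mult nat_pow_def[of _ _ 0])

lemma Gam_comm: "x \<in> cG i \<Longrightarrow> y \<in> cG i \<Longrightarrow> x \<otimes>\<^bsub>Gam A i\<^esub> y = y \<otimes>\<^bsub>Gam A i\<^esub> x"
  by (rule chi_inj[of _ i]) (auto simp: chi_mult)

lemma near_refl [simp]: "near i M x x" by (simp add: near_def)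
lemma near_sym: "near i M x y \<Longrightarrow> near i M y x"
  unfolding near_def using sm_minus[of M "(chi A i x - chi A i y) / tp"]
  by (simp add: minus_divide_left)
lemma near_trans: "near i M x y \<Longrightarrow> near i M y z \<Longrightarrow> near i M x z"
  unfolding near_def using sm_add[of M "(chi A i x - chi A i y) / tp" "(chi A i y - chi A i z) / tp"]
  by (simp add: add_divide_distrib[symmetric])
lemma near_mono: "near i M x y \<Longrightarrow> N \<le> M \<Longrightarrow> near i N x y"
  unfolding near_def by (rule sm_mono)
lemma near_mult:
  assumes "x \<in> cG i" "y \<in> cG i" "x' \<in> cG i" "y' \<in> cG i" "near i M x y" "near i M x' y'"
  shows "near i M (x \<otimes>\<^bsub>Gam A i\<^esub> x') (y \<otimes>\<^bsub>Gam A i\<^esub> y')"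
proof -
  have "(chi A i x * chi A i x' - chi A i y * chi A i y') / tp
    = chi A i x * ((chi A i x' - chi A i y') / tp) + ((chi A i x - chi A i y) / tp) * chi A i y'"
    by (simp add: field_simps)
  moreover have "sm 0 (chi A i x)" "sm 0 (chi A i y')" using assms chi_OK OK_sm by auto
  moreover have "sm M ((chi A i x - chi A i y) / tp)" "sm M ((chi A i x' - chi A i y') / tp)"
    using assms by (auto simp: near_def)
  ultimately have "sm M ((chi A i x * chi A i x' - chi A i y * chi A i y') / tp)"
    by (simp only:) (intro sm_add sm_mult1 sm_mult2)
  then show ?thesis using assms by (simp add: near_def chi_mult)
qed
lemma near_pow:
  assumes "x \<in> cG i" "y \<in> cG i" "near i M x y"
  shows "near i M (x [^]\<^bsub>Gam A i\<^esub> (n::nat)) (y [^]\<^bsub>Gam A i\<^esub> n)"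
  by (induction n) (use assms in \<open>auto simp: Gam_pow_Suc nat_pow_def[of _ _ 0] intro!: near_mult\<close>)
lemma near_all_eq: "x \<in> cG i \<Longrightarrow> y \<in> cG i \<Longrightarrow> (\<And>M. near i M x y) \<Longrightarrow> x = y"
  using chi_inj[of x i y] sm_zero_all[of "(chi A i x - chi A i y) / tp"] by (auto simp: near_def)

lemma ord_uu_ge: "ordp A (uu i - 1) \<ge> ordp A tp"
  using chi_near_one[OF gam_in[of i]] ord_divide[OF tp_nz, of "uu i - 1"] ord_tp
  by (cases "ordp A (uu i - 1)") (auto simp: uu_def sm_def)

lemma ord_uu_power: "ordp A (uu i ^ r - 1) = ordp A (uu i - 1) + ordp A (of_nat r)"
  by (rule ord_power_minus_one[of "(uu i - 1) / tp"])
    (use chi_near_one[OF gam_in[of i]] tp_nz in \<open>auto simp: uu_def simp flip: tp_def simp del: of_nat_mult\<close>)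

lemma near_open: "x \<in> cG i \<Longrightarrow> openin (Gtop A i) {y \<in> cG i. near i M y x}"
proof -
  assume x: "x \<in> cG i"
  have "open {w. sm M ((w - chi A i x) / tp)}"
    unfolding open_iff_sm
  proof safe
    fix w assume w: "sm M ((w - chi A i x) / tp)"
    show "\<exists>N. \<forall>y. sm N (y - w) \<longrightarrow> y \<in> {w. sm M ((w - chi A i x) / tp)}"
    proof (intro exI[of _ "M + 2"] allI impI)
      fix y assume "sm (M + 2) (y - w)"
      from sm_add[OF sm_div_tp[OF this] w] show "y \<in> {w. sm M ((w - chi A i x) / tp)}"
        by (simp add: add_divide_distrib[symmetric])
    qed
  qed
  then have "openin (top_of_set U1) (U1 \<inter> {w. sm M ((w - chi A i x) / tp)})"
    by (rule openin_open_Int)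
  from openin_continuous_map_preimage[OF homeomorphic_imp_continuous_map[OF chi_homeo[of i]] this]
  have "openin (Gtop A i) {y \<in> cG i. chi A i y \<in> U1 \<inter> {w. sm M ((w - chi A i x) / tp)}}"
    by (simp add: topspace_Gtop)
  moreover have "{y \<in> cG i. chi A i y \<in> U1 \<inter> {w. sm M ((w - chi A i x) / tp)}} = {y \<in> cG i. near i M y x}"
    using homeomorphic_imp_surjective_map[OF chi_homeo[of i]]
    by (auto simp: near_def topspace_Gtop)
  ultimately show ?thesis by simp
qed

text \<open>The character is a homeomorphism onto its image, so valuation balls in the image give a
  neighbourhood basis.\<close>

lemma nbhd_near:
  assumes "openin (Gtop A i) T" "a \<in> T"
  shows "\<exists>M. \<forall>y\<in>cG i. near i M y a \<longrightarrow> y \<in> T"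
proof -
  have TG: "T \<subseteq> cG i" using openin_subset[OF assms(1)] topspace_Gtop by auto
  have "openin (top_of_set U1) (chi A i ` T)"
    using homeomorphic_imp_open_map[OF chi_homeo[of i]] assms(1) by (auto simp: open_map_def)
  then obtain V where V: "open V" "chi A i ` T = U1 \<inter> V" by (auto simp: openin_open)
  have "chi A i a \<in> V" using V assms(2) by auto
  then obtain N where N: "\<And>w. sm N (w - chi A i a) \<Longrightarrow> w \<in> V" using V(1) open_iff_sm by blast
  have "\<forall>y\<in>cG i. near i N y a \<longrightarrow> y \<in> T"
  proof safe
    fix y assume y: "y \<in> cG i" "near i N y a"
    then have "sm N (chi A i y - chi A i a)" using sm_of_div_tp sm_mono unfolding near_def by (meson le_SucI order_refl)
    then have "chi A i y \<in> V" by (rule N)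
    moreover have "chi A i y \<in> U1" using homeomorphic_imp_surjective_map[OF chi_homeo[of i]] y topspace_Gtop by auto
    ultimately have "chi A i y \<in> chi A i ` T" using V by blast
    then obtain y' where "y' \<in> T" "chi A i y = chi A i y'" by auto
    then show "y \<in> T" using chi_inj y TG by (metis subsetD)
  qed
  then show ?thesis by blast
qed

text \<open>Modulo any power of \<open>p\<close> the inverse of the generator is again a positive power of it, because
  \<open>u\<^bsup>p^M\<^esup>\<close> is close to \<open>1\<close>. Hence natural exponents suffice for all approximations.\<close>

lemma gam_approx_gen:
  assumes "x \<in> generate (Gam A i) {gam A i}"
  shows "x \<in> cG i \<and> (\<exists>r::nat. near i M x (gam A i [^]\<^bsub>Gam A i\<^esub> r))"
  using assms
proof (induction rule: generate.induct)
  case one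
  have "near i M \<one>\<^bsub>Gam A i\<^esub> (gam A i [^]\<^bsub>Gam A i\<^esub> (0::nat))" by (simp add: nat_pow_def)
  then show ?case using one_in by (intro conjI exI)
next
  case (incl h)
  have "gam A i [^]\<^bsub>Gam A i\<^esub> (Suc 0) = gam A i"
    using group_Gam by (simp add: Gam_pow_Suc nat_pow_def[of _ _ 0] group.is_monoid monoid.l_one)
  then have "near i M h (gam A i [^]\<^bsub>Gam A i\<^esub> (Suc 0))" using incl by simp
  moreover have "h \<in> cG i" using incl by simp
  ultimately show ?case by (intro conjI exI)
next
  case (inv h)
  then have h: "h = gam A i" by simp
  interpret group "Gam A i" by (rule group_Gam)
  have iG: "inv\<^bsub>Gam A i\<^esub> h \<in> cG i" by (simp add: h)
  have "chi A i (inv\<^bsub>Gam A i\<^esub> h) * uu i = 1"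
    using chi_mult[OF iG gam_in] l_inv[OF gam_in] chi_one[of i] by (simp add: h uu_def)
  then have e: "chi A i (inv\<^bsub>Gam A i\<^esub> h) * uu i ^ (prm A ^ M) = uu i ^ (prm A ^ M - 1)"
  proof -
    have "uu i ^ (prm A ^ M) = uu i * uu i ^ (prm A ^ M - 1)"
      using power_minus_mult[of "prm A ^ M" "uu i"] by (simp add: mult.commute)
    then show ?thesis using \<open>chi A i (inv\<^bsub>Gam A i\<^esub> h) * uu i = 1\<close> by (simp add: mult.assoc[symmetric])
  qed
  have "near i M (inv\<^bsub>Gam A i\<^esub> h) (gam A i [^]\<^bsub>Gam A i\<^esub> (prm A ^ M - 1))"
  proof -
    have "ordp A ((uu i ^ (prm A ^ M) - 1) / tp) = ordp A ((uu i - 1) / tp) + ordp A (of_nat (prm A ^ M))"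
      using ord_uu_power[of i "prm A ^ M"] ord_tp
      by (cases "ordp A (uu i - 1)"; cases "ordp A (of_nat (prm A ^ M))") (auto simp: ord_divide)
    moreover have "0 \<le> ordp A ((uu i - 1) / tp)"
      using chi_near_one[OF gam_in[of i]] by (simp add: uu_def sm_def zero_ereal_def)
    ultimately have "ereal (real M) \<le> ordp A ((uu i ^ (prm A ^ M) - 1) / tp)"
      by (simp add: ord_p_pow add_increasing)
    then have "sm M ((uu i ^ (prm A ^ M) - 1) / tp)" by (simp add: sm_def)
    then have 1: "sm M (- chi A i (inv\<^bsub>Gam A i\<^esub> h) * ((uu i ^ (prm A ^ M) - 1) / tp))"
      using chi_OK[OF iG] OK_sm by (intro sm_mult2) auto
    have 2: "- chi A i (inv\<^bsub>Gam A i\<^esub> h) * ((uu i ^ (prm A ^ M) - 1) / tp) =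
      (chi A i (inv\<^bsub>Gam A i\<^esub> h) - uu i ^ (prm A ^ M - 1)) / tp"
      unfolding e[symmetric] by (simp add: algebra_simps)
    show ?thesis using 1 unfolding 2 by (simp add: near_def chi_pow uu_def)
  qed
  then show ?case using iG by (intro conjI exI)
next
  case (eng h1 h2)
  interpret group "Gam A i" by (rule group_Gam)
  from eng obtain r s where rs: "near i M h1 (gam A i [^]\<^bsub>Gam A i\<^esub> (r::nat))" "near i M h2 (gam A i [^]\<^bsub>Gam A i\<^esub> (s::nat))"
    "h1 \<in> cG i" "h2 \<in> cG i" by metis
  then have "near i M (h1 \<otimes>\<^bsub>Gam A i\<^esub> h2) (gam A i [^]\<^bsub>Gam A i\<^esub> (r + s))"
    using near_mult[OF rs(3) _ rs(4) _ rs(1) rs(2)] by (simp add: nat_pow_mult)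
  then show ?case using mult_in[OF rs(3,4)] by (intro conjI exI)
qed

lemma gam_approx: "x \<in> cG i \<Longrightarrow> \<exists>r::nat. near i M x (gam A i [^]\<^bsub>Gam A i\<^esub> r)"
proof -
  assume x: "x \<in> cG i"
  then have "x \<in> Gtop A i closure_of generate (Gam A i) {gam A i}" by (simp add: gam_dense)
  then have "\<forall>T. x \<in> T \<and> openin (Gtop A i) T \<longrightarrow> (\<exists>y. y \<in> generate (Gam A i) {gam A i} \<and> y \<in> T)"
    unfolding in_closure_of by (rule conjunct2)
  from spec[OF this, of "{y \<in> cG i. near i M y x}"]
  obtain y where "y \<in> generate (Gam A i) {gam A i}" "y \<in> cG i" "near i M y x"
    using near_open[OF x, of M] x by auto
  then show ?thesis using gam_approx_gen[of y i M] near_sym near_trans by blast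
qed

text \<open>A topological generator cannot be closer to \<open>1\<close> than the group allows: the element with
  character value \<open>1 + 2 p\<close> is approximated by a power \<open>u\<^sup>r\<close>, and \<open>u\<^sup>r - 1\<close> is divisible by \<open>u - 1\<close>.\<close>

lemma ord_uu: "ordp A (uu i - 1) = ordp A tp"
proof -
  have "(1::'c) \<in> Q_p" unfolding Q_p_def by (rule subsetD[OF closure_subset]) (metis of_rat_1 rangeI)
  then have "(1::'c) \<in> Z_p A" by (simp add: Z_p_def)
  then have "1 + 2 * of_nat (prm A) * 1 \<in> U1" by blast
  then obtain x where x: "x \<in> cG i" "chi A i x = 1 + tp" using chi_surj[of "1 + 2 * of_nat (prm A) * 1" i] by (auto simp: tp_def)
  obtain r where "near i 1 x (gam A i [^]\<^bsub>Gam A i\<^esub> (r::nat))" using gam_approx[OF x(1)] by blast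
  then have "sm 1 ((1 + tp - uu i ^ r) / tp)" by (simp add: near_def x chi_pow uu_def)
  moreover have "(uu i ^ r - 1) / tp - 1 = - ((1 + tp - uu i ^ r) / tp)" by (simp add: field_simps)
  ultimately have "sm 1 ((uu i ^ r - 1) / tp - 1)" by (simp only: sm_minus)
  then have "ordp A 1 < ordp A ((uu i ^ r - 1) / tp - 1)"
    by (auto simp: sm_def one_ereal_def[symmetric] less_le_trans[of 0 1])
  then have "ordp A ((uu i ^ r - 1) / tp) = 0" using ord_perturb[of 1 "(uu i ^ r - 1) / tp"] by simp
  then have 1: "ordp A (uu i ^ r - 1) = ordp A tp"
    using ord_tp by (cases "ordp A (uu i ^ r - 1)") (auto simp: ord_divide zero_ereal_def)
  have "ordp A (uu i - 1) \<le> ordp A (uu i ^ r - 1)"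
    unfolding ord_uu_power using sm0_nat[of r] by (simp add: sm_def zero_ereal_def[symmetric] add_increasing2)
  then show ?thesis using 1 ord_uu_ge[of i] by simp
qed

text \<open>The map \<open>r \<mapsto> \<gamma>\<^sup>r\<close> is an isometry from the integers with their \<open>p\<close>-adic metric to the factor.\<close>

lemma ord_uu_diff_tp:
  "ordp A ((uu i ^ r - uu i ^ s) / tp) = ordp A (of_int (int r - int s))"
proof -
  have *: "ordp A ((uu i ^ r - uu i ^ s) / tp) = ordp A (of_nat (r - s))" if "s \<le> r" for r s
  proof -
    have "uu i ^ r - uu i ^ s = uu i ^ s * (uu i ^ (r - s) - 1)"
      using that by (simp add: right_diff_distrib power_add[symmetric])
    then have "ordp A (uu i ^ r - uu i ^ s) = ordp A (uu i ^ s) + (ordp A tp + ordp A (of_nat (r - s)))"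
      by (simp add: ord_mult ord_uu_power ord_uu)
    also have "ordp A (uu i ^ s) = 0" using ord_chi_powi[OF gam_in, of i "int s"] by (simp add: uu_def)
    finally show ?thesis using ord_tp by (cases "ordp A (of_nat (r - s))") (auto simp: ord_divide)
  qed
  show ?thesis
  proof (cases "s \<le> r")
    case True
    then show ?thesis using *[OF True] by (simp add: of_nat_diff)
  next
    case False
    then have "ordp A ((uu i ^ s - uu i ^ r) / tp) = ordp A (of_nat (s - r))" using * by simp
    moreover have "(uu i ^ r - uu i ^ s) / tp = - ((uu i ^ s - uu i ^ r) / tp)" by (simp add: field_simps)
    moreover have "of_int (int r - int s) = - (of_nat (s - r) :: 'c)" using False by (simp add: of_nat_diff)
    ultimately show ?thesis by (metis ord_minus)
  qed
qed

lemma near_gam_iff: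
  "near i M (gam A i [^]\<^bsub>Gam A i\<^esub> (r::nat)) (gam A i [^]\<^bsub>Gam A i\<^esub> (s::nat)) \<longleftrightarrow> r mod prm A ^ M = s mod prm A ^ M"
proof -
  have "near i M (gam A i [^]\<^bsub>Gam A i\<^esub> r) (gam A i [^]\<^bsub>Gam A i\<^esub> s) \<longleftrightarrow> sm M (of_int (int r - int s))"
    unfolding near_def by (simp add: chi_pow uu_def[symmetric] sm_def ord_uu_diff_tp)
  also have "\<dots> \<longleftrightarrow> int (prm A ^ M) dvd int r - int s" by (simp only: sm_of_int_iff of_nat_power)
  also have "\<dots> \<longleftrightarrow> int r mod int (prm A ^ M) = int s mod int (prm A ^ M)" by (rule mod_eq_dvd_iff[symmetric])
  also have "\<dots> \<longleftrightarrow> r mod prm A ^ M = s mod prm A ^ M" by (metis of_nat_eq_iff of_nat_mod)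
  finally show ?thesis .
qed

text \<open>The exponent modulo \<open>p\<^sup>M\<close> of an element with respect to the chosen generator, that is, its class
  in \<open>\<Gamma>\<^sub>i / \<Gamma>\<^sub>i\<^bsup>p^M\<^esup> \<cong> \<int>/p\<^sup>M\<close>.\<close>

definition "res i M x = (SOME r::nat. near i M x (gam A i [^]\<^bsub>Gam A i\<^esub> r)) mod prm A ^ M"

lemma near_res: "x \<in> cG i \<Longrightarrow> near i M x (gam A i [^]\<^bsub>Gam A i\<^esub> res i M x)"
proof -
  assume "x \<in> cG i"
  from someI_ex[OF gam_approx[OF this, of M]]
  have "near i M x (gam A i [^]\<^bsub>Gam A i\<^esub> (SOME r::nat. near i M x (gam A i [^]\<^bsub>Gam A i\<^esub> r)))" .
  then show ?thesis unfolding res_def by (rule near_trans) (simp add: near_gam_iff)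
qed

lemma res_less [simp]: "res i M x < prm A ^ M" by (simp add: res_def)

lemma near_gam_res: "x \<in> cG i \<Longrightarrow> near i M x (gam A i [^]\<^bsub>Gam A i\<^esub> (r::nat)) \<longleftrightarrow> r mod prm A ^ M = res i M x"
proof -
  assume x: "x \<in> cG i"
  have "near i M x (gam A i [^]\<^bsub>Gam A i\<^esub> (r::nat)) \<longleftrightarrow> near i M (gam A i [^]\<^bsub>Gam A i\<^esub> (r::nat)) (gam A i [^]\<^bsub>Gam A i\<^esub> (res i M x))"
    using near_res[OF x, of M] near_sym near_trans by blast
  then show ?thesis by (simp add: near_gam_iff)
qed

lemma near_iff_res: "x \<in> cG i \<Longrightarrow> y \<in> cG i \<Longrightarrow> near i M x y \<longleftrightarrow> res i M x = res i M y"
proof -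
  assume x: "x \<in> cG i" and y: "y \<in> cG i"
  have "near i M x y \<longleftrightarrow> near i M x (gam A i [^]\<^bsub>Gam A i\<^esub> (res i M y))"
    using near_res[OF y, of M] near_sym near_trans by blast
  then show ?thesis using near_gam_res[OF x] by auto
qed

lemma res_gam [simp]: "res i M (gam A i [^]\<^bsub>Gam A i\<^esub> (r::nat)) = r mod prm A ^ M"
  using near_gam_res[of "gam A i [^]\<^bsub>Gam A i\<^esub> r" i M r] by simp

lemma res_mult: "x \<in> cG i \<Longrightarrow> y \<in> cG i \<Longrightarrow> res i M (x \<otimes>\<^bsub>Gam A i\<^esub> y) = (res i M x + res i M y) mod prm A ^ M"
proof -
  assume x: "x \<in> cG i" and y: "y \<in> cG i"
  interpret group "Gam A i" by (rule group_Gam)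
  have "near i M (x \<otimes>\<^bsub>Gam A i\<^esub> y) (gam A i [^]\<^bsub>Gam A i\<^esub> (res i M x + res i M y))"
    using near_mult[OF x _ y _ near_res[OF x] near_res[OF y]] by (simp add: nat_pow_mult)
  then show ?thesis using near_gam_res x y by simp
qed

lemma res_mono: "x \<in> cG i \<Longrightarrow> N \<le> M \<Longrightarrow> res i M x mod prm A ^ N = res i N x"
  using near_mono[OF near_res[of x i M], of N] near_gam_res[of x i N] by simp

lemma res_one [simp]: "res i M \<one>\<^bsub>Gam A i\<^esub> = 0"
  using res_gam[of i M 0] by (simp add: nat_pow_def del: res_gam)

lemma closed_U1: "closed U1"
  unfolding closed_def open_iff_sm
proof (rule ballI)
  fix w assume w: "w \<in> - U1"
  have cl: "closed (Z_p A)"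
  proof -
    have "Z_p A = Q_p \<inter> {y. sm 0 (y - 0)}" by (auto simp: Z_p_def sm_def zero_ereal_def)
    then show ?thesis using closed_sm[of 0 0] by (simp add: Q_p_def closed_Int)
  qed
  have e: "v \<in> U1 \<longleftrightarrow> (v - 1) / tp \<in> Z_p A" for v
    by (auto simp: tp_def intro!: exI[of _ "(v - 1) / tp"])
  have "(w - 1) / tp \<in> - Z_p A" using w e by auto
  then obtain N where N: "\<And>y. sm N (y - (w - 1) / tp) \<Longrightarrow> y \<notin> Z_p A"
    using cl unfolding closed_def open_iff_sm by blast
  show "\<exists>N. \<forall>y. sm N (y - w) \<longrightarrow> y \<in> - U1"
  proof (intro exI[of _ "N + 2"] allI impI)
    fix y assume "sm (N + 2) (y - w)"
    from sm_div_tp[OF this] have "sm N ((y - 1) / tp - (w - 1) / tp)"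
      by (simp add: diff_divide_distrib[symmetric])
    then show "y \<in> - U1" using N e by blast
  qed
qed

text \<open>The image \<open>1 + 2 p \<int>\<^sub>p\<close> is closed in a complete space and covered by balls around
  \<open>p\<^sup>N\<close> powers of \<open>u\<close>, hence complete and totally bounded.\<close>

lemma compact_Gtop: "compact_space (Gtop A i)"
proof -
  have "compact U1"
    unfolding compact_eq_totally_bounded
  proof safe
    show "complete U1" using closed_U1 by (simp add: complete_eq_closed)
    fix e :: real assume "e > 0"
    then obtain N where N: "\<forall>x y. sm N (x - y) \<longrightarrow> dist x y < e" using dist_small by blast
    have "U1 \<subseteq> (\<Union>x\<in>(\<lambda>r. uu i ^ r) ` {..<prm A ^ N}. ball x e)"
    proof
      fix w assume "w \<in> U1"
      then obtain x where x: "x \<in> cG i" "chi A i x = w" using chi_surj[of w i] by auto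
      have "sm (Suc N) (chi A i x - uu i ^ res i N x)"
        using near_res[OF x(1), of N] sm_of_div_tp by (simp add: near_def chi_pow uu_def)
      then have "sm N (uu i ^ res i N x - w)" using sm_commute sm_mono x(2) by (meson Suc_n_not_le_n nat_le_linear)
      then have "w \<in> ball (uu i ^ res i N x) e" using N by simp
      then show "w \<in> (\<Union>x\<in>(\<lambda>r. uu i ^ r) ` {..<prm A ^ N}. ball x e)" using res_less[of i N x] by blast
    qed
    then show "\<exists>k. finite k \<and> U1 \<subseteq> (\<Union>x\<in>k. ball x e)" by (meson finite_imageI finite_lessThan)
  qed
  then have "compact_space (top_of_set U1)" by (simp add: compact_space_def compactin_subtopology)
  then show ?thesis
    using homeomorphic_compact_space[OF homeomorphic_map_imp_homeomorphic_space[OF chi_homeo[of i]]] by simp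
qed

text \<open>If \<open>y\<close> is the limit of \<open>\<gamma>\<^bsup>q k\<^esup>\<close> for exponents \<open>k\<close> that converge \<open>p\<close>-adically, then it is the \<open>q\<close>-th power of
  the limit of \<open>\<gamma>\<^sup>k\<close>. This identifies cosets of powers with residue classes.\<close>

lemma power_of_res_zero:
  assumes y: "y \<in> cG i" and r0: "res i m y = 0"
  shows "\<exists>g\<in>cG i. y = g [^]\<^bsub>Gam A i\<^esub> (prm A ^ m)"
proof -
  let ?q = "prm A ^ m"
  let ?k = "\<lambda>M. res i (M + m) y div ?q"
  have k: "?q * ?k M = res i (M + m) y" for M
    using res_mono[OF y, of m "M + m"] r0 by (metis le_add2 minus_mod_eq_mult_div diff_zero)
  have step: "near i M (gam A i [^]\<^bsub>Gam A i\<^esub> ?k (Suc M)) (gam A i [^]\<^bsub>Gam A i\<^esub> ?k M)" for M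
  proof -
    have "res i (Suc M + m) y mod prm A ^ (M + m) = res i (M + m) y mod prm A ^ (M + m)"
      using res_mono[OF y, of "M + m" "Suc M + m"] by simp
    then have "(?q * ?k (Suc M)) mod (?q * prm A ^ M) = (?q * ?k M) mod (?q * prm A ^ M)"
      unfolding k by (simp only: power_add mult.commute)
    then have "?k (Suc M) mod prm A ^ M = ?k M mod prm A ^ M" by (simp add: mult_mod_right[symmetric])
    then show ?thesis by (simp add: near_gam_iff)
  qed
  have "sm M (uu i ^ ?k (Suc M) / tp - uu i ^ ?k M / tp)" for M
    using step[of M] by (simp add: near_def chi_pow uu_def diff_divide_distrib)
  from sm_complete[of "\<lambda>M. uu i ^ ?k M / tp", OF this]
  obtain L where L: "\<And>M. sm M (L - uu i ^ ?k M / tp)" by blast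
  have "tp * L \<in> U1"
  proof (rule ccontr)
    assume "tp * L \<notin> U1"
    then obtain N where N: "\<And>y. sm N (y - tp * L) \<Longrightarrow> y \<notin> U1"
      using closed_U1 unfolding closed_def open_iff_sm by blast
    have "sm (1 + N) (tp * (L - uu i ^ ?k N / tp))" by (rule sm_mult[OF sm_tp L])
    then have "sm N (uu i ^ ?k N - tp * L)"
      using sm_commute[of N "tp * L"] sm_mono[of "1 + N" _ N] by (simp add: algebra_simps)
    moreover have "uu i ^ ?k N \<in> U1"
      using homeomorphic_imp_surjective_map[OF chi_homeo[of i]] topspace_Gtop[of i]
        pow_in[OF gam_in, of i "?k N"] chi_pow[OF gam_in, of i "?k N"]
      by (metis (no_types, lifting) imageI topspace_euclidean_subtopology uu_def)
    ultimately show False using N by blast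
  qed
  then obtain g where g: "g \<in> cG i" "chi A i g = tp * L" using chi_surj by blast
  have gn: "near i M g (gam A i [^]\<^bsub>Gam A i\<^esub> ?k M)" for M
    using L[of M] by (simp add: near_def g chi_pow diff_divide_distrib uu_def)
  interpret group "Gam A i" by (rule group_Gam)
  have "near i M (g [^]\<^bsub>Gam A i\<^esub> ?q) y" for M
  proof -
    have "near i M (g [^]\<^bsub>Gam A i\<^esub> ?q) (gam A i [^]\<^bsub>Gam A i\<^esub> (?k M * ?q))"
      using near_pow[OF g(1) _ gn, of M ?q] by (simp add: nat_pow_pow)
    moreover have "near i M y (gam A i [^]\<^bsub>Gam A i\<^esub> (?k M * ?q))"
      using near_mono[OF near_res[OF y, of "M + m"], of M] k[of M] by (simp add: mult.commute)
    ultimately show ?thesis using near_sym near_trans by blast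
  qed
  then show ?thesis using near_all_eq[of "g [^]\<^bsub>Gam A i\<^esub> ?q" i y] g y by auto
qed

end

section \<open>The product group and its continuous functions\<close>

context pdatum
begin

text \<open>The elements \<open>\<gamma>\<^sup>r\<close> with \<open>r\<close> in \<open>\<nat>\<^sup>k\<close> are dense; all interpolation takes place at these points.\<close>

definition "gpow r = (\<lambda>i. gam A i [^]\<^bsub>Gam A i\<^esub> (r i :: nat))"
definition "gnear m x y \<longleftrightarrow> (\<forall>i. near i (m i) (x i) (y i))"
definition "rs m x = (\<lambda>i. res i (m i) (x i))"

lemma G_iff: "x \<in> G \<longleftrightarrow> (\<forall>i. x i \<in> cG i)"
  by (auto simp: Gprod_def PiE_UNIV_domain Pi_iff)

lemma G_in: "x \<in> G \<Longrightarrow> x i \<in> cG i" by (simp add: G_iff)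

lemma Gmult: "x \<otimes>\<^bsub>Gprod A\<^esub> y = (\<lambda>i. x i \<otimes>\<^bsub>Gam A i\<^esub> y i)"
  by (simp add: Gprod_def restrict_UNIV)

lemma Gone: "\<one>\<^bsub>Gprod A\<^esub> = (\<lambda>i. \<one>\<^bsub>Gam A i\<^esub>)"
  by (simp add: Gprod_def restrict_UNIV)

lemma group_G: "group (Gprod A)"
  unfolding Gprod_def by (rule product_group) (rule group_Gam)

lemma G_mult_in [simp]: "x \<in> G \<Longrightarrow> y \<in> G \<Longrightarrow> x \<otimes>\<^bsub>Gprod A\<^esub> y \<in> G"
  by (simp add: G_iff Gmult)
lemma G_one_in [simp]: "\<one>\<^bsub>Gprod A\<^esub> \<in> G" by (simp add: G_iff Gone)
lemma G_assoc: "x \<in> G \<Longrightarrow> y \<in> G \<Longrightarrow> z \<in> G \<Longrightarrow>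
  x \<otimes>\<^bsub>Gprod A\<^esub> y \<otimes>\<^bsub>Gprod A\<^esub> z = x \<otimes>\<^bsub>Gprod A\<^esub> (y \<otimes>\<^bsub>Gprod A\<^esub> z)"
  using group_G by (simp add: group.is_monoid monoid.m_assoc)
lemma G_comm: "x \<in> G \<Longrightarrow> y \<in> G \<Longrightarrow> x \<otimes>\<^bsub>Gprod A\<^esub> y = y \<otimes>\<^bsub>Gprod A\<^esub> x"
  using Gam_comm by (auto simp: Gmult G_iff)
lemma G_lone [simp]: "x \<in> G \<Longrightarrow> \<one>\<^bsub>Gprod A\<^esub> \<otimes>\<^bsub>Gprod A\<^esub> x = x"
  using group_G by (simp add: group.is_monoid monoid.l_one)
lemma G_rone [simp]: "x \<in> G \<Longrightarrow> x \<otimes>\<^bsub>Gprod A\<^esub> \<one>\<^bsub>Gprod A\<^esub> = x"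
  using group_G by (simp add: group.is_monoid monoid.r_one)
lemma G_upd [simp]: "x \<in> G \<Longrightarrow> g \<in> cG i \<Longrightarrow> x(i := g) \<in> G" by (simp add: G_iff)
lemma gpow_in [simp]: "gpow r \<in> G" by (simp add: G_iff gpow_def)
lemma gnear_refl [simp]: "gnear m x x" by (simp add: gnear_def)
lemma gnear_sym: "gnear m x y \<Longrightarrow> gnear m y x" by (auto simp: gnear_def near_sym)
lemma gnear_trans: "gnear m x y \<Longrightarrow> gnear m y z \<Longrightarrow> gnear m x z"
  unfolding gnear_def using near_trans by blast
lemma gnear_mono: "gnear m x y \<Longrightarrow> n \<le> m \<Longrightarrow> gnear n x y"
  unfolding gnear_def le_fun_def using near_mono by blast
lemma gnear_mult: "x \<in> G \<Longrightarrow> y \<in> G \<Longrightarrow> x' \<in> G \<Longrightarrow> y' \<in> G \<Longrightarrow> gnear m x y \<Longrightarrow> gnear m x' y' \<Longrightarrow>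
  gnear m (x \<otimes>\<^bsub>Gprod A\<^esub> x') (y \<otimes>\<^bsub>Gprod A\<^esub> y')"
  by (simp add: gnear_def Gmult G_iff near_mult)
lemma gnear_iff: "x \<in> G \<Longrightarrow> y \<in> G \<Longrightarrow> gnear m x y \<longleftrightarrow> rs m x = rs m y"
  by (auto simp: gnear_def rs_def G_iff near_iff_res fun_eq_iff)
lemma gnear_rs: "x \<in> G \<Longrightarrow> gnear m x (gpow (rs m x))"
  by (simp add: gnear_def gpow_def rs_def G_iff near_res)
lemma rs_gpow: "rs m (gpow r) = (\<lambda>i. r i mod prm A ^ m i)"
  by (simp add: rs_def gpow_def)
lemma rs_mono: "x \<in> G \<Longrightarrow> n \<le> m \<Longrightarrow> rs m x i mod prm A ^ n i = rs n x i"
  by (simp add: rs_def res_mono G_iff le_fun_def)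
lemma rs_less [simp]: "rs m x i < prm A ^ m i" by (simp add: rs_def)

lemma topspace_G: "topspace (Gprod_top A) = G"
  by (simp add: Gprod_top_def Gprod_def topspace_Gtop)

lemma open_coset: "a \<in> G \<Longrightarrow> openin (Gprod_top A) {x \<in> G. gnear m x a}"
proof -
  assume a: "a \<in> G"
  have "openin (product_topology (Gtop A) UNIV) (\<Pi>\<^sub>E i\<in>UNIV. {y \<in> cG i. near i (m i) y (a i)})"
    by (rule product_topology_basis) (use a in \<open>auto intro!: near_open simp: G_iff\<close>)
  moreover have "(\<Pi>\<^sub>E i\<in>UNIV. {y \<in> cG i. near i (m i) y (a i)}) = {x \<in> G. gnear m x a}"
    by (auto simp: G_iff gnear_def PiE_UNIV_domain Pi_iff)
  ultimately show ?thesis by (simp add: Gprod_top_def)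
qed

lemma nbhd_G:
  assumes "openin (Gprod_top A) U" "a \<in> U"
  shows "\<exists>M. \<forall>x\<in>G. gnear (\<lambda>_. M) x a \<longrightarrow> x \<in> U"
proof -
  from product_topology_open_contains_basis[OF assms(1)[unfolded Gprod_top_def] assms(2)]
  obtain X where X: "a \<in> (\<Pi>\<^sub>E i\<in>UNIV. X i)" "\<And>i. openin (Gtop A i) (X i)" "(\<Pi>\<^sub>E i\<in>UNIV. X i) \<subseteq> U"
    by auto
  have "\<forall>i. \<exists>M. \<forall>y\<in>cG i. near i M y (a i) \<longrightarrow> y \<in> X i"
    using nbhd_near X(1,2) by (auto simp: PiE_UNIV_domain Pi_iff)
  then obtain M where M: "\<And>i y. y \<in> cG i \<Longrightarrow> near i (M i) y (a i) \<Longrightarrow> y \<in> X i" by metis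
  have "x \<in> U" if "x \<in> G" "gnear (\<lambda>_. Max (range M)) x a" for x
  proof -
    have "x i \<in> X i" for i
      using that M[of "x i" i] near_mono[of i "Max (range M)" "x i" "a i" "M i"]
      by (auto simp: gnear_def G_iff)
    then show ?thesis using X(3) by (auto simp: PiE_UNIV_domain Pi_iff)
  qed
  then show ?thesis by blast
qed

lemma compact_G: "compact_space (Gprod_top A)"
  unfolding Gprod_top_def compact_space_product_topology using compact_Gtop by blast

text \<open>By compactness, a property that holds locally holds on all cosets of one level.\<close>

lemma uniformly_if_locally:
  assumes loc: "\<And>a. a \<in> G \<Longrightarrow> \<exists>U. openin (Gprod_top A) U \<and> a \<in> U \<and> Q U"
    and anti: "\<And>U V. Q U \<Longrightarrow> V \<subseteq> U \<Longrightarrow> Q V"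
  shows "\<exists>M. \<forall>a\<in>G. Q {x \<in> G. gnear (\<lambda>_. M) x a}"
proof -
  have "\<forall>a\<in>G. \<exists>M. Q {x \<in> G. gnear (\<lambda>_. M) x a}"
  proof
    fix a assume a: "a \<in> G"
    then obtain U where U: "openin (Gprod_top A) U" "a \<in> U" "Q U" using loc by blast
    obtain M where "\<forall>x\<in>G. gnear (\<lambda>_. M) x a \<longrightarrow> x \<in> U" using nbhd_G[OF U(1,2)] by blast
    then have "{x \<in> G. gnear (\<lambda>_. M) x a} \<subseteq> U" by auto
    then show "\<exists>M. Q {x \<in> G. gnear (\<lambda>_. M) x a}" using anti U(3) by blast
  qed
  then obtain M where M: "\<And>a. a \<in> G \<Longrightarrow> Q {x \<in> G. gnear (\<lambda>_. M a) x a}"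
    using bchoice[of G "\<lambda>a M. Q {x \<in> G. gnear (\<lambda>_. M) x a}"] by auto
  let ?C = "\<lambda>a. {x \<in> G. gnear (\<lambda>_. M a) x a}"
  have cov: "\<forall>U\<in>?C ` G. openin (Gprod_top A) U" using open_coset by blast
  moreover have "topspace (Gprod_top A) \<subseteq> \<Union> (?C ` G)" unfolding topspace_G
    using gnear_refl by blast
  ultimately obtain F where F: "finite F" "F \<subseteq> ?C ` G" "topspace (Gprod_top A) \<subseteq> \<Union>F"
    using compact_G unfolding compact_space_alt by meson
  obtain S where S: "S \<subseteq> G" "finite S" "F = ?C ` S" using finite_subset_image[OF F(1,2)] by auto
  let ?M = "Max (insert 0 (M ` S))"
  have "Q {x \<in> G. gnear (\<lambda>_. ?M) x a}" if a: "a \<in> G" for a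
  proof -
    obtain b where b: "b \<in> S" "gnear (\<lambda>_. M b) a b" using F(3) S(3) a topspace_G by auto
    have "M b \<le> ?M" using b S(2) by auto
    then have "{x \<in> G. gnear (\<lambda>_. ?M) x a} \<subseteq> ?C b"
      using b(2) gnear_trans[of "\<lambda>_. M b" _ a b] gnear_mono[of "\<lambda>_. ?M" _ a "\<lambda>_. M b"]
      by (auto simp: le_fun_def)
    then show ?thesis using anti M[of b] S(1) b(1) by blast
  qed
  then show ?thesis by blast
qed

text \<open>One inclusion computes residues of powers; the other needs the extraction of
  \<open>p\<^sup>m\<close>-th roots from \<open>power_of_res_zero\<close>.\<close>

lemma p_coset_iff:
  assumes a: "a \<in> G"
  shows "x \<in> p_coset A a m \<longleftrightarrow> x \<in> G \<and> gnear m x a"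
proof -
  have "(\<exists>g\<in>cG j. x j = a j \<otimes>\<^bsub>Gam A j\<^esub> g [^]\<^bsub>Gam A j\<^esub> (prm A ^ m j)) \<longleftrightarrow> x j \<in> cG j \<and> near j (m j) (x j) (a j)" for j
  proof -
    interpret group "Gam A j" by (rule group_Gam)
    have aj: "a j \<in> cG j" using a by (simp add: G_iff)
    show ?thesis
    proof safe
      fix g assume g: "g \<in> cG j" "x j = a j \<otimes>\<^bsub>Gam A j\<^esub> g [^]\<^bsub>Gam A j\<^esub> (prm A ^ m j)"
      show "x j \<in> cG j" using g aj by simp
      have "near j (m j) (g [^]\<^bsub>Gam A j\<^esub> (prm A ^ m j)) (gam A j [^]\<^bsub>Gam A j\<^esub> (res j (m j) g * prm A ^ m j))"
        using near_pow[OF g(1) _ near_res[OF g(1)], of "m j" "prm A ^ m j"] by (simp add: nat_pow_pow)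
      then have "res j (m j) (g [^]\<^bsub>Gam A j\<^esub> (prm A ^ m j)) = 0"
        using g(1) by (subst (asm) near_gam_res) auto
      then have "res j (m j) (x j) = res j (m j) (a j)"
        using g aj by (simp add: res_mult)
      then show "near j (m j) (x j) (a j)" using near_iff_res g aj by auto
    next
      assume x: "x j \<in> cG j" "near j (m j) (x j) (a j)"
      let ?y = "inv\<^bsub>Gam A j\<^esub> (a j) \<otimes>\<^bsub>Gam A j\<^esub> x j"
      have "near j (m j) ?y (inv\<^bsub>Gam A j\<^esub> (a j) \<otimes>\<^bsub>Gam A j\<^esub> a j)"
        using x aj by (intro near_mult) auto
      then have "near j (m j) ?y (\<one>\<^bsub>Gam A j\<^esub>)" using aj by simp
      then have "res j (m j) ?y = 0" using near_iff_res[of ?y j "\<one>\<^bsub>Gam A j\<^esub>" "m j"] x aj by simp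
      then obtain g where "g \<in> cG j" "?y = g [^]\<^bsub>Gam A j\<^esub> (prm A ^ m j)"
        using power_of_res_zero[of ?y j] x aj by auto
      then show "\<exists>g\<in>cG j. x j = a j \<otimes>\<^bsub>Gam A j\<^esub> g [^]\<^bsub>Gam A j\<^esub> (prm A ^ m j)"
        using x aj by (metis inv_closed l_one m_assoc r_inv)
    qed
  qed
  then show ?thesis by (auto simp: p_coset_def G_iff gnear_def)
qed

text \<open>Uniform continuity in terms of levels; by compactness it is equivalent to continuity, and it is
  the form in which functions are extended from the dense set of powers.\<close>

definition "uc f \<longleftrightarrow> (\<forall>N. \<exists>M. \<forall>x\<in>G. \<forall>y\<in>G. gnear (\<lambda>_. M) x y \<longrightarrow> sm N (f x - f y))"

lemma uc_of_continuous:
  assumes c: "continuous_map (Gprod_top A) euclidean f"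
  shows "uc f"
  unfolding uc_def
proof
  fix N
  let ?U = "\<lambda>a. {x \<in> topspace (Gprod_top A). f x \<in> {z. sm N (z - f a)}}"
  let ?Q = "\<lambda>U. \<forall>x\<in>U. \<forall>y\<in>U. sm N (f x - f y)"
  have "\<exists>M. \<forall>a\<in>G. ?Q {x \<in> G. gnear (\<lambda>_. M) x a}"
  proof (rule uniformly_if_locally)
    fix a assume a: "a \<in> G"
    have o: "openin (Gprod_top A) (?U a)"
      by (rule openin_continuous_map_preimage[OF c]) (simp add: open_sm)
    have q: "?Q (?U a)"
    proof (intro ballI)
      fix x y assume "x \<in> ?U a" "y \<in> ?U a"
      then have "sm N (f x - f a)" "sm N (f a - f y)" using sm_commute[of N "f y" "f a"] by auto
      then show "sm N (f x - f y)" by (rule sm_trans)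
    qed
    have "a \<in> ?U a" using a topspace_G by simp
    with o q show "\<exists>U. openin (Gprod_top A) U \<and> a \<in> U \<and> ?Q U" by (intro exI[of _ "?U a"] conjI)
  next
    fix U V assume a: "?Q U" "V \<subseteq> U"
    show "?Q V"
    proof (intro ballI)
      fix x y assume "x \<in> V" "y \<in> V"
      then have "x \<in> U" "y \<in> U" using a(2) by auto
      then show "sm N (f x - f y)" using a(1) by simp
    qed
  qed
  then obtain M where M: "\<And>a. a \<in> G \<Longrightarrow> ?Q {x \<in> G. gnear (\<lambda>_. M) x a}" by auto
  have "sm N (f x - f y)" if "x \<in> G" "y \<in> G" "gnear (\<lambda>_. M) x y" for x y
    using M[OF that(2)] that by simp
  then show "\<exists>M. \<forall>x\<in>G. \<forall>y\<in>G. gnear (\<lambda>_. M) x y \<longrightarrow> sm N (f x - f y)" by auto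
qed

lemma continuous_of_uc:
  assumes u: "uc f"
  shows "continuous_map (Gprod_top A) euclidean f"
proof -
  have "openin (Gprod_top A) {x \<in> topspace (Gprod_top A). f x \<in> V}" if V: "open V" for V
  proof (rule openin_subopen[THEN iffD2], rule ballI)
    fix a assume "a \<in> {x \<in> topspace (Gprod_top A). f x \<in> V}"
    then have a: "a \<in> G" "f a \<in> V" by (auto simp: topspace_G)
    then obtain N where N: "\<And>y. sm N (y - f a) \<Longrightarrow> y \<in> V" using V[unfolded open_iff_sm] by auto
    obtain M where M: "\<And>x y. x\<in>G \<Longrightarrow> y\<in>G \<Longrightarrow> gnear (\<lambda>_. M) x y \<Longrightarrow> sm N (f x - f y)"
      using u[unfolded uc_def, rule_format, of N] by auto
    have "{x \<in> G. gnear (\<lambda>_. M) x a} \<subseteq> {x \<in> topspace (Gprod_top A). f x \<in> V}"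
      using M N a by (auto simp: topspace_G)
    then show "\<exists>T. openin (Gprod_top A) T \<and> a \<in> T \<and> T \<subseteq> {x \<in> topspace (Gprod_top A). f x \<in> V}"
      using a open_coset[OF a(1), of "\<lambda>_. M"]
      by (intro exI[of _ "{x \<in> G. gnear (\<lambda>_. M) x a}"]) simp
  qed
  then show ?thesis by (simp add: continuous_map_def)
qed

lemma cts_iff: "f \<in> cts A \<longleftrightarrow> f \<in> extensional G \<and> (\<forall>x\<in>G. f x \<in> OK) \<and> uc f"
  unfolding cts_def using uc_of_continuous[of f] continuous_of_uc[of f] by (auto simp: PiE_def Pi_iff)

lemma cts_ext: "f \<in> cts A \<Longrightarrow> f \<in> extensional G" and cts_OK: "f \<in> cts A \<Longrightarrow> x \<in> G \<Longrightarrow> f x \<in> OK"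
  and cts_uc: "f \<in> cts A \<Longrightarrow> uc f"
  by (auto simp: cts_iff)

lemma uc_cong: "(\<And>x. x \<in> G \<Longrightarrow> f x = g x) \<Longrightarrow> uc f \<longleftrightarrow> uc g"
  unfolding uc_def by simp

lemma uc_restrict [simp]: "uc (restrict f G) \<longleftrightarrow> uc f"
  by (rule uc_cong) simp

lemma ctsI: "(\<And>x. x \<in> G \<Longrightarrow> f x \<in> OK) \<Longrightarrow> uc f \<Longrightarrow> restrict f G \<in> cts A"
  by (auto simp: cts_iff)

lemma uc_const [simp]: "uc (\<lambda>_. c)" by (simp add: uc_def)

lemma uc2:
  assumes "uc f" "uc g" "\<And>N x y. x \<in> G \<Longrightarrow> y \<in> G \<Longrightarrow> sm N (f x - f y) \<Longrightarrow> sm N (g x - g y) \<Longrightarrow> sm N (h x - h y)"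
  shows "uc h"
  unfolding uc_def
proof
  fix N
  obtain M1 M2 where M: "\<And>x y. x\<in>G \<Longrightarrow> y\<in>G \<Longrightarrow> gnear (\<lambda>_. M1) x y \<Longrightarrow> sm N (f x - f y)"
    "\<And>x y. x\<in>G \<Longrightarrow> y\<in>G \<Longrightarrow> gnear (\<lambda>_. M2) x y \<Longrightarrow> sm N (g x - g y)"
    using assms(1,2) unfolding uc_def by metis
  show "\<exists>M. \<forall>x\<in>G. \<forall>y\<in>G. gnear (\<lambda>_. M) x y \<longrightarrow> sm N (h x - h y)"
  proof (intro exI[of _ "max M1 M2"] ballI impI)
    fix x y assume xy: "x \<in> G" "y \<in> G" "gnear (\<lambda>_. max M1 M2) x y"
    then have "gnear (\<lambda>_. M1) x y" "gnear (\<lambda>_. M2) x y"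
      using gnear_mono[OF xy(3)] by (auto simp: le_fun_def)
    then show "sm N (h x - h y)" using assms(3) M xy by blast
  qed
qed

lemma uc_add: "uc f \<Longrightarrow> uc g \<Longrightarrow> uc (\<lambda>x. f x + g x)"
proof (rule uc2[of f g])
  fix N x y assume "sm N (f x - f y)" "sm N (g x - g y)"
  from sm_add[OF this] show "sm N (f x + g x - (f y + g y))" by (simp add: algebra_simps)
qed
lemma uc_mult:
  assumes "uc f" "uc g" "\<And>x. x \<in> G \<Longrightarrow> sm 0 (f x)" "\<And>x. x \<in> G \<Longrightarrow> sm 0 (g x)"
  shows "uc (\<lambda>x. f x * g x)"
proof (rule uc2[OF assms(1,2)])
  fix N x y assume a: "x \<in> G" "y \<in> G" "sm N (f x - f y)" "sm N (g x - g y)"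
  have "sm N (f x * (g x - g y) + (f x - f y) * g y)"
    using a assms(3)[OF a(1)] assms(4)[OF a(2)] by (intro sm_add sm_mult1 sm_mult2)
  then show "sm N (f x * g x - f y * g y)" by (simp add: algebra_simps)
qed
lemma uc_cmult: "uc f \<Longrightarrow> uc (\<lambda>x. c * f x)"
proof -
  assume u: "uc f"
  show ?thesis
  proof (cases "c = 0")
    case False
    then obtain r where r: "ordp A c = ereal r" using ord_finite by auto
    obtain k where k: "- r \<le> real k" using real_arch_simple by blast
    show ?thesis unfolding uc_def
    proof
      fix N
      obtain M where M: "\<forall>x\<in>G. \<forall>y\<in>G. gnear (\<lambda>_. M) x y \<longrightarrow> sm (N + k) (f x - f y)" using u[unfolded uc_def] by blast
      have "sm N (c * f x - c * f y)" if "sm (N + k) (f x - f y)" for x y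
      proof -
        have "ordp A (c * (f x - f y)) \<ge> ereal (real N)"
          using that k r unfolding ord_mult sm_def by (cases "ordp A (f x - f y)") auto
        then show ?thesis by (simp add: sm_def right_diff_distrib)
      qed
      then show "\<exists>M. \<forall>x\<in>G. \<forall>y\<in>G. gnear (\<lambda>_. M) x y \<longrightarrow> sm N (c * f x - c * f y)" using M by blast
    qed
  qed simp
qed
lemma uc_minus: "uc f \<Longrightarrow> uc (\<lambda>x. - f x)" using uc_cmult[of f "-1"] by simp
lemma uc_diff: "uc f \<Longrightarrow> uc g \<Longrightarrow> uc (\<lambda>x. f x - g x)" using uc_add[of f "\<lambda>x. - g x"] uc_minus by simp
lemma uc_sum: "(\<And>i. i \<in> I \<Longrightarrow> uc (f i)) \<Longrightarrow> uc (\<lambda>x. \<Sum>i\<in>I. f i x)"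
  by (induction I rule: infinite_finite_induct) (auto intro: uc_add)
lemma uc_prod: "(\<And>i. i \<in> I \<Longrightarrow> uc (f i)) \<Longrightarrow> (\<And>i x. i \<in> I \<Longrightarrow> x \<in> G \<Longrightarrow> sm 0 (f i x)) \<Longrightarrow> uc (\<lambda>x. \<Prod>i\<in>I. f i x)"
  by (induction I rule: infinite_finite_induct) (auto intro!: uc_mult sm_prod)

lemma uc_chi: "uc (\<lambda>x. chi A i (x i))"
  unfolding uc_def
proof (intro allI exI ballI impI)
  fix N x y assume "gnear (\<lambda>_. N) x y"
  then have "sm N ((chi A i (x i) - chi A i (y i)) / tp)" by (simp add: gnear_def near_def)
  from sm_mono[OF sm_of_div_tp[OF this]] show "sm N (chi A i (x i) - chi A i (y i))" by simp
qed

lemma uc_inverse: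
  assumes "uc f" "\<And>x. x \<in> G \<Longrightarrow> ordp A (f x) = 0"
  shows "uc (\<lambda>x. inverse (f x))"
proof (rule uc2[OF assms(1) assms(1)])
  fix N x y assume a: "x \<in> G" "y \<in> G" "sm N (f x - f y)"
  have nz: "f x \<noteq> 0" "f y \<noteq> 0" using assms(2)[OF a(1)] assms(2)[OF a(2)] by auto
  have "sm N ((f y - f x) * (inverse (f x) * inverse (f y)))"
    using nz assms(2)[OF a(1)] assms(2)[OF a(2)] sm_commute[OF a(3)]
    by (intro sm_mult1) (auto simp: sm_def ord_inverse zero_ereal_def)
  then show "sm N (inverse (f x) - inverse (f y))" using nz by (simp add: field_simps)
qed

lemma uc_power: "uc f \<Longrightarrow> (\<And>x. x \<in> G \<Longrightarrow> sm 0 (f x)) \<Longrightarrow> uc (\<lambda>x. f x ^ n)"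
  by (induction n) (auto intro!: uc_mult sm_power)

lemma uc_chi_powi: "uc (\<lambda>x. chi A i (x i) powi n)"
proof -
  have s: "sm 0 (chi A i (x i))" "sm 0 (inverse (chi A i (x i)))" if "x \<in> G" for x
    using that chi_OK[of "x i" i] OK_sm chi_powi_OK[of "x i" i "-1"] by (auto simp: G_iff power_int_minus)
  show ?thesis
  proof (cases "n \<ge> 0")
    case True
    then show ?thesis using uc_power[OF uc_chi[of i], of "nat n"] s(1) by (simp add: power_int_def)
  next
    case False
    then show ?thesis using uc_power[OF uc_inverse[OF uc_chi[of i]], of "nat (- n)"] s(2)
      by (simp add: power_int_def ord_chi G_iff)
  qed
qed

lemma uc_local: "(\<And>x y. x \<in> G \<Longrightarrow> y \<in> G \<Longrightarrow> gnear m x y \<Longrightarrow> f x = f y) \<Longrightarrow> uc f"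
  unfolding uc_def
proof
  fix N assume a: "\<And>x y. x \<in> G \<Longrightarrow> y \<in> G \<Longrightarrow> gnear m x y \<Longrightarrow> f x = f y"
  show "\<exists>M. \<forall>x\<in>G. \<forall>y\<in>G. gnear (\<lambda>_. M) x y \<longrightarrow> sm N (f x - f y)"
  proof (intro exI[of _ "Max (range m)"] ballI impI)
    fix x y assume xy: "x \<in> G" "y \<in> G" "gnear (\<lambda>_. Max (range m)) x y"
    have "gnear m x y" by (rule gnear_mono[OF xy(3)]) (auto simp: le_fun_def)
    then show "sm N (f x - f y)" using a[OF xy(1,2)] by simp
  qed
qed

lemma uc_piecewise:
  assumes P: "\<And>x y. x \<in> G \<Longrightarrow> y \<in> G \<Longrightarrow> gnear m x y \<Longrightarrow> P x \<longleftrightarrow> P y" and "uc f" "uc g"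
  shows "uc (\<lambda>x. if P x then f x else g x)"
  unfolding uc_def
proof
  fix N
  obtain M1 M2 where M: "\<And>x y. x\<in>G \<Longrightarrow> y\<in>G \<Longrightarrow> gnear (\<lambda>_. M1) x y \<Longrightarrow> sm N (f x - f y)"
    "\<And>x y. x\<in>G \<Longrightarrow> y\<in>G \<Longrightarrow> gnear (\<lambda>_. M2) x y \<Longrightarrow> sm N (g x - g y)"
    using assms(2,3) unfolding uc_def by metis
  let ?M = "max (Max (range m)) (max M1 M2)"
  have "sm N ((if P x then f x else g x) - (if P y then f y else g y))"
    if xy: "x \<in> G" "y \<in> G" "gnear (\<lambda>_. ?M) x y" for x y
  proof -
    have mm: "m i \<le> ?M" for i by (rule max.coboundedI1) simp
    have "gnear m x y" "gnear (\<lambda>_. M1) x y" "gnear (\<lambda>_. M2) x y"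
      using gnear_mono[OF xy(3)] mm by (auto simp: le_fun_def)
    then show ?thesis using P[OF xy(1,2)] M xy by auto
  qed
  then show "\<exists>M. \<forall>x\<in>G. \<forall>y\<in>G. gnear (\<lambda>_. M) x y \<longrightarrow>
      sm N ((if P x then f x else g x) - (if P y then f y else g y))" by blast
qed

lemma uc_comp:
  assumes "uc f" "\<And>x. x \<in> G \<Longrightarrow> t x \<in> G" "\<And>M x y. x \<in> G \<Longrightarrow> y \<in> G \<Longrightarrow> gnear (\<lambda>_. M) x y \<Longrightarrow> gnear (\<lambda>_. M) (t x) (t y)"
  shows "uc (\<lambda>x. f (t x))"
  using assms unfolding uc_def by meson

lemma cts_add: "f \<in> cts A \<Longrightarrow> g \<in> cts A \<Longrightarrow> (\<lambda>x\<in>G. f x + g x) \<in> cts A"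
  by (rule ctsI) (auto intro: cts_OK OK_add uc_add cts_uc)
lemma cts_diff: "f \<in> cts A \<Longrightarrow> g \<in> cts A \<Longrightarrow> (\<lambda>x\<in>G. f x - g x) \<in> cts A"
  by (rule ctsI) (auto intro: cts_OK OK_diff uc_diff cts_uc)
lemma cts_cmult: "c \<in> OK \<Longrightarrow> f \<in> cts A \<Longrightarrow> (\<lambda>x\<in>G. c * f x) \<in> cts A"
  by (rule ctsI) (auto intro: cts_OK OK_mult uc_cmult cts_uc)
lemma cts_zero [simp]: "(\<lambda>x\<in>G. 0) \<in> cts A" by (rule ctsI) auto
lemma cts_div_ppow: "f \<in> cts A \<Longrightarrow> (\<And>x. x \<in> G \<Longrightarrow> sm N (f x)) \<Longrightarrow> (\<lambda>x\<in>G. f x / of_nat (prm A) ^ N) \<in> cts A"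
  using uc_cmult[OF cts_uc, of f "1 / of_nat (prm A) ^ N"] by (intro ctsI) (auto simp: OK_div_ppow OK_K cts_OK)

lemma cts_eqI: "f \<in> cts A \<Longrightarrow> g \<in> cts A \<Longrightarrow> (\<And>x. x \<in> G \<Longrightarrow> f x = g x) \<Longrightarrow> f = g"
  using cts_ext extensionalityI by blast

definition "gtr f y = (\<lambda>x\<in>G. f (x \<otimes>\<^bsub>Gprod A\<^esub> y))"

lemma gtr_cts: "f \<in> cts A \<Longrightarrow> y \<in> G \<Longrightarrow> gtr f y \<in> cts A"
  unfolding gtr_def
proof (rule ctsI)
  assume f: "f \<in> cts A" "y \<in> G"
  show "uc (\<lambda>x. f (x \<otimes>\<^bsub>Gprod A\<^esub> y))"
    by (rule uc_comp[OF cts_uc[OF f(1)]]) (use f in \<open>auto intro: gnear_mult\<close>)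
qed (auto intro: cts_OK)

text \<open>Density of the powers of one generator in its factor, with the other coordinates fixed.\<close>

lemma uc_zero_coord:
  assumes "uc f" "x \<in> G" "\<And>r::nat. f (x(i := gam A i [^]\<^bsub>Gam A i\<^esub> r)) = 0"
  shows "f x = 0"
proof (rule sm_zero_all)
  fix N
  obtain M where M: "\<forall>x\<in>G. \<forall>y\<in>G. gnear (\<lambda>_. M) x y \<longrightarrow> sm N (f x - f y)" using assms(1)[unfolded uc_def] by blast
  let ?y = "x(i := gam A i [^]\<^bsub>Gam A i\<^esub> res i M (x i))"
  have "gnear (\<lambda>_. M) x ?y" using near_res[of "x i" i M] assms(2) by (auto simp: gnear_def G_iff)
  then have "sm N (f x - f ?y)" using M assms(2) by simp
  then show "sm N (f x)" using assms(3) by simp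
qed

lemma cts_eq_dense:
  assumes "f \<in> cts A" "g \<in> cts A" "\<And>r. f (gpow r) = g (gpow r)"
  shows "f = g"
proof (rule cts_eqI[OF assms(1,2)])
  fix x assume x: "x \<in> G"
  have u: "uc (\<lambda>x. f x - g x)" using uc_diff cts_uc assms by blast
  have "f x - g x = 0"
  proof (rule sm_zero_all)
    fix N
    obtain M where M: "\<forall>x\<in>G. \<forall>y\<in>G. gnear (\<lambda>_. M) x y \<longrightarrow> sm N ((f x - g x) - (f y - g y))" using u[unfolded uc_def] by blast
    then have "sm N ((f x - g x) - (f (gpow (rs (\<lambda>_. M) x)) - g (gpow (rs (\<lambda>_. M) x))))"
      by (simp add: x gnear_rs)
    then show "sm N (f x - g x)" by (simp add: assms(3))
  qed
  then show "f x = g x" by simp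
qed

text \<open>Extension by uniform continuity from the dense set of powers, identified with \<open>\<nat>\<^sup>k\<close>. The value at
  \<open>x\<close> is the limit of the values at the residues of \<open>x\<close>.\<close>

lemma cts_extend:
  fixes F :: "('k \<Rightarrow> nat) \<Rightarrow> 'c"
  assumes FO: "\<And>r. F r \<in> OK"
    and Fuc: "\<And>N. \<exists>M. \<forall>r r'. (\<forall>i. r i mod prm A ^ M = r' i mod prm A ^ M) \<longrightarrow> sm N (F r - F r')"
  shows "\<exists>f\<in>cts A. \<forall>r. f (gpow r) = F r"
proof -
  obtain M0 where M0: "\<And>N r r'. (\<forall>i. r i mod prm A ^ M0 N = r' i mod prm A ^ M0 N) \<Longrightarrow> sm N (F r - F r')"
    using Fuc by metis
  \<comment> \<open>the moduli of continuity are made increasing, so that residues of consecutive levels are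
    compatible\<close>
  define M where "M N = (\<Sum>j\<le>N. M0 j)" for N
  have MM: "M0 N \<le> M N" for N unfolding M_def by (rule member_le_sum) auto
  have Mmono: "M N \<le> M (Suc N)" for N unfolding M_def by simp
  have M: "sm N (F r - F r')" if "\<And>i. r i mod prm A ^ M N = r' i mod prm A ^ M N" for N r r'
    using that le_imp_power_dvd[OF MM[of N], of "prm A"] by (intro M0) (metis mod_mod_cancel)
  have "\<exists>L. (\<lambda>N. F (rs (\<lambda>_. M N) x)) \<longlonglongrightarrow> L \<and> (\<forall>N. sm N (L - F (rs (\<lambda>_. M N) x)))" if "x \<in> G" for x
  proof (rule sm_complete, rule M)
    show "rs (\<lambda>_. M (Suc N)) x i mod prm A ^ M N = rs (\<lambda>_. M N) x i mod prm A ^ M N" for N i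
      using rs_mono[OF that, of "\<lambda>_. M N" "\<lambda>_. M (Suc N)" i] Mmono[of N] rs_less[of "\<lambda>_. M N" x i]
      by (simp add: le_fun_def)
  qed
  then obtain L where L: "\<And>x. x \<in> G \<Longrightarrow> (\<lambda>N. F (rs (\<lambda>_. M N) x)) \<longlonglongrightarrow> L x"
     "\<And>x N. x \<in> G \<Longrightarrow> sm N (L x - F (rs (\<lambda>_. M N) x))" by metis
  have "restrict L G \<in> cts A"
  proof (rule ctsI)
    fix x assume x: "x \<in> G"
    have "L x \<in> K" using closed_sequentially[OF closed_K _ L(1)[OF x]] FO OK_K by blast
    moreover have "sm 0 (L x)" using sm_add[OF L(2)[OF x, of 0] OK_sm[OF FO[of "rs (\<lambda>_. M 0) x"]]] by simp
    ultimately show "L x \<in> OK" by (simp add: OK_iff)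
  next
    show "uc L" unfolding uc_def
    proof (intro allI exI ballI impI)
      fix N x y assume xy: "x \<in> G" "y \<in> G" "gnear (\<lambda>_. M N) x y"
      then have "rs (\<lambda>_. M N) x = rs (\<lambda>_. M N) y" using gnear_iff by blast
      then show "sm N (L x - L y)" using L(2)[OF xy(1), of N] L(2)[OF xy(2), of N] sm_trans sm_commute by metis
    qed
  qed
  moreover have "L (gpow r) = F r" for r
  proof (rule sm_eqI)
    fix N
    have "sm N (F (rs (\<lambda>_. M N) (gpow r)) - F r)" by (rule M) (simp add: rs_gpow)
    then show "sm N (L (gpow r) - F r)" using L(2)[OF gpow_in, of N r] sm_trans by blast
  qed
  ultimately show ?thesis by (intro bexI[of _ "restrict L G"]) auto
qed

end

section \<open>Linear functionals and the Iwasawa algebra\<close>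

context pdatum
begin

text \<open>The submodules of functions over the ring of integers on which functionals are considered.\<close>

definition "fmod C \<longleftrightarrow> (\<lambda>x\<in>G. 0) \<in> C \<and> C \<subseteq> extensional G \<and> (\<forall>f\<in>C. \<forall>g\<in>C. (\<lambda>x\<in>G. f x + g x) \<in> C)
   \<and> (\<forall>c\<in>OK. \<forall>f\<in>C. (\<lambda>x\<in>G. c * f x) \<in> C)"

lemma fmodD:
  assumes "fmod C"
  shows "(\<lambda>x\<in>G. 0) \<in> C" "f \<in> C \<Longrightarrow> f \<in> extensional G" "f \<in> C \<Longrightarrow> g \<in> C \<Longrightarrow> (\<lambda>x\<in>G. f x + g x) \<in> C"
    "c \<in> OK \<Longrightarrow> f \<in> C \<Longrightarrow> (\<lambda>x\<in>G. c * f x) \<in> C"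
  using assms by (auto simp: fmod_def)

lemma fmod_sum:
  assumes C: "fmod C" and "finite I" "\<And>i. i \<in> I \<Longrightarrow> c i \<in> OK" "\<And>i. i \<in> I \<Longrightarrow> f i \<in> C"
  shows "(\<lambda>x\<in>G. \<Sum>i\<in>I. c i * f i x) \<in> C"
  using assms(2-)
proof (induction I rule: finite_induct)
  case (insert a F)
  have "(\<lambda>x\<in>G. (\<lambda>x\<in>G. c a * f a x) x + (\<lambda>x\<in>G. \<Sum>i\<in>F. c i * f i x) x) \<in> C"
    using insert by (intro fmodD[OF C]) auto
  moreover have "(\<lambda>x\<in>G. (\<lambda>x\<in>G. c a * f a x) x + (\<lambda>x\<in>G. \<Sum>i\<in>F. c i * f i x) x) = (\<lambda>x\<in>G. \<Sum>i\<in>insert a F. c i * f i x)"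
    using insert by (intro restrict_ext) simp
  ultimately show ?case by (simp only:)
qed (simp add: fmodD[OF C])

lemma fmod_cts: "fmod (cts A)"
  by (auto simp: fmod_def cts_add cts_cmult cts_ext)

abbreviation "Fn C S \<equiv> carrier (functionals A C S)"

lemma Fn_iff: "\<mu> \<in> Fn C S \<longleftrightarrow> \<mu> \<in> extensional C \<and> (\<forall>f\<in>C. \<mu> f \<in> S) \<and>
   (\<forall>f\<in>C. \<forall>g\<in>C. \<mu> (\<lambda>x\<in>G. f x + g x) = \<mu> f + \<mu> g) \<and> (\<forall>c\<in>OK. \<forall>f\<in>C. \<mu> (\<lambda>x\<in>G. c * f x) = c * \<mu> f)"
  by (auto simp: functionals_def PiE_def Pi_iff)

lemma Fn_ext: "\<mu> \<in> Fn C S \<Longrightarrow> \<mu> \<in> extensional C"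
  and Fn_in: "\<mu> \<in> Fn C S \<Longrightarrow> f \<in> C \<Longrightarrow> \<mu> f \<in> S"
  and Fn_add: "\<mu> \<in> Fn C S \<Longrightarrow> f \<in> C \<Longrightarrow> g \<in> C \<Longrightarrow> \<mu> (\<lambda>x\<in>G. f x + g x) = \<mu> f + \<mu> g"
  and Fn_cmult: "\<mu> \<in> Fn C S \<Longrightarrow> c \<in> OK \<Longrightarrow> f \<in> C \<Longrightarrow> \<mu> (\<lambda>x\<in>G. c * f x) = c * \<mu> f"
  by (auto simp: Fn_iff)

lemma Fn_zero: "fmod C \<Longrightarrow> \<mu> \<in> Fn C S \<Longrightarrow> \<mu> (\<lambda>x\<in>G. 0) = 0"
  using Fn_cmult[of \<mu> C S 0 "\<lambda>x\<in>G. 0"] fmodD(1)[of C] by simp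

lemma Fn_sum:
  assumes C: "fmod C" and mu: "\<mu> \<in> Fn C S" and "finite I" "\<And>i. i \<in> I \<Longrightarrow> c i \<in> OK" "\<And>i. i \<in> I \<Longrightarrow> f i \<in> C"
  shows "\<mu> (\<lambda>x\<in>G. \<Sum>i\<in>I. c i * f i x) = (\<Sum>i\<in>I. c i * \<mu> (f i))"
  using assms(3-)
proof (induction I rule: finite_induct)
  case (insert a F)
  have "(\<lambda>x\<in>G. (\<lambda>x\<in>G. c a * f a x) x + (\<lambda>x\<in>G. \<Sum>i\<in>F. c i * f i x) x) = (\<lambda>x\<in>G. \<Sum>i\<in>insert a F. c i * f i x)"
    using insert by (intro restrict_ext) simp
  moreover have "(\<lambda>x\<in>G. c a * f a x) \<in> C" "(\<lambda>x\<in>G. \<Sum>i\<in>F. c i * f i x) \<in> C"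
    using insert by (auto intro!: fmodD(4)[OF C] fmod_sum[OF C])
  ultimately have "\<mu> (\<lambda>x\<in>G. \<Sum>i\<in>insert a F. c i * f i x) = \<mu> (\<lambda>x\<in>G. c a * f a x) + \<mu> (\<lambda>x\<in>G. \<Sum>i\<in>F. c i * f i x)"
    using Fn_add[OF mu, of "\<lambda>x\<in>G. c a * f a x" "\<lambda>x\<in>G. \<Sum>i\<in>F. c i * f i x"] by (simp only:)
  also have "\<mu> (\<lambda>x\<in>G. c a * f a x) = c a * \<mu> (f a)" using insert by (intro Fn_cmult[OF mu]) auto
  also have "\<mu> (\<lambda>x\<in>G. \<Sum>i\<in>F. c i * f i x) = (\<Sum>i\<in>F. c i * \<mu> (f i))"
    by (rule insert.IH) (use insert.prems in auto)
  finally show ?case using insert.hyps by (simp only: sum.insert not_False_eq_True)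
qed (simp add: Fn_zero[OF C mu])

lemma Fn_diff:
  assumes C: "fmod C" and mu: "\<mu> \<in> Fn C S" and f: "f \<in> C" "g \<in> C"
  shows "\<mu> (\<lambda>x\<in>G. f x - g x) = \<mu> f - \<mu> g"
proof -
  have "(\<lambda>x\<in>G. f x + (\<lambda>x\<in>G. - 1 * g x) x) = (\<lambda>x\<in>G. f x - g x)" by (intro restrict_ext) simp
  moreover have m: "- 1 \<in> OK" by (rule OK_minus) simp
  ultimately have "\<mu> (\<lambda>x\<in>G. f x - g x) = \<mu> f + \<mu> (\<lambda>x\<in>G. - 1 * g x)"
    using Fn_add[OF mu f(1) fmodD(4)[OF C m f(2)]] by (simp only:)
  then show ?thesis unfolding Fn_cmult[OF mu m f(2)] by simp
qed

lemma fmod_diff: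
  assumes C: "fmod C" and f: "f \<in> C" "g \<in> C"
  shows "(\<lambda>x\<in>G. f x - g x) \<in> C"
proof -
  have "(\<lambda>x\<in>G. f x + (\<lambda>x\<in>G. - 1 * g x) x) = (\<lambda>x\<in>G. f x - g x)" by (intro restrict_ext) simp
  moreover have m: "- 1 \<in> OK" by (rule OK_minus) simp
  ultimately show ?thesis using fmodD(3)[OF C f(1) fmodD(4)[OF C m f(2)]] by (simp only:)
qed

lemma functionals_sel [simp]:
  "\<zero>\<^bsub>functionals A C S\<^esub> = (\<lambda>f\<in>C. 0)" "\<mu> \<oplus>\<^bsub>functionals A C S\<^esub> \<nu> = (\<lambda>f\<in>C. \<mu> f + \<nu> f)"
  "c \<odot>\<^bsub>functionals A C S\<^esub> \<mu> = (\<lambda>f\<in>C. c * \<mu> f)"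
  by (auto simp: functionals_def)

lemma functionals_module:
  assumes C: "fmod C" and S: "0 \<in> S" "\<And>x y. x \<in> S \<Longrightarrow> y \<in> S \<Longrightarrow> x + y \<in> S" "\<And>c x. c \<in> OK \<Longrightarrow> x \<in> S \<Longrightarrow> c * x \<in> S"
  shows "module (scalars OK) (functionals A C S)"
proof (rule moduleI)
  note cl = fmodD[OF C]
  have add: "(\<lambda>f\<in>C. \<mu> f + \<nu> f) \<in> Fn C S" if "\<mu> \<in> Fn C S" "\<nu> \<in> Fn C S" for \<mu> \<nu>
    using that S cl by (auto simp: Fn_iff algebra_simps)
  have smul: "(\<lambda>f\<in>C. c * \<mu> f) \<in> Fn C S" if "\<mu> \<in> Fn C S" "c \<in> OK" for \<mu> c
    using that S cl by (auto simp: Fn_iff algebra_simps)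
  have mone: "- 1 \<in> OK" by (rule OK_minus) simp
  show "cring (scalars OK)" by (rule cring_OK)
  show "abelian_group (functionals A C S)"
  proof (rule abelian_groupI)
    show "\<zero>\<^bsub>functionals A C S\<^esub> \<in> Fn C S" using S cl by (auto simp: Fn_iff)
    fix x assume x: "x \<in> Fn C S"
    show "\<zero>\<^bsub>functionals A C S\<^esub> \<oplus>\<^bsub>functionals A C S\<^esub> x = x"
      using x by (auto simp: Fn_iff intro!: extensionalityI[of _ C])
    show "\<exists>y\<in>Fn C S. y \<oplus>\<^bsub>functionals A C S\<^esub> x = \<zero>\<^bsub>functionals A C S\<^esub>"
      by (rule bexI[OF _ smul[OF x mone]]) auto
  qed (auto intro: add restrict_ext simp: algebra_simps)
qed (use S fmodD[OF C] in \<open>auto simp: Fn_iff scalars_def algebra_simps intro!: extensionalityI[of _ C]\<close>)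

text \<open>A functional with integral values commutes with division by \<open>p\<^sup>N\<close>, hence is a contraction.\<close>

lemma Fn_sm:
  assumes "l \<in> Fn (cts A) OK" "f \<in> cts A" "\<And>x. x \<in> G \<Longrightarrow> sm N (f x)"
  shows "sm N (l f)"
proof -
  let ?g = "\<lambda>x\<in>G. f x / of_nat (prm A) ^ N"
  have g: "?g \<in> cts A" using cts_div_ppow assms by blast
  have "(\<lambda>x\<in>G. of_nat (prm A) ^ N * ?g x) \<in> cts A" by (rule cts_cmult[OF _ g]) (simp add: OK_power)
  from cts_eqI[OF this assms(2)] have "(\<lambda>x\<in>G. of_nat (prm A) ^ N * ?g x) = f" by simp
  then have "l f = of_nat (prm A) ^ N * l ?g" using Fn_cmult[OF assms(1) _ g, of "of_nat (prm A) ^ N"] OK_power by simp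
  then show ?thesis using sm_mult1[OF sm_p_pow] OK_sm Fn_in[OF assms(1) g] by simp
qed

abbreviation "Lam \<equiv> Fn (cts A) OK"

lemma Iw_sel [simp]:
  "carrier (Iwasawa A) = Lam" "\<one>\<^bsub>Iwasawa A\<^esub> = dirac A \<one>\<^bsub>Gprod A\<^esub>"
  "\<zero>\<^bsub>Iwasawa A\<^esub> = (\<lambda>f\<in>cts A. 0)" "\<mu> \<oplus>\<^bsub>Iwasawa A\<^esub> \<nu> = (\<lambda>f\<in>cts A. \<mu> f + \<nu> f)"
  "c \<odot>\<^bsub>Iwasawa A\<^esub> \<mu> = (\<lambda>f\<in>cts A. c * \<mu> f)" "\<mu> \<otimes>\<^bsub>Iwasawa A\<^esub> \<nu> = convolution A (cts A) \<mu> \<nu>"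
  by (auto simp: Iwasawa_def functionals_def)

text \<open>The function \<open>y \<mapsto> \<integral> f(x y) dl(x)\<close>. Convolution by \<open>l\<close> is the transpose of this operator, which turns
  identities in the algebra into identities between operators on functions.\<close>

definition "avg l f = (\<lambda>y\<in>G. l (gtr f y))"

lemma convolution_avg: "convolution A C l \<mu> = (\<lambda>f\<in>C. \<mu> (avg l f))"
  by (simp add: convolution_def avg_def gtr_def)

lemma gtr_gtr: "y \<in> G \<Longrightarrow> z \<in> G \<Longrightarrow> gtr (gtr f y) z = gtr f (z \<otimes>\<^bsub>Gprod A\<^esub> y)"
  unfolding gtr_def by (rule restrict_ext) (simp add: G_assoc)

lemma gtr_add: "y \<in> G \<Longrightarrow> gtr (\<lambda>x\<in>G. f x + g x) y = (\<lambda>x\<in>G. gtr f y x + gtr g y x)"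
  unfolding gtr_def by (rule restrict_ext) simp
lemma gtr_cmult: "y \<in> G \<Longrightarrow> gtr (\<lambda>x\<in>G. c * f x) y = (\<lambda>x\<in>G. c * gtr f y x)"
  unfolding gtr_def by (rule restrict_ext) simp

text \<open>Translates of \<open>f\<close> depend uniformly on the translation, and a functional with integral values is a
  contraction.\<close>

lemma avg_cts:
  assumes l: "l \<in> Lam" and f: "f \<in> cts A"
  shows "avg l f \<in> cts A"
  unfolding avg_def
proof (rule ctsI)
  show "l (gtr f y) \<in> OK" if "y \<in> G" for y using Fn_in[OF l] gtr_cts[OF f that] by blast
  show "uc (\<lambda>y. l (gtr f y))" unfolding uc_def
  proof
    fix N
    obtain M where M: "\<And>x y. x\<in>G \<Longrightarrow> y\<in>G \<Longrightarrow> gnear (\<lambda>_. M) x y \<Longrightarrow> sm N (f x - f y)"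
      using cts_uc[OF f, unfolded uc_def, rule_format, of N] by auto
    have "sm N (l (gtr f y) - l (gtr f z))" if yz: "y \<in> G" "z \<in> G" "gnear (\<lambda>_. M) y z" for y z
    proof -
      have "l (gtr f y) - l (gtr f z) = l (\<lambda>x\<in>G. gtr f y x - gtr f z x)"
        using Fn_diff[OF fmod_cts l] gtr_cts[OF f] yz by simp
      moreover have "sm N (l (\<lambda>x\<in>G. gtr f y x - gtr f z x))"
      proof (rule Fn_sm[OF l])
        show "(\<lambda>x\<in>G. gtr f y x - gtr f z x) \<in> cts A" using cts_diff gtr_cts[OF f] yz by blast
        fix x assume x: "x \<in> G"
        then show "sm N ((\<lambda>x\<in>G. gtr f y x - gtr f z x) x)"
          using yz gnear_mult[OF x x yz(1,2) gnear_refl yz(3)] by (simp add: gtr_def M)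
      qed
      ultimately show ?thesis by simp
    qed
    then show "\<exists>M. \<forall>x\<in>G. \<forall>y\<in>G. gnear (\<lambda>_. M) x y \<longrightarrow> sm N (l (gtr f x) - l (gtr f y))" by auto
  qed
qed

lemma avg_add: "l \<in> Lam \<Longrightarrow> f \<in> cts A \<Longrightarrow> g \<in> cts A \<Longrightarrow> avg l (\<lambda>x\<in>G. f x + g x) = (\<lambda>y\<in>G. avg l f y + avg l g y)"
  unfolding avg_def by (rule restrict_ext) (simp add: gtr_add Fn_add gtr_cts)
lemma avg_cmult: "l \<in> Lam \<Longrightarrow> f \<in> cts A \<Longrightarrow> c \<in> OK \<Longrightarrow> avg l (\<lambda>x\<in>G. c * f x) = (\<lambda>y\<in>G. c * avg l f y)"
  unfolding avg_def by (rule restrict_ext) (simp add: gtr_cmult Fn_cmult gtr_cts)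

text \<open>The domain and the range of the functional are arbitrary, so that this covers the product in
  the Iwasawa algebra and its action on distributions.\<close>

lemma conv_in:
  assumes l: "l \<in> Lam" and C: "fmod C" "C \<subseteq> cts A" and mu: "\<mu> \<in> Fn C S" and av: "\<And>f. f \<in> C \<Longrightarrow> avg l f \<in> C"
  shows "convolution A C l \<mu> \<in> Fn C S"
  unfolding Fn_iff convolution_avg
proof (intro conjI ballI)
  fix f g assume fg: "f \<in> C" "g \<in> C"
  show "(\<lambda>f\<in>C. \<mu> (avg l f)) (\<lambda>x\<in>G. f x + g x) = (\<lambda>f\<in>C. \<mu> (avg l f)) f + (\<lambda>f\<in>C. \<mu> (avg l f)) g"
    using fg fmodD(3)[OF C(1)] C(2) av by (simp add: avg_add[OF l] subsetD Fn_add[OF mu])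
next
  fix c f assume cf: "c \<in> OK" "f \<in> C"
  show "(\<lambda>f\<in>C. \<mu> (avg l f)) (\<lambda>x\<in>G. c * f x) = c * (\<lambda>f\<in>C. \<mu> (avg l f)) f"
    using cf fmodD(4)[OF C(1)] C(2) av by (simp add: avg_cmult[OF l] subsetD Fn_cmult[OF mu])
qed (use av Fn_in[OF mu] in auto)

lemma Iw_mult_in: "l \<in> Lam \<Longrightarrow> \<mu> \<in> Lam \<Longrightarrow> convolution A (cts A) l \<mu> \<in> Lam"
  by (rule conv_in) (auto intro: fmod_cts avg_cts)

lemma dirac_in: "a \<in> G \<Longrightarrow> dirac A a \<in> Lam"
  by (auto simp: Fn_iff dirac_def cts_OK cts_add cts_cmult)

lemma dirac_apply: "f \<in> cts A \<Longrightarrow> dirac A a f = f a" by (simp add: dirac_def)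

lemma avg_dirac: "f \<in> cts A \<Longrightarrow> a \<in> G \<Longrightarrow> avg (dirac A a) f = (\<lambda>y\<in>G. f (a \<otimes>\<^bsub>Gprod A\<^esub> y))"
  unfolding avg_def by (rule restrict_ext) (simp add: dirac_apply gtr_cts, simp add: gtr_def)

lemma avg_conv:
  assumes "l \<in> Lam" "\<mu> \<in> Lam" "f \<in> cts A"
  shows "avg (convolution A (cts A) l \<mu>) f = avg \<mu> (avg l f)"
proof -
  have "avg l (gtr f y) = gtr (avg l f) y" if "y \<in> G" for y
    using that unfolding avg_def gtr_def[of "avg l f" for l f] gtr_def[of "\<lambda>y\<in>G. l (gtr f y)"]
    by (intro restrict_ext) (simp add: gtr_gtr)
  then show ?thesis using assms unfolding avg_def[of "convolution A (cts A) l \<mu>"] avg_def[of \<mu>]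
    by (intro restrict_ext) (simp add: convolution_avg gtr_cts)
qed

lemma Iw_module: "module (scalars OK) (functionals A (cts A) OK)"
  by (rule functionals_module) (auto intro: fmod_cts OK_add OK_mult)

lemma Iw_ring: "ring (Iwasawa A)"
proof (rule ringI)
  interpret M: module "scalars OK" "functionals A (cts A) OK" by (rule Iw_module)
  have "add_monoid (Iwasawa A) = add_monoid (functionals A (cts A) OK)"
    by (simp add: Iwasawa_def)
  then show "abelian_group (Iwasawa A)"
    using M.abelian_group_axioms unfolding abelian_group_def abelian_monoid_def abelian_group_axioms_def by simp
  show "monoid (Iwasawa A)"
  proof (rule monoidI)
    fix l \<mu> \<nu> assume *: "l \<in> carrier (Iwasawa A)" "\<mu> \<in> carrier (Iwasawa A)" "\<nu> \<in> carrier (Iwasawa A)"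
    show "l \<otimes>\<^bsub>Iwasawa A\<^esub> \<mu> \<otimes>\<^bsub>Iwasawa A\<^esub> \<nu> = l \<otimes>\<^bsub>Iwasawa A\<^esub> (\<mu> \<otimes>\<^bsub>Iwasawa A\<^esub> \<nu>)"
    proof -
      have *: "l \<in> Lam" "\<mu> \<in> Lam" "\<nu> \<in> Lam" using * by auto
      have "(\<lambda>f\<in>cts A. \<nu> (avg (convolution A (cts A) l \<mu>) f)) = (\<lambda>f\<in>cts A. convolution A (cts A) \<mu> \<nu> (avg l f))"
        by (rule restrict_ext) (simp add: avg_conv[OF *(1,2)] convolution_avg[of "cts A" \<mu> \<nu>] avg_cts[OF *(1)])
      then show ?thesis
        unfolding Iw_sel convolution_avg[of "cts A" l "convolution A (cts A) \<mu> \<nu>"]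
          convolution_avg[of "cts A" "convolution A (cts A) l \<mu>" \<nu>] .
    qed
  next
    fix l assume l: "l \<in> carrier (Iwasawa A)"
    then have l': "l \<in> Lam" by simp
    have 1: "avg (dirac A \<one>\<^bsub>Gprod A\<^esub>) f = f" if "f \<in> cts A" for f
      using that by (intro cts_eqI[OF avg_cts[OF dirac_in that]]) (auto simp: avg_dirac)
    have 2: "gtr f \<one>\<^bsub>Gprod A\<^esub> = f" if "f \<in> cts A" for f
      using that by (intro cts_eqI[OF gtr_cts that]) (auto simp: gtr_def)
    have 3: "avg l f \<one>\<^bsub>Gprod A\<^esub> = l f" if "f \<in> cts A" for f using 2[OF that] by (simp add: avg_def)
    show "\<one>\<^bsub>Iwasawa A\<^esub> \<otimes>\<^bsub>Iwasawa A\<^esub> l = l"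
      using Fn_ext[OF l'] by (simp add: convolution_avg) (rule extensionalityI[of _ "cts A"], auto simp: 1)
    show "l \<otimes>\<^bsub>Iwasawa A\<^esub> \<one>\<^bsub>Iwasawa A\<^esub> = l"
      using Fn_ext[OF l'] by (simp add: convolution_avg)
        (rule extensionalityI[of _ "cts A"], auto simp: 3 dirac_apply avg_cts[OF l'])
  qed (auto intro: Iw_mult_in dirac_in)
  fix l \<mu> \<nu> assume *: "l \<in> carrier (Iwasawa A)" "\<mu> \<in> carrier (Iwasawa A)" "\<nu> \<in> carrier (Iwasawa A)"
  then have *: "l \<in> Lam" "\<mu> \<in> Lam" "\<nu> \<in> Lam" by auto
  show "(l \<oplus>\<^bsub>Iwasawa A\<^esub> \<mu>) \<otimes>\<^bsub>Iwasawa A\<^esub> \<nu> = l \<otimes>\<^bsub>Iwasawa A\<^esub> \<nu> \<oplus>\<^bsub>Iwasawa A\<^esub> \<mu> \<otimes>\<^bsub>Iwasawa A\<^esub> \<nu>"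
  proof -
    have "avg (\<lambda>f\<in>cts A. l f + \<mu> f) f = (\<lambda>y\<in>G. avg l f y + avg \<mu> f y)" if "f \<in> cts A" for f
      using that unfolding avg_def by (intro restrict_ext) (simp add: gtr_cts)
    then show ?thesis using * by (simp add: convolution_avg) (intro restrict_ext, simp add: Fn_add avg_cts)
  qed
  show "\<nu> \<otimes>\<^bsub>Iwasawa A\<^esub> (l \<oplus>\<^bsub>Iwasawa A\<^esub> \<mu>) = \<nu> \<otimes>\<^bsub>Iwasawa A\<^esub> l \<oplus>\<^bsub>Iwasawa A\<^esub> \<nu> \<otimes>\<^bsub>Iwasawa A\<^esub> \<mu>"
    using * by (simp add: convolution_avg) (intro restrict_ext, simp add: avg_cts)
qed

end

section \<open>Locally polynomial functions\<close>

locale pdatum_de = pdatum A for A :: "('c::{alg_closed_field, field_char_0, complete_space}, 'k::finite, 'g) datum" +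
  fixes d e :: "'k \<Rightarrow> int"
  assumes de: "d \<le> e"
begin

text \<open>Weights are written as \<open>d + n\<close> with \<open>n\<close> in a box of natural numbers; \<open>wt\<close> is this translation.\<close>

definition "dbox = {n :: 'k \<Rightarrow> nat. \<forall>i. int (n i) \<le> e i - d i}"

text \<open>The monomial \<open>\<chi>\<^sup>j\<close>, a character of \<open>\<Gamma>\<close>.\<close>

definition "wmon j x = (\<Prod>i\<in>UNIV. chi A i (x i) powi (j i))"
definition "wt n = (\<lambda>i. d i + int (n i))"

lemma de_i: "d i \<le> e i" using de by (simp add: le_fun_def)

lemma finite_dbox [simp]: "finite dbox"
proof -
  have "dbox \<subseteq> (\<Pi>\<^sub>E i\<in>UNIV. {.. nat (e i - d i)})"
  proof
    fix n assume "n \<in> dbox"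
    then have "nat (int (n i)) \<le> nat (e i - d i)" for i unfolding dbox_def by (intro nat_mono) simp
    then show "n \<in> (\<Pi>\<^sub>E i\<in>UNIV. {.. nat (e i - d i)})" by (simp add: PiE_UNIV_domain)
  qed
  then show ?thesis by (rule finite_subset) (auto intro: finite_PiE)
qed

lemma weights_dbox: "{d..e} = wt ` dbox"
proof
  show "{d..e} \<subseteq> wt ` dbox"
  proof
    fix i assume i: "i \<in> {d..e}"
    then have i': "d j \<le> i j" "i j \<le> e j" for j by (auto simp: le_fun_def)
    have "i = wt (\<lambda>j. nat (i j - d j))" using i' by (auto simp: wt_def)
    moreover have "(\<lambda>j. nat (i j - d j)) \<in> dbox" using i' by (auto simp: dbox_def)
    ultimately show "i \<in> wt ` dbox" by blast
  qed
  show "wt ` dbox \<subseteq> {d..e}" by (auto simp: wt_def dbox_def le_fun_def) (smt (verit))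
qed

lemma mon_OK: "x \<in> G \<Longrightarrow> wmon j x \<in> OK"
  by (auto simp: wmon_def G_iff intro!: OK_prod chi_powi_OK)
lemma mon_nz: "x \<in> G \<Longrightarrow> wmon j x \<noteq> 0"
  by (auto simp: wmon_def G_iff)
lemma uc_mon: "uc (wmon j)"
proof -
  have "uc (\<lambda>x. \<Prod>i\<in>UNIV. chi A i (x i) powi j i)"
    by (rule uc_prod) (auto simp: uc_chi_powi G_iff intro: OK_sm chi_powi_OK)
  then show ?thesis by (simp add: wmon_def[abs_def])
qed
lemma mon_mult: "x \<in> G \<Longrightarrow> y \<in> G \<Longrightarrow> wmon j (x \<otimes>\<^bsub>Gprod A\<^esub> y) = wmon j x * wmon j y"
  by (simp add: wmon_def Gmult G_iff chi_mult power_int_mult_distrib prod.distrib)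
lemma mon_add: "x \<in> G \<Longrightarrow> wmon (\<lambda>i. j i + j' i) x = wmon j x * wmon j' x"
  by (simp add: wmon_def G_iff power_int_add prod.distrib)

lemma C_fun_alt: "x \<in> G \<Longrightarrow>
  ((\<Prod>i\<in>UNIV. chi A i (x i) powi (- d i)) * y = (\<Sum>n | \<forall>i. int (n i) \<le> e i - d i. P n * (\<Prod>i\<in>UNIV. chi A i (x i) ^ n i)))
   \<longleftrightarrow> y = (\<Sum>n\<in>dbox. P n * wmon (wt n) x)"
proof -
  assume x: "x \<in> G"
  let ?S = "\<Sum>n\<in>dbox. P n * (\<Prod>i\<in>UNIV. chi A i (x i) ^ n i)"
  have a: "(\<Prod>i\<in>UNIV. chi A i (x i) powi (- d i)) = inverse (wmon d x)"
    using x by (simp add: wmon_def power_int_minus prod_inversef[unfolded comp_def])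
  have b: "wmon (wt n) x = wmon d x * (\<Prod>i\<in>UNIV. chi A i (x i) ^ n i)" for n
    using x unfolding wt_def by (subst mon_add) (auto simp: wmon_def)
  have "(\<Sum>n\<in>dbox. P n * wmon (wt n) x) = wmon d x * ?S"
    by (simp add: b sum_distrib_left mult_ac)
  then show ?thesis using mon_nz[OF x, of d] unfolding a dbox_def by (auto simp: field_simps)
qed

lemma C_funI:
  assumes O: "\<And>x. x \<in> G \<Longrightarrow> f x \<in> OK" and c: "\<And>r n. c r n \<in> OK"
    and f: "\<And>x. x \<in> G \<Longrightarrow> f x = (\<Sum>n\<in>dbox. c (rs m x) n * wmon (wt n) x)"
  shows "restrict f G \<in> C_fun A d e"
  unfolding C_fun_def
proof (intro CollectI conjI ballI)
  show "restrict f G \<in> G \<rightarrow>\<^sub>E OK" using O by auto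
  fix a assume a: "a \<in> G"
  let ?U = "{x \<in> G. gnear m x a}"
  have "(\<Prod>i\<in>UNIV. chi A i (x i) powi (- d i)) * restrict f G x
     = (\<Sum>n | \<forall>i. int (n i) \<le> e i - d i. c (rs m a) n * (\<Prod>i\<in>UNIV. chi A i (x i) ^ n i))" if "x \<in> ?U" for x
    using that f[of x] gnear_iff[of x a m] a by (subst C_fun_alt) auto
  then show "\<exists>U. openin (Gprod_top A) U \<and> a \<in> U \<and> (\<exists>P. range P \<subseteq> OK \<and>
    (\<forall>x\<in>U. (\<Prod>i\<in>UNIV. chi A i (x i) powi (- d i)) * restrict f G x
     = (\<Sum>n | \<forall>i. int (n i) \<le> e i - d i. P n * (\<Prod>i\<in>UNIV. chi A i (x i) ^ n i))))"
    using open_coset[OF a, of m] a c by (intro exI[of _ ?U] conjI exI[of _ "c (rs m a)"]) auto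
qed

text \<open>Compactness turns the local polynomials into one formula with coefficients that depend on the
  residue class only; it persists at all higher levels.\<close>

lemma C_funE:
  assumes f: "f \<in> C_fun A d e"
  shows "f \<in> extensional G" "\<And>x. x \<in> G \<Longrightarrow> f x \<in> OK"
    "\<exists>M0. \<forall>m. (\<forall>i. M0 \<le> m i) \<longrightarrow> (\<exists>c. (\<forall>r n. c r n \<in> OK) \<and> (\<forall>x\<in>G. f x = (\<Sum>n\<in>dbox. c (rs m x) n * wmon (wt n) x)))"
proof -
  show "f \<in> extensional G" "\<And>x. x \<in> G \<Longrightarrow> f x \<in> OK" using f by (auto simp: C_fun_def PiE_def Pi_iff)
  define Q where "Q U \<longleftrightarrow> (\<exists>P. range P \<subseteq> OK \<and> (\<forall>x\<in>U. x \<in> G \<longrightarrow> f x = (\<Sum>n\<in>dbox. P n * wmon (wt n) x)))" for U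
  have "\<exists>M. \<forall>a\<in>G. Q {x \<in> G. gnear (\<lambda>_. M) x a}"
  proof (rule uniformly_if_locally)
    fix a assume "a \<in> G"
    then obtain U P where "openin (Gprod_top A) U" "a \<in> U" "range P \<subseteq> OK"
      "\<forall>x\<in>U. (\<Prod>i\<in>UNIV. chi A i (x i) powi (- d i)) * f x
     = (\<Sum>n | \<forall>i. int (n i) \<le> e i - d i. P n * (\<Prod>i\<in>UNIV. chi A i (x i) ^ n i))"
      using f unfolding C_fun_def by blast
    then show "\<exists>U. openin (Gprod_top A) U \<and> a \<in> U \<and> Q U"
      unfolding Q_def by (intro exI[of _ U] conjI exI[of _ P]) (auto simp: C_fun_alt)
  next
    fix U V assume "Q U" "V \<subseteq> U"
    then show "Q V" unfolding Q_def by (meson subsetD)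
  qed
  then obtain M where M: "\<And>a. a \<in> G \<Longrightarrow> Q {x \<in> G. gnear (\<lambda>_. M) x a}" by auto
  show "\<exists>M0. \<forall>m. (\<forall>i. M0 \<le> m i) \<longrightarrow> (\<exists>c. (\<forall>r n. c r n \<in> OK) \<and> (\<forall>x\<in>G. f x = (\<Sum>n\<in>dbox. c (rs m x) n * wmon (wt n) x)))"
  proof (intro exI[of _ M] allI impI)
    fix m :: "'k \<Rightarrow> nat" assume m: "\<forall>i. M \<le> m i"
    have "\<forall>r. \<exists>P. range P \<subseteq> OK \<and> (\<forall>x\<in>G. gnear (\<lambda>_. M) x (gpow r) \<longrightarrow> f x = (\<Sum>n\<in>dbox. P n * wmon (wt n) x))"
    proof
      fix r
      obtain P where "range P \<subseteq> OK" "\<forall>x\<in>{x \<in> G. gnear (\<lambda>_. M) x (gpow r)}. x \<in> G \<longrightarrow> f x = (\<Sum>n\<in>dbox. P n * wmon (wt n) x)"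
        using M[OF gpow_in[of r]] unfolding Q_def by auto
      then show "\<exists>P. range P \<subseteq> OK \<and> (\<forall>x\<in>G. gnear (\<lambda>_. M) x (gpow r) \<longrightarrow> f x = (\<Sum>n\<in>dbox. P n * wmon (wt n) x))"
        by (intro exI[of _ P]) auto
    qed
    from choice[OF this] obtain c where
      "\<forall>r. range (c r) \<subseteq> OK \<and> (\<forall>x\<in>G. gnear (\<lambda>_. M) x (gpow r) \<longrightarrow> f x = (\<Sum>n\<in>dbox. c r n * wmon (wt n) x))" ..
    then have c: "\<And>r. range (c r) \<subseteq> OK"
      "\<And>r x. x \<in> G \<Longrightarrow> gnear (\<lambda>_. M) x (gpow r) \<Longrightarrow> f x = (\<Sum>n\<in>dbox. c r n * wmon (wt n) x)" by simp_all
    have "f x = (\<Sum>n\<in>dbox. c (rs m x) n * wmon (wt n) x)" if x: "x \<in> G" for x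
      using c(2)[OF x gnear_mono[OF gnear_rs[OF x, of m]]] m by (auto simp: le_fun_def)
    then show "\<exists>c. (\<forall>r n. c r n \<in> OK) \<and> (\<forall>x\<in>G. f x = (\<Sum>n\<in>dbox. c (rs m x) n * wmon (wt n) x))"
      using subsetD[OF c(1) rangeI] by (intro exI[of _ c]) auto
  qed
qed

text \<open>Representatives for the residue classes of level \<open>m\<close>.\<close>

definition "Rm m = {r :: 'k \<Rightarrow> nat. \<forall>i. r i < prm A ^ m i}"
lemma finite_Rm [simp]: "finite (Rm m)"
proof -
  have "Rm m \<subseteq> (\<Pi>\<^sub>E i\<in>UNIV. {..< prm A ^ m i})" by (auto simp: Rm_def PiE_UNIV_domain Pi_iff)
  then show ?thesis by (rule finite_subset) (auto intro: finite_PiE)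
qed
lemma rs_Rm [simp]: "rs m x \<in> Rm m" by (simp add: Rm_def)

text \<open>The character \<open>\<chi>\<^sup>j\<close> cut off to the residue class \<open>r\<close>.\<close>

definition "bas m r j = (\<lambda>x\<in>G. if rs m x = r then wmon j x else 0)"

lemma uc_bas: "uc (\<lambda>x. if rs m x = r then wmon j x else 0)"
  by (rule uc_piecewise[where m = m]) (auto simp: gnear_iff uc_mon)

lemma bas_cts: "bas m r j \<in> cts A"
  unfolding bas_def by (rule ctsI) (auto simp: mon_OK uc_bas)

lemma bas_C_fun: "n \<in> dbox \<Longrightarrow> bas m r (wt n) \<in> C_fun A d e"
  unfolding bas_def
  by (rule C_funI[where m = m and c = "\<lambda>r' n'. if r' = r \<and> n' = n then 1 else 0"])
    (auto simp: mon_OK if_distrib[of "\<lambda>x. x * _"] sum.delta cong: if_cong)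

lemma normal_form_sum:
  "(\<Sum>n\<in>dbox. c (rs m x) n * wmon (wt n) x) = (\<Sum>rn\<in>Rm m \<times> dbox. c (fst rn) (snd rn) * bas m (fst rn) (wt (snd rn)) x)"
  if "x \<in> G"
proof -
  have "(\<Sum>rn\<in>Rm m \<times> dbox. c (fst rn) (snd rn) * bas m (fst rn) (wt (snd rn)) x)
    = (\<Sum>r\<in>Rm m. if r = rs m x then (\<Sum>n\<in>dbox. c r n * wmon (wt n) x) else 0)"
    unfolding sum.cartesian_product[symmetric, where g = "\<lambda>r n. c r n * bas m r (wt n) x", simplified case_prod_unfold]
    using that by (intro sum.cong) (auto simp: bas_def)
  also have "\<dots> = (\<Sum>n\<in>dbox. c (rs m x) n * wmon (wt n) x)" by (simp add: sum.delta')
  finally show ?thesis by simp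
qed

text \<open>The cut-off characters generate the locally polynomial functions, with all sufficiently large
  levels allowed simultaneously.\<close>

lemma C_fun_expand:
  assumes f: "f \<in> C_fun A d e"
  shows "\<exists>M0. \<forall>m. (\<forall>i. M0 \<le> m i) \<longrightarrow> (\<exists>c. (\<forall>r n. c r n \<in> OK) \<and>
    f = (\<lambda>x\<in>G. \<Sum>rn\<in>Rm m \<times> dbox. c (fst rn) (snd rn) * bas m (fst rn) (wt (snd rn)) x))"
proof -
  obtain M0 where M0: "\<And>m. (\<forall>i. M0 \<le> m i) \<Longrightarrow> (\<exists>c. (\<forall>r n. c r n \<in> OK) \<and> (\<forall>x\<in>G. f x = (\<Sum>n\<in>dbox. c (rs m x) n * wmon (wt n) x)))"
    using C_funE(3)[OF f] by auto
  show ?thesis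
  proof (intro exI[of _ M0] allI impI)
    fix m :: "'k \<Rightarrow> nat" assume m: "\<forall>i. M0 \<le> m i"
    have "\<exists>c. (\<forall>r n. c r n \<in> OK) \<and> (\<forall>x\<in>G. f x = (\<Sum>n\<in>dbox. c (rs m x) n * wmon (wt n) x))" by (rule M0) (rule m)
    then obtain c where c: "\<forall>r n. c r n \<in> OK" "\<forall>x\<in>G. f x = (\<Sum>n\<in>dbox. c (rs m x) n * wmon (wt n) x)" by auto
    have "f = (\<lambda>x\<in>G. \<Sum>rn\<in>Rm m \<times> dbox. c (fst rn) (snd rn) * bas m (fst rn) (wt (snd rn)) x)"
      by (rule extensionalityI[OF C_funE(1)[OF f]]) (use c(2) normal_form_sum[of _ c m] in auto)
    then show "\<exists>c. (\<forall>r n. c r n \<in> OK) \<and> f = (\<lambda>x\<in>G. \<Sum>rn\<in>Rm m \<times> dbox. c (fst rn) (snd rn) * bas m (fst rn) (wt (snd rn)) x)"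
      using c(1) by auto
  qed
qed

lemma C_fun_cts: "C_fun A d e \<subseteq> cts A"
proof
  fix f assume f: "f \<in> C_fun A d e"
  obtain M0 where "\<forall>m. (\<forall>i. M0 \<le> m i) \<longrightarrow> (\<exists>c. (\<forall>r n. c r n \<in> OK) \<and>
    f = (\<lambda>x\<in>G. \<Sum>rn\<in>Rm m \<times> dbox. c (fst rn) (snd rn) * bas m (fst rn) (wt (snd rn)) x))"
    using C_fun_expand[OF f] by auto
  from this[rule_format, of "\<lambda>_. M0"] obtain c where c: "\<And>r n. c r n \<in> OK"
    "f = (\<lambda>x\<in>G. \<Sum>rn\<in>Rm (\<lambda>_. M0) \<times> dbox. c (fst rn) (snd rn) * bas (\<lambda>_. M0) (fst rn) (wt (snd rn)) x)" by auto
  show "f \<in> cts A" unfolding c(2)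
    by (rule fmod_sum[OF fmod_cts]) (auto simp: c(1) bas_cts)
qed

lemma C_fun_common:
  assumes "f \<in> C_fun A d e" "g \<in> C_fun A d e"
  shows "\<exists>m c c'. (\<forall>r n. c r n \<in> OK) \<and> (\<forall>r n. c' r n \<in> OK) \<and> (\<forall>x\<in>G. f x = (\<Sum>n\<in>dbox. c (rs m x) n * wmon (wt n) x))
     \<and> (\<forall>x\<in>G. g x = (\<Sum>n\<in>dbox. c' (rs m x) n * wmon (wt n) x))"
proof -
  obtain M1 where M1: "\<And>m. (\<forall>i. M1 \<le> m i) \<Longrightarrow> (\<exists>c. (\<forall>r n. c r n \<in> OK) \<and> (\<forall>x\<in>G. f x = (\<Sum>n\<in>dbox. c (rs m x) n * wmon (wt n) x)))"
    using C_funE(3)[OF assms(1)] by auto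
  obtain M2 where M2: "\<And>m. (\<forall>i. M2 \<le> m i) \<Longrightarrow> (\<exists>c. (\<forall>r n. c r n \<in> OK) \<and> (\<forall>x\<in>G. g x = (\<Sum>n\<in>dbox. c (rs m x) n * wmon (wt n) x)))"
    using C_funE(3)[OF assms(2)] by auto
  let ?m = "\<lambda>_. max M1 M2"
  obtain c c' where "\<forall>r n. c r n \<in> OK" "\<forall>x\<in>G. f x = (\<Sum>n\<in>dbox. c (rs ?m x) n * wmon (wt n) x)"
    "\<forall>r n. c' r n \<in> OK" "\<forall>x\<in>G. g x = (\<Sum>n\<in>dbox. c' (rs ?m x) n * wmon (wt n) x)"
    using M1[of ?m] M2[of ?m] by auto
  then show ?thesis by (intro exI[of _ ?m] exI[of _ c] exI[of _ c']) simp
qed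

lemma C_fun_normal:
  assumes "f \<in> C_fun A d e"
  shows "\<exists>m c. (\<forall>r n. c r n \<in> OK) \<and> (\<forall>x\<in>G. f x = (\<Sum>n\<in>dbox. c (rs m x) n * wmon (wt n) x))"
proof -
  obtain M where M: "\<And>m. (\<forall>i. M \<le> m i) \<Longrightarrow> (\<exists>c. (\<forall>r n. c r n \<in> OK) \<and> (\<forall>x\<in>G. f x = (\<Sum>n\<in>dbox. c (rs m x) n * wmon (wt n) x)))"
    using C_funE(3)[OF assms] by auto
  show ?thesis by (rule exI[of _ "\<lambda>_. M"], rule M) simp
qed

lemma fmod_C_fun: "fmod (C_fun A d e)"
  unfolding fmod_def
proof (intro conjI ballI)
  show "(\<lambda>x\<in>G. 0) \<in> C_fun A d e"
    by (rule C_funI[where c = "\<lambda>r n. 0" and m = "\<lambda>_. 0"]) auto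
  show "C_fun A d e \<subseteq> extensional G" using C_funE(1) by auto
next
  fix f g assume fg: "f \<in> C_fun A d e" "g \<in> C_fun A d e"
  obtain m c c' where "\<forall>r n. c r n \<in> OK" "\<forall>r n. c' r n \<in> OK" "\<forall>x\<in>G. f x = (\<Sum>n\<in>dbox. c (rs m x) n * wmon (wt n) x)"
    "\<forall>x\<in>G. g x = (\<Sum>n\<in>dbox. c' (rs m x) n * wmon (wt n) x)" using C_fun_common[OF fg] by auto
  then show "(\<lambda>x\<in>G. f x + g x) \<in> C_fun A d e"
    using C_funE(2)[OF fg(1)] C_funE(2)[OF fg(2)]
    by (intro C_funI[where c = "\<lambda>r n. c r n + c' r n" and m = m]) (auto simp: algebra_simps sum.distrib OK_add)
next
  fix a f assume a: "a \<in> OK" and f: "f \<in> C_fun A d e"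
  obtain m c where "\<forall>r n. c r n \<in> OK" "\<forall>x\<in>G. f x = (\<Sum>n\<in>dbox. c (rs m x) n * wmon (wt n) x)" using C_fun_normal[OF f] by auto
  then show "(\<lambda>x\<in>G. a * f x) \<in> C_fun A d e"
    using a
    by (intro C_funI[where c = "\<lambda>r n. a * c r n" and m = m] OK_mult[OF a C_funE(2)[OF f]])
      (auto simp: sum_distrib_left mult_ac OK_mult)
qed

text \<open>The characters in the normal form of \<open>f\<close> are multiplicative, so integrating a translate of \<open>f\<close>
  affects only the coefficients, which depend on the residue class of the translation.\<close>

lemma avg_C_fun:
  assumes l: "l \<in> Lam" and f: "f \<in> C_fun A d e"
  shows "avg l f \<in> C_fun A d e"
proof -
  obtain m c where c0: "\<forall>r n. c r n \<in> OK" "\<forall>x\<in>G. f x = (\<Sum>n\<in>dbox. c (rs m x) n * wmon (wt n) x)" using C_fun_normal[OF f] by auto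
  note c = c0[rule_format]
  have fc: "f \<in> cts A" using f C_fun_cts by auto
  let ?g = "\<lambda>r n. \<lambda>x\<in>G. c (rs m (x \<otimes>\<^bsub>Gprod A\<^esub> gpow r)) n * wmon (wt n) x"
  have g: "?g r n \<in> cts A" for r n
  proof (rule ctsI)
    show "uc (\<lambda>x. c (rs m (x \<otimes>\<^bsub>Gprod A\<^esub> gpow r)) n * wmon (wt n) x)"
    proof (intro uc_mult uc_mon uc_local[where m = m])
      fix x y assume xy: "x \<in> G" "y \<in> G" "gnear m x y"
      have "gnear m (x \<otimes>\<^bsub>Gprod A\<^esub> gpow r) (y \<otimes>\<^bsub>Gprod A\<^esub> gpow r)" using gnear_mult[OF xy(1,2) _ _ xy(3)] by simp
      then show "c (rs m (x \<otimes>\<^bsub>Gprod A\<^esub> gpow r)) n = c (rs m (y \<otimes>\<^bsub>Gprod A\<^esub> gpow r)) n" using xy by (simp add: gnear_iff)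
    qed (auto intro: OK_sm c mon_OK)
  qed (auto intro!: OK_mult c mon_OK)
  have "l (gtr f y) = (\<Sum>n\<in>dbox. l (?g (rs m y) n) * wmon (wt n) y)" if y: "y \<in> G" for y
  proof -
    have "gtr f y = (\<lambda>x\<in>G. \<Sum>n\<in>dbox. wmon (wt n) y * ?g (rs m y) n x)"
      unfolding gtr_def
    proof (rule restrict_ext)
      fix x assume x: "x \<in> G"
      have "gnear m (x \<otimes>\<^bsub>Gprod A\<^esub> y) (x \<otimes>\<^bsub>Gprod A\<^esub> gpow (rs m y))"
        by (rule gnear_mult) (auto simp: x y gnear_rs)
      then have "rs m (x \<otimes>\<^bsub>Gprod A\<^esub> y) = rs m (x \<otimes>\<^bsub>Gprod A\<^esub> gpow (rs m y))" using x y by (simp add: gnear_iff)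
      then show "f (x \<otimes>\<^bsub>Gprod A\<^esub> y) = (\<Sum>n\<in>dbox. wmon (wt n) y * ?g (rs m y) n x)"
        using x y c(2)[of "x \<otimes>\<^bsub>Gprod A\<^esub> y"] by (simp add: mon_mult mult_ac)
    qed
    then show ?thesis using Fn_sum[OF fmod_cts l, of dbox "\<lambda>n. wmon (wt n) y" "?g (rs m y)"] g y mon_OK
      by (simp add: mult.commute)
  qed
  note e = this
  show ?thesis unfolding avg_def
  proof (rule C_funI[where c = "\<lambda>r n. l (?g r n)" and m = m])
    fix x assume x: "x \<in> G"
    show "l (gtr f x) \<in> OK" by (rule Fn_in[OF l gtr_cts[OF fc x]])
    show "l (gtr f x) = (\<Sum>n\<in>dbox. l (?g (rs m x) n) * wmon (wt n) x)" by (rule e[OF x])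
  next
    show "l (?g r n) \<in> OK" for r n by (rule Fn_in[OF l g])
  qed
qed

end

section \<open>Lagrange interpolation at powers of the generators\<close>

context pdatum_de
begin

text \<open>The number of weights in direction \<open>i\<close>.\<close>

definition "nn i = nat (e i - d i) + 1"
definition "qq m i = prm A ^ (m i :: nat)"

text \<open>Translation by \<open>\<gamma>\<^sub>i\<^sup>q\<close>.\<close>

definition "tr i q x = x(i := gam A i [^]\<^bsub>Gam A i\<^esub> (q::nat) \<otimes>\<^bsub>Gam A i\<^esub> x i)"

text \<open>The effect on functions of the factor \<open>[\<gamma>\<^sub>i]\<^sup>q - u\<^sub>i\<^bsup>j q\<^esup>\<close> of the generator of the ideal.\<close>

definition "omega_factor i q j f = (\<lambda>y\<in>G. f (tr i q y) - uu i powi (j * int q) * f y)"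

text \<open>The effect on functions of the product of the first \<open>n\<close> factors.\<close>

primrec omega_op where
  "omega_op i q 0 f = f"
| "omega_op i q (Suc n) f = omega_op i q n (omega_factor i q (d i + int n) f)"
definition "z0 = (\<lambda>x\<in>G. 0 :: 'c)"

text \<open>The functions on which the quotient by the ideal of level \<open>m\<close> can be evaluated.\<close>

definition "W m = {f \<in> cts A. \<forall>i. omega_op i (qq m i) (nn i) f = z0}"

lemma qq_pos [simp]: "qq m i > 0" by (simp add: qq_def)
lemma nn_pos [simp]: "nn i > 0" by (simp add: nn_def)

lemma tr_in [simp]: "x \<in> G \<Longrightarrow> tr i q x \<in> G" by (simp add: tr_def G_in)

lemma tr_eq: "x \<in> G \<Longrightarrow> tr i q x = (\<one>\<^bsub>Gprod A\<^esub>)(i := gam A i [^]\<^bsub>Gam A i\<^esub> q) \<otimes>\<^bsub>Gprod A\<^esub> x"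
proof -
  assume x: "x \<in> G"
  have "\<one>\<^bsub>Gam A j\<^esub> \<otimes>\<^bsub>Gam A j\<^esub> x j = x j" for j
    using group_Gam[of j] G_in[OF x, of j] by (simp add: group.is_monoid monoid.l_one)
  then show ?thesis by (auto simp: tr_def Gmult Gone)
qed

lemma gq_in: "(\<one>\<^bsub>Gprod A\<^esub>)(i := gam A i [^]\<^bsub>Gam A i\<^esub> (q::nat)) \<in> G" by simp

lemma tr_mult_left: "x \<in> G \<Longrightarrow> y \<in> G \<Longrightarrow> tr i q (x \<otimes>\<^bsub>Gprod A\<^esub> y) = tr i q x \<otimes>\<^bsub>Gprod A\<^esub> y"
  by (simp add: tr_eq G_assoc)
lemma tr_mult_right: "x \<in> G \<Longrightarrow> y \<in> G \<Longrightarrow> tr i q (x \<otimes>\<^bsub>Gprod A\<^esub> y) = x \<otimes>\<^bsub>Gprod A\<^esub> tr i q y"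
  using tr_mult_left[of y x i q] G_comm[of x y] G_comm[of x "tr i q y"] by simp

lemma tr_gnear: "x \<in> G \<Longrightarrow> y \<in> G \<Longrightarrow> gnear m x y \<Longrightarrow> gnear m (tr i q x) (tr i q y)"
  by (simp add: tr_eq gnear_mult del: fun_upd_apply)

lemma uu_powi_OK [simp]: "uu i powi j \<in> OK" by (simp add: uu_def chi_powi_OK)
lemma uu_nz [simp]: "uu i \<noteq> 0" by (simp add: uu_def)

lemma tr_upd: "tr i q (x(i := gam A i [^]\<^bsub>Gam A i\<^esub> (r::nat))) = x(i := gam A i [^]\<^bsub>Gam A i\<^esub> (q + r))"
proof -
  interpret group "Gam A i" by (rule group_Gam)
  show ?thesis by (simp add: tr_def nat_pow_mult)
qed
lemma tr_upd_other: "i \<noteq> j \<Longrightarrow> tr i q (x(j := g)) = (tr i q x)(j := g)"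
  by (auto simp: tr_def)
lemma tr_other: "i \<noteq> j \<Longrightarrow> tr i q x j = x j" by (simp add: tr_def)
lemma chi_tr: "x \<in> G \<Longrightarrow> chi A i (tr i q x i) = uu i ^ q * chi A i (x i)"
  by (simp add: tr_def chi_mult G_in chi_pow uu_def)
lemma res_tr: "x \<in> G \<Longrightarrow> res i m (tr i (prm A ^ m) x i) = res i m (x i)"
  by (simp add: tr_def res_mult G_in)

lemma omega_factor_cts: "f \<in> cts A \<Longrightarrow> omega_factor i q j f \<in> cts A"
  unfolding omega_factor_def
proof (rule ctsI)
  assume f: "f \<in> cts A"
  show "uc (\<lambda>y. f (tr i q y) - uu i powi (j * int q) * f y)"
    by (intro uc_diff uc_cmult cts_uc[OF f] uc_comp[OF cts_uc[OF f]]) (auto intro: tr_gnear)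
  show "\<And>x. x \<in> G \<Longrightarrow> f (tr i q x) - uu i powi (j * int q) * f x \<in> OK"
    by (auto intro!: OK_diff OK_mult cts_OK[OF f])
qed

lemma omega_op_cts: "f \<in> cts A \<Longrightarrow> omega_op i q n f \<in> cts A"
  by (induction n arbitrary: f) (auto intro: omega_factor_cts)

lemma omega_op_sum: "omega_op i q n (\<lambda>x\<in>G. \<Sum>k\<in>I. c k * f k x) = (\<lambda>x\<in>G. \<Sum>k\<in>I. c k * omega_op i q n (f k) x)"
proof (induction n arbitrary: f)
  case (Suc n)
  have "omega_factor i q (d i + int n) (\<lambda>x\<in>G. \<Sum>k\<in>I. c k * f k x) = (\<lambda>x\<in>G. \<Sum>k\<in>I. c k * omega_factor i q (d i + int n) (f k) x)"
    unfolding omega_factor_def by (rule restrict_ext) (simp add: sum_subtractf sum_distrib_left right_diff_distrib mult.left_commute)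
  then show ?case by (simp only: omega_op.simps Suc.IH)
qed simp

lemma omega_op_diff: "omega_op i q n (\<lambda>x\<in>G. f x - g x) = (\<lambda>x\<in>G. omega_op i q n f x - omega_op i q n g x)"
proof (induction n arbitrary: f g)
  case (Suc n)
  have "omega_factor i q (d i + int n) (\<lambda>x\<in>G. f x - g x) = (\<lambda>x\<in>G. omega_factor i q (d i + int n) f x - omega_factor i q (d i + int n) g x)"
    unfolding omega_factor_def by (rule restrict_ext) (simp add: algebra_simps)
  then show ?case by (simp only: omega_op.simps Suc.IH)
qed simp

lemma omega_op_avg: "l \<in> Lam \<Longrightarrow> f \<in> cts A \<Longrightarrow> omega_op i q n (avg l f) = avg l (omega_op i q n f)"
proof (induction n arbitrary: f)
  case (Suc n)
  let ?a = "uu i powi ((d i + int n) * int q)"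
  have "omega_factor i q (d i + int n) (avg l f) = avg l (omega_factor i q (d i + int n) f)"
    unfolding omega_factor_def[of _ _ _ "avg l f"] avg_def[of l "omega_factor i q (d i + int n) f"]
  proof (rule restrict_ext)
    fix y assume y: "y \<in> G"
    let ?h = "\<lambda>x\<in>G. ?a * gtr f y x"
    have h: "?h \<in> cts A" by (rule cts_cmult[OF uu_powi_OK gtr_cts[OF Suc.prems(2) y]])
    have "gtr (omega_factor i q (d i + int n) f) y = (\<lambda>x\<in>G. gtr f (tr i q y) x - ?h x)"
      unfolding gtr_def omega_factor_def using y by (intro restrict_ext) (simp add: tr_mult_right)
    moreover have "l (\<lambda>x\<in>G. gtr f (tr i q y) x - ?h x) = l (gtr f (tr i q y)) - l ?h"
      by (rule Fn_diff[OF fmod_cts Suc.prems(1) gtr_cts[OF Suc.prems(2) tr_in[OF y]] h])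
    moreover have "l ?h = ?a * l (gtr f y)"
      by (rule Fn_cmult[OF Suc.prems(1) uu_powi_OK gtr_cts[OF Suc.prems(2) y]])
    ultimately show "avg l f (tr i q y) - ?a * avg l f y = l (gtr (omega_factor i q (d i + int n) f) y)"
      using y by (simp add: avg_def)
  qed
  then show ?case using Suc.IH[OF Suc.prems(1) omega_factor_cts[OF Suc.prems(2)]] by (simp only: omega_op.simps)
qed simp

lemma omega_op_gtr: "y \<in> G \<Longrightarrow> omega_op i q n (gtr f y) = gtr (omega_op i q n f) y"
proof (induction n arbitrary: f)
  case (Suc n)
  have "omega_factor i q (d i + int n) (gtr f y) = gtr (omega_factor i q (d i + int n) f) y"
    unfolding omega_factor_def gtr_def using Suc.prems by (intro restrict_ext) (simp add: tr_mult_left)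
  then show ?case using Suc.IH[OF Suc.prems] by (simp only: omega_op.simps)
qed simp

text \<open>One factor applied to \<open>f\<close> gives a function with values in \<open>S\<close>, by induction on the number of
  factors, and this is a recurrence for \<open>f\<close> of step \<open>q\<close> with a unit as coefficient. Taking the ring of integers for
  \<open>S\<close> gives integrality, taking \<open>0\<close> gives uniqueness.\<close>

lemma omega_op_recurrence:
  assumes q: "q > 0" and x: "x \<in> G"
    and S: "\<And>a b. a \<in> S \<Longrightarrow> b \<in> S \<Longrightarrow> a + b \<in> S" "\<And>a b. a \<in> S \<Longrightarrow> b \<in> S \<Longrightarrow> a - b \<in> S"
      "\<And>a k. a \<in> S \<Longrightarrow> uu i powi k * a \<in> S"
    and T: "\<And>r::nat. omega_op i q n f (x(i := gam A i [^]\<^bsub>Gam A i\<^esub> r)) \<in> S"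
    and init: "\<And>r::nat. r < q * n \<Longrightarrow> f (x(i := gam A i [^]\<^bsub>Gam A i\<^esub> r)) \<in> S"
  shows "f (x(i := gam A i [^]\<^bsub>Gam A i\<^esub> (r::nat))) \<in> S"
  using T init
proof (induction n arbitrary: f r)
  case (Suc n)
  let ?x = "\<lambda>r. x(i := gam A i [^]\<^bsub>Gam A i\<^esub> (r::nat))"
  let ?a = "uu i powi ((d i + int n) * int q)"
  let ?g = "omega_factor i q (d i + int n) f"
  have g: "?g (?x r) = f (?x (q + r)) - ?a * f (?x r)" for r
    using x by (simp add: omega_factor_def tr_upd)
  have gS: "?g (?x r) \<in> S" for r
  proof (rule Suc.IH)
    show "omega_op i q n ?g (?x r) \<in> S" for r using Suc.prems(1)[of r] by (simp only: omega_op.simps)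
    show "?g (?x r) \<in> S" if "r < q * n" for r
      unfolding g using that by (intro S Suc.prems(2)) auto
  qed
  show ?case
  proof (induction r rule: less_induct)
    case (less r)
    show ?case
    proof (cases "r < q")
      case True
      then show ?thesis using Suc.prems(2)[of r] by simp
    next
      case False
      then have r: "q + (r - q) = r" by simp
      have "f (?x r) = ?g (?x (r - q)) + ?a * f (?x (r - q))" unfolding g r by simp
      moreover have "f (?x (r - q)) \<in> S" by (rule less) (use False q in auto)
      then have "?g (?x (r - q)) + ?a * f (?x (r - q)) \<in> S" by (rule S(1)[OF gS S(3)])
      ultimately show ?thesis by (simp only:)
    qed
  qed
qed simp

text \<open>The character \<open>\<chi>\<^sup>j\<close> is an eigenfunction of the translation with eigenvalue \<open>u\<^bsup>j q\<^esup>\<close>, and functions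
  that are periodic under the translation behave as constants; each factor removes one weight.\<close>

lemma omega_op_kills:
  assumes g: "\<And>t x. x \<in> G \<Longrightarrow> g t (tr i q x) = g t x"
  shows "omega_op i q n (\<lambda>x\<in>G. \<Sum>t<n. g t x * chi A i (x i) powi (d i + int t)) = z0"
  using assms
proof (induction n arbitrary: g)
  case (Suc n)
  let ?a = "\<lambda>t. uu i powi ((d i + int t) * int q)"
  have p: "chi A i (tr i q x i) powi j = uu i powi (j * int q) * chi A i (x i) powi j" if "x \<in> G" for x j
    using that by (simp add: chi_tr power_int_mult_distrib power_int_mult mult.commute[of j])
  have "omega_factor i q (d i + int n) (\<lambda>x\<in>G. \<Sum>t<Suc n. g t x * chi A i (x i) powi (d i + int t))
    = (\<lambda>x\<in>G. \<Sum>t<n. (g t x * (?a t - ?a n)) * chi A i (x i) powi (d i + int t))"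
    unfolding omega_factor_def
    by (rule restrict_ext) (simp add: p Suc.prems algebra_simps sum_subtractf sum_distrib_left)
  then show ?case by (simp only: omega_op.simps) (rule Suc.IH, simp add: Suc.prems)
qed (simp add: z0_def)

text \<open>The points of interpolation for the index \<open>r\<close> are the powers of \<open>u\<close> with exponents in the residue
  class of \<open>r\<close>; \<open>u\<^sup>r\<close> itself is the one with index \<open>r div q\<close>.\<close>

definition "node i q r l = uu i ^ (r mod q + q * l :: nat)"

text \<open>On the residue class of \<open>r\<close>, the Lagrange polynomial for these nodes times the character
  \<open>\<chi>\<^sup>d\<close> normalised at \<open>u\<^sup>r\<close>; zero elsewhere.\<close>

definition "lagrange i m r y = (if res i m y = r mod (prm A ^ m) then (chi A i y / uu i ^ r) powi (d i) *
   (\<Prod>l\<in>{..<nn i} - {r div (prm A ^ m)}. (chi A i y - node i (prm A ^ m) r l) / (uu i ^ r - node i (prm A ^ m) r l)) else 0)"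

lemma uu_inj: "uu i ^ r = uu i ^ s \<longleftrightarrow> r = s"
proof
  assume "uu i ^ r = uu i ^ s"
  then have "ordp A (of_int (int r - int s)) = \<infinity>" using ord_uu_diff_tp[of i r s] by simp
  then show "r = s" using ord_infty by (metis of_int_eq_0_iff of_nat_eq_iff right_minus_eq)
qed simp

lemma node_self: "node i q r (r div q) = uu i ^ r"
  by (simp add: node_def)

lemma lagrange_gam:
  assumes "r < prm A ^ m * nn i" "s < prm A ^ m * nn i"
  shows "lagrange i m r (gam A i [^]\<^bsub>Gam A i\<^esub> s) = (if r = s then 1 else 0)"
proof (cases "s mod prm A ^ m = r mod prm A ^ m")
  case True
  let ?q = "prm A ^ m"
  have nz: "uu i ^ r - node i ?q r l \<noteq> 0" if "l \<noteq> r div ?q" for l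
  proof
    assume "uu i ^ r - node i ?q r l = 0"
    then have "r = r mod ?q + ?q * l" by (simp add: node_def uu_inj)
    then have "r div ?q = l" by (metis add.right_neutral div_mult_self2 mod_div_trivial add_0 mult.commute power_not_zero p_nonzero div_mult_self4)
    then show False using that by simp
  qed
  show ?thesis
  proof (cases "r = s")
    case True
    then show ?thesis using nz by (auto simp: lagrange_def chi_pow uu_def[symmetric] intro!: prod.neutral)
  next
    case False
    have "s div ?q \<noteq> r div ?q" using True False by (metis div_mult_mod_eq)
    moreover have "s div ?q < nn i" using assms(2) by (simp add: less_mult_imp_div_less mult.commute)
    moreover have "node i ?q r (s div ?q) = uu i ^ s" using True node_self[of i ?q s] by (simp add: node_def)
    ultimately have "(\<Prod>l\<in>{..<nn i} - {r div ?q}. (uu i ^ s - node i ?q r l) / (uu i ^ r - node i ?q r l)) = 0"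
      by (intro prod_zero bexI[of _ "s div ?q"]) auto
    then show ?thesis using False True by (simp add: lagrange_def chi_pow uu_def[symmetric])
  qed
next
  case False
  then show ?thesis by (auto simp: lagrange_def)
qed

lemma poly_prod_linear_expand:
  fixes a :: "nat \<Rightarrow> 'c"
  assumes "finite I"
  shows "\<exists>c. \<forall>x. (\<Prod>l\<in>I. a l * x - b l) = (\<Sum>t<card I + 1. c t * x ^ t)"
proof -
  let ?P = "\<Prod>l\<in>I. [: - b l, a l :]"
  have deg: "degree ?P \<le> card I"
  proof -
    have "degree ?P \<le> sum (degree \<circ> (\<lambda>l. [: - b l, a l :])) I" by (rule degree_prod_sum_le[OF assms])
    also have "\<dots> \<le> (\<Sum>l\<in>I. 1)" by (rule sum_mono) (simp add: degree_pCons_eq_if)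
    finally show ?thesis by simp
  qed
  have "(\<Prod>l\<in>I. a l * x - b l) = (\<Sum>t<card I + 1. poly.coeff ?P t * x ^ t)" for x
  proof -
    have "(\<Prod>l\<in>I. a l * x - b l) = poly ?P x" by (simp add: poly_prod mult.commute)
    also have "\<dots> = (\<Sum>t\<le>degree ?P. poly.coeff ?P t * x ^ t)" by (rule poly_altdef)
    also have "\<dots> = (\<Sum>t<card I + 1. poly.coeff ?P t * x ^ t)"
      by (rule sum.mono_neutral_left) (use deg in \<open>auto simp: coeff_eq_0\<close>)
    finally show ?thesis .
  qed
  then show ?thesis by (intro exI[of _ "poly.coeff ?P"]) auto
qed

lemma lagrange_expand:
  assumes r: "r < prm A ^ m * nn i"
  shows "\<exists>c. \<forall>y\<in>cG i. lagrange i m r y = (\<Sum>t<nn i. (if res i m y = r mod prm A ^ m then c t else 0) * chi A i y powi (d i + int t))"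
proof -
  let ?q = "prm A ^ m"
  let ?I = "{..<nn i} - {r div ?q}"
  have "r div ?q < nn i" using r by (simp add: less_mult_imp_div_less mult.commute)
  then have cI: "card ?I + 1 = nn i" by simp
  let ?D = "\<lambda>l. uu i ^ r - node i ?q r l"
  obtain c where c: "\<And>x. (\<Prod>l\<in>?I. (1 / ?D l) * x - node i ?q r l / ?D l) = (\<Sum>t<nn i. c t * x ^ t)"
    using poly_prod_linear_expand[of ?I "\<lambda>l. 1 / ?D l" "\<lambda>l. node i ?q r l / ?D l"] unfolding cI by auto
  show ?thesis
  proof (intro exI[of _ "\<lambda>t. c t / (uu i ^ r) powi d i"] ballI)
    fix y assume y: "y \<in> cG i"
    show "lagrange i m r y = (\<Sum>t<nn i. (if res i m y = r mod prm A ^ m then c t / (uu i ^ r) powi d i else 0) * chi A i y powi (d i + int t))"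
    proof (cases "res i m y = r mod ?q")
      case True
      have "(\<Prod>l\<in>?I. (chi A i y - node i ?q r l) / ?D l) = (\<Sum>t<nn i. c t * chi A i y ^ t)"
        unfolding c[symmetric] by (simp add: diff_divide_distrib)
      then have "lagrange i m r y = (chi A i y / uu i ^ r) powi d i * (\<Sum>t<nn i. c t * chi A i y ^ t)"
        using True by (simp add: lagrange_def)
      also have "\<dots> = (\<Sum>t<nn i. (c t / (uu i ^ r) powi d i) * chi A i y powi (d i + int t))"
        using y by (simp add: sum_distrib_left power_int_divide_distrib power_int_add field_simps)
      finally show ?thesis using True by simp
    qed (simp add: lagrange_def)
  qed
qed

lemma uc_lagrange:
  assumes r: "r < prm A ^ m * nn i"
  shows "uc (\<lambda>x. lagrange i m r (x i))"
proof -
  obtain c where c: "\<forall>y\<in>cG i. lagrange i m r y = (\<Sum>t<nn i. (if res i m y = r mod prm A ^ m then c t else 0) * chi A i y powi (d i + int t))"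
    using lagrange_expand[OF r] by auto
  have "uc (\<lambda>x. \<Sum>t<nn i. c t * (if res i m (x i) = r mod prm A ^ m then chi A i (x i) powi (d i + int t) else 0))"
  proof (intro uc_sum uc_cmult uc_piecewise[where m = "\<lambda>_. m"] uc_chi_powi uc_const)
    fix x y assume "x \<in> G" "y \<in> G" "gnear (\<lambda>_. m) x y"
    then have "res i m (x i) = res i m (y i)" by (auto simp: gnear_def G_in near_iff_res)
    then show "(res i m (x i) = r mod prm A ^ m) = (res i m (y i) = r mod prm A ^ m)" by simp
  qed
  moreover have "(\<Sum>t<nn i. c t * (if res i m (x i) = r mod prm A ^ m then chi A i (x i) powi (d i + int t) else 0))
      = lagrange i m r (x i)" if "x \<in> G" for x
    using c that by (auto simp: G_in intro!: sum.cong)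
  ultimately show ?thesis using uc_cong[of "\<lambda>x. \<Sum>t<nn i. c t * (if res i m (x i) = r mod prm A ^ m then chi A i (x i) powi (d i + int t) else 0)"
     "\<lambda>x. lagrange i m r (x i)"] by simp
qed

lemma omega_op_lagrange:
  assumes r: "r < prm A ^ m * nn i" and h: "\<And>x. x \<in> G \<Longrightarrow> h (tr i (prm A ^ m) x) = h x"
  shows "omega_op i (prm A ^ m) (nn i) (\<lambda>x\<in>G. h x * lagrange i m r (x i)) = z0"
proof -
  obtain c where c: "\<forall>y\<in>cG i. lagrange i m r y = (\<Sum>t<nn i. (if res i m y = r mod prm A ^ m then c t else 0) * chi A i y powi (d i + int t))"
    using lagrange_expand[OF r] by auto
  have "omega_op i (prm A ^ m) (nn i) (\<lambda>x\<in>G. \<Sum>t<nn i. (h x * (if res i m (x i) = r mod prm A ^ m then c t else 0)) * chi A i (x i) powi (d i + int t)) = z0"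
    by (rule omega_op_kills) (simp add: h res_tr)
  moreover have "(\<lambda>x\<in>G. h x * lagrange i m r (x i)) = (\<lambda>x\<in>G. \<Sum>t<nn i. (h x * (if res i m (x i) = r mod prm A ^ m then c t else 0)) * chi A i (x i) powi (d i + int t))"
    by (rule restrict_ext) (simp add: c G_in sum_distrib_left mult.assoc)
  ultimately show ?thesis by simp
qed

text \<open>Integrality is not visible from the formula, whose denominators are not units. It follows from
  the recurrence: the first \<open>q n\<close> values on powers of the generator are \<open>0\<close> or \<open>1\<close>, so that all of
  them are integral, and these powers are dense.\<close>

lemma lagrange_OK:
  assumes r: "r < prm A ^ m * nn i" and y: "y \<in> cG i"
  shows "lagrange i m r y \<in> OK"
proof -
  let ?f = "\<lambda>x\<in>G. 1 * lagrange i m r (x i)"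
  let ?x = "\<lambda>r. (\<one>\<^bsub>Gprod A\<^esub>)(i := gam A i [^]\<^bsub>Gam A i\<^esub> (r::nat))"
  have "?f (?x s) \<in> OK" for s
  proof (rule omega_op_recurrence[where q = "prm A ^ m" and n = "nn i"])
    show "omega_op i (prm A ^ m) (nn i) ?f (?x s) \<in> OK" for s
      by (subst omega_op_lagrange[OF r]) (auto simp: z0_def simp del: fun_upd_apply)
    show "?f (?x s) \<in> OK" if "s < prm A ^ m * nn i" for s using lagrange_gam[OF r that] by simp
  qed (auto intro: OK_add OK_diff OK_mult)
  then have gs: "lagrange i m r (gam A i [^]\<^bsub>Gam A i\<^esub> (s::nat)) \<in> OK" for s
    using gq_in[of i s] by (auto simp del: fun_upd_apply simp: fun_upd_same)
  have u: "uc (\<lambda>x. lagrange i m r (x i))" by (rule uc_lagrange[OF r])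
  obtain M where M: "\<And>x y. x\<in>G \<Longrightarrow> y\<in>G \<Longrightarrow> gnear (\<lambda>_. M) x y \<Longrightarrow> sm 0 (lagrange i m r (x i) - lagrange i m r (y i))"
    using u[unfolded uc_def, rule_format, of 0] by auto
  let ?y = "(\<one>\<^bsub>Gprod A\<^esub>)(i := y)"
  have "gnear (\<lambda>_. M) ?y (?x (res i M y))" using near_res[OF y, of M] by (simp add: gnear_def)
  then have "sm 0 (lagrange i m r (?y i) - lagrange i m r (?x (res i M y) i))" by (intro M) (use y in \<open>auto simp del: fun_upd_apply\<close>)
  then have "sm 0 (lagrange i m r y - lagrange i m r (gam A i [^]\<^bsub>Gam A i\<^esub> res i M y))" by simp
  from sm_add[OF this OK_sm[OF gs[of "res i M y"]]] have 1: "sm 0 (lagrange i m r y)" by simp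
  have "lagrange i m r y \<in> K" unfolding lagrange_def node_def uu_def using y
    by (auto intro!: K_mult K_powi K_divide K_prod K_diff K_power chi_K)
  with 1 show ?thesis by (simp add: OK_iff)
qed

text \<open>Interpolation in the coordinate \<open>j\<close>, a projection of the continuous functions onto the kernel of
  the operator in this coordinate; it commutes with the operators in the other coordinates.\<close>

definition "interp_proj j m f = (\<lambda>x\<in>G. \<Sum>r<prm A ^ m * nn j. f (x(j := gam A j [^]\<^bsub>Gam A j\<^esub> r)) * lagrange j m r (x j))"

lemma interp_proj_cts:
  assumes f: "f \<in> cts A"
  shows "interp_proj j m f \<in> cts A"
  unfolding interp_proj_def
proof (rule ctsI)
  show "uc (\<lambda>x. \<Sum>r<prm A ^ m * nn j. f (x(j := gam A j [^]\<^bsub>Gam A j\<^esub> r)) * lagrange j m r (x j))"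
  proof (intro uc_sum uc_mult uc_lagrange)
    fix r show "uc (\<lambda>x. f (x(j := gam A j [^]\<^bsub>Gam A j\<^esub> (r::nat))))"
      by (rule uc_comp[OF cts_uc[OF f]]) (auto simp: gnear_def)
  qed (auto intro!: OK_sm cts_OK[OF f] lagrange_OK simp: G_in)
qed (auto intro!: OK_sum OK_mult cts_OK[OF f] lagrange_OK simp: G_in)

lemma omega_op_interp_proj_same: "omega_op j (prm A ^ m) (nn j) (interp_proj j m f) = z0"
proof -
  have "interp_proj j m f = (\<lambda>x\<in>G. \<Sum>r<prm A ^ m * nn j. 1 * (\<lambda>x\<in>G. f (x(j := gam A j [^]\<^bsub>Gam A j\<^esub> r)) * lagrange j m r (x j)) x)"
    unfolding interp_proj_def by (rule restrict_ext) simp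
  then have "omega_op j (prm A ^ m) (nn j) (interp_proj j m f) = (\<lambda>x\<in>G. \<Sum>r<prm A ^ m * nn j. 1 *
     omega_op j (prm A ^ m) (nn j) (\<lambda>x\<in>G. f (x(j := gam A j [^]\<^bsub>Gam A j\<^esub> r)) * lagrange j m r (x j)) x)"
    by (simp only: omega_op_sum)
  also have "\<dots> = z0" unfolding z0_def
  proof (rule restrict_ext)
    fix x assume x: "x \<in> G"
    have "omega_op j (prm A ^ m) (nn j) (\<lambda>x\<in>G. f (x(j := gam A j [^]\<^bsub>Gam A j\<^esub> r)) * lagrange j m r (x j)) = z0"
      if "r < prm A ^ m * nn j" for r
      by (rule omega_op_lagrange[OF that]) (simp add: tr_def)
    then show "(\<Sum>r<prm A ^ m * nn j. 1 * omega_op j (prm A ^ m) (nn j) (\<lambda>x\<in>G. f (x(j := gam A j [^]\<^bsub>Gam A j\<^esub> r)) * lagrange j m r (x j)) x) = 0"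
      using x by (intro sum.neutral) (auto simp: z0_def)
  qed
  finally show ?thesis .
qed

lemma omega_op_interp_proj_other: "i \<noteq> j \<Longrightarrow> omega_op i q n (interp_proj j m f) = interp_proj j m (omega_op i q n f)"
proof (induction n arbitrary: f)
  case (Suc n)
  have "omega_factor i q (d i + int n) (interp_proj j m f) = interp_proj j m (omega_factor i q (d i + int n) f)"
    unfolding interp_proj_def omega_factor_def using Suc.prems
    by (intro restrict_ext) (simp add: tr_upd_other tr_other sum_distrib_left sum_subtractf algebra_simps)
  then show ?case using Suc.IH[OF Suc.prems] by (simp only: omega_op.simps)
qed simp

lemma interp_proj_z0: "interp_proj j m z0 = z0"
  unfolding interp_proj_def z0_def by (rule restrict_ext) simp

text \<open>The difference of the two sides is in the kernel and vanishes at the nodes, hence vanishes by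
  the recurrence.\<close>

lemma interp_proj_fix:
  assumes f: "f \<in> cts A" and T: "omega_op j (prm A ^ m) (nn j) f = z0"
  shows "interp_proj j m f = f"
proof (rule cts_eqI[OF interp_proj_cts[OF f] f])
  fix x assume x: "x \<in> G"
  let ?h = "\<lambda>x\<in>G. f x - interp_proj j m f x"
  let ?x = "\<lambda>r. x(j := gam A j [^]\<^bsub>Gam A j\<^esub> (r::nat))"
  have "?h (?x r) \<in> {0}" for r
  proof (rule omega_op_recurrence[where q = "prm A ^ m" and n = "nn j"])
    show "omega_op j (prm A ^ m) (nn j) ?h (?x r) \<in> {0}" for r
      using x unfolding omega_op_diff T omega_op_interp_proj_same by (simp add: z0_def del: fun_upd_apply)
    show "?h (?x s) \<in> {0}" if s: "s < prm A ^ m * nn j" for s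
    proof -
      have "interp_proj j m f (?x s) = (\<Sum>r<prm A ^ m * nn j. f (?x r) * (if r = s then 1 else 0))"
        using x s unfolding interp_proj_def by (simp add: lagrange_gam)
      also have "\<dots> = f (?x s)" using s by (simp add: if_distrib[of "\<lambda>c. _ * c"] sum.delta cong: if_cong)
      finally show ?thesis using x by (simp del: fun_upd_apply)
    qed
  qed (use x in auto)
  then have hz: "?h (?x r) = 0" for r by blast
  have "uc (\<lambda>x. f x - interp_proj j m f x)" by (rule uc_diff[OF cts_uc[OF f] cts_uc[OF interp_proj_cts[OF f]]])
  then have uch: "uc ?h" unfolding uc_restrict .
  have "?h x = 0" by (rule uc_zero_coord[OF uch x, of j]) (rule hz)
  then show "interp_proj j m f x = f x" using x by simp
qed

text \<open>The exponents \<open>r\<close> of the points at which functions in \<open>W m\<close> are evaluated.\<close>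

definition "Ebox m = {r :: 'k \<Rightarrow> nat. \<forall>i. r i < qq m i * nn i}"

text \<open>The basis of \<open>W m\<close> dual to evaluation at these points.\<close>

definition "E m r = (\<lambda>x\<in>G. \<Prod>i\<in>UNIV. lagrange i (m i) (r i) (x i))"

lemma finite_Ebox [simp]: "finite (Ebox m)"
proof -
  have "Ebox m \<subseteq> (\<Pi>\<^sub>E i\<in>UNIV. {..< qq m i * nn i})" by (auto simp: Ebox_def PiE_UNIV_domain Pi_iff)
  then show ?thesis by (rule finite_subset) (auto intro: finite_PiE)
qed

lemma W_cts: "f \<in> W m \<Longrightarrow> f \<in> cts A" by (simp add: W_def)

lemma fmod_W: "fmod (W m)"
proof -
  have 1: "omega_op i q n (\<lambda>x\<in>G. a * f x + b * g x) = (\<lambda>x\<in>G. a * omega_op i q n f x + b * omega_op i q n g x)" for i q n a b f g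
    using omega_op_sum[where i = i and q = q and n = n and I = "{True, False}" and c = "\<lambda>k. if k then a else b" and f = "\<lambda>k. if k then f else g"] by simp
  have 2: "omega_op i q n (\<lambda>x\<in>G. f x + g x) = (\<lambda>x\<in>G. omega_op i q n f x + omega_op i q n g x)" for i q n f g
    using 1[of i q n 1 f 1 g] by simp
  have 3: "omega_op i q n (\<lambda>x\<in>G. c * f x) = (\<lambda>x\<in>G. c * omega_op i q n f x)" for i q n f c
    using 1[of i q n c f 0 f] by simp
  have 4: "omega_op i q n (\<lambda>x\<in>G. 0) = (\<lambda>x\<in>G. 0)" for i q n
    using 3[of i q n 0 "\<lambda>_. 0"] by simp
  show ?thesis unfolding fmod_def W_def
    by (auto simp: 2 3 4 cts_ext cts_add cts_cmult) (auto simp: z0_def restrict_def)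
qed

lemma lagrange_E_cts: "r \<in> Ebox m \<Longrightarrow> E m r \<in> cts A"
  unfolding E_def
  by (rule ctsI) (auto intro!: OK_prod lagrange_OK uc_prod uc_lagrange OK_sm simp: G_in Ebox_def qq_def)

lemma E_W: "r \<in> Ebox m \<Longrightarrow> E m r \<in> W m"
proof -
  assume r: "r \<in> Ebox m"
  have "omega_op i (qq m i) (nn i) (E m r) = z0" for i
  proof -
    have "E m r = (\<lambda>x\<in>G. (\<Prod>j\<in>UNIV - {i}. lagrange j (m j) (r j) (x j)) * lagrange i (m i) (r i) (x i))"
      unfolding E_def by (rule restrict_ext) (simp add: prod.remove[of UNIV i] mult.commute)
    moreover have "omega_op i (prm A ^ m i) (nn i) (\<lambda>x\<in>G. (\<Prod>j\<in>UNIV - {i}. lagrange j (m j) (r j) (x j)) * lagrange i (m i) (r i) (x i)) = z0"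
      by (rule omega_op_lagrange) (use r in \<open>auto simp: Ebox_def qq_def tr_other intro!: prod.cong\<close>)
    ultimately show ?thesis by (simp add: qq_def)
  qed
  then show ?thesis using lagrange_E_cts[OF r] by (simp add: W_def)
qed

text \<open>Induction on the set of coordinates in which the point is arbitrary; each new coordinate is
  freed by the uniqueness of interpolation in one variable.\<close>

lemma W_vanish:
  assumes g: "g \<in> W m" and z: "\<And>r. r \<in> Ebox m \<Longrightarrow> g (gpow r) = 0" and x: "x \<in> G"
  shows "g x = 0"
proof -
  have *: "\<forall>x\<in>G. (\<forall>i. i \<notin> I \<longrightarrow> (\<exists>r<qq m i * nn i. x i = gam A i [^]\<^bsub>Gam A i\<^esub> r)) \<longrightarrow> g x = 0" if "finite I" for I :: "'k set"
    using that
  proof (induction I rule: finite_induct)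
    case empty
    show ?case
    proof (intro ballI impI)
      fix x assume "x \<in> G" "\<forall>i. i \<notin> {} \<longrightarrow> (\<exists>r<qq m i * nn i. x i = gam A i [^]\<^bsub>Gam A i\<^esub> r)"
      then have "\<forall>i. \<exists>r. r<qq m i * nn i \<and> x i = gam A i [^]\<^bsub>Gam A i\<^esub> r" by simp
      from choice[OF this] obtain r where "\<forall>i. r i<qq m i * nn i \<and> x i = gam A i [^]\<^bsub>Gam A i\<^esub> (r i)" ..
      then have "r \<in> Ebox m" "x = gpow r" by (auto simp: Ebox_def gpow_def)
      then show "g x = 0" using z by simp
    qed
  next
    case (insert j I)
    show ?case
    proof (intro ballI impI)
      fix x assume x: "x \<in> G" and hx: "\<forall>i. i \<notin> insert j I \<longrightarrow> (\<exists>r<qq m i * nn i. x i = gam A i [^]\<^bsub>Gam A i\<^esub> r)"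
      let ?x = "\<lambda>r. x(j := gam A j [^]\<^bsub>Gam A j\<^esub> (r::nat))"
      have "g (?x r) \<in> {0}" for r
      proof (rule omega_op_recurrence[where q = "qq m j" and n = "nn j"])
        show "omega_op j (qq m j) (nn j) g (?x r) \<in> {0}" for r
          using g x by (simp add: W_def z0_def del: fun_upd_apply)
        show "g (?x s) \<in> {0}" if "s < qq m j * nn j" for s
        proof -
          have "?x s \<in> G" using x by simp
          moreover have "\<forall>i. i \<notin> I \<longrightarrow> (\<exists>r<qq m i * nn i. ?x s i = gam A i [^]\<^bsub>Gam A i\<^esub> r)" using hx that by auto
          ultimately show ?thesis using insert.IH by blast
        qed
      qed (use x in auto)
      then show "g x = 0" using uc_zero_coord[OF cts_uc[OF W_cts[OF g]] x, of j] by simp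
    qed
  qed
  show ?thesis using *[of UNIV] x by simp
qed

lemma E_gpow: "r \<in> Ebox m \<Longrightarrow> s \<in> Ebox m \<Longrightarrow> E m r (gpow s) = (if r = s then 1 else 0)"
proof -
  assume rs: "r \<in> Ebox m" "s \<in> Ebox m"
  have "E m r (gpow s) = (\<Prod>i\<in>UNIV. if r i = s i then 1 else 0)"
    unfolding E_def using rs by (simp add: Ebox_def gpow_def[of s] lagrange_gam qq_def) (simp add: gpow_def[symmetric])
  also have "\<dots> = (if r = s then 1 else 0)"
  proof (cases "r = s")
    case False
    then obtain i where "r i \<noteq> s i" by auto
    then show ?thesis using False by (auto intro!: prod_zero)
  qed simp
  finally show ?thesis .
qed

lemma W_expand:
  assumes f: "f \<in> W m"
  shows "f = (\<lambda>x\<in>G. \<Sum>r\<in>Ebox m. f (gpow r) * E m r x)"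
proof -
  have OKf: "f (gpow r) \<in> OK" for r using cts_OK[OF W_cts[OF f]] by simp
  let ?S = "\<lambda>x\<in>G. \<Sum>r\<in>Ebox m. f (gpow r) * E m r x"
  have S: "?S \<in> W m" by (rule fmod_sum[OF fmod_W]) (auto simp: OKf E_W)
  have d: "(\<lambda>x\<in>G. f x - ?S x) \<in> W m" by (rule fmod_diff[OF fmod_W f S])
  have z: "(\<lambda>x\<in>G. f x - ?S x) (gpow s) = 0" if "s \<in> Ebox m" for s
    using that by (simp add: E_gpow if_distrib[of "\<lambda>c. _ * c"] sum.delta cong: if_cong)
  show ?thesis
  proof (rule cts_eqI[OF W_cts[OF f] W_cts[OF S]])
    fix x assume x: "x \<in> G"
    show "f x = ?S x" using W_vanish[OF d z x] x by simp
  qed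
qed

end

section \<open>The ideals as annihilators\<close>

context pdatum_de
begin

lemma sum_lessThan_add:
  fixes H :: "nat \<Rightarrow> 'c" and a P :: nat
  shows "(\<Sum>s<a + P. H s) = (\<Sum>s<a. H s) + (\<Sum>c<P. H (a + c))"
  by (induction P) (auto simp: add.assoc)

text \<open>The sum over \<open>p\<^sup>N\<close> periods is \<open>p\<^sup>N\<close> times the sum over one period, up to the error of periodicity.\<close>

lemma sum_periodic_small:
  fixes H :: "nat \<Rightarrow> 'c" and n P t N :: nat
  assumes H0: "\<And>s. sm 0 (H s)" and per: "\<And>s. sm N (H (s + P) - H s)"
  shows "sm N ((\<Sum>s<n + P * (prm A ^ N * t). H s) - (\<Sum>s<n. H s))"
proof -
  have perk: "sm N (H (s + P * k) - H s)" for s k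
  proof (induction k)
    case (Suc k)
    from sm_trans[OF per[of "s + P * k"] Suc] show ?case by (simp add: algebra_simps)
  qed simp
  let ?B = "\<Sum>c<P. H (n + c)"
  have *: "sm N ((\<Sum>s<n + P * k. H s) - (\<Sum>s<n. H s) - of_nat k * ?B)" for k
  proof (induction k)
    case (Suc k)
    have "sm N (\<Sum>c<P. (H (n + c + P * k) - H (n + c)))" by (intro sm_sum perk)
    then have "sm N ((\<Sum>c<P. H (n + P * k + c)) - ?B)" by (simp add: sum_subtractf algebra_simps)
    from sm_add[OF Suc this] show ?case
      using sum_lessThan_add[of H "n + P * k" P] by (simp add: algebra_simps)
  qed simp
  have "sm N (of_nat (prm A ^ N * t) * ?B)"
    by (rule sm_mult1) (auto intro!: sm_sum H0 sm_mult1)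
  from sm_add[OF *[of "prm A ^ N * t"] this] show ?thesis by simp
qed

lemma gnear_gpow: "(\<And>i. r i mod prm A ^ M = r' i mod prm A ^ M) \<Longrightarrow> gnear (\<lambda>_. M) (gpow r) (gpow r')"
  by (simp add: gnear_iff rs_gpow)

lemma tr_gpow: "tr i q (gpow r) = gpow (r(i := q + r i))"
proof -
  interpret group "Gam A i" by (rule group_Gam)
  show ?thesis by (auto simp: tr_def gpow_def nat_pow_mult fun_eq_iff)
qed

text \<open>The partial sums of \<open>g\<close> along translates by \<open>\<gamma>\<^sub>i\<^sup>q\<close>, which solve the equation \<open>f(\<gamma>\<^sub>i\<^sup>q x) - f(x) = g(x)\<close> on the
  dense set of powers. They are uniformly continuous in the exponent since \<open>g\<close> is periodic up to
  \<open>p\<^sup>N\<close>, so that sums over many periods are small, and hence they extend.\<close>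

lemma telescoping_solution:
  assumes g: "g \<in> cts A"
  shows "\<exists>f\<in>cts A. \<forall>r. f (gpow r) = (\<Sum>t<r i div prm A ^ m. g (gpow (r(i := r i mod prm A ^ m + prm A ^ m * t))))"
proof (rule cts_extend)
  let ?q = "prm A ^ m"
  let ?F = "\<lambda>r. \<Sum>t<r i div ?q. g (gpow (r(i := r i mod ?q + ?q * t)))"
  show "?F r \<in> OK" for r by (intro OK_sum cts_OK[OF g]) simp
  fix N
  obtain M0 where M0: "\<And>x y. x\<in>G \<Longrightarrow> y\<in>G \<Longrightarrow> gnear (\<lambda>_. M0) x y \<Longrightarrow> sm N (g x - g y)"
    using cts_uc[OF g, unfolded uc_def, rule_format, of N] by auto
  \<comment> \<open>agreement of exponents modulo \<open>p\<close> to the power \<open>m + M0 + N\<close> means that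
    their quotients by \<open>p\<^sup>m\<close> differ by \<open>p\<^sup>N\<close> times a multiple
    of the period \<open>p\<close> to the power \<open>M0\<close>\<close>
  let ?M = "m + (M0 + N)"
  have main: "sm N (?F r' - ?F r)" if eq: "\<forall>k. r k mod prm A ^ ?M = r' k mod prm A ^ ?M" and le: "r i \<le> r' i" for r r'
  proof -
    have eqm: "r k mod prm A ^ M1 = r' k mod prm A ^ M1" if "M1 \<le> ?M" for k M1
    proof -
      have dv: "prm A ^ M1 dvd prm A ^ ?M" by (rule le_imp_power_dvd[OF that])
      have "r k mod prm A ^ ?M mod prm A ^ M1 = r' k mod prm A ^ ?M mod prm A ^ M1" using eq by (simp only:)
      then show ?thesis unfolding mod_mod_cancel[OF dv] .
    qed
    have a: "r' i mod ?q = r i mod ?q" using eqm[of m i] by simp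
    have "prm A ^ ?M dvd r' i - r i" using mod_eq_dvd_iff_nat[OF le, of "prm A ^ ?M"] eq[rule_format, of i] by simp
    then obtain t where t: "r' i = r i + prm A ^ ?M * t" using le by (metis dvdE le_add_diff_inverse)
    have n': "r' i div ?q = r i div ?q + prm A ^ M0 * (prm A ^ N * t)"
    proof -
      have "r' i = r i + ?q * (prm A ^ M0 * (prm A ^ N * t))" by (simp add: t power_add mult.assoc)
      then show ?thesis by simp
    qed
    define H where "H s = g (gpow (r'(i := r i mod ?q + ?q * s)))" for s
    have 1: "sm N ((\<Sum>s<r i div ?q + prm A ^ M0 * (prm A ^ N * t). H s) - (\<Sum>s<r i div ?q. H s))"
    proof (rule sum_periodic_small)
      show "sm 0 (H s)" for s unfolding H_def by (rule OK_sm[OF cts_OK[OF g]]) simp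
      show "sm N (H (s + prm A ^ M0) - H s)" for s unfolding H_def
      proof (rule M0[OF gpow_in gpow_in], rule gnear_gpow)
        fix k
        have "(r i mod ?q + ?q * (s + prm A ^ M0)) mod prm A ^ M0 = (r i mod ?q + ?q * s) mod prm A ^ M0"
          by (simp add: distrib_left add.assoc[symmetric])
        then show "(r'(i := r i mod ?q + ?q * (s + prm A ^ M0))) k mod prm A ^ M0
           = (r'(i := r i mod ?q + ?q * s)) k mod prm A ^ M0" by simp
      qed
    qed
    have 2: "sm N (\<Sum>s<r i div ?q. (H s - g (gpow (r(i := r i mod ?q + ?q * s)))))"
    proof (rule sm_sum)
      fix s show "sm N (H s - g (gpow (r(i := r i mod ?q + ?q * s))))" unfolding H_def
        by (rule M0[OF gpow_in gpow_in], rule gnear_gpow) (use eqm[of M0] in simp)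
    qed
    have "?F r' - ?F r = ((\<Sum>s<r i div ?q + prm A ^ M0 * (prm A ^ N * t). H s) - (\<Sum>s<r i div ?q. H s))
      + (\<Sum>s<r i div ?q. (H s - g (gpow (r(i := r i mod ?q + ?q * s)))))"
      unfolding n' a by (simp add: H_def sum_subtractf)
    then show ?thesis using sm_add[OF 1 2] by (simp only:)
  qed
  show "\<exists>M. \<forall>r r'. (\<forall>k. r k mod prm A ^ M = r' k mod prm A ^ M) \<longrightarrow> sm N (?F r - ?F r')"
  proof (intro exI[of _ ?M] allI impI)
    fix r r' :: "'k \<Rightarrow> nat" assume eq: "\<forall>k. r k mod prm A ^ ?M = r' k mod prm A ^ ?M"
    show "sm N (?F r - ?F r')"
    proof (cases "r i \<le> r' i")
      case True
      show ?thesis by (rule sm_commute[OF main[OF eq True]])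
    next
      case False
      show ?thesis by (rule main) (use eq False in auto)
    qed
  qed
qed

text \<open>Conjugation by the character \<open>\<chi>\<^sup>j\<close> turns the operator into a unit times the difference operator of
  \<open>telescoping_solution\<close>.\<close>

lemma omega_factor_surj:
  assumes g: "g \<in> cts A"
  shows "\<exists>f\<in>cts A. omega_factor i (prm A ^ m) j f = g"
proof -
  let ?q = "prm A ^ m"
  let ?a = "uu i powi (j * int ?q)"
  let ?g = "\<lambda>x\<in>G. uu i powi (- (j * int ?q)) * (chi A i (x i) powi (- j) * g x)"
  have "(\<lambda>x\<in>G. chi A i (x i) powi (- j) * g x) \<in> cts A"
    by (rule ctsI) (auto intro!: OK_mult cts_OK[OF g] uc_mult uc_chi_powi cts_uc[OF g] OK_sm chi_powi_OK simp: G_in)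
  from cts_cmult[OF uu_powi_OK this] have g': "?g \<in> cts A" by (simp cong: restrict_cong)
  obtain f0 where f0: "f0 \<in> cts A" "\<And>r. f0 (gpow r) = (\<Sum>t<r i div ?q. ?g (gpow (r(i := r i mod ?q + ?q * t))))"
    using telescoping_solution[OF g', of i m] by blast
  let ?f = "\<lambda>x\<in>G. chi A i (x i) powi j * f0 x"
  have f: "?f \<in> cts A"
    by (rule ctsI) (auto intro!: OK_mult cts_OK[OF f0(1)] uc_mult uc_chi_powi cts_uc[OF f0(1)] OK_sm chi_powi_OK simp: G_in)
  have "omega_factor i ?q j ?f (gpow r) = g (gpow r)" for r
  proof -
    let ?c = "chi A i (gpow r i)"
    have c: "?c \<noteq> 0" by (simp add: G_in[OF gpow_in])
    have step: "f0 (gpow (r(i := ?q + r i))) = f0 (gpow r) + ?g (gpow r)"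
    proof -
      have "r i mod ?q + ?q * (r i div ?q) = r i" by (rule mod_mult_div_eq)
      then show ?thesis unfolding f0(2) by (simp add: fun_upd_idem del: restrict_apply)
    qed
    have "omega_factor i ?q j ?f (gpow r) = (uu i ^ ?q * ?c) powi j * f0 (gpow (r(i := ?q + r i))) - ?a * (?c powi j * f0 (gpow r))"
      unfolding omega_factor_def using chi_tr[OF gpow_in, of i ?q r] by (simp add: tr_gpow)
    also have "(uu i ^ ?q * ?c) powi j = ?a * ?c powi j"
      using power_int_mult[of "uu i" "int ?q" j] unfolding power_int_of_nat
      by (simp only: power_int_mult_distrib mult.commute[of j])
    also have "?a * ?c powi j * f0 (gpow (r(i := ?q + r i))) - ?a * (?c powi j * f0 (gpow r)) = ?a * (?c powi j) * ?g (gpow r)"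
      unfolding step distrib_left mult.assoc by (rule add_diff_cancel_left')
    also have "\<dots> = g (gpow r)"
      using c by (simp add: power_int_minus field_simps)
    finally show ?thesis .
  qed
  then have "omega_factor i ?q j ?f = g" by (rule cts_eq_dense[OF omega_factor_cts[OF f] g])
  then show ?thesis using f by blast
qed

lemma omega_op_surj: "g \<in> cts A \<Longrightarrow> \<exists>f\<in>cts A. omega_op i (prm A ^ m) n f = g"
proof (induction n arbitrary: g)
  case (Suc n)
  then obtain h where h: "h \<in> cts A" "omega_op i (prm A ^ m) n h = g" by blast
  obtain f where "f \<in> cts A" "omega_factor i (prm A ^ m) (d i + int n) f = h" using omega_factor_surj[OF h(1)] by blast
  then show ?case using h by (intro bexI[of _ f]) auto
qed auto

interpretation Iw: ring "Iwasawa A" by (rule Iw_ring)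

lemma Iw_minus: "y \<in> Lam \<Longrightarrow> \<ominus>\<^bsub>Iwasawa A\<^esub> y = (\<lambda>f\<in>cts A. - y f)"
proof -
  assume y: "y \<in> Lam"
  have m: "(\<lambda>f\<in>cts A. - y f) \<in> Lam"
    using y by (auto simp: Fn_iff cts_add cts_cmult OK_minus)
  show ?thesis
  proof (rule Iw.minus_equality)
    show "(\<lambda>f\<in>cts A. - y f) \<oplus>\<^bsub>Iwasawa A\<^esub> y = \<zero>\<^bsub>Iwasawa A\<^esub>" by (auto intro: restrict_ext)
  qed (use y m in auto)
qed

lemma Iw_diff: "x \<in> Lam \<Longrightarrow> y \<in> Lam \<Longrightarrow> x \<ominus>\<^bsub>Iwasawa A\<^esub> y = (\<lambda>f\<in>cts A. x f - y f)"
  by (simp add: a_minus_def Iw_minus) (rule restrict_ext, simp)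

lemma Iw_smult_in: "c \<in> OK \<Longrightarrow> x \<in> Lam \<Longrightarrow> (\<lambda>f\<in>cts A. c * x f) \<in> Lam"
  by (auto simp: Fn_iff cts_add cts_cmult OK_mult algebra_simps)

lemma Iw_add_in: "x \<in> Lam \<Longrightarrow> y \<in> Lam \<Longrightarrow> (\<lambda>f\<in>cts A. x f + y f) \<in> Lam"
  using Iw.a_closed[of x y] by simp

lemma dirac_pow:
  "dirac A ((\<one>\<^bsub>Gprod A\<^esub>)(i := gam A i)) [^]\<^bsub>Iwasawa A\<^esub> (n::nat) = dirac A ((\<one>\<^bsub>Gprod A\<^esub>)(i := gam A i [^]\<^bsub>Gam A i\<^esub> n))"
proof (induction n)
  case 0
  have "(\<one>\<^bsub>Gprod A\<^esub>)(i := \<one>\<^bsub>Gam A i\<^esub>) = \<one>\<^bsub>Gprod A\<^esub>" by (auto simp: Gone)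
  then show ?case by (simp add: nat_pow_def[of "Gam A i" _ 0])
next
  case (Suc n)
  have m: "(\<one>\<^bsub>Gprod A\<^esub>)(i := gam A i [^]\<^bsub>Gam A i\<^esub> n) \<otimes>\<^bsub>Gprod A\<^esub> (\<one>\<^bsub>Gprod A\<^esub>)(i := gam A i)
    = (\<one>\<^bsub>Gprod A\<^esub>)(i := gam A i [^]\<^bsub>Gam A i\<^esub> (Suc n))"
  proof -
    have "\<one>\<^bsub>Gam A j\<^esub> \<otimes>\<^bsub>Gam A j\<^esub> \<one>\<^bsub>Gam A j\<^esub> = \<one>\<^bsub>Gam A j\<^esub>" for j
      using group_Gam[of j] by (simp add: group.is_monoid monoid.l_one)
    then show ?thesis by (auto simp: Gmult Gone Gam_pow_Suc)
  qed
  have conv: "convolution A (cts A) (dirac A a) (dirac A b) = dirac A (a \<otimes>\<^bsub>Gprod A\<^esub> b)" if "a \<in> G" "b \<in> G" for a b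
    unfolding convolution_avg dirac_def[of A "a \<otimes>\<^bsub>Gprod A\<^esub> b"]
    using that by (intro restrict_ext) (simp add: dirac_apply avg_cts[OF dirac_in] avg_dirac[symmetric], simp add: avg_dirac)
  have "gam A i \<in> cG i" by simp
  then have g1: "(\<one>\<^bsub>Gprod A\<^esub>)(i := gam A i) \<in> G" by (rule G_upd[OF G_one_in])
  show ?case using Suc conv[OF gq_in[of i n] g1] m by (simp only: Iw.nat_pow_Suc Iw_sel)
qed

text \<open>One factor of the generator of the ideal.\<close>

definition "fac i q j = dirac A ((\<one>\<^bsub>Gprod A\<^esub>)(i := gam A i)) [^]\<^bsub>Iwasawa A\<^esub> (q::nat)
        \<ominus>\<^bsub>Iwasawa A\<^esub> ((chi A i (gam A i) powi (j * int q)) \<odot>\<^bsub>Iwasawa A\<^esub> \<one>\<^bsub>Iwasawa A\<^esub>)"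

lemma fac_eq: "fac i q j = (\<lambda>f\<in>cts A. dirac A ((\<one>\<^bsub>Gprod A\<^esub>)(i := gam A i [^]\<^bsub>Gam A i\<^esub> q)) f - (\<lambda>f\<in>cts A. uu i powi (j * int q) * dirac A \<one>\<^bsub>Gprod A\<^esub> f) f)"
  unfolding fac_def dirac_pow uu_def[symmetric] Iw_sel
  by (rule Iw_diff[OF dirac_in[OF gq_in] Iw_smult_in[OF uu_powi_OK dirac_in[OF G_one_in]]])

lemma fac_in: "fac i q j \<in> Lam"
proof -
  have 1: "dirac A ((\<one>\<^bsub>Gprod A\<^esub>)(i := gam A i [^]\<^bsub>Gam A i\<^esub> q)) \<in> Lam" by (rule dirac_in[OF gq_in])
  have 2: "(\<lambda>f\<in>cts A. uu i powi (j * int q) * dirac A \<one>\<^bsub>Gprod A\<^esub> f) \<in> Lam"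
    by (rule Iw_smult_in[OF uu_powi_OK dirac_in[OF G_one_in]])
  have "fac i q j = dirac A ((\<one>\<^bsub>Gprod A\<^esub>)(i := gam A i [^]\<^bsub>Gam A i\<^esub> q)) \<ominus>\<^bsub>Iwasawa A\<^esub>
    (\<lambda>f\<in>cts A. uu i powi (j * int q) * dirac A \<one>\<^bsub>Gprod A\<^esub> f)"
    unfolding Iw_diff[OF 1 2] by (rule fac_eq)
  then show ?thesis using Iw.minus_closed 1 2 by (simp only: Iw_sel)
qed

lemma avg_fac: "f \<in> cts A \<Longrightarrow> avg (fac i q j) f = omega_factor i q j f"
  unfolding avg_def omega_factor_def
proof (rule restrict_ext)
  fix y assume f: "f \<in> cts A" and y: "y \<in> G"
  have "fac i q j (gtr f y) = gtr f y ((\<one>\<^bsub>Gprod A\<^esub>)(i := gam A i [^]\<^bsub>Gam A i\<^esub> q)) - uu i powi (j * int q) * gtr f y \<one>\<^bsub>Gprod A\<^esub>"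
    unfolding fac_eq using gtr_cts[OF f y] by (simp add: dirac_apply del: fun_upd_apply)
  then show "fac i q j (gtr f y) = f (tr i q y) - uu i powi (j * int q) * f y"
    using gq_in[of i q] y by (simp add: gtr_def tr_eq del: fun_upd_apply)
qed

lemma omega_factor_commute: "omega_factor i q j (omega_factor i q j' f) = omega_factor i q j' (omega_factor i q j f)"
  unfolding omega_factor_def by (rule restrict_ext) (simp add: algebra_simps)

text \<open>The product in the definition of the generators is a fold over a finite set. The recursion
  for this fold asks that left multiplications by the factors commute with each other; they do,
  because the corresponding operators on functions commute.\<close>

lemma fac_LCD: "LCD B Lam (\<lambda>j x. convolution A (cts A) (fac i q j) x)"
proof
  fix x y z assume z: "z \<in> Lam"
  have "convolution A (cts A) (fac i q x) (convolution A (cts A) (fac i q y) z)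
    = (\<lambda>f\<in>cts A. z (omega_factor i q y (omega_factor i q x f)))" for x y
    by (subst convolution_avg, rule restrict_ext) (simp add: avg_fac convolution_avg omega_factor_cts)
  then show "convolution A (cts A) (fac i q x) (convolution A (cts A) (fac i q y) z)
     = convolution A (cts A) (fac i q y) (convolution A (cts A) (fac i q x) z)"
    using omega_factor_commute[of i q] by simp
qed (auto intro: Iw_mult_in fac_in)

lemma finprod_fac:
  "finprod (Iwasawa A) (fac i q) {d i..<d i + int n} \<in> Lam \<and>
   (\<forall>f\<in>cts A. avg (finprod (Iwasawa A) (fac i q) {d i..<d i + int n}) f = omega_op i q n f)"
proof (induction n)
  case 0
  have "avg (dirac A \<one>\<^bsub>Gprod A\<^esub>) f = f" if "f \<in> cts A" for f
    using that by (intro cts_eqI[OF avg_cts[OF dirac_in that]]) (auto simp: avg_dirac)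
  then show ?case by (simp add: finprod_def foldD_empty dirac_in)
next
  case (Suc n)
  let ?B = "{d i..<d i + int n}"
  let ?P = "finprod (Iwasawa A) (fac i q)"
  have ins: "{d i..<d i + int (Suc n)} = insert (d i + int n) ?B" by auto
  have comp: "((\<otimes>\<^bsub>Iwasawa A\<^esub>) \<circ> fac i q) = (\<lambda>j x. convolution A (cts A) (fac i q j) x)"
    by (auto simp: fun_eq_iff)
  have "?P (insert (d i + int n) ?B) = convolution A (cts A) (fac i q (d i + int n)) (?P ?B)"
    unfolding finprod_def comp using LCD.foldD_insert[OF fac_LCD[of UNIV i q], of ?B "d i + int n" "\<one>\<^bsub>Iwasawa A\<^esub>"]
    by (simp add: dirac_in)
  then have P: "?P {d i..<d i + int (Suc n)} = convolution A (cts A) (fac i q (d i + int n)) (?P ?B)"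
    by (simp only: ins)
  show ?case unfolding P using Suc fac_in
    by (auto intro: Iw_mult_in simp: avg_conv[OF fac_in] avg_fac omega_factor_cts)
qed

lemma omega_gen: "Omega_gen A d e m i = finprod (Iwasawa A) (fac i (qq m i)) {d i..<d i + int (nn i)}"
proof -
  have "{d i..e i} = {d i..<d i + int (nn i)}" using de_i[of i] by (auto simp: nn_def)
  then show ?thesis by (simp add: Omega_gen_def fac_def[abs_def] qq_def)
qed

lemma omega_in: "Omega_gen A d e m i \<in> Lam"
  and avg_omega: "f \<in> cts A \<Longrightarrow> avg (Omega_gen A d e m i) f = omega_op i (qq m i) (nn i) f"
  unfolding omega_gen using finprod_fac[of i "qq m i" "nn i"] by auto

lemma gtr_W: "f \<in> W m \<Longrightarrow> y \<in> G \<Longrightarrow> gtr f y \<in> W m"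
  by (auto simp: W_def gtr_cts omega_op_gtr) (auto simp: gtr_def z0_def intro!: restrict_ext)

lemma avg_W: "l \<in> Lam \<Longrightarrow> f \<in> W m \<Longrightarrow> avg l f \<in> W m"
proof -
  assume l: "l \<in> Lam" and f: "f \<in> W m"
  have "avg l z0 = z0"
  proof -
    have "gtr z0 y = (\<lambda>x\<in>G. 0)" if "y \<in> G" for y using that unfolding gtr_def z0_def by (intro restrict_ext) simp
    then show ?thesis unfolding avg_def z0_def[symmetric] using Fn_zero[OF fmod_cts l] by (auto simp: z0_def intro!: restrict_ext)
  qed
  then show ?thesis using f by (auto simp: W_def avg_cts[OF l] omega_op_avg[OF l])
qed

definition "Ann m = {l \<in> Lam. \<forall>f\<in>W m. l f = 0}"

text \<open>The space \<open>W m\<close> is stable under averages and translations, as these commute with the operators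
  that define it.\<close>

lemma Ann_ideal: "ideal (Ann m) (Iwasawa A)"
proof (rule idealI)
  show "ring (Iwasawa A)" by (rule Iw_ring)
  show "subgroup (Ann m) (add_monoid (Iwasawa A))"
  proof
    show "Ann m \<subseteq> carrier (add_monoid (Iwasawa A))" by (auto simp: Ann_def)
    fix x y assume xy: "x \<in> Ann m" "y \<in> Ann m"
    then show "x \<otimes>\<^bsub>add_monoid (Iwasawa A)\<^esub> y \<in> Ann m"
      using Iw_add_in[of x y] W_cts by (auto simp: Ann_def)
  next
    show "\<one>\<^bsub>add_monoid (Iwasawa A)\<^esub> \<in> Ann m" using Iw.zero_closed W_cts by (auto simp: Ann_def)
  next
    fix x assume x: "x \<in> Ann m"
    then have "x \<in> Lam" by (simp add: Ann_def)
    then have "inv\<^bsub>add_monoid (Iwasawa A)\<^esub> x = (\<lambda>f\<in>cts A. - x f)" using Iw_minus by (simp add: a_inv_def)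
    moreover have "(\<lambda>f\<in>cts A. - x f) \<in> Lam" using Iw.a_inv_closed[of x] Iw_minus[OF \<open>x \<in> Lam\<close>] \<open>x \<in> Lam\<close> by simp
    ultimately show "inv\<^bsub>add_monoid (Iwasawa A)\<^esub> x \<in> Ann m" using x W_cts by (auto simp: Ann_def)
  qed
  fix a x assume a: "a \<in> Ann m" and x: "x \<in> carrier (Iwasawa A)"
  then have a': "a \<in> Lam" "\<And>f. f \<in> W m \<Longrightarrow> a f = 0" and x': "x \<in> Lam" by (auto simp: Ann_def)
  show "x \<otimes>\<^bsub>Iwasawa A\<^esub> a \<in> Ann m"
  proof -
    have "convolution A (cts A) x a f = 0" if "f \<in> W m" for f
      using a'(2)[OF avg_W[OF x' that]] W_cts[OF that] by (simp add: convolution_avg)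
    then show ?thesis using Iw_mult_in[OF x' a'(1)] by (simp add: Ann_def)
  qed
  show "a \<otimes>\<^bsub>Iwasawa A\<^esub> x \<in> Ann m"
  proof -
    have "avg a f = (\<lambda>y\<in>G. 0)" if "f \<in> W m" for f
      unfolding avg_def by (rule restrict_ext) (simp add: a' gtr_W that)
    then have "convolution A (cts A) a x f = 0" if "f \<in> W m" for f
      using that Fn_zero[OF fmod_cts x'] W_cts[OF that] by (simp add: convolution_avg)
    then show ?thesis using Iw_mult_in[OF a'(1) x'] by (simp add: Ann_def)
  qed
qed

lemma interp_proj_lin:
  assumes "f \<in> cts A" "g \<in> cts A"
  shows "interp_proj j m (\<lambda>x\<in>G. f x + g x) = (\<lambda>x\<in>G. interp_proj j m f x + interp_proj j m g x)"
    "interp_proj j m (\<lambda>x\<in>G. f x - g x) = (\<lambda>x\<in>G. interp_proj j m f x - interp_proj j m g x)"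
    "interp_proj j m (\<lambda>x\<in>G. c * f x) = (\<lambda>x\<in>G. c * interp_proj j m f x)"
  unfolding interp_proj_def
  by (intro restrict_ext, simp add: sum.distrib sum_subtractf sum_distrib_left algebra_simps)+

text \<open>The generators annihilate \<open>W m\<close> by \<open>avg_omega\<close>. For the converse, induction on a set \<open>I\<close> of
  coordinates shows that \<open>l\<close> is in the ideal if it kills all functions in the kernel of the operators
  with index in \<open>I\<close>. For a new coordinate \<open>j\<close> split \<open>l\<close> by the interpolation projection: the first
  part satisfies the induction hypothesis, and the second one vanishes on the kernel of the operator
  in direction \<open>j\<close>. As this operator is surjective, the second part factors through it, which means
  that it is a multiple of the generator with index \<open>j\<close>.\<close>

lemma Omega_eq_Ann: "Omega A d e m = Ann m"
proof
  have gens: "range (Omega_gen A d e m) \<subseteq> Ann m"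
  proof safe
    fix i
    have "Omega_gen A d e m i f = 0" if f: "f \<in> W m" for f
    proof -
      have "avg (Omega_gen A d e m i) f \<one>\<^bsub>Gprod A\<^esub> = 0"
        using f by (simp add: avg_omega W_cts) (simp add: W_def z0_def)
      moreover have "gtr f \<one>\<^bsub>Gprod A\<^esub> = f"
        using W_cts[OF f] by (intro cts_eqI[OF gtr_cts]) (auto simp: gtr_def)
      ultimately show ?thesis by (simp add: avg_def)
    qed
    then show "Omega_gen A d e m i \<in> Ann m" by (simp add: Ann_def omega_in)
  qed
  show "Omega A d e m \<subseteq> Ann m"
    unfolding Omega_def by (rule Iw.genideal_minimal[OF Ann_ideal gens])
  have sub: "range (Omega_gen A d e m) \<subseteq> carrier (Iwasawa A)" using omega_in by auto
  have I: "ideal (Omega A d e m) (Iwasawa A)" unfolding Omega_def by (rule Iw.genideal_ideal[OF sub])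
  have gen_in: "Omega_gen A d e m i \<in> Omega A d e m" for i
    using Iw.genideal_self[OF sub] unfolding Omega_def by auto
  have *: "\<forall>l\<in>Lam. (\<forall>f\<in>cts A. (\<forall>i\<in>I. omega_op i (qq m i) (nn i) f = z0) \<longrightarrow> l f = 0) \<longrightarrow> l \<in> Omega A d e m"
    if "finite I" for I :: "'k set"
    using that
  proof (induction I rule: finite_induct)
    case empty
    show ?case
    proof (intro ballI impI)
      fix l assume l: "l \<in> Lam" "\<forall>f\<in>cts A. (\<forall>i\<in>{}. omega_op i (qq m i) (nn i) f = z0) \<longrightarrow> l f = 0"
      have "l = \<zero>\<^bsub>Iwasawa A\<^esub>" using l(2) Fn_ext[OF l(1)] by (auto intro!: extensionalityI[of _ "cts A"])
      then show "l \<in> Omega A d e m" using I by (simp add: ideal.axioms(1) additive_subgroup.zero_closed del: Iw_sel)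
    qed
  next
    case (insert j I)
    show ?case
    proof (intro ballI impI)
      fix l assume l: "l \<in> Lam" and z: "\<forall>f\<in>cts A. (\<forall>i\<in>insert j I. omega_op i (qq m i) (nn i) f = z0) \<longrightarrow> l f = 0"
      let ?P = "interp_proj j (m j)"
      let ?T = "omega_op j (qq m j) (nn j)"
      \<comment> \<open>the part of \<open>l\<close> that factors through interpolation in the coordinate
        \<open>j\<close>\<close>
      let ?l1 = "\<lambda>f\<in>cts A. l (?P f)"
      have l1: "?l1 \<in> Lam"
        using l by (auto simp: Fn_iff cts_add cts_cmult interp_proj_cts interp_proj_lin)
      have "?l1 f = 0" if f: "f \<in> cts A" "\<forall>i\<in>I. omega_op i (qq m i) (nn i) f = z0" for f
      proof -
        have "\<forall>i\<in>insert j I. omega_op i (qq m i) (nn i) (?P f) = z0"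
        proof
          fix i assume i: "i \<in> insert j I"
          show "omega_op i (qq m i) (nn i) (?P f) = z0"
          proof (cases "i = j")
            case True
            then show ?thesis using omega_op_interp_proj_same[of j "m j" f] by (simp add: qq_def)
          next
            case False
            then show ?thesis using f(2) i by (simp add: omega_op_interp_proj_other interp_proj_z0)
          qed
        qed
        then show ?thesis using z interp_proj_cts[OF f(1)] f(1) by simp
      qed
      then have 1: "?l1 \<in> Omega A d e m" using insert.IH l1 by blast
      have dep: "l h - l (?P h) = l h' - l (?P h')" if h: "h \<in> cts A" "h' \<in> cts A" "?T h = ?T h'" for h h'
      proof -
        let ?d = "\<lambda>x\<in>G. h x - h' x"
        have dc: "?d \<in> cts A" by (rule cts_diff[OF h(1,2)])
        have "?T ?d = z0" unfolding omega_op_diff using h(3) by (simp add: z0_def)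
        then have "?P ?d = ?d" by (intro interp_proj_fix[OF dc]) (simp add: qq_def)
        then have "l ?d = l (\<lambda>x\<in>G. ?P h x - ?P h' x)" unfolding interp_proj_lin(2)[OF h(1,2)] by simp
        then have "l h - l h' = l (?P h) - l (?P h')"
          using Fn_diff[OF fmod_cts l] h interp_proj_cts by simp
        then show ?thesis by (simp add: algebra_simps)
      qed
      have "\<forall>g\<in>cts A. \<exists>h. h \<in> cts A \<and> ?T h = g" using omega_op_surj[of _ j "m j" "nn j"] by (auto simp: qq_def)
      from bchoice[OF this] obtain S where S: "\<And>g. g \<in> cts A \<Longrightarrow> S g \<in> cts A" "\<And>g. g \<in> cts A \<Longrightarrow> ?T (S g) = g" by auto
      \<comment> \<open>the remaining part vanishes on the kernel of the operator, so it is well defined on its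
        image, here through a section \<open>S\<close>\<close>
      let ?nu = "\<lambda>g\<in>cts A. l (S g) - l (?P (S g))"
      have nuT: "?nu (?T h) = l h - l (?P h)" if h: "h \<in> cts A" for h
        using dep[OF S(1) h S(2)] omega_op_cts[OF h] by simp
      have nu: "?nu \<in> Lam"
        unfolding Fn_iff
      proof (intro conjI ballI)
        fix g assume g: "g \<in> cts A"
        show "?nu g \<in> OK" using Fn_in[OF l] S(1) interp_proj_cts g by (auto intro!: OK_diff)
        fix g' assume g': "g' \<in> cts A"
        let ?s = "\<lambda>x\<in>G. S g x + S g' x"
        have s: "?s \<in> cts A" by (rule cts_add[OF S(1)[OF g] S(1)[OF g']])
        have "?T ?s = (\<lambda>x\<in>G. g x + g' x)"
          using omega_op_sum[where i = j and q = "qq m j" and n = "nn j" and I = "{True, False}" and c = "\<lambda>k. 1" and f = "\<lambda>k. if k then S g else S g'"]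
            S(2)[OF g] S(2)[OF g'] by simp
        then have "?nu (\<lambda>x\<in>G. g x + g' x) = l ?s - l (?P ?s)" using nuT[OF s] by (simp only:)
        also have "\<dots> = (l (S g) + l (S g')) - (l (?P (S g)) + l (?P (S g')))"
          unfolding interp_proj_lin(1)[OF S(1)[OF g] S(1)[OF g']]
          using Fn_add[OF l S(1)[OF g] S(1)[OF g']] Fn_add[OF l interp_proj_cts[OF S(1)[OF g]] interp_proj_cts[OF S(1)[OF g']]] by (simp only:)
        finally show "?nu (\<lambda>x\<in>G. g x + g' x) = ?nu g + ?nu g'" using g g' by simp
      next
        fix c g assume c: "c \<in> OK" and g: "g \<in> cts A"
        let ?s = "\<lambda>x\<in>G. c * S g x"
        have s: "?s \<in> cts A" by (rule cts_cmult[OF c S(1)[OF g]])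
        have "?T ?s = (\<lambda>x\<in>G. c * g x)"
          using omega_op_sum[where i = j and q = "qq m j" and n = "nn j" and I = "{True}" and c = "\<lambda>k. c" and f = "\<lambda>k. S g"]
            S(2)[OF g] by simp
        then have "?nu (\<lambda>x\<in>G. c * g x) = l ?s - l (?P ?s)" using nuT[OF s] by (simp only:)
        also have "\<dots> = c * l (S g) - c * l (?P (S g))"
          unfolding interp_proj_lin(3)[OF S(1)[OF g] S(1)[OF g]]
          using Fn_cmult[OF l c S(1)[OF g]] Fn_cmult[OF l c interp_proj_cts[OF S(1)[OF g]]] by (simp only:)
        finally show "?nu (\<lambda>x\<in>G. c * g x) = c * ?nu g" using g by (simp add: algebra_simps)
      qed auto
      have 2: "convolution A (cts A) (Omega_gen A d e m j) ?nu \<in> Omega A d e m"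
        using ideal.I_r_closed[OF I gen_in[of j], of ?nu] nu by simp
      have "l = ?l1 \<oplus>\<^bsub>Iwasawa A\<^esub> convolution A (cts A) (Omega_gen A d e m j) ?nu"
      proof (rule extensionalityI[OF Fn_ext[OF l]])
        fix f assume f: "f \<in> cts A"
        have "convolution A (cts A) (Omega_gen A d e m j) ?nu f = ?nu (?T f)"
          unfolding convolution_avg using f avg_omega[OF f] by simp
        then show "l f = (?l1 \<oplus>\<^bsub>Iwasawa A\<^esub> convolution A (cts A) (Omega_gen A d e m j) ?nu) f"
          using f nuT[OF f] by simp
      qed simp
      then show "l \<in> Omega A d e m"
        using additive_subgroup.a_closed[OF ideal.axioms(1)[OF I] 1 2] by (simp only:)
    qed
  qed
  show "Ann m \<subseteq> Omega A d e m"
    using *[of UNIV] by (auto simp: Ann_def W_def)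
qed

end

section \<open>Base change\<close>

context pdatum
begin

text \<open>Modules over the ring of integers; the base change to \<open>K\<close> is studied through the explicit
  presentation of the tensor product by generators and relations.\<close>

abbreviation omod :: "('c, 'm) module \<Rightarrow> bool" where "omod M \<equiv> module (scalars OK) M"

abbreviation "FA M \<equiv> free_Abelian_group (carrier M \<times> K)"
abbreviation "TR M \<equiv> tensor_relations (scalars OK) M (scalars K)"
abbreviation "TN M \<equiv> generate (FA M) (TR M)"

lemma scal_sel [simp]:
  "carrier (scalars S) = S" "x \<otimes>\<^bsub>scalars S\<^esub> y = x * y" "\<one>\<^bsub>scalars S\<^esub> = 1" "\<zero>\<^bsub>scalars S\<^esub> = 0"
  "x \<oplus>\<^bsub>scalars S\<^esub> y = x + y" "x \<odot>\<^bsub>scalars S\<^esub> y = x * y"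
  by (auto simp: scalars_def)

lemma tens_alt: "tens A M = FA M Mod TN M"
  and ptens_alt: "ptens A M x c = TN M #>\<^bsub>FA M\<^esub> frag_of (x, c)"
  by (auto simp: tens_def tensor_def ptens_def pure_tensor_def Let_def)

lemma omod_facts:
  assumes "omod M"
  shows "x \<in> carrier M \<Longrightarrow> y \<in> carrier M \<Longrightarrow> x \<oplus>\<^bsub>M\<^esub> y \<in> carrier M"
    "c \<in> OK \<Longrightarrow> x \<in> carrier M \<Longrightarrow> c \<odot>\<^bsub>M\<^esub> x \<in> carrier M"
    "\<zero>\<^bsub>M\<^esub> \<in> carrier M"
    "c \<in> OK \<Longrightarrow> x \<in> carrier M \<Longrightarrow> y \<in> carrier M \<Longrightarrow> c \<odot>\<^bsub>M\<^esub> (x \<oplus>\<^bsub>M\<^esub> y) = c \<odot>\<^bsub>M\<^esub> x \<oplus>\<^bsub>M\<^esub> c \<odot>\<^bsub>M\<^esub> y"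
proof -
  interpret module "scalars OK" M by (rule assms)
  show "x \<in> carrier M \<Longrightarrow> y \<in> carrier M \<Longrightarrow> x \<oplus>\<^bsub>M\<^esub> y \<in> carrier M" "\<zero>\<^bsub>M\<^esub> \<in> carrier M"
    by auto
  show "c \<in> OK \<Longrightarrow> x \<in> carrier M \<Longrightarrow> c \<odot>\<^bsub>M\<^esub> x \<in> carrier M"
    "c \<in> OK \<Longrightarrow> x \<in> carrier M \<Longrightarrow> y \<in> carrier M \<Longrightarrow> c \<odot>\<^bsub>M\<^esub> (x \<oplus>\<^bsub>M\<^esub> y) = c \<odot>\<^bsub>M\<^esub> x \<oplus>\<^bsub>M\<^esub> c \<odot>\<^bsub>M\<^esub> y"
    using smult_closed[of c x] smult_r_distr[of c x y] by auto
qed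

lemma frag_diff_in: "x \<in> carrier (free_Abelian_group S) \<Longrightarrow> y \<in> carrier (free_Abelian_group S) \<Longrightarrow> x - y \<in> carrier (free_Abelian_group S)"
  using keys_diff[of x y] by auto

lemma TR_sub: "omod M \<Longrightarrow> TR M \<subseteq> carrier (FA M)"
  unfolding tensor_relations_def
  by (auto simp del: carrier_free_Abelian_group_iff intro!: frag_diff_in simp: omod_facts K_add K_mult OK_K)

lemma TN_subgroup: "omod M \<Longrightarrow> subgroup (TN M) (FA M)"
  by (rule group.generate_is_subgroup[OF group_free_Abelian_group TR_sub])

lemma TN_normal: "omod M \<Longrightarrow> TN M \<lhd> FA M"
  by (rule comm_group.subgroup_imp_normal[OF abelian_free_Abelian_group TN_subgroup])

lemma tens_comm_group: "omod M \<Longrightarrow> comm_group (tens A M)"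
  unfolding tens_alt by (rule comm_group.abelian_FactGroup[OF abelian_free_Abelian_group TN_subgroup])

lemma tens_group: "omod M \<Longrightarrow> group (tens A M)"
  using tens_comm_group comm_group_def by blast

lemma coset_in: "z \<in> carrier (FA M) \<Longrightarrow> TN M #>\<^bsub>FA M\<^esub> z \<in> carrier (tens A M)"
  unfolding tens_alt carrier_FactGroup by blast

lemma pt_in: "x \<in> carrier M \<Longrightarrow> c \<in> K \<Longrightarrow> ptens A M x c \<in> carrier (tens A M)"
  unfolding ptens_alt by (rule coset_in) simp

lemma coset_mult: "omod M \<Longrightarrow> y \<in> carrier (FA M) \<Longrightarrow> z \<in> carrier (FA M) \<Longrightarrow>
  (TN M #>\<^bsub>FA M\<^esub> y) \<otimes>\<^bsub>tens A M\<^esub> (TN M #>\<^bsub>FA M\<^esub> z) = TN M #>\<^bsub>FA M\<^esub> (y + z)"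
  unfolding tens_alt mult_FactGroup using normal.rcos_sum[OF TN_normal] by simp

lemma coset_eq:
  assumes M: "omod M" and yz: "y \<in> carrier (FA M)" "z \<in> carrier (FA M)" and d: "y - z \<in> TN M"
  shows "TN M #>\<^bsub>FA M\<^esub> y = TN M #>\<^bsub>FA M\<^esub> z"
proof -
  have "y = (y - z) \<otimes>\<^bsub>FA M\<^esub> z" by simp
  then have "y \<in> TN M #>\<^bsub>FA M\<^esub> z" using d unfolding r_coset_def by blast
  from group.repr_independence[OF group_free_Abelian_group this yz(2) TN_subgroup[OF M]] show ?thesis by simp
qed

lemma frag_sum_in: "x \<in> carrier (free_Abelian_group S) \<Longrightarrow> y \<in> carrier (free_Abelian_group S) \<Longrightarrow> x + y \<in> carrier (free_Abelian_group S)"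
  using group.is_monoid[OF group_free_Abelian_group, of S] monoid.m_closed[of "free_Abelian_group S" x y] by simp

lemma coset_split:
  assumes M: "omod M" and yzw: "y \<in> carrier (FA M)" "z \<in> carrier (FA M)" "w \<in> carrier (FA M)" and d: "y - z - w \<in> TR M"
  shows "TN M #>\<^bsub>FA M\<^esub> y = (TN M #>\<^bsub>FA M\<^esub> z) \<otimes>\<^bsub>tens A M\<^esub> (TN M #>\<^bsub>FA M\<^esub> w)"
proof -
  have "y - (z + w) \<in> TN M" using generate.incl[OF d, of "FA M"] by (simp add: algebra_simps)
  then show ?thesis unfolding coset_mult[OF M yzw(2,3)] by (rule coset_eq[OF M yzw(1) frag_sum_in[OF yzw(2,3)]])
qed

lemma pt_add1:
  assumes M: "omod M" and x: "x \<in> carrier M" "y \<in> carrier M" "c \<in> K"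
  shows "ptens A M (x \<oplus>\<^bsub>M\<^esub> y) c = ptens A M x c \<otimes>\<^bsub>tens A M\<^esub> ptens A M y c"
proof -
  have "frag_of (x \<oplus>\<^bsub>M\<^esub> y, c) - frag_of (x, c) - frag_of (y, c) \<in> TR M"
    unfolding tensor_relations_def using x by auto
  then show ?thesis unfolding ptens_alt
    by (intro coset_split[OF M]) (use x omod_facts[OF M] in auto)
qed

lemma pt_add2:
  assumes M: "omod M" and x: "x \<in> carrier M" "c \<in> K" "c' \<in> K"
  shows "ptens A M x (c + c') = ptens A M x c \<otimes>\<^bsub>tens A M\<^esub> ptens A M x c'"
proof -
  have "frag_of (x, c + c') - frag_of (x, c) - frag_of (x, c') \<in> TR M"
    unfolding tensor_relations_def using x by auto
  then show ?thesis unfolding ptens_alt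
    by (intro coset_split[OF M]) (use x K_add in auto)
qed

lemma pt_bal:
  assumes M: "omod M" and x: "x \<in> carrier M" "a \<in> OK" "c \<in> K"
  shows "ptens A M (a \<odot>\<^bsub>M\<^esub> x) c = ptens A M x (a * c)"
proof -
  have "frag_of (a \<odot>\<^bsub>M\<^esub> x, c) - frag_of (x, a * c) \<in> TR M"
    unfolding tensor_relations_def using x by auto
  then have "frag_of (a \<odot>\<^bsub>M\<^esub> x, c) - frag_of (x, a * c) \<in> TN M" by (rule generate.incl)
  then show ?thesis unfolding ptens_alt using x omod_facts[OF M] K_mult OK_K
    by (intro coset_eq[OF M]) (auto simp del: carrier_free_Abelian_group_iff)
qed

lemma K_denominators: "c \<in> K \<Longrightarrow> \<exists>N0. \<forall>N\<ge>N0. c * of_nat (prm A) ^ N \<in> OK"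
proof -
  assume c: "c \<in> K"
  show ?thesis
  proof (cases "c = 0")
    case False
    then obtain r where r: "ordp A c = ereal r" using ord_finite by auto
    obtain N0 where N0: "- r \<le> real N0" using real_arch_simple by blast
    have "c * of_nat (prm A) ^ N \<in> OK" if "N0 \<le> N" for N
    proof -
      have "0 \<le> r + real N" using N0 that by linarith
      then have "sm 0 (c * of_nat (prm A) ^ N)" by (simp add: sm_def ord_mult r ord_p_pow)
      then show ?thesis using c by (simp add: OK_iff K_mult K_power)
    qed
    then show ?thesis by blast
  qed auto
qed

lemma pt_zero: "omod M \<Longrightarrow> ptens A M \<zero>\<^bsub>M\<^esub> 0 = \<one>\<^bsub>tens A M\<^esub>"
proof -
  assume M: "omod M"
  interpret T: group "tens A M" by (rule tens_group[OF M])
  interpret M: module "scalars OK" M by (rule M)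
  have z: "\<zero>\<^bsub>M\<^esub> \<in> carrier M" by simp
  have "ptens A M \<zero>\<^bsub>M\<^esub> (0 + 0) = ptens A M \<zero>\<^bsub>M\<^esub> 0 \<otimes>\<^bsub>tens A M\<^esub> ptens A M \<zero>\<^bsub>M\<^esub> 0"
    by (rule pt_add2[OF M z]) auto
  then show ?thesis using pt_in[OF z K_0] by simp
qed

lemma pt_zero2: "omod M \<Longrightarrow> x \<in> carrier M \<Longrightarrow> ptens A M x 0 = \<one>\<^bsub>tens A M\<^esub>"
proof -
  assume M: "omod M" and x: "x \<in> carrier M"
  interpret T: group "tens A M" by (rule tens_group[OF M])
  have "ptens A M x (0 + 0) = ptens A M x 0 \<otimes>\<^bsub>tens A M\<^esub> ptens A M x 0"
    by (rule pt_add2[OF M x]) auto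
  then show ?thesis using pt_in[OF x K_0] by simp
qed

lemma pt_inv: "omod M \<Longrightarrow> x \<in> carrier M \<Longrightarrow> c \<in> K \<Longrightarrow> inv\<^bsub>tens A M\<^esub> (ptens A M x c) = ptens A M x (- c)"
proof -
  assume M: "omod M" and x: "x \<in> carrier M" and c: "c \<in> K"
  interpret T: group "tens A M" by (rule tens_group[OF M])
  have "ptens A M x (- c) \<otimes>\<^bsub>tens A M\<^esub> ptens A M x c = \<one>\<^bsub>tens A M\<^esub>"
    using pt_add2[OF M x K_minus[OF c] c] pt_zero2[OF M x] by simp
  then show ?thesis by (rule T.inv_equality[OF _ pt_in[OF x c] pt_in[OF x K_minus[OF c]]])
qed

text \<open>Two pure tensors have a common denominator \<open>p\<^sup>N\<close>, and tensors with the same denominator are added in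
  the first factor.\<close>

lemma pt_common:
  assumes M: "omod M" and x: "x \<in> carrier M" "y \<in> carrier M" "c \<in> K" "c' \<in> K"
  shows "\<exists>z\<in>carrier M. \<exists>N. ptens A M x c \<otimes>\<^bsub>tens A M\<^esub> ptens A M y c' = ptens A M z (1 / of_nat (prm A) ^ N)"
proof -
  obtain N1 N2 where "\<forall>N\<ge>N1. c * of_nat (prm A) ^ N \<in> OK" "\<forall>N\<ge>N2. c' * of_nat (prm A) ^ N \<in> OK"
    using K_denominators x by metis
  then obtain N where N: "c * of_nat (prm A) ^ N \<in> OK" "c' * of_nat (prm A) ^ N \<in> OK"
    by (meson max.cobounded1 max.cobounded2)
  let ?i = "1 / of_nat (prm A) ^ N"
  have iK: "?i \<in> K" by (intro K_divide K_power) auto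
  have "ptens A M x c = ptens A M ((c * of_nat (prm A) ^ N) \<odot>\<^bsub>M\<^esub> x) ?i"
    "ptens A M y c' = ptens A M ((c' * of_nat (prm A) ^ N) \<odot>\<^bsub>M\<^esub> y) ?i"
    using pt_bal[OF M x(1) N(1) iK] pt_bal[OF M x(2) N(2) iK] by auto
  then have "ptens A M x c \<otimes>\<^bsub>tens A M\<^esub> ptens A M y c' =
     ptens A M ((c * of_nat (prm A) ^ N) \<odot>\<^bsub>M\<^esub> x \<oplus>\<^bsub>M\<^esub> (c' * of_nat (prm A) ^ N) \<odot>\<^bsub>M\<^esub> y) ?i"
    using pt_add1[OF M _ _ iK] x N omod_facts[OF M] by simp
  then show ?thesis using x N omod_facts[OF M] by blast
qed

text \<open>As \<open>K\<close> is a localisation of the ring of integers, every tensor is pure.\<close>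

lemma tens_pure:
  fixes M :: "('c, 'b) module"
  assumes M: "omod M" and t: "t \<in> carrier (tens A M)"
  shows "\<exists>x\<in>carrier M. \<exists>N. t = ptens A M x (1 / of_nat (prm A) ^ N)"
proof -
  interpret T: group "tens A M" by (rule tens_group[OF M])
  interpret M: module "scalars OK" M by (rule M)
  obtain z where z: "z \<in> carrier (FA M)" "t = TN M #>\<^bsub>FA M\<^esub> z" using t unfolding tens_alt carrier_FactGroup by auto
  have iK: "1 / of_nat (prm A) ^ N \<in> K" for N by (intro K_divide K_power) auto
  have "\<exists>x\<in>carrier M. \<exists>N. TN M #>\<^bsub>FA M\<^esub> z = ptens A M x (1 / of_nat (prm A) ^ N)"
  proof (rule free_Abelian_group_induct[OF z(1)[unfolded carrier_free_Abelian_group_iff]])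
    have "TN M #>\<^bsub>FA M\<^esub> 0 = \<one>\<^bsub>tens A M\<^esub>"
      using group.coset_mult_one[OF group_free_Abelian_group, of "TN M" "carrier M \<times> K"] subgroup.subset[OF TN_subgroup[OF M]]
      unfolding tens_alt one_FactGroup by simp
    also have "\<dots> = ptens A M \<zero>\<^bsub>M\<^esub> 0 \<otimes>\<^bsub>tens A M\<^esub> ptens A M \<zero>\<^bsub>M\<^esub> 0" using pt_zero[OF M] by simp
    finally show "\<exists>x\<in>carrier M. \<exists>N. TN M #>\<^bsub>FA M\<^esub> 0 = ptens A M x (1 / of_nat (prm A) ^ N)"
      using pt_common[OF M, of "\<zero>\<^bsub>M\<^esub>" "\<zero>\<^bsub>M\<^esub>" 0 0] by simp
  next
    fix a b :: "('b \<times> 'c) \<Rightarrow>\<^sub>0 int"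
    assume 2: "Poly_Mapping.keys a \<subseteq> carrier M \<times> K" "Poly_Mapping.keys b \<subseteq> carrier M \<times> K"
      "\<exists>x\<in>carrier M. \<exists>N. TN M #>\<^bsub>FA M\<^esub> a = ptens A M x (1 / of_nat (prm A) ^ N)"
      "\<exists>x\<in>carrier M. \<exists>N. TN M #>\<^bsub>FA M\<^esub> b = ptens A M x (1 / of_nat (prm A) ^ N)"
    then obtain x N y N' where xy: "x \<in> carrier M" "TN M #>\<^bsub>FA M\<^esub> a = ptens A M x (1 / of_nat (prm A) ^ N)"
      "y \<in> carrier M" "TN M #>\<^bsub>FA M\<^esub> b = ptens A M y (1 / of_nat (prm A) ^ N')" by blast
    have ab: "a \<in> carrier (FA M)" "b \<in> carrier (FA M)" using 2 by auto
    have "(TN M #>\<^bsub>FA M\<^esub> (a - b)) \<otimes>\<^bsub>tens A M\<^esub> (TN M #>\<^bsub>FA M\<^esub> b) = TN M #>\<^bsub>FA M\<^esub> a"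
      using coset_mult[OF M frag_diff_in[OF ab] ab(2)] by simp
    note e = this
    have "TN M #>\<^bsub>FA M\<^esub> (a - b) = ptens A M x (1 / of_nat (prm A) ^ N) \<otimes>\<^bsub>tens A M\<^esub> inv\<^bsub>tens A M\<^esub> ptens A M y (1 / of_nat (prm A) ^ N')"
      unfolding xy(2)[symmetric] xy(4)[symmetric]
      by (rule T.inv_solve_right[OF coset_in[OF frag_diff_in[OF ab]] coset_in[OF ab(1)] coset_in[OF ab(2)], THEN iffD2])
        (rule e[symmetric])
    also have "\<dots> = ptens A M x (1 / of_nat (prm A) ^ N) \<otimes>\<^bsub>tens A M\<^esub> ptens A M y (- (1 / of_nat (prm A) ^ N'))"
      using pt_inv[OF M xy(3) iK[of N']] by simp
    finally show "\<exists>x\<in>carrier M. \<exists>N. TN M #>\<^bsub>FA M\<^esub> (a - b) = ptens A M x (1 / of_nat (prm A) ^ N)"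
      using pt_common[OF M xy(1,3) iK K_minus[OF iK]] by (simp only:)
  next
    fix a assume "a \<in> carrier M \<times> K"
    then obtain x c where a: "a = (x, c)" "x \<in> carrier M" "c \<in> K" by auto
    have "TN M #>\<^bsub>FA M\<^esub> frag_of a = ptens A M x c \<otimes>\<^bsub>tens A M\<^esub> ptens A M \<zero>\<^bsub>M\<^esub> 0"
      using pt_zero[OF M] pt_in[OF a(2,3)] by (simp add: a ptens_alt)
    then show "\<exists>x\<in>carrier M. \<exists>N. TN M #>\<^bsub>FA M\<^esub> frag_of a = ptens A M x (1 / of_nat (prm A) ^ N)"
      using pt_common[OF M a(2) _ a(3), of "\<zero>\<^bsub>M\<^esub>" 0] by simp
  qed
  then show ?thesis using z(2) by simp
qed

lemma tens_pureE:
  assumes "omod M" "t \<in> carrier (tens A M)"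
  obtains x c where "x \<in> carrier M" "c \<in> K" "c \<noteq> 0" "t = ptens A M x c"
proof -
  obtain x N where "x \<in> carrier M" "t = ptens A M x (1 / of_nat (prm A) ^ N)" using tens_pure[OF assms] by auto
  moreover have "1 / of_nat (prm A) ^ N \<in> K" by (intro K_divide K_power) auto
  ultimately show ?thesis using that[of x "1 / of_nat (prm A) ^ N"] by simp
qed

text \<open>Balanced biadditive maps.\<close>

definition "bal M H b \<longleftrightarrow> (\<forall>x\<in>carrier M. \<forall>c\<in>K. b x c \<in> carrier H) \<and>
   (\<forall>x\<in>carrier M. \<forall>y\<in>carrier M. \<forall>c\<in>K. b (x \<oplus>\<^bsub>M\<^esub> y) c = b x c \<otimes>\<^bsub>H\<^esub> b y c) \<and>
   (\<forall>x\<in>carrier M. \<forall>c\<in>K. \<forall>c'\<in>K. b x (c + c') = b x c \<otimes>\<^bsub>H\<^esub> b x c') \<and>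
   (\<forall>a\<in>OK. \<forall>x\<in>carrier M. \<forall>c\<in>K. b (a \<odot>\<^bsub>M\<^esub> x) c = b x (a * c))"

lemma balI:
  assumes "\<And>x c. x \<in> carrier M \<Longrightarrow> c \<in> K \<Longrightarrow> b x c \<in> carrier H"
    "\<And>x y c. x \<in> carrier M \<Longrightarrow> y \<in> carrier M \<Longrightarrow> c \<in> K \<Longrightarrow> b (x \<oplus>\<^bsub>M\<^esub> y) c = b x c \<otimes>\<^bsub>H\<^esub> b y c"
    "\<And>x c c'. x \<in> carrier M \<Longrightarrow> c \<in> K \<Longrightarrow> c' \<in> K \<Longrightarrow> b x (c + c') = b x c \<otimes>\<^bsub>H\<^esub> b x c'"
    "\<And>a x c. a \<in> OK \<Longrightarrow> x \<in> carrier M \<Longrightarrow> c \<in> K \<Longrightarrow> b (a \<odot>\<^bsub>M\<^esub> x) c = b x (a * c)"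
  shows "bal M H b"
  using assms unfolding bal_def by simp

text \<open>The universal property: a balanced map extends to the free abelian group, kills the relations,
  and so descends; uniqueness makes the definite description denote this descent.\<close>

lemma tlift_props:
  assumes M: "omod M" and H: "comm_group H" and b: "bal M H b"
  shows "tlift A M H b \<in> hom (tens A M) H"
    "\<And>x c. x \<in> carrier M \<Longrightarrow> c \<in> K \<Longrightarrow> tlift A M H b (ptens A M x c) = b x c"
proof -
  interpret H: comm_group H by (rule H)
  interpret T: group "tens A M" by (rule tens_group[OF M])
  have "(\<lambda>(x, c). b x c) ` (carrier M \<times> K) \<subseteq> carrier H" using b by (auto simp: bal_def)
  from H.free_Abelian_group_universal[OF this]
  obtain h where h: "h \<in> hom (FA M) H" "\<And>x. x \<in> carrier M \<times> K \<Longrightarrow> h (frag_of x) = (case x of (x, c) \<Rightarrow> b x c)" by blast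
  have h2: "h (frag_of (x, c)) = b x c" if "x \<in> carrier M" "c \<in> K" for x c using h(2)[of "(x, c)"] that by simp
  interpret hh: group_hom "FA M" H h
    using h(1) by (simp add: group_hom_def group_hom_axioms_def)
  have hdiff: "h (y - z) = h y \<otimes>\<^bsub>H\<^esub> inv\<^bsub>H\<^esub> h z" if "y \<in> carrier (FA M)" "z \<in> carrier (FA M)" for y z
  proof -
    have "h ((y - z) \<otimes>\<^bsub>FA M\<^esub> z) = h (y - z) \<otimes>\<^bsub>H\<^esub> h z" by (rule hh.hom_mult[OF frag_diff_in[OF that] that(2)])
    then have "h y = h (y - z) \<otimes>\<^bsub>H\<^esub> h z" by simp
    then show ?thesis
      using H.inv_solve_right[OF hh.hom_closed[OF frag_diff_in[OF that]] hh.hom_closed[OF that(1)] hh.hom_closed[OF that(2)]] by simp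
  qed
  have rel: "h r = \<one>\<^bsub>H\<^esub>" if "r \<in> TR M" for r
  proof -
    have bc: "b x c \<in> carrier H" if "x \<in> carrier M" "c \<in> K" for x c using b that by (auto simp: bal_def)
    have fin: "frag_of (x, c) \<in> carrier (FA M)" if "x \<in> carrier M" "c \<in> K" for x c using that by simp
    have canc: "a \<otimes>\<^bsub>H\<^esub> b' \<otimes>\<^bsub>H\<^esub> inv\<^bsub>H\<^esub> a \<otimes>\<^bsub>H\<^esub> inv\<^bsub>H\<^esub> b' = \<one>\<^bsub>H\<^esub>" if "a \<in> carrier H" "b' \<in> carrier H" for a b'
      using that by (simp add: H.m_comm[of a b'] H.m_assoc)
    from that consider (1) x x' y where "r = frag_of (x \<oplus>\<^bsub>M\<^esub> x', y) - frag_of (x, y) - frag_of (x', y)" "x \<in> carrier M" "x' \<in> carrier M" "y \<in> K"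
      | (2) x y y' where "r = frag_of (x, y + y') - frag_of (x, y) - frag_of (x, y')" "x \<in> carrier M" "y \<in> K" "y' \<in> K"
      | (3) a x y where "r = frag_of (a \<odot>\<^bsub>M\<^esub> x, y) - frag_of (x, a * y)" "a \<in> OK" "x \<in> carrier M" "y \<in> K"
      unfolding tensor_relations_def by auto
    then show ?thesis
    proof cases
      case 1
      have i: "frag_of (x \<oplus>\<^bsub>M\<^esub> x', y) \<in> carrier (FA M)" "frag_of (x, y) \<in> carrier (FA M)" "frag_of (x', y) \<in> carrier (FA M)"
        using 1 omod_facts[OF M] by auto
      have "h r = b (x \<oplus>\<^bsub>M\<^esub> x') y \<otimes>\<^bsub>H\<^esub> inv\<^bsub>H\<^esub> b x y \<otimes>\<^bsub>H\<^esub> inv\<^bsub>H\<^esub> b x' y"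
        unfolding 1(1) hdiff[OF frag_diff_in[OF i(1,2)] i(3)] hdiff[OF i(1,2)] using 1 omod_facts[OF M] by (simp add: h2)
      moreover have "b (x \<oplus>\<^bsub>M\<^esub> x') y = b x y \<otimes>\<^bsub>H\<^esub> b x' y" using b 1 by (simp add: bal_def)
      ultimately show ?thesis using canc bc 1 by simp
    next
      case 2
      have i: "frag_of (x, y + y') \<in> carrier (FA M)" "frag_of (x, y) \<in> carrier (FA M)" "frag_of (x, y') \<in> carrier (FA M)"
        using 2 K_add by auto
      have "h r = b x (y + y') \<otimes>\<^bsub>H\<^esub> inv\<^bsub>H\<^esub> b x y \<otimes>\<^bsub>H\<^esub> inv\<^bsub>H\<^esub> b x y'"
        unfolding 2(1) hdiff[OF frag_diff_in[OF i(1,2)] i(3)] hdiff[OF i(1,2)] using 2 K_add by (simp add: h2)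
      moreover have "b x (y + y') = b x y \<otimes>\<^bsub>H\<^esub> b x y'" using b 2 by (simp add: bal_def)
      ultimately show ?thesis using canc bc 2 by simp
    next
      case 3
      have i: "frag_of (a \<odot>\<^bsub>M\<^esub> x, y) \<in> carrier (FA M)" "frag_of (x, a * y) \<in> carrier (FA M)"
        using 3 omod_facts[OF M] K_mult OK_K by auto
      have "h r = b (a \<odot>\<^bsub>M\<^esub> x) y \<otimes>\<^bsub>H\<^esub> inv\<^bsub>H\<^esub> b x (a * y)"
        unfolding 3(1) hdiff[OF i] using 3 omod_facts[OF M] K_mult OK_K by (simp add: h2)
      moreover have "b (a \<odot>\<^bsub>M\<^esub> x) y = b x (a * y)" using b 3 by (simp add: bal_def)
      ultimately show ?thesis using bc 3 K_mult OK_K by simp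
    qed
  qed
  have "TN M \<subseteq> kernel (FA M) H h"
  proof (rule group.generate_subgroup_incl[OF group_free_Abelian_group])
    show "TR M \<subseteq> kernel (FA M) H h" using rel TR_sub[OF M] by (auto simp: kernel_def simp del: carrier_free_Abelian_group_iff)
    show "subgroup (kernel (FA M) H h) (FA M)" by (rule hh.subgroup_kernel)
  qed
  from hh.FactGroup_universal_kernel[OF TN_normal[OF M] this]
  obtain g where g: "g \<in> hom (tens A M) H" "\<And>z. z \<in> carrier (FA M) \<Longrightarrow> g (TN M #>\<^bsub>FA M\<^esub> z) = h z"
    unfolding tens_alt by blast
  have gp: "g (ptens A M x c) = b x c" if "x \<in> carrier M" "c \<in> K" for x c
    unfolding ptens_alt using g(2)[of "frag_of (x, c)"] h2 that by simp
  let ?Q = "\<lambda>f. f \<in> extensional (carrier (tens A M)) \<and> f \<in> hom (tens A M) H \<and>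
        (\<forall>x\<in>carrier M. \<forall>y\<in>carrier (scalars K). f (pure_tensor (scalars OK) M (scalars K) x y) = b x y)"
  let ?g = "restrict g (carrier (tens A M))"
  have Q: "?Q ?g"
    using g(1) gp pt_in[where M = M] by (auto simp: hom_def ptens_def[symmetric] Pi_iff T.m_closed simp del: tens_alt)
  have uniq: "f = ?g" if f: "?Q f" for f
  proof (rule extensionalityI)
    show "f \<in> extensional (carrier (tens A M))" using f by simp
    fix t assume t: "t \<in> carrier (tens A M)"
    obtain x c where "x \<in> carrier M" "c \<in> K" "t = ptens A M x c" using tens_pureE[OF M t] by metis
    then show "f t = ?g t" using f gp t by (auto simp: ptens_def)
  qed simp
  have "tlift A M H b = ?g"
    unfolding tlift_def tensor_lift_def tens_def[symmetric] by (rule the_equality) (use Q uniq in blast)+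
  then show "tlift A M H b \<in> hom (tens A M) H"
    "\<And>x c. x \<in> carrier M \<Longrightarrow> c \<in> K \<Longrightarrow> tlift A M H b (ptens A M x c) = b x c"
    using Q gp pt_in[where M = M] by auto
qed

lemma tmap_props:
  assumes M: "omod M" and N: "omod N" and f: "\<And>x. x \<in> carrier M \<Longrightarrow> f x \<in> carrier N"
    "\<And>x y. x \<in> carrier M \<Longrightarrow> y \<in> carrier M \<Longrightarrow> f (x \<oplus>\<^bsub>M\<^esub> y) = f x \<oplus>\<^bsub>N\<^esub> f y"
    "\<And>a x. a \<in> OK \<Longrightarrow> x \<in> carrier M \<Longrightarrow> f (a \<odot>\<^bsub>M\<^esub> x) = a \<odot>\<^bsub>N\<^esub> f x"
  shows "tmap A M N f \<in> hom (tens A M) (tens A N)"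
    "\<And>x c. x \<in> carrier M \<Longrightarrow> c \<in> K \<Longrightarrow> tmap A M N f (ptens A M x c) = ptens A N (f x) c"
proof -
  have b: "bal M (tens A N) (\<lambda>x c. ptens A N (f x) c)"
    by (rule balI) (auto simp: f pt_in pt_add1[OF N] pt_add2[OF N] pt_bal[OF N])
  show "tmap A M N f \<in> hom (tens A M) (tens A N)"
    "\<And>x c. x \<in> carrier M \<Longrightarrow> c \<in> K \<Longrightarrow> tmap A M N f (ptens A M x c) = ptens A N (f x) c"
    unfolding tmap_def using tlift_props[OF M tens_comm_group[OF N] b] by auto
qed

lemma tscale_pt:
  assumes M: "omod M" and a: "a \<in> K" and x: "x \<in> carrier M" "c \<in> K"
  shows "tscale A M a (ptens A M x c) = ptens A M x (a * c)"
proof -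
  have b: "bal M (tens A M) (\<lambda>x c. ptens A M x (a * c))"
    by (rule balI) (auto simp: pt_in pt_add1[OF M] pt_add2[OF M] pt_bal[OF M] K_mult a distrib_left mult.left_commute)
  show ?thesis unfolding tscale_def using tlift_props(2)[OF M tens_comm_group[OF M] b] x by simp
qed

text \<open>Actions of the Iwasawa algebra that are bilinear over the ring of integers; only these occur in
  the definition of the action of the base change.\<close>

definition "bilin M act \<longleftrightarrow> (\<forall>l\<in>Lam. \<forall>x\<in>carrier M. act l x \<in> carrier M) \<and>
  (\<forall>l\<in>Lam. \<forall>x\<in>carrier M. \<forall>y\<in>carrier M. act l (x \<oplus>\<^bsub>M\<^esub> y) = act l x \<oplus>\<^bsub>M\<^esub> act l y) \<and>
  (\<forall>l\<in>Lam. \<forall>l'\<in>Lam. \<forall>x\<in>carrier M. act (l \<oplus>\<^bsub>Iwasawa A\<^esub> l') x = act l x \<oplus>\<^bsub>M\<^esub> act l' x) \<and>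
  (\<forall>a\<in>OK. \<forall>l\<in>Lam. \<forall>x\<in>carrier M. act (a \<odot>\<^bsub>Iwasawa A\<^esub> l) x = a \<odot>\<^bsub>M\<^esub> act l x \<and> act l (a \<odot>\<^bsub>M\<^esub> x) = a \<odot>\<^bsub>M\<^esub> act l x)"

lemma Iw_omod: "omod (Iwasawa A)"
proof -
  interpret M: module "scalars OK" "functionals A (cts A) OK" by (rule Iw_module)
  interpret R: ring "Iwasawa A" by (rule Iw_ring)
  show ?thesis
    by (rule moduleI) (use M.smult_closed M.smult_l_distr M.smult_r_distr M.smult_assoc1 M.smult_one
      in \<open>auto intro: cring_OK R.abelian_group_axioms simp: restrict_def\<close>)
qed

lemma taction_pt:
  assumes M: "omod M" and act: "bilin M act" and l: "l \<in> Lam" "a \<in> K" and x: "x \<in> carrier M" "c \<in> K"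
  shows "taction A M act (ptens A (Iwasawa A) l a) (ptens A M x c) = ptens A M (act l x) (a * c)"
proof -
  have b: "bal M (tens A M) (\<lambda>x c. ptens A M (act l x) (a * c))" if "l \<in> Lam" "a \<in> K" for l a
    by (rule balI) (use act that in \<open>auto simp: bilin_def pt_in pt_add1[OF M] pt_add2[OF M] pt_bal[OF M] K_mult distrib_left mult.left_commute\<close>)
  have inner: "tlift A M (tens A M) (\<lambda>x c. ptens A M (act l x) (a * c)) (ptens A M x c) = ptens A M (act l x) (a * c)"
    if "l \<in> Lam" "a \<in> K" for l a
    using tlift_props(2)[OF M tens_comm_group[OF M] b[OF that]] x by simp
  have bo: "bal (Iwasawa A) (tens A M) (\<lambda>l a. tlift A M (tens A M) (\<lambda>x c. ptens A M (act l x) (a * c)) (ptens A M x c))"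
  proof (rule balI)
    fix l l' a assume "l \<in> carrier (Iwasawa A)" "l' \<in> carrier (Iwasawa A)" "a \<in> K"
    then have *: "l \<in> Lam" "l' \<in> Lam" "a \<in> K" by auto
    have s: "l \<oplus>\<^bsub>Iwasawa A\<^esub> l' \<in> Lam" using omod_facts(1)[OF Iw_omod, of l l'] * by simp
    show "tlift A M (tens A M) (\<lambda>x c. ptens A M (act (l \<oplus>\<^bsub>Iwasawa A\<^esub> l') x) (a * c)) (ptens A M x c) =
       tlift A M (tens A M) (\<lambda>x c. ptens A M (act l x) (a * c)) (ptens A M x c) \<otimes>\<^bsub>tens A M\<^esub>
       tlift A M (tens A M) (\<lambda>x c. ptens A M (act l' x) (a * c)) (ptens A M x c)"
      unfolding inner[OF s *(3)] inner[OF *(1,3)] inner[OF *(2,3)]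
      using act * x by (simp add: bilin_def pt_add1[OF M] K_mult del: Iw_sel)
  next
    fix l a a' assume "l \<in> carrier (Iwasawa A)" "a \<in> K" "a' \<in> K"
    then have *: "l \<in> Lam" "a \<in> K" "a' \<in> K" by auto
    show "tlift A M (tens A M) (\<lambda>x c. ptens A M (act l x) ((a + a') * c)) (ptens A M x c) =
       tlift A M (tens A M) (\<lambda>x c. ptens A M (act l x) (a * c)) (ptens A M x c) \<otimes>\<^bsub>tens A M\<^esub>
       tlift A M (tens A M) (\<lambda>x c. ptens A M (act l x) (a' * c)) (ptens A M x c)"
      unfolding inner[OF *(1) K_add[OF *(2,3)]] inner[OF *(1,2)] inner[OF *(1,3)]
      using act x * by (simp add: bilin_def pt_add2[OF M] K_mult distrib_right)
  next
    fix r l a assume "r \<in> OK" "l \<in> carrier (Iwasawa A)" "a \<in> K"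
    then have *: "r \<in> OK" "l \<in> Lam" "a \<in> K" by auto
    have s: "r \<odot>\<^bsub>Iwasawa A\<^esub> l \<in> Lam" using omod_facts(2)[OF Iw_omod, of r l] * by simp
    show "tlift A M (tens A M) (\<lambda>x c. ptens A M (act (r \<odot>\<^bsub>Iwasawa A\<^esub> l) x) (a * c)) (ptens A M x c) =
       tlift A M (tens A M) (\<lambda>x c. ptens A M (act l x) (r * a * c)) (ptens A M x c)"
      unfolding inner[OF s *(3)] inner[OF *(2) K_mult[OF OK_K[OF *(1)] *(3)]]
      using act * x by (simp add: bilin_def pt_bal[OF M] K_mult mult.assoc del: Iw_sel)
  next
    fix l a assume "l \<in> carrier (Iwasawa A)" "a \<in> K"
    then show "tlift A M (tens A M) (\<lambda>x c. ptens A M (act l x) (a * c)) (ptens A M x c) \<in> carrier (tens A M)"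
      using act x by (simp add: inner bilin_def pt_in K_mult)
  qed
  show ?thesis unfolding taction_def
    using tlift_props(2)[OF Iw_omod tens_comm_group[OF M] bo] l inner[OF l] by simp
qed

end

section \<open>The distribution attached to a compatible system\<close>

context pdatum_de
begin

interpretation Iw: ring "Iwasawa A" by (rule Iw_ring)

lemma ideal_J: "ideal (Omega A d e m) (Iwasawa A)"
  unfolding Omega_eq_Ann by (rule Ann_ideal)

abbreviation "Q m \<equiv> Iw_quot A d e m"
definition "cl m l = Omega A d e m +>\<^bsub>Iwasawa A\<^esub> l"

lemma Q_sel:
  "carrier (Q m) = carrier (Iwasawa A Quot Omega A d e m)"
  "\<zero>\<^bsub>Q m\<^esub> = \<zero>\<^bsub>Iwasawa A Quot Omega A d e m\<^esub>" "X \<oplus>\<^bsub>Q m\<^esub> Y = X \<oplus>\<^bsub>Iwasawa A Quot Omega A d e m\<^esub> Y"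
  "X \<otimes>\<^bsub>Q m\<^esub> Y = X \<otimes>\<^bsub>Iwasawa A Quot Omega A d e m\<^esub> Y"
  "c \<odot>\<^bsub>Q m\<^esub> X = cl m (c \<odot>\<^bsub>Iwasawa A\<^esub> \<one>\<^bsub>Iwasawa A\<^esub>) \<otimes>\<^bsub>Iwasawa A Quot Omega A d e m\<^esub> X"
  by (auto simp: Iw_quot_def quot_algebra_def cl_def)

lemma cl_in: "l \<in> Lam \<Longrightarrow> cl m l \<in> carrier (Q m)"
proof -
  assume l: "l \<in> Lam"
  interpret J: ideal "Omega A d e m" "Iwasawa A" by (rule ideal_J)
  show ?thesis using ring_hom_closed[OF J.rcos_ring_hom, of l] l by (simp add: Q_sel cl_def)
qed

text \<open>The quotient is handled through representatives: \<open>cl m l\<close> is the class of \<open>l\<close>.\<close>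

lemma Q_rep: "X \<in> carrier (Q m) \<Longrightarrow> \<exists>l\<in>Lam. X = cl m l"
  by (auto simp: Q_sel FactRing_def A_RCOSETS_def' a_r_coset_def' cl_def)

lemma cl_add: "l \<in> Lam \<Longrightarrow> l' \<in> Lam \<Longrightarrow> cl m l \<oplus>\<^bsub>Q m\<^esub> cl m l' = cl m (l \<oplus>\<^bsub>Iwasawa A\<^esub> l')"
proof -
  assume l: "l \<in> Lam" "l' \<in> Lam"
  interpret J: ideal "Omega A d e m" "Iwasawa A" by (rule ideal_J)
  show ?thesis unfolding Q_sel cl_def using l by (intro ring_hom_add[OF J.rcos_ring_hom, symmetric]) auto
qed

lemma cl_mult: "l \<in> Lam \<Longrightarrow> l' \<in> Lam \<Longrightarrow> cl m l \<otimes>\<^bsub>Q m\<^esub> cl m l' = cl m (l \<otimes>\<^bsub>Iwasawa A\<^esub> l')"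
proof -
  assume l: "l \<in> Lam" "l' \<in> Lam"
  interpret J: ideal "Omega A d e m" "Iwasawa A" by (rule ideal_J)
  show ?thesis unfolding Q_sel cl_def using l by (intro ring_hom_mult[OF J.rcos_ring_hom, symmetric]) auto
qed

lemma scalar_conv: "c \<in> OK \<Longrightarrow> l \<in> Lam \<Longrightarrow> (c \<odot>\<^bsub>Iwasawa A\<^esub> \<one>\<^bsub>Iwasawa A\<^esub>) \<otimes>\<^bsub>Iwasawa A\<^esub> l = c \<odot>\<^bsub>Iwasawa A\<^esub> l"
proof -
  assume c: "c \<in> OK" and l: "l \<in> Lam"
  have "avg (\<lambda>f\<in>cts A. c * dirac A \<one>\<^bsub>Gprod A\<^esub> f) f = (\<lambda>x\<in>G. c * f x)" if "f \<in> cts A" for f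
    unfolding avg_def
  proof (rule restrict_ext)
    fix y assume y: "y \<in> G"
    show "(\<lambda>f\<in>cts A. c * dirac A \<one>\<^bsub>Gprod A\<^esub> f) (gtr f y) = c * f y"
      using gtr_cts[OF that y] y by (simp add: dirac_apply) (simp add: gtr_def)
  qed
  then show ?thesis using Fn_cmult[OF l c]
    by (simp add: convolution_avg) (rule restrict_ext, simp)
qed

lemma cl_smult: "c \<in> OK \<Longrightarrow> l \<in> Lam \<Longrightarrow> c \<odot>\<^bsub>Q m\<^esub> cl m l = cl m (c \<odot>\<^bsub>Iwasawa A\<^esub> l)"
proof -
  assume c: "c \<in> OK" and l: "l \<in> Lam"
  have s: "c \<odot>\<^bsub>Iwasawa A\<^esub> \<one>\<^bsub>Iwasawa A\<^esub> \<in> Lam" using Iw_smult_in[OF c dirac_in[OF G_one_in]] by simp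
  have "c \<odot>\<^bsub>Q m\<^esub> cl m l = cl m (c \<odot>\<^bsub>Iwasawa A\<^esub> \<one>\<^bsub>Iwasawa A\<^esub>) \<otimes>\<^bsub>Q m\<^esub> cl m l" unfolding Q_sel ..
  also have "\<dots> = cl m ((c \<odot>\<^bsub>Iwasawa A\<^esub> \<one>\<^bsub>Iwasawa A\<^esub>) \<otimes>\<^bsub>Iwasawa A\<^esub> l)" by (rule cl_mult[OF s l])
  finally show ?thesis unfolding scalar_conv[OF c l] .
qed

text \<open>Two classes agree iff their representatives agree on \<open>W m\<close>; this is where the identification of
  the ideal with an annihilator enters.\<close>

lemma cl_eq_iff: "l \<in> Lam \<Longrightarrow> l' \<in> Lam \<Longrightarrow> cl m l = cl m l' \<longleftrightarrow> (\<forall>f\<in>W m. l f = l' f)"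
proof -
  assume l: "l \<in> Lam" "l' \<in> Lam"
  interpret J: ideal "Omega A d e m" "Iwasawa A" by (rule ideal_J)
  have "cl m l = cl m l' \<longleftrightarrow> l \<ominus>\<^bsub>Iwasawa A\<^esub> l' \<in> Omega A d e m"
    unfolding cl_def using Iw.quotient_eq_iff_same_a_r_cos[OF ideal_J, of l l'] l by simp
  also have "\<dots> \<longleftrightarrow> (\<forall>f\<in>W m. l f = l' f)"
  proof -
    have "(\<lambda>f\<in>cts A. l f - l' f) \<in> Lam" using Iw.minus_closed[of l l'] l Iw_diff[OF l] by simp
    then show ?thesis unfolding Omega_eq_Ann Iw_diff[OF l] using W_cts by (auto simp: Ann_def)
  qed
  finally show ?thesis .
qed

lemma Q_omod: "omod (Q m)"
proof (rule moduleI)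
  interpret J: ideal "Omega A d e m" "Iwasawa A" by (rule ideal_J)
  interpret R: ring "Iwasawa A Quot Omega A d e m" by (rule J.quotient_is_ring)
  interpret L: module "scalars OK" "Iwasawa A" by (rule Iw_omod)
  note sm = L.smult_closed[simplified scal_sel]
  show "cring (scalars OK)" by (rule cring_OK)
  show "abelian_group (Q m)"
  proof (rule abelian_groupI)
    fix x assume "x \<in> carrier (Q m)"
    then show "\<exists>y\<in>carrier (Q m). y \<oplus>\<^bsub>Q m\<^esub> x = \<zero>\<^bsub>Q m\<^esub>"
      using R.l_neg[of x] R.a_inv_closed[of x] unfolding Q_sel by blast
  qed (auto simp: Q_sel R.a_assoc, (metis R.a_comm)+)
  fix X assume X: "X \<in> carrier (Q m)"
  obtain l where l: "l \<in> Lam" "X = cl m l" using Q_rep[OF X] by auto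
  show "\<one>\<^bsub>scalars OK\<^esub> \<odot>\<^bsub>Q m\<^esub> X = X" using L.smult_one[of l] l by (simp add: cl_smult del: Iw_sel(5))
  fix a assume a: "a \<in> carrier (scalars OK)"
  have aL: "a \<odot>\<^bsub>Iwasawa A\<^esub> l \<in> Lam" using sm[of a l] a l by simp
  show "a \<odot>\<^bsub>Q m\<^esub> X \<in> carrier (Q m)" using a l aL by (simp add: cl_smult cl_in del: Iw_sel(5))
  fix b assume b: "b \<in> carrier (scalars OK)"
  have bL: "b \<odot>\<^bsub>Iwasawa A\<^esub> l \<in> Lam" using sm[of b l] b l by simp
  show "(a \<oplus>\<^bsub>scalars OK\<^esub> b) \<odot>\<^bsub>Q m\<^esub> X = a \<odot>\<^bsub>Q m\<^esub> X \<oplus>\<^bsub>Q m\<^esub> b \<odot>\<^bsub>Q m\<^esub> X"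
    using L.smult_l_distr[of a b l] a b l aL bL OK_add
    by (simp add: cl_smult cl_add del: Iw_sel(4,5))
  show "(a \<otimes>\<^bsub>scalars OK\<^esub> b) \<odot>\<^bsub>Q m\<^esub> X = a \<odot>\<^bsub>Q m\<^esub> (b \<odot>\<^bsub>Q m\<^esub> X)"
    using L.smult_assoc1[of a b l] a b l aL bL OK_mult
    by (simp add: cl_smult del: Iw_sel(4,5))
next
  interpret L: module "scalars OK" "Iwasawa A" by (rule Iw_omod)
  fix a X Y assume a: "a \<in> carrier (scalars OK)" and X: "X \<in> carrier (Q m)" and Y: "Y \<in> carrier (Q m)"
  obtain l where l: "l \<in> Lam" "X = cl m l" using Q_rep[OF X] by auto
  obtain l' where l': "l' \<in> Lam" "Y = cl m l'" using Q_rep[OF Y] by auto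
  have c: "a \<odot>\<^bsub>Iwasawa A\<^esub> l \<in> Lam" "a \<odot>\<^bsub>Iwasawa A\<^esub> l' \<in> Lam" "l \<oplus>\<^bsub>Iwasawa A\<^esub> l' \<in> Lam"
    using L.smult_closed[of a l] L.smult_closed[of a l'] Iw.a_closed[of l l'] a l l' by simp_all
  show "a \<odot>\<^bsub>Q m\<^esub> (X \<oplus>\<^bsub>Q m\<^esub> Y) = a \<odot>\<^bsub>Q m\<^esub> X \<oplus>\<^bsub>Q m\<^esub> a \<odot>\<^bsub>Q m\<^esub> Y"
    using omod_facts(4)[OF Iw_omod, of a l l'] a l l' c
    by (simp add: cl_smult cl_add del: Iw_sel(4,5))
qed

lemma product_omod:
  assumes M: "\<And>i. omod (N i)"
  shows "omod (product_module N)"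
proof (rule moduleI)
  have g: "abelian_group (N i)" for i using M[of i] by (simp add: module_def)
  have am: "abelian_monoid (N i)" for i using g[of i] by (simp add: abelian_group_def)
  show "cring (scalars OK)" by (rule cring_OK)
  show "abelian_group (product_module N)"
  proof (rule abelian_groupI)
    fix x assume x: "x \<in> carrier (product_module N)"
    show "\<exists>y\<in>carrier (product_module N). y \<oplus>\<^bsub>product_module N\<^esub> x = \<zero>\<^bsub>product_module N\<^esub>"
      using x abelian_group.a_inv_closed[OF g] abelian_group.l_neg[OF g]
      by (intro bexI[of _ "\<lambda>i. \<ominus>\<^bsub>N i\<^esub> x i"]) (auto simp: product_module_def)
  qed (auto simp: product_module_def fun_eq_iff abelian_monoid.a_assoc[OF am] abelian_monoid.a_comm[OF am]
      abelian_monoid.a_lcomm[OF am] abelian_monoid.l_zero[OF am] abelian_monoid.r_zero[OF am]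
      abelian_monoid.a_closed[OF am] abelian_monoid.zero_closed[OF am])
qed (use M in \<open>auto simp: product_module_def module_def module_axioms_def fun_eq_iff\<close>)

lemma res_tr_le:
  assumes x: "x \<in> G" and le: "m \<le> m'"
  shows "res i m (tr i (prm A ^ m') x i) = res i m (x i)"
proof -
  have "prm A ^ m dvd prm A ^ m'" by (rule le_imp_power_dvd[OF le])
  then have "prm A ^ m' mod prm A ^ m = 0" by simp
  then show ?thesis using x by (simp add: tr_def res_mult G_in)
qed

lemma omega_op_lagrange_le:
  assumes r: "r < prm A ^ m * nn i" and le: "m \<le> m'" and h: "\<And>x. x \<in> G \<Longrightarrow> h (tr i (prm A ^ m') x) = h x"
  shows "omega_op i (prm A ^ m') (nn i) (\<lambda>x\<in>G. h x * lagrange i m r (x i)) = z0"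
proof -
  obtain c where c: "\<forall>y\<in>cG i. lagrange i m r y = (\<Sum>t<nn i. (if res i m y = r mod prm A ^ m then c t else 0) * chi A i y powi (d i + int t))"
    using lagrange_expand[OF r] by auto
  have "omega_op i (prm A ^ m') (nn i) (\<lambda>x\<in>G. \<Sum>t<nn i. (h x * (if res i m (x i) = r mod prm A ^ m then c t else 0)) * chi A i (x i) powi (d i + int t)) = z0"
    by (rule omega_op_kills) (simp add: h res_tr_le[OF _ le])
  moreover have "(\<lambda>x\<in>G. h x * lagrange i m r (x i)) = (\<lambda>x\<in>G. \<Sum>t<nn i. (h x * (if res i m (x i) = r mod prm A ^ m then c t else 0)) * chi A i (x i) powi (d i + int t))"
    by (rule restrict_ext) (simp add: c G_in sum_distrib_left mult.assoc)
  ultimately show ?thesis by simp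
qed

text \<open>The basis functions of the lower level are periodic under the longer translation up to their
  characters, so they are killed by the operators of the higher level.\<close>

lemma W_mono:
  assumes le: "m \<le> m'"
  shows "W m \<subseteq> W m'"
proof
  fix f assume f: "f \<in> W m"
  have E: "E m r \<in> W m'" if r: "r \<in> Ebox m" for r
  proof -
    have "omega_op i (qq m' i) (nn i) (E m r) = z0" for i
    proof -
      have "E m r = (\<lambda>x\<in>G. (\<Prod>j\<in>UNIV - {i}. lagrange j (m j) (r j) (x j)) * lagrange i (m i) (r i) (x i))"
        unfolding E_def by (rule restrict_ext) (simp add: prod.remove[of UNIV i] mult.commute)
      moreover have "omega_op i (prm A ^ m' i) (nn i) (\<lambda>x\<in>G. (\<Prod>j\<in>UNIV - {i}. lagrange j (m j) (r j) (x j)) * lagrange i (m i) (r i) (x i)) = z0"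
        by (rule omega_op_lagrange_le) (use r le in \<open>auto simp: Ebox_def qq_def tr_other le_fun_def intro!: prod.cong\<close>)
      ultimately show ?thesis by (simp add: qq_def)
    qed
    then show ?thesis using lagrange_E_cts[OF r] by (simp add: W_def)
  qed
  have "(\<lambda>x\<in>G. \<Sum>r\<in>Ebox m. f (gpow r) * E m r x) \<in> W m'"
    by (rule fmod_sum[OF fmod_W]) (auto intro: E cts_OK[OF W_cts[OF f]])
  then show "f \<in> W m'" using W_expand[OF f] by simp
qed

text \<open>In each coordinate a cut-off character is a periodic function times a character of an admissible
  weight.\<close>

lemma bas_W:
  assumes n: "n \<in> dbox"
  shows "bas m r (wt n) \<in> W m"
proof -
  have "omega_op i (qq m i) (nn i) (bas m r (wt n)) = z0" for i
  proof -
    let ?g = "\<lambda>t x. if t = n i \<and> rs m x = r then (\<Prod>j\<in>UNIV - {i}. chi A j (x j) powi (wt n j)) else 0"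
    have ni: "n i < nn i" using n de_i[of i] by (auto simp: dbox_def nn_def) (smt (verit) int_nat_eq of_nat_le_iff le_imp_less_Suc)
    have "bas m r (wt n) = (\<lambda>x\<in>G. \<Sum>t<nn i. ?g t x * chi A i (x i) powi (d i + int t))"
      unfolding bas_def
    proof (rule restrict_ext)
      fix x assume "x \<in> G"
      have "(\<Sum>t<nn i. ?g t x * chi A i (x i) powi (d i + int t)) =
        (\<Sum>t<nn i. if t = n i then (if rs m x = r then (\<Prod>j\<in>UNIV - {i}. chi A j (x j) powi (wt n j)) * chi A i (x i) powi (wt n i) else 0) else 0)"
        by (rule sum.cong) (auto simp: wt_def)
      also have "\<dots> = (if rs m x = r then wmon (wt n) x else 0)"
        using ni by (simp add: wmon_def prod.remove[of UNIV i] mult.commute)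
      finally show "(if rs m x = r then wmon (wt n) x else 0) = (\<Sum>t<nn i. ?g t x * chi A i (x i) powi (d i + int t))" by simp
    qed
    moreover have "omega_op i (qq m i) (nn i) (\<lambda>x\<in>G. \<Sum>t<nn i. ?g t x * chi A i (x i) powi (d i + int t)) = z0"
    proof (rule omega_op_kills)
      fix t x assume x: "x \<in> G"
      have "rs m (tr i (qq m i) x) = rs m x"
        using res_tr[OF x, of i "m i"] by (auto simp: rs_def fun_eq_iff qq_def) (metis tr_other)
      moreover have "(\<Prod>j\<in>UNIV - {i}. chi A j (tr i (qq m i) x j) powi (wt n j)) = (\<Prod>j\<in>UNIV - {i}. chi A j (x j) powi (wt n j))"
        by (rule prod.cong) (auto simp: tr_other)
      ultimately show "?g t (tr i (qq m i) x) = ?g t x" by simp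
    qed
    ultimately show ?thesis by simp
  qed
  then show ?thesis using bas_cts by (simp add: W_def)
qed

lemma C_fun_W_level:
  assumes f: "f \<in> C_fun A d e"
  shows "\<exists>N. f \<in> W (\<lambda>_. N)"
proof -
  obtain M0 where "\<forall>m. (\<forall>i. M0 \<le> m i) \<longrightarrow> (\<exists>c. (\<forall>r n. c r n \<in> OK) \<and>
    f = (\<lambda>x\<in>G. \<Sum>rn\<in>Rm m \<times> dbox. c (fst rn) (snd rn) * bas m (fst rn) (wt (snd rn)) x))"
    using C_fun_expand[OF f] by auto
  from this[rule_format, of "\<lambda>_. M0"] obtain c where c: "\<And>r n. c r n \<in> OK"
    "f = (\<lambda>x\<in>G. \<Sum>rn\<in>Rm (\<lambda>_. M0) \<times> dbox. c (fst rn) (snd rn) * bas (\<lambda>_. M0) (fst rn) (wt (snd rn)) x)" by auto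
  have "f \<in> W (\<lambda>_. M0)" unfolding c(2)
    by (rule fmod_sum[OF fmod_W]) (auto simp: c(1) bas_W)
  then show ?thesis by blast
qed

text \<open>The value at \<open>f\<close> of a class, taken on a representative; on \<open>W m\<close> the choice is irrelevant.\<close>

definition "evq m X f = (SOME l. l \<in> Lam \<and> X = cl m l) f"
abbreviation "H0 \<equiv> add_monoid (scalars (UNIV :: 'c set))"

text \<open>The pairing of the base change of the quotient with \<open>W m\<close>, with values in the field.\<close>

definition "pairing m u f = tlift A (Q m) H0 (\<lambda>X c. c * evq m X f) u"

lemma H0_comm_group: "comm_group H0"
proof -
  interpret R: cring "scalars (UNIV :: 'c set)" by (rule cring_scalars) auto
  show ?thesis by (rule R.a_comm_group)
qed

lemma H0_sel [simp]: "carrier H0 = UNIV" "x \<otimes>\<^bsub>H0\<^esub> y = x + y"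
  by simp_all

lemma evq_cl: "l \<in> Lam \<Longrightarrow> f \<in> W m \<Longrightarrow> evq m (cl m l) f = l f"
proof -
  assume l: "l \<in> Lam" and f: "f \<in> W m"
  have "\<exists>l'. l' \<in> Lam \<and> cl m l = cl m l'" using l by blast
  from someI_ex[OF this] have "(SOME l'. l' \<in> Lam \<and> cl m l = cl m l') \<in> Lam"
    "cl m l = cl m (SOME l'. l' \<in> Lam \<and> cl m l = cl m l')" by auto
  then show ?thesis using cl_eq_iff[OF l] f by (auto simp: evq_def)
qed

lemma pairing_bal: "f \<in> W m \<Longrightarrow> bal (Q m) H0 (\<lambda>X c. c * evq m X f)"
proof (rule balI)
  assume f: "f \<in> W m"
  note fc = W_cts[OF f]
  fix X Y c assume "X \<in> carrier (Q m)" "Y \<in> carrier (Q m)"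
  then obtain l l' where l: "l \<in> Lam" "l' \<in> Lam" "X = cl m l" "Y = cl m l'" using Q_rep by blast
  have "l \<oplus>\<^bsub>Iwasawa A\<^esub> l' \<in> Lam" using Iw_add_in[OF l(1,2)] by simp
  then show "c * evq m (X \<oplus>\<^bsub>Q m\<^esub> Y) f = (c * evq m X f) \<otimes>\<^bsub>H0\<^esub> (c * evq m Y f)"
    using l f fc by (simp add: cl_add evq_cl distrib_left del: Iw_sel(4)) (simp add: distrib_left)
next
  assume f: "f \<in> W m"
  fix a X c assume a: "a \<in> OK" and "X \<in> carrier (Q m)"
  then obtain l where l: "l \<in> Lam" "X = cl m l" using Q_rep by blast
  have "a \<odot>\<^bsub>Iwasawa A\<^esub> l \<in> Lam" using Iw_smult_in[OF a l(1)] by simp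
  then show "c * evq m (a \<odot>\<^bsub>Q m\<^esub> X) f = a * c * evq m X f"
    using l f a W_cts[OF f] by (simp add: cl_smult evq_cl del: Iw_sel(5)) simp
qed (auto simp: distrib_right)

lemma pairing_pt: "l \<in> Lam \<Longrightarrow> c \<in> K \<Longrightarrow> f \<in> W m \<Longrightarrow> pairing m (ptens A (Q m) (cl m l) c) f = c * l f"
  unfolding pairing_def using tlift_props(2)[OF Q_omod H0_comm_group pairing_bal, of f m "cl m l" c] by (simp add: cl_in evq_cl)

lemma QK_rep:
  assumes "u \<in> carrier (tens A (Q m))"
  obtains l c where "l \<in> Lam" "c \<in> K" "c \<noteq> 0" "u = ptens A (Q m) (cl m l) c"
proof -
  obtain X c where "X \<in> carrier (Q m)" "c \<in> K" "c \<noteq> 0" "u = ptens A (Q m) X c"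
    using tens_pureE[OF Q_omod assms] by metis
  moreover then obtain l where "l \<in> Lam" "X = cl m l" using Q_rep by blast
  ultimately show ?thesis using that by blast
qed

lemma QK_in: "l \<in> Lam \<Longrightarrow> c \<in> K \<Longrightarrow> ptens A (Q m) (cl m l) c \<in> carrier (tens A (Q m))"
  by (simp add: pt_in cl_in)

lemma pairing_add: "u \<in> carrier (tens A (Q m)) \<Longrightarrow> v \<in> carrier (tens A (Q m)) \<Longrightarrow> f \<in> W m \<Longrightarrow>
  pairing m (u \<otimes>\<^bsub>tens A (Q m)\<^esub> v) f = pairing m u f + pairing m v f"
  unfolding pairing_def using hom_mult[OF tlift_props(1)[OF Q_omod H0_comm_group pairing_bal], of f m u v] by simp

lemma pairing_K: "u \<in> carrier (tens A (Q m)) \<Longrightarrow> f \<in> W m \<Longrightarrow> pairing m u f \<in> K"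
proof -
  assume u: "u \<in> carrier (tens A (Q m))" and f: "f \<in> W m"
  obtain l c where "l \<in> Lam" "c \<in> K" "u = ptens A (Q m) (cl m l) c" using QK_rep[OF u] by metis
  then show ?thesis using f W_cts[OF f] by (simp add: pairing_pt K_mult OK_K Fn_in)
qed

lemma pairing_fun_add: "u \<in> carrier (tens A (Q m)) \<Longrightarrow> f \<in> W m \<Longrightarrow> g \<in> W m \<Longrightarrow>
   pairing m u (\<lambda>x\<in>G. f x + g x) = pairing m u f + pairing m u g"
proof -
  assume u: "u \<in> carrier (tens A (Q m))" and f: "f \<in> W m" "g \<in> W m"
  obtain l c where l: "l \<in> Lam" "c \<in> K" "u = ptens A (Q m) (cl m l) c" using QK_rep[OF u] by metis
  show ?thesis unfolding l(3) pairing_pt[OF l(1,2) f(1)] pairing_pt[OF l(1,2) f(2)] pairing_pt[OF l(1,2) fmodD(3)[OF fmod_W f]]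
    using Fn_add[OF l(1) W_cts[OF f(1)] W_cts[OF f(2)]] by (simp add: distrib_left)
qed

lemma pairing_fun_cmult: "u \<in> carrier (tens A (Q m)) \<Longrightarrow> f \<in> W m \<Longrightarrow> a \<in> OK \<Longrightarrow>
   pairing m u (\<lambda>x\<in>G. a * f x) = a * pairing m u f"
proof -
  assume u: "u \<in> carrier (tens A (Q m))" and f: "f \<in> W m" and a: "a \<in> OK"
  obtain l c where l: "l \<in> Lam" "c \<in> K" "u = ptens A (Q m) (cl m l) c" using QK_rep[OF u] by metis
  show ?thesis unfolding l(3) pairing_pt[OF l(1,2) f] pairing_pt[OF l(1,2) fmodD(4)[OF fmod_W a f]]
    using Fn_cmult[OF l(1) a W_cts[OF f]] by simp
qed

lemma QK_common:
  assumes l: "l \<in> Lam" and c: "c \<in> K" and N: "c * of_nat (prm A) ^ N \<in> OK"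
  shows "\<exists>l'\<in>Lam. ptens A (Q m) (cl m l) c = ptens A (Q m) (cl m l') (1 / of_nat (prm A) ^ N)"
proof -
  have iK: "1 / of_nat (prm A) ^ N \<in> K" by (intro K_divide K_power) auto
  have "ptens A (Q m) (cl m l) c = ptens A (Q m) ((c * of_nat (prm A) ^ N) \<odot>\<^bsub>Q m\<^esub> cl m l) (1 / of_nat (prm A) ^ N)"
    using pt_bal[OF Q_omod cl_in[OF l] N iK] by simp
  also have "(c * of_nat (prm A) ^ N) \<odot>\<^bsub>Q m\<^esub> cl m l = cl m ((c * of_nat (prm A) ^ N) \<odot>\<^bsub>Iwasawa A\<^esub> l)"
    by (rule cl_smult[OF N l])
  finally show ?thesis using Iw_smult_in[OF N l] by auto
qed

text \<open>After clearing denominators both elements come from classes, and classes are separated by \<open>W m\<close>.\<close>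

lemma pairing_inj:
  assumes u: "u \<in> carrier (tens A (Q m))" "v \<in> carrier (tens A (Q m))" and eq: "\<And>f. f \<in> W m \<Longrightarrow> pairing m u f = pairing m v f"
  shows "u = v"
proof -
  obtain l c where l: "l \<in> Lam" "c \<in> K" "u = ptens A (Q m) (cl m l) c" using QK_rep[OF u(1)] by metis
  obtain k b where k: "k \<in> Lam" "b \<in> K" "v = ptens A (Q m) (cl m k) b" using QK_rep[OF u(2)] by metis
  obtain N1 N2 where "\<forall>N\<ge>N1. c * of_nat (prm A) ^ N \<in> OK" "\<forall>N\<ge>N2. b * of_nat (prm A) ^ N \<in> OK"
    using K_denominators l k by metis
  then obtain N where N: "c * of_nat (prm A) ^ N \<in> OK" "b * of_nat (prm A) ^ N \<in> OK"
    by (meson max.cobounded1 max.cobounded2)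
  let ?i = "1 / of_nat (prm A) ^ N"
  have iK: "?i \<in> K" by (intro K_divide K_power) auto
  obtain l' where l': "l' \<in> Lam" "u = ptens A (Q m) (cl m l') ?i" using QK_common[OF l(1,2) N(1)] l(3) by auto
  obtain k' where k': "k' \<in> Lam" "v = ptens A (Q m) (cl m k') ?i" using QK_common[OF k(1,2) N(2)] k(3) by auto
  have "l' f = k' f" if "f \<in> W m" for f
    using eq[OF that] unfolding l'(2) k'(2) pairing_pt[OF l'(1) iK that] pairing_pt[OF k'(1) iK that] by simp
  then have "cl m l' = cl m k'" using cl_eq_iff[OF l'(1) k'(1)] by simp
  then show ?thesis using l' k' by simp
qed

lemma pairing_tscale: "u \<in> carrier (tens A (Q m)) \<Longrightarrow> f \<in> W m \<Longrightarrow> a \<in> K \<Longrightarrow> pairing m (tscale A (Q m) a u) f = a * pairing m u f"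
proof -
  assume u: "u \<in> carrier (tens A (Q m))" and f: "f \<in> W m" and a: "a \<in> K"
  obtain l c where l: "l \<in> Lam" "c \<in> K" "u = ptens A (Q m) (cl m l) c" using QK_rep[OF u] by metis
  show ?thesis unfolding l(3) tscale_pt[OF Q_omod a cl_in[OF l(1)] l(2)] pairing_pt[OF l(1,2) f] pairing_pt[OF l(1) K_mult[OF a l(2)] f] by simp
qed

abbreviation "trm m X \<equiv> Omega A d e m <+>\<^bsub>Iwasawa A\<^esub> X"

lemma trans_cl:
  assumes le: "m \<le> m'" and l: "l \<in> Lam"
  shows "trm m (cl m' l) = cl m l"
proof -
  have sub: "Omega A d e m' \<subseteq> Omega A d e m"
    unfolding Omega_eq_Ann Ann_def using W_mono[OF le] by auto
  interpret J: ideal "Omega A d e m" "Iwasawa A" by (rule ideal_J)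
  interpret J': ideal "Omega A d e m'" "Iwasawa A" by (rule ideal_J)
  have lc: "l \<in> carrier (Iwasawa A)" using l by simp
  show ?thesis
  proof
    show "trm m (cl m' l) \<subseteq> cl m l"
    proof
      fix x assume "x \<in> trm m (cl m' l)"
      then obtain a b where ab: "a \<in> Omega A d e m" "b \<in> Omega A d e m'" "x = a \<oplus>\<^bsub>Iwasawa A\<^esub> (b \<oplus>\<^bsub>Iwasawa A\<^esub> l)"
        unfolding set_add_def' cl_def a_r_coset_def' by blast
      have "x = (a \<oplus>\<^bsub>Iwasawa A\<^esub> b) \<oplus>\<^bsub>Iwasawa A\<^esub> l"
        unfolding ab(3) by (rule Iw.a_assoc[symmetric]) (use ab lc J.a_Hcarr J'.a_Hcarr in blast)+
      moreover have "a \<oplus>\<^bsub>Iwasawa A\<^esub> b \<in> Omega A d e m" using ab sub by (intro J.a_closed) auto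
      ultimately show "x \<in> cl m l" unfolding cl_def a_r_coset_def' by blast
    qed
    show "cl m l \<subseteq> trm m (cl m' l)"
    proof
      fix x assume "x \<in> cl m l"
      then obtain a where a: "a \<in> Omega A d e m" "x = a \<oplus>\<^bsub>Iwasawa A\<^esub> l" unfolding cl_def a_r_coset_def' by blast
      have "l = \<zero>\<^bsub>Iwasawa A\<^esub> \<oplus>\<^bsub>Iwasawa A\<^esub> l" using lc by (rule Iw.l_zero[symmetric])
      moreover have "\<zero>\<^bsub>Iwasawa A\<^esub> \<in> Omega A d e m'" by (rule J'.zero_closed)
      ultimately have "l \<in> cl m' l" unfolding cl_def a_r_coset_def' by blast
      then show "x \<in> trm m (cl m' l)" using a unfolding set_add_def' by blast
    qed
  qed
qed

lemma tmap_trans_pt: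
  assumes le: "m \<le> m'" and l: "l \<in> Lam" and c: "c \<in> K"
  shows "tmap A (Q m') (Q m) (trm m) (ptens A (Q m') (cl m' l) c) = ptens A (Q m) (cl m l) c"
proof -
  have "tmap A (Q m') (Q m) (trm m) (ptens A (Q m') (cl m' l) c) = ptens A (Q m) (trm m (cl m' l)) c"
  proof (rule tmap_props(2)[OF Q_omod Q_omod])
    fix X assume "X \<in> carrier (Q m')"
    then obtain k where k: "k \<in> Lam" "X = cl m' k" using Q_rep by blast
    show "trm m X \<in> carrier (Q m)" using k by (simp add: trans_cl[OF le] cl_in)
    show "trm m (a \<odot>\<^bsub>Q m'\<^esub> X) = a \<odot>\<^bsub>Q m\<^esub> trm m X" if "a \<in> OK" for a
      using k Iw_smult_in[OF that k(1)] that trans_cl[OF le, of "a \<odot>\<^bsub>Iwasawa A\<^esub> k"] by (simp add: trans_cl[OF le] cl_smult)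
    fix Y assume "Y \<in> carrier (Q m')"
    then obtain k' where k': "k' \<in> Lam" "Y = cl m' k'" using Q_rep by blast
    show "trm m (X \<oplus>\<^bsub>Q m'\<^esub> Y) = trm m X \<oplus>\<^bsub>Q m\<^esub> trm m Y"
      using k k' Iw_add_in[OF k(1) k'(1)] trans_cl[OF le, of "k \<oplus>\<^bsub>Iwasawa A\<^esub> k'"] by (simp add: trans_cl[OF le] cl_add)
  qed (use l c in \<open>auto intro: cl_in\<close>)
  then show ?thesis using trans_cl[OF le l] by simp
qed

text \<open>Passing to a lower level restricts the pairing to the smaller space.\<close>

lemma pairing_tmap:
  assumes le: "m \<le> m'" and u: "u \<in> carrier (tens A (Q m'))" and f: "f \<in> W m"
  shows "pairing m (tmap A (Q m') (Q m) (trm m) u) f = pairing m' u f"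
proof -
  obtain l c where l: "l \<in> Lam" "c \<in> K" "u = ptens A (Q m') (cl m' l) c" using QK_rep[OF u] by metis
  have f': "f \<in> W m'" using f W_mono[OF le] by auto
  show ?thesis unfolding l(3) tmap_trans_pt[OF le l(1,2)] pairing_pt[OF l(1,2) f] pairing_pt[OF l(1,2) f'] ..
qed

lemma tmap_trans_in:
  assumes le: "m \<le> m'" and u: "u \<in> carrier (tens A (Q m'))"
  shows "tmap A (Q m') (Q m) (trm m) u \<in> carrier (tens A (Q m))"
proof -
  obtain l c where l: "l \<in> Lam" "c \<in> K" "u = ptens A (Q m') (cl m' l) c" using QK_rep[OF u] by metis
  show ?thesis unfolding l(3) tmap_trans_pt[OF le l(1,2)] by (rule QK_in[OF l(1,2)])
qed

text \<open>Some level at which the function can be evaluated.\<close>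

definition "lev g = (SOME N. g \<in> W (\<lambda>_. N))"

text \<open>The distribution attached to a compatible system. The level at which it is computed does not matter
  by \<open>mu_eq\<close>.\<close>

definition "mu s = (\<lambda>g\<in>C_fun A d e. pairing (\<lambda>_. lev g) (s (\<lambda>_. lev g)) g)"

lemma lev_W: "g \<in> C_fun A d e \<Longrightarrow> g \<in> W (\<lambda>_. lev g)"
  unfolding lev_def by (rule someI_ex[OF C_fun_W_level])

lemma proj_in: "s \<in> proj_limit A d e \<Longrightarrow> s m \<in> carrier (tens A (Q m))"
  by (simp add: proj_limit_def)

text \<open>This is the compatibility of the system, seen on functions.\<close>

lemma pairing_level:
  assumes s: "s \<in> proj_limit A d e" and le: "m \<le> m'" and f: "f \<in> W m"
  shows "pairing m' (s m') f = pairing m (s m) f"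
  using pairing_tmap[OF le proj_in[OF s] f] s le unfolding proj_limit_def by simp

lemma pairing_level2:
  assumes s: "s \<in> proj_limit A d e" and f: "f \<in> W m" "f \<in> W m'"
  shows "pairing m (s m) f = pairing m' (s m') f"
proof -
  let ?M = "\<lambda>i. max (m i) (m' i)"
  have "m \<le> ?M" "m' \<le> ?M" by (auto simp: le_fun_def)
  then show ?thesis using pairing_level[OF s _ f(1), of ?M] pairing_level[OF s _ f(2), of ?M] by simp
qed

lemma mu_eq:
  assumes s: "s \<in> proj_limit A d e" and g: "g \<in> C_fun A d e" "g \<in> W m"
  shows "mu s g = pairing m (s m) g"
  using pairing_level2[OF s lev_W[OF g(1)] g(2)] g(1) by (simp add: mu_def)

lemma mu_in:
  assumes s: "s \<in> proj_limit A d e"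
  shows "mu s \<in> Fn (C_fun A d e) K"
  unfolding Fn_iff
proof (intro conjI ballI)
  show "mu s \<in> extensional (C_fun A d e)" by (simp add: mu_def)
  fix f assume f: "f \<in> C_fun A d e"
  show "mu s f \<in> K" unfolding mu_eq[OF s f lev_W[OF f]] by (rule pairing_K[OF proj_in[OF s] lev_W[OF f]])
  fix g assume g: "g \<in> C_fun A d e"
  let ?m = "\<lambda>_::'k. max (lev f) (lev g)"
  have fm: "f \<in> W ?m" and gm: "g \<in> W ?m"
    using lev_W[OF f] lev_W[OF g] W_mono[of "\<lambda>_. lev f" ?m] W_mono[of "\<lambda>_. lev g" ?m] by (auto simp: le_fun_def)
  show "mu s (\<lambda>x\<in>G. f x + g x) = mu s f + mu s g"
    unfolding mu_eq[OF s f fm] mu_eq[OF s g gm] mu_eq[OF s fmodD(3)[OF fmod_C_fun f g] fmodD(3)[OF fmod_W fm gm]]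
    by (rule pairing_fun_add[OF proj_in[OF s] fm gm])
next
  fix c f assume c: "c \<in> OK" and f: "f \<in> C_fun A d e"
  show "mu s (\<lambda>x\<in>G. c * f x) = c * mu s f"
    unfolding mu_eq[OF s f lev_W[OF f]] mu_eq[OF s fmodD(4)[OF fmod_C_fun c f] fmodD(4)[OF fmod_W c lev_W[OF f]]]
    by (rule pairing_fun_cmult[OF proj_in[OF s] lev_W[OF f] c])
qed

end

section \<open>Denominators of the interpolation functions\<close>

context pdatum_de
begin

definition "cterm i = (if d i < e i
        then ordp A (fact (nat (e i - d i))) +
          ereal (2 * real_of_int (e i - d i)
            + real_of_int \<lfloor>real_of_int (e i - d i + 1) / (real (prm A) - 1)\<rfloor> + 1)
        else 0)"
definition "cc i = real_of_ereal (cterm i)"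

lemma c_const_sum: "c_const A d e = (\<Sum>i\<in>UNIV. cterm i)"
  by (simp add: c_const_def cterm_def)

lemma cterm_cc: "cterm i = ereal (cc i)"
proof -
  obtain r where "ordp A (fact (nat (e i - d i))) = ereal r" using ord_finite[of "fact (nat (e i - d i))"] by auto
  then show ?thesis by (simp add: cc_def cterm_def)
qed

lemma c_const_cc: "c_const A d e = ereal (\<Sum>i\<in>UNIV. cc i)"
  by (simp add: c_const_sum cterm_cc)

lemma cterm_ge: "ordp A (fact (nn i - 1)) + ereal (2 * real (nn i - 1)) \<le> cterm i"
proof (cases "d i < e i")
  case True
  have n: "nn i - 1 = nat (e i - d i)" by (simp add: nn_def)
  have "0 \<le> \<lfloor>real_of_int (e i - d i + 1) / (real (prm A) - 1)\<rfloor>"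
    using True p_gt_1 by simp
  then have fl: "0 \<le> real_of_int \<lfloor>real_of_int (e i - d i + 1) / (real (prm A) - 1)\<rfloor>" by (simp only: of_int_0_le_iff)
  have "real (nn i - 1) = real_of_int (e i - d i)" unfolding n using True by simp
  then have "2 * real (nn i - 1) \<le> 2 * real_of_int (e i - d i) + real_of_int \<lfloor>real_of_int (e i - d i + 1) / (real (prm A) - 1)\<rfloor> + 1"
  proof -
    have "2 * a \<le> 2 * a + b + 1" if "0 \<le> b" for a b :: real using that by linarith
    from this[OF fl] show ?thesis unfolding \<open>real (nn i - 1) = real_of_int (e i - d i)\<close> .
  qed
  then show ?thesis using True unfolding cterm_def n by (auto intro!: add_left_mono)
next
  case False
  then have "d i = e i" using de_i[of i] by simp
  then show ?thesis by (simp add: cterm_def nn_def)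
qed

text \<open>The product is \<open>\<plusminus> l0! (N - l0)!\<close>, and the quotient is a binomial coefficient.\<close>

lemma prod_int_diff_dvd_fact:
  assumes "l0 \<le> N"
  shows "(\<Prod>l\<in>{..N} - {l0}. int l0 - int l) dvd fact N"
proof -
  have split: "{..N} - {l0} = {..<l0} \<union> {l0<..N}" using assms by auto
  have 1: "(\<Prod>l<l0. int l0 - int l) = fact l0"
    by (simp add: fact_prod_rev atLeast0LessThan of_nat_diff)
  have 2: "(\<Prod>l\<in>{l0<..N}. int l0 - int l) = (\<Prod>i\<in>{1..N - l0}. - int i)"
    by (rule prod.reindex_bij_witness[of _ "\<lambda>i. l0 + i" "\<lambda>l. l - l0"]) (use assms in auto)
  have 3: "(\<Prod>i\<in>{1..N - l0}. - int i) = (-1) ^ (N - l0) * fact (N - l0)"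
    by (simp add: prod_uminus fact_prod)
  have "(\<Prod>l\<in>{..N} - {l0}. int l0 - int l) = fact l0 * ((-1) ^ (N - l0) * fact (N - l0))"
    unfolding split 1[symmetric] 3[symmetric] 2[symmetric] by (rule prod.union_disjoint) auto
  moreover have "fact N = fact l0 * ((-1) ^ (N - l0) * fact (N - l0)) * ((-1) ^ (N - l0) * int (N choose l0))"
  proof -
    have "int (fact l0 * fact (N - l0) * (N choose l0)) = int (fact N)" using binomial_fact_lemma[OF assms] by (simp only:)
    moreover have "((-1::int) ^ (N - l0)) * (-1) ^ (N - l0) = 1" by (simp flip: power_mult_distrib)
    ultimately show ?thesis by (simp add: mult_ac mult.left_commute)
  qed
  ultimately show ?thesis by simp
qed

lemma poly_prod_shift:
  assumes "finite I" "\<And>l. l \<in> I \<Longrightarrow> z l \<in> OK"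
  shows "\<exists>b. (\<forall>t. b t \<in> OK) \<and> (\<forall>Y. (\<Prod>l\<in>I. Y + z l) = (\<Sum>t<card I + 1. b t * Y ^ t))"
proof -
  let ?P = "\<lambda>I. \<Prod>l\<in>I. [: z l, 1 :]"
  have c: "\<forall>t. poly.coeff (?P I) t \<in> OK" using assms
  proof (induction I rule: finite_induct)
    case empty
    then show ?case by (simp add: coeff_1)
  next
    case (insert a F)
    have IH: "poly.coeff (?P F) t \<in> OK" for t using insert by auto
    have e: "?P (insert a F) = Polynomial.smult (z a) (?P F) + pCons 0 (?P F)" using insert by simp
    show ?case
    proof
      fix t show "poly.coeff (?P (insert a F)) t \<in> OK"
        unfolding e using IH insert.prems by (cases t) (auto intro!: OK_add OK_mult)
    qed
  qed
  have deg: "degree (?P I) \<le> card I"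
  proof -
    have "degree (?P I) \<le> sum (degree \<circ> (\<lambda>l. [: z l, 1 :])) I" by (rule degree_prod_sum_le[OF assms(1)])
    also have "\<dots> \<le> (\<Sum>l\<in>I. 1)" by (rule sum_mono) (simp add: degree_pCons_eq_if)
    finally show ?thesis by simp
  qed
  have "(\<Prod>l\<in>I. Y + z l) = (\<Sum>t<card I + 1. poly.coeff (?P I) t * Y ^ t)" for Y
  proof -
    have "(\<Prod>l\<in>I. Y + z l) = poly (?P I) Y" by (simp add: poly_prod add.commute)
    also have "\<dots> = (\<Sum>t\<le>degree (?P I). poly.coeff (?P I) t * Y ^ t)" by (rule poly_altdef)
    also have "\<dots> = (\<Sum>t<card I + 1. poly.coeff (?P I) t * Y ^ t)"
      by (rule sum.mono_neutral_left) (use deg in \<open>auto simp: coeff_eq_0\<close>)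
    finally show ?thesis .
  qed
  then show ?thesis using c by (intro exI[of _ "poly.coeff (?P I)"]) auto
qed

text \<open>The Lagrange polynomial is expanded in powers of \<open>Y = (\<chi> - u\<^sup>r)/p\<^sup>m\<close>. The numerators
  become \<open>Y\<close> plus integral elements, and the denominators are the products of \<open>2 p\<close> and of
  elements with the valuation of \<open>l0 - l\<close>, where \<open>l0\<close> and \<open>l\<close> are indices of nodes. The latter
  multiply to a divisor of a factorial, so the loss of integrality is bounded by the constant, apart
  from the powers of \<open>p\<^sup>m\<close> that come with \<open>Y\<close>.\<close>

lemma lagrange_test:
  assumes r: "r < prm A ^ m * nn i"
  shows "\<exists>\<beta>. (\<forall>t<nn i. \<beta> t \<in> K \<and> ereal (- cc i - real m * real t) \<le> ordp A (\<beta> t)) \<and>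
    (\<forall>y\<in>cG i. lagrange i m r y = (if res i m y = r mod prm A ^ m then chi A i y powi d i * (\<Sum>t<nn i. \<beta> t * (chi A i y - uu i ^ r) ^ t) else 0))"
proof -
  let ?q = "prm A ^ m"
  let ?l0 = "r div ?q"
  let ?I = "{..<nn i} - {?l0}"
  let ?pm = "of_nat (prm A) ^ m :: 'c"
  have l0: "?l0 < nn i" using r by (simp add: less_mult_imp_div_less mult.commute)
  have cI: "card ?I + 1 = nn i" using l0 by simp
  have I2: "?I = {..nn i - 1} - {?l0}" by (simp add: lessThan_Suc_atMost[symmetric])
  \<comment> \<open>the differences of nodes, divided by \<open>2 p\<close> and \<open>p\<^sup>m\<close>, have the
    valuation of the differences of their indices\<close>
  define w where "w l = (uu i ^ r - node i ?q r l) / tp / ?pm" for l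
  have pm: "?pm \<noteq> 0" by simp
  have uK: "uu i ^ r \<in> K" for r by (simp add: uu_def chi_K K_power)
  have tpK: "tp \<in> K" unfolding tp_def by (rule K_nat)
  have wK: "w l \<in> K" for l unfolding w_def node_def by (intro K_divide K_diff uK K_power tpK) auto
  have wo: "ordp A (w l) = ordp A (of_int (int ?l0 - int l))" for l
  proof -
    have "ordp A ((uu i ^ r - node i ?q r l) / tp) = ordp A (of_int (int r - int (r mod ?q + ?q * l)))"
      unfolding node_def by (rule ord_uu_diff_tp)
    also have "int r - int (r mod ?q + ?q * l) = int ?q * (int ?l0 - int l)"
    proof -
      have "int r = int (r mod ?q) + int ?q * int ?l0"
        by (metis mod_mult_div_eq of_nat_add of_nat_mult)
      then show ?thesis by (simp add: algebra_simps)
    qed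
    also have "ordp A (of_int (int ?q * (int ?l0 - int l))) = ereal (real m) + ordp A (of_int (int ?l0 - int l))"
      by (simp add: ord_mult ord_p_pow del: of_int_diff)
    finally have "ordp A ((uu i ^ r - node i ?q r l) / tp) = ereal (real m) + ordp A (of_int (int ?l0 - int l))" .
    then show ?thesis unfolding w_def ord_divide[OF pm] ord_p_pow
      by (cases "ordp A (of_int (int ?l0 - int l))") (auto simp del: of_int_diff)
  qed
  have tpO: "tp \<in> OK" unfolding tp_def by (rule OK_nat)
  have wOK: "w l \<in> OK" for l
    using wK[of l] wo[of l] sm0_int[of "int ?l0 - int l"] by (simp add: OK_iff sm_def)
  have z: "tp * w l \<in> OK" for l by (intro OK_mult tpO wOK)
  have wnz: "w l \<noteq> 0" if "l \<noteq> ?l0" for l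
  proof
    assume "w l = 0"
    then have "ordp A (of_int (int ?l0 - int l)) = \<infinity>" using wo[of l] by simp
    then show False using that ord_infty[of "of_int (int ?l0 - int l)"] by simp
  qed
  obtain b where b: "\<And>t. b t \<in> OK" "\<And>Y. (\<Prod>l\<in>?I. Y + tp * w l) = (\<Sum>t<nn i. b t * Y ^ t)"
    using poly_prod_shift[of ?I "\<lambda>l. tp * w l"] z unfolding cI by auto
  define Z where "Z = (\<Prod>l\<in>?I. tp * w l)"
  have Znz: "Z \<noteq> 0" unfolding Z_def using wnz by auto
  have ZK: "Z \<in> K" unfolding Z_def by (intro K_prod K_mult tpK wK)
  have Zo: "ordp A Z \<le> cterm i"
  proof -
    have "Z = tp ^ (nn i - 1) * (\<Prod>l\<in>?I. w l)"
      unfolding Z_def using l0 by (simp add: prod.distrib)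
    moreover have "ordp A (\<Prod>l\<in>?I. w l) = ordp A (of_int (\<Prod>l\<in>?I. int ?l0 - int l))"
      unfolding of_int_prod ord_prod by (rule sum.cong) (auto simp: wo simp del: of_int_diff)
    moreover have "ordp A (of_int (\<Prod>l\<in>?I. int ?l0 - int l)) \<le> ordp A (fact (nn i - 1))"
    proof -
      have "?l0 \<le> nn i - 1" using l0 by simp
      then obtain k where k: "fact (nn i - 1) = (\<Prod>l\<in>?I. int ?l0 - int l) * k"
        using prod_int_diff_dvd_fact[of ?l0 "nn i - 1"] unfolding I2 by (auto elim: dvdE)
      have "(fact (nn i - 1) :: 'c) = of_int (fact (nn i - 1))" by simp
      also have "\<dots> = of_int (\<Prod>l\<in>?I. int ?l0 - int l) * of_int k" by (simp only: k of_int_mult)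
      finally have "ordp A (fact (nn i - 1)) = ordp A (of_int (\<Prod>l\<in>?I. int ?l0 - int l)) + ordp A (of_int k)"
        by (simp only: ord_mult)
      moreover have "0 \<le> ordp A (of_int k)" using sm0_int[of k] by (simp add: sm_def zero_ereal_def)
      ultimately show ?thesis using add_left_mono[of 0 "ordp A (of_int k)" "ordp A (of_int (\<Prod>l\<in>?I. int ?l0 - int l))"] by simp
    qed
    moreover have "ordp A (tp ^ (nn i - 1)) \<le> ereal (2 * real (nn i - 1))"
    proof -
      obtain r0 where r0: "ordp A tp = ereal r0" "r0 \<le> 2" using ord_tp by auto
      show ?thesis unfolding ord_power[OF r0(1)] using mult_right_mono[OF r0(2), of "real (nn i - 1)"] by (simp add: mult.commute)
    qed
    ultimately have "ordp A Z \<le> ereal (2 * real (nn i - 1)) + ordp A (fact (nn i - 1))"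
      by (simp add: ord_mult add_mono)
    then show ?thesis using cterm_ge[of i] by (simp add: add.commute)
  qed
  define \<beta> where "\<beta> t = b t / (Z * (uu i ^ r) powi d i * ?pm ^ t)" for t
  have ou: "ordp A ((uu i ^ r) powi d i) = 0"
    using ord_chi_powi[OF pow_in[OF gam_in], of i r "d i"] by (simp add: chi_pow uu_def)
  have unz: "(uu i ^ r) powi d i \<noteq> 0" by simp
  have \<beta>K: "\<beta> t \<in> K" for t unfolding \<beta>_def
    by (intro K_divide K_mult OK_K[OF b(1)] ZK K_powi uK K_power) auto
  have \<beta>o: "ereal (- cc i - real m * real t) \<le> ordp A (\<beta> t)" for t
  proof -
    obtain z where z: "ordp A Z = ereal z" "z \<le> cc i" using Zo ord_finite[OF Znz] unfolding cterm_cc by auto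
    have "ordp A (?pm ^ t) = ereal (real t * real m)" using ord_power[OF ord_p_pow, of m t] by simp
    then have "ordp A (Z * (uu i ^ r) powi d i * ?pm ^ t) = ereal (z + real t * real m)"
      by (simp add: ord_mult ou z(1))
    moreover have "0 \<le> ordp A (b t)" using OK_sm[OF b(1)] by (simp add: sm_def zero_ereal_def)
    moreover have "Z * (uu i ^ r) powi d i * ?pm ^ t \<noteq> 0" using Znz by simp
    ultimately show ?thesis unfolding \<beta>_def using z(2)
      by (cases "ordp A (b t)") (auto simp: ord_divide algebra_simps)
  qed
  have "lagrange i m r y = (if res i m y = r mod prm A ^ m then chi A i y powi d i * (\<Sum>t<nn i. \<beta> t * (chi A i y - uu i ^ r) ^ t) else 0)"
    if y: "y \<in> cG i" for y
  proof (cases "res i m y = r mod ?q")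
    case True
    let ?Y = "(chi A i y - uu i ^ r) / ?pm"
    have f: "(chi A i y - node i ?q r l) / (uu i ^ r - node i ?q r l) = (?Y + tp * w l) / (tp * w l)" if "l \<in> ?I" for l
    proof -
      have n: "uu i ^ r - node i ?q r l = ?pm * (tp * w l)" by (simp add: w_def)
      have "chi A i y - node i ?q r l = ?pm * (?Y + tp * w l)"
        unfolding distrib_left n[symmetric] by simp
      then show ?thesis unfolding n using pm by simp
    qed
    have "(\<Prod>l\<in>?I. (chi A i y - node i ?q r l) / (uu i ^ r - node i ?q r l)) = (\<Prod>l\<in>?I. (?Y + tp * w l) / (tp * w l))"
      by (rule prod.cong) (simp_all only: f)
    also have "\<dots> = (\<Sum>t<nn i. b t * ?Y ^ t) / Z" unfolding prod_dividef b(2) Z_def ..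
    finally have "lagrange i m r y = (chi A i y / uu i ^ r) powi d i * ((\<Sum>t<nn i. b t * ?Y ^ t) / Z)"
      using True by (simp only: lagrange_def if_True simp_thms)
    also have "\<dots> = chi A i y powi d i * (\<Sum>t<nn i. \<beta> t * (chi A i y - uu i ^ r) ^ t)"
    proof -
      have "b t * ?Y ^ t / (Z * (uu i ^ r) powi d i) = \<beta> t * (chi A i y - uu i ^ r) ^ t" for t
        unfolding \<beta>_def power_divide by simp
      then have "(\<Sum>t<nn i. b t * ?Y ^ t) / (Z * (uu i ^ r) powi d i) = (\<Sum>t<nn i. \<beta> t * (chi A i y - uu i ^ r) ^ t)"
        by (simp only: sum_divide_distrib)
      moreover have "(x / v) powi k * (S / Z') = x powi k * (S / (Z' * v powi k))" for x v S Z' :: 'c and k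
        by (simp add: power_int_divide_distrib)
      ultimately show ?thesis by (simp only:)
    qed
    finally show ?thesis using True by simp
  qed (simp add: lagrange_def)
  then show ?thesis using \<beta>K \<beta>o by (intro exI[of _ \<beta>]) auto
qed

lemma dbox_PiE: "dbox = (\<Pi>\<^sub>E i\<in>UNIV. {..<nn i})"
proof -
  have "int (n i) \<le> e i - d i \<longleftrightarrow> n i < nn i" for n :: "'k \<Rightarrow> nat" and i
    using de_i[of i] unfolding nn_def by linarith
  then show ?thesis by (auto simp: dbox_def PiE_UNIV_domain Pi_iff)
qed

abbreviation "tst a m n \<equiv> test_fun A d a m (wt n)"

lemma tst_eq: "a \<in> G \<Longrightarrow> x \<in> G \<Longrightarrow> tst a m n x =
  (if rs m x = rs m a then (\<Prod>j\<in>UNIV. (chi A j (x j) - chi A j (a j)) ^ n j * chi A j (x j) powi d j) else 0)"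
  by (simp add: test_fun_def p_coset_iff gnear_iff wt_def)

lemma tst_ext: "tst a m n \<in> extensional G" by (simp add: test_fun_def)

text \<open>Binomial expansion of the powers of \<open>\<chi> - \<chi>(a)\<close> in each coordinate.\<close>

lemma tst_normal:
  assumes a: "a \<in> G" and n: "n \<in> dbox"
  shows "\<exists>c. (\<forall>k. c k \<in> OK) \<and> (\<forall>x\<in>G. (\<Prod>j\<in>UNIV. (chi A j (x j) - chi A j (a j)) ^ n j * chi A j (x j) powi d j) = (\<Sum>k\<in>dbox. c k * wmon (wt k) x))"
proof -
  let ?c = "\<lambda>j t. of_nat (n j choose t) * (- chi A j (a j)) ^ (n j - t)"
  have nn: "n j < nn j" for j using n by (auto simp: dbox_PiE PiE_UNIV_domain Pi_iff)
  have one: "(chi A j y - chi A j (a j)) ^ n j * chi A j y powi d j = (\<Sum>t<nn j. ?c j t * chi A j y powi (d j + int t))"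
    if y: "y \<in> cG j" for j y
  proof -
    have "(chi A j y - chi A j (a j)) ^ n j = (chi A j y + (- chi A j (a j))) ^ n j" by simp
    also have "\<dots> = (\<Sum>t\<le>n j. of_nat (n j choose t) * chi A j y ^ t * (- chi A j (a j)) ^ (n j - t))" by (rule binomial_ring)
    also have "\<dots> = (\<Sum>t<nn j. of_nat (n j choose t) * chi A j y ^ t * (- chi A j (a j)) ^ (n j - t))"
      by (rule sum.mono_neutral_left) (use nn[of j] in \<open>auto simp: binomial_eq_0\<close>)
    finally show ?thesis using y by (simp add: sum_distrib_left sum_distrib_right power_int_add mult_ac)
  qed
  have "(\<Prod>j\<in>UNIV. (chi A j (x j) - chi A j (a j)) ^ n j * chi A j (x j) powi d j) = (\<Sum>k\<in>dbox. (\<Prod>j\<in>UNIV. ?c j (k j)) * wmon (wt k) x)"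
    if x: "x \<in> G" for x
  proof -
    have "(\<Prod>j\<in>UNIV. (chi A j (x j) - chi A j (a j)) ^ n j * chi A j (x j) powi d j)
      = (\<Prod>j\<in>UNIV. \<Sum>t<nn j. ?c j t * chi A j (x j) powi (d j + int t))"
      by (rule prod.cong) (simp_all add: one G_in[OF x])
    also have "\<dots> = (\<Sum>k\<in>dbox. \<Prod>j\<in>UNIV. ?c j (k j) * chi A j (x j) powi (d j + int (k j)))"
      unfolding dbox_PiE by (rule prod_sum_PiE) auto
    also have "\<dots> = (\<Sum>k\<in>dbox. (\<Prod>j\<in>UNIV. ?c j (k j)) * wmon (wt k) x)"
      by (simp add: prod.distrib wmon_def wt_def)
    finally show ?thesis .
  qed
  moreover have "(\<Prod>j\<in>UNIV. ?c j (k j)) \<in> OK" for k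
    by (intro OK_prod OK_mult OK_power OK_minus chi_OK G_in[OF a]) simp
  ultimately show ?thesis by (intro exI[of _ "\<lambda>k. \<Prod>j\<in>UNIV. ?c j (k j)"]) auto
qed

lemma tst_expand:
  assumes a: "a \<in> G" and n: "n \<in> dbox"
  shows "\<exists>c. (\<forall>k. c k \<in> OK) \<and> (\<forall>x\<in>G. tst a m n x = (\<Sum>k\<in>dbox. c k * bas m (rs m a) (wt k) x))"
proof -
  obtain c where c: "\<forall>k. c k \<in> OK" "\<forall>x\<in>G. (\<Prod>j\<in>UNIV. (chi A j (x j) - chi A j (a j)) ^ n j * chi A j (x j) powi d j) = (\<Sum>k\<in>dbox. c k * wmon (wt k) x)"
    using tst_normal[OF a n] by auto
  have "tst a m n x = (\<Sum>k\<in>dbox. c k * bas m (rs m a) (wt k) x)" if x: "x \<in> G" for x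
    using c(2) x a by (simp add: tst_eq bas_def)
  then show ?thesis using c(1) by auto
qed

lemma tst_fmod:
  assumes a: "a \<in> G" and n: "n \<in> dbox" and C: "fmod C" "\<And>k. k \<in> dbox \<Longrightarrow> bas m (rs m a) (wt k) \<in> C"
  shows "tst a m n \<in> C"
proof -
  obtain c where c: "\<And>k. c k \<in> OK" "\<forall>x\<in>G. tst a m n x = (\<Sum>k\<in>dbox. c k * bas m (rs m a) (wt k) x)"
    using tst_expand[OF a n, of m] by auto
  have "(\<lambda>x\<in>G. \<Sum>k\<in>dbox. c k * bas m (rs m a) (wt k) x) \<in> C"
    by (rule fmod_sum[OF C(1)]) (auto simp: c(1) C(2))
  moreover have "tst a m n = (\<lambda>x\<in>G. \<Sum>k\<in>dbox. c k * bas m (rs m a) (wt k) x)"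
    by (rule extensionalityI[OF tst_ext]) (use c(2) in auto)
  ultimately show ?thesis by simp
qed

lemma tst_C_fun: "a \<in> G \<Longrightarrow> n \<in> dbox \<Longrightarrow> tst a m n \<in> C_fun A d e"
  by (rule tst_fmod[OF _ _ fmod_C_fun]) (auto intro: bas_C_fun)
lemma tst_W: "a \<in> G \<Longrightarrow> n \<in> dbox \<Longrightarrow> tst a m n \<in> W m"
  by (rule tst_fmod[OF _ _ fmod_W]) (auto intro: bas_W)

lemma sm_power_mult: "sm k X \<Longrightarrow> sm (k * n) (X ^ n)"
  by (induction n) (auto dest: sm_mult)

definition "pair n m = (\<Sum>j\<in>UNIV. n j * m j :: nat)"

text \<open>On the coset of level \<open>m\<close> the factor \<open>\<chi> - \<chi>(a)\<close> is divisible by \<open>p\<^sup>m\<close>; this gain balances the correction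
  term in the definition of \<open>v_adm\<close>.\<close>

lemma tst_sm:
  assumes a: "a \<in> G" and x: "x \<in> G"
  shows "sm (pair n m) (tst a m n x)"
proof (cases "rs m x = rs m a")
  case True
  have "sm (m j * n j) ((chi A j (x j) - chi A j (a j)) ^ n j)" for j
  proof -
    have "near j (m j) (x j) (a j)" using True x a by (simp add: gnear_iff[symmetric] gnear_def)
    then have "sm (m j) (chi A j (x j) - chi A j (a j))" unfolding near_def by (meson sm_mono sm_of_div_tp le_SucI order_refl)
    then show ?thesis by (rule sm_power_mult)
  qed
  note s1 = this
  have s2: "sm (m j * n j) ((chi A j (x j) - chi A j (a j)) ^ n j * chi A j (x j) powi d j)" for j
    by (rule sm_mult1[OF s1]) (rule OK_sm[OF chi_powi_OK[OF G_in[OF x]]])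
  have "sm (\<Sum>j\<in>I. m j * n j) (\<Prod>j\<in>I. (chi A j (x j) - chi A j (a j)) ^ n j * chi A j (x j) powi d j)" for I
    by (induction I rule: infinite_finite_induct) (auto intro: sm_mult s2)
  from this[of UNIV] show ?thesis using True a x by (simp add: tst_eq pair_def mult.commute)
qed (use a x in \<open>simp add: tst_eq\<close>)

text \<open>The product over the coordinates of \<open>lagrange_test\<close>.\<close>

lemma E_test:
  assumes r: "r \<in> Ebox m"
  shows "\<exists>B. (\<forall>n\<in>dbox. B n \<in> K \<and> ereal (- (\<Sum>i\<in>UNIV. cc i) - real (pair n m)) \<le> ordp A (B n)) \<and>
     (\<forall>x\<in>G. E m r x = (\<Sum>n\<in>dbox. B n * tst (gpow r) m n x))"
proof -
  have rr: "r i < prm A ^ m i * nn i" for i using r by (simp add: Ebox_def qq_def)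
  have "\<forall>i. \<exists>\<beta>. (\<forall>t<nn i. \<beta> t \<in> K \<and> ereal (- cc i - real (m i) * real t) \<le> ordp A (\<beta> t)) \<and>
    (\<forall>y\<in>cG i. lagrange i (m i) (r i) y = (if res i (m i) y = r i mod prm A ^ m i then chi A i y powi d i * (\<Sum>t<nn i. \<beta> t * (chi A i y - uu i ^ r i) ^ t) else 0))"
    using lagrange_test[OF rr] by blast
  from choice[OF this] obtain \<beta> where
    \<beta>0: "\<forall>i. (\<forall>t<nn i. \<beta> i t \<in> K \<and> ereal (- cc i - real (m i) * real t) \<le> ordp A (\<beta> i t)) \<and>
    (\<forall>y\<in>cG i. lagrange i (m i) (r i) y = (if res i (m i) y = r i mod prm A ^ m i then chi A i y powi d i * (\<Sum>t<nn i. \<beta> i t * (chi A i y - uu i ^ r i) ^ t) else 0))" ..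
  then have \<beta>: "\<And>i t. t < nn i \<Longrightarrow> \<beta> i t \<in> K" "\<And>i t. t < nn i \<Longrightarrow> ereal (- cc i - real (m i) * real t) \<le> ordp A (\<beta> i t)"
    "\<And>i y. y \<in> cG i \<Longrightarrow> lagrange i (m i) (r i) y = (if res i (m i) y = r i mod prm A ^ m i then chi A i y powi d i * (\<Sum>t<nn i. \<beta> i t * (chi A i y - uu i ^ r i) ^ t) else 0)"
    by auto
  define B where "B n = (\<Prod>i\<in>UNIV. \<beta> i (n i))" for n
  have nlt: "n i < nn i" if "n \<in> dbox" for n i using that by (auto simp: dbox_PiE PiE_UNIV_domain Pi_iff)
  have "B n \<in> K \<and> ereal (- (\<Sum>i\<in>UNIV. cc i) - real (pair n m)) \<le> ordp A (B n)" if n: "n \<in> dbox" for n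
  proof
    show "B n \<in> K" unfolding B_def by (intro K_prod \<beta> nlt n)
    have "(\<Sum>i\<in>UNIV. ereal (- cc i - real (m i) * real (n i))) \<le> ordp A (B n)"
      unfolding B_def ord_prod by (rule sum_mono) (rule \<beta>(2)[OF nlt[OF n]])
    moreover have "(\<Sum>i\<in>UNIV. ereal (- cc i - real (m i) * real (n i))) = ereal (- (\<Sum>i\<in>UNIV. cc i) - real (pair n m))"
      by (simp add: pair_def sum_subtractf sum_negf mult.commute)
    ultimately show "ereal (- (\<Sum>i\<in>UNIV. cc i) - real (pair n m)) \<le> ordp A (B n)" by simp
  qed
  moreover have "E m r x = (\<Sum>n\<in>dbox. B n * tst (gpow r) m n x)" if x: "x \<in> G" for x
  proof (cases "rs m x = rs m (gpow r)")
    case True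
    then have rx: "res i (m i) (x i) = r i mod prm A ^ m i" for i by (auto simp: rs_def rs_gpow gpow_def fun_eq_iff)
    have "E m r x = (\<Prod>i\<in>UNIV. \<Sum>t<nn i. \<beta> i t * ((chi A i (x i) - uu i ^ r i) ^ t * chi A i (x i) powi d i))"
      unfolding E_def using x by (simp add: \<beta>(3) G_in rx sum_distrib_left mult_ac)
    also have "\<dots> = (\<Sum>n\<in>dbox. \<Prod>i\<in>UNIV. \<beta> i (n i) * ((chi A i (x i) - uu i ^ r i) ^ n i * chi A i (x i) powi d i))"
      unfolding dbox_PiE by (rule prod_sum_PiE) auto
    also have "\<dots> = (\<Sum>n\<in>dbox. B n * tst (gpow r) m n x)"
    proof -
      have cg: "chi A i (gpow r i) = uu i ^ r i" for i by (simp add: gpow_def chi_pow uu_def)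
      show ?thesis using True x by (simp add: B_def prod.distrib tst_eq cg)
    qed
    finally show ?thesis .
  next
    case False
    then obtain i where "res i (m i) (x i) \<noteq> r i mod prm A ^ m i" by (auto simp: rs_def rs_gpow gpow_def fun_eq_iff)
    then have "E m r x = 0" unfolding E_def using x by (auto simp: \<beta>(3) G_in intro!: prod_zero bexI[of _ i])
    then show ?thesis using False x by (simp add: tst_eq)
  qed
  ultimately show ?thesis by (intro exI[of _ B]) auto
qed

end

section \<open>The bijection between systems and distributions\<close>

context pdatum_de
begin

abbreviation "pw N \<equiv> of_nat (prm A) ^ (N::nat) :: 'c"

lemma pw_OK [simp]: "pw N \<in> OK" by (rule OK_power) simp
lemma pw_K [simp]: "pw N \<in> K" by (rule OK_K) simp

lemma K_denominators_finite:
  assumes "finite I" "\<And>i. i \<in> I \<Longrightarrow> c i \<in> K"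
  shows "\<exists>N0. \<forall>N\<ge>N0. \<forall>i\<in>I. c i * pw N \<in> OK"
  using assms
proof (induction I rule: finite_induct)
  case (insert a F)
  have "\<exists>N0. \<forall>N\<ge>N0. \<forall>i\<in>F. c i * pw N \<in> OK" by (rule insert.IH) (use insert.prems in auto)
  then obtain N0 where N0: "\<forall>N\<ge>N0. \<forall>i\<in>F. c i * pw N \<in> OK" by auto
  have "c a \<in> K" using insert.prems by simp
  then obtain N1 where N1: "\<forall>N\<ge>N1. c a * pw N \<in> OK" using K_denominators by blast
  show ?case by (rule exI[of _ "max N0 N1"]) (use N0 N1 in auto)
qed auto

text \<open>The expansion in test functions has coefficients in the field, so a power of \<open>p\<close> is needed to remain
  inside the locally polynomial functions; a linear functional does not notice it.\<close>

lemma E_expansion_K: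
  assumes r: "r \<in> Ebox m" and B: "\<And>n. n \<in> dbox \<Longrightarrow> B n \<in> K" "\<forall>x\<in>G. E m r x = (\<Sum>n\<in>dbox. B n * tst (gpow r) m n x)"
  shows "\<exists>N0. \<forall>N\<ge>N0. (\<lambda>x\<in>G. pw N * E m r x) \<in> C_fun A d e \<and>
    (\<forall>\<mu>\<in>Fn (C_fun A d e) K. \<mu> (\<lambda>x\<in>G. pw N * E m r x) = pw N * (\<Sum>n\<in>dbox. B n * \<mu> (tst (gpow r) m n)))"
proof -
  obtain N0 where N0: "\<And>N n. N0 \<le> N \<Longrightarrow> n \<in> dbox \<Longrightarrow> B n * pw N \<in> OK" using K_denominators_finite[OF finite_dbox, of B] B(1) by auto
  have "(\<lambda>x\<in>G. pw N * E m r x) \<in> C_fun A d e \<and>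
    (\<forall>\<mu>\<in>Fn (C_fun A d e) K. \<mu> (\<lambda>x\<in>G. pw N * E m r x) = pw N * (\<Sum>n\<in>dbox. B n * \<mu> (tst (gpow r) m n)))" if N: "N0 \<le> N" for N
  proof -
    have e: "(\<lambda>x\<in>G. pw N * E m r x) = (\<lambda>x\<in>G. \<Sum>n\<in>dbox. (B n * pw N) * tst (gpow r) m n x)"
      by (rule restrict_ext) (simp add: B(2) sum_distrib_left mult_ac)
    have t: "tst (gpow r) m n \<in> C_fun A d e" if "n \<in> dbox" for n by (rule tst_C_fun[OF gpow_in that])
    have 1: "(\<lambda>x\<in>G. \<Sum>n\<in>dbox. (B n * pw N) * tst (gpow r) m n x) \<in> C_fun A d e"
      by (rule fmod_sum[OF fmod_C_fun finite_dbox N0[OF N] t])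
    have 2: "\<mu> (\<lambda>x\<in>G. \<Sum>n\<in>dbox. (B n * pw N) * tst (gpow r) m n x) = pw N * (\<Sum>n\<in>dbox. B n * \<mu> (tst (gpow r) m n))"
      if "\<mu> \<in> Fn (C_fun A d e) K" for \<mu>
      using Fn_sum[OF fmod_C_fun that finite_dbox N0[OF N] t] by (simp add: sum_distrib_left mult_ac)
    show ?thesis unfolding e using 1 2 by simp
  qed
  then show ?thesis by (intro exI[of _ N0]) auto
qed

text \<open>A distribution extends to \<open>W m\<close> after clearing denominators. The numbers \<open>mE r\<close> are its values on the
  basis, obtained through the expansion in test functions, so that a bound for the distribution on test
  functions bounds them with a loss of at most the constant.\<close>

lemma mu_W_values:
  assumes mu: "\<mu> \<in> Fn (C_fun A d e) K"
  shows "\<exists>mE. (\<forall>r\<in>Ebox m. mE r \<in> K \<and>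
      (\<forall>C0. (\<forall>a\<in>G. \<forall>n\<in>dbox. ereal (C0 + real (pair n m)) \<le> ordp A (\<mu> (tst a m n))) \<longrightarrow> ereal (C0 - (\<Sum>i\<in>UNIV. cc i)) \<le> ordp A (mE r))) \<and>
    (\<forall>f\<in>C_fun A d e. f \<in> W m \<longrightarrow> \<mu> f = (\<Sum>r\<in>Ebox m. f (gpow r) * mE r)) \<and>
    (\<exists>N. \<forall>f\<in>W m. (\<lambda>x\<in>G. pw N * f x) \<in> C_fun A d e)"
proof -
  have "\<forall>r\<in>Ebox m. \<exists>B. (\<forall>n\<in>dbox. B n \<in> K \<and> ereal (- (\<Sum>i\<in>UNIV. cc i) - real (pair n m)) \<le> ordp A (B n)) \<and>
     (\<forall>x\<in>G. E m r x = (\<Sum>n\<in>dbox. B n * tst (gpow r) m n x))" using E_test by blast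
  from bchoice[OF this] obtain B where B0: "\<forall>r\<in>Ebox m. (\<forall>n\<in>dbox. B r n \<in> K \<and> ereal (- (\<Sum>i\<in>UNIV. cc i) - real (pair n m)) \<le> ordp A (B r n)) \<and>
     (\<forall>x\<in>G. E m r x = (\<Sum>n\<in>dbox. B r n * tst (gpow r) m n x))" ..
  then have B: "\<And>r n. r \<in> Ebox m \<Longrightarrow> n \<in> dbox \<Longrightarrow> B r n \<in> K"
    "\<And>r n. r \<in> Ebox m \<Longrightarrow> n \<in> dbox \<Longrightarrow> ereal (- (\<Sum>i\<in>UNIV. cc i) - real (pair n m)) \<le> ordp A (B r n)"
    "\<And>r. r \<in> Ebox m \<Longrightarrow> \<forall>x\<in>G. E m r x = (\<Sum>n\<in>dbox. B r n * tst (gpow r) m n x)" by auto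
  define mE where "mE r = (\<Sum>n\<in>dbox. B r n * \<mu> (tst (gpow r) m n))" for r
  have "\<forall>r\<in>Ebox m. \<exists>N0. \<forall>N\<ge>N0. (\<lambda>x\<in>G. pw N * E m r x) \<in> C_fun A d e \<and>
    (\<forall>\<mu>\<in>Fn (C_fun A d e) K. \<mu> (\<lambda>x\<in>G. pw N * E m r x) = pw N * (\<Sum>n\<in>dbox. B r n * \<mu> (tst (gpow r) m n)))"
    using E_expansion_K B(1,3) by blast
  from bchoice[OF this] obtain N1 where N1: "\<forall>r\<in>Ebox m. \<forall>N\<ge>N1 r. (\<lambda>x\<in>G. pw N * E m r x) \<in> C_fun A d e \<and>
    (\<forall>\<mu>\<in>Fn (C_fun A d e) K. \<mu> (\<lambda>x\<in>G. pw N * E m r x) = pw N * (\<Sum>n\<in>dbox. B r n * \<mu> (tst (gpow r) m n)))" ..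
  define N where "N = (\<Sum>r\<in>Ebox m. N1 r)"
  have NE: "(\<lambda>x\<in>G. pw N * E m r x) \<in> C_fun A d e" "\<mu> (\<lambda>x\<in>G. pw N * E m r x) = pw N * mE r" if r: "r \<in> Ebox m" for r
  proof -
    have "N1 r \<le> N" unfolding N_def by (rule member_le_sum[OF r]) auto
    then show "(\<lambda>x\<in>G. pw N * E m r x) \<in> C_fun A d e" "\<mu> (\<lambda>x\<in>G. pw N * E m r x) = pw N * mE r"
      using N1 r mu unfolding mE_def by auto
  qed
  have ex: "(\<lambda>x\<in>G. pw N * f x) = (\<lambda>x\<in>G. \<Sum>r\<in>Ebox m. f (gpow r) * (\<lambda>x\<in>G. pw N * E m r x) x)" if f: "f \<in> W m" for f
  proof (rule restrict_ext)
    fix x assume x: "x \<in> G"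
    have "f x = (\<Sum>r\<in>Ebox m. f (gpow r) * E m r x)" using fun_cong[OF W_expand[OF f], of x] x by simp
    then show "pw N * f x = (\<Sum>r\<in>Ebox m. f (gpow r) * (\<lambda>x\<in>G. pw N * E m r x) x)"
      using x by (simp add: sum_distrib_left mult.left_commute)
  qed
  have fO: "f (gpow r) \<in> OK" if "f \<in> W m" for f r using cts_OK[OF W_cts[OF that]] by simp
  have inC: "(\<lambda>x\<in>G. pw N * f x) \<in> C_fun A d e" if f: "f \<in> W m" for f
    unfolding ex[OF f] by (rule fmod_sum[OF fmod_C_fun finite_Ebox fO[OF f] NE(1)])
  have val: "\<mu> f = (\<Sum>r\<in>Ebox m. f (gpow r) * mE r)" if fC: "f \<in> C_fun A d e" and f: "f \<in> W m" for f
  proof -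
    have "pw N * \<mu> f = \<mu> (\<lambda>x\<in>G. pw N * f x)" using Fn_cmult[OF mu pw_OK fC] by simp
    also have "\<dots> = (\<Sum>r\<in>Ebox m. f (gpow r) * (pw N * mE r))"
      unfolding ex[OF f] using Fn_sum[OF fmod_C_fun mu finite_Ebox fO[OF f] NE(1)] NE(2) by simp
    also have "\<dots> = pw N * (\<Sum>r\<in>Ebox m. f (gpow r) * mE r)" by (simp add: sum_distrib_left mult.left_commute)
    finally show ?thesis by simp
  qed
  have K: "mE r \<in> K" if "r \<in> Ebox m" for r
    unfolding mE_def by (intro K_sum K_mult B(1)[OF that] Fn_in[OF mu] tst_C_fun) auto
  have bd: "ereal (C0 - (\<Sum>i\<in>UNIV. cc i)) \<le> ordp A (mE r)"
    if r: "r \<in> Ebox m" and C0: "\<forall>a\<in>G. \<forall>n\<in>dbox. ereal (C0 + real (pair n m)) \<le> ordp A (\<mu> (tst a m n))" for r C0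
    unfolding mE_def
  proof (rule ord_sum_ge)
    fix n assume n: "n \<in> dbox"
    have "ereal (- (\<Sum>i\<in>UNIV. cc i) - real (pair n m)) + ereal (C0 + real (pair n m)) \<le> ordp A (B r n) + ordp A (\<mu> (tst (gpow r) m n))"
      using B(2)[OF r n] C0 n by (intro add_mono) auto
    then show "ereal (C0 - (\<Sum>i\<in>UNIV. cc i)) \<le> ordp A (B r n * \<mu> (tst (gpow r) m n))" by (simp add: ord_mult)
  qed
  show ?thesis
  proof (intro exI[of _ mE] conjI ballI allI impI)
    show "\<exists>N. \<forall>f\<in>W m. (\<lambda>x\<in>G. pw N * f x) \<in> C_fun A d e" using inC by blast
  qed (use K bd val in auto)
qed

lemma W_scale: "\<exists>N. \<forall>f\<in>W m. (\<lambda>x\<in>G. pw N * f x) \<in> C_fun A d e"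
proof -
  have "(\<lambda>f\<in>C_fun A d e. 0) \<in> Fn (C_fun A d e) K" using fmodD[OF fmod_C_fun] by (auto simp: Fn_iff)
  from mu_W_values[OF this, of m] show ?thesis by blast
qed

lemma pairing_scaled:
  assumes u: "u \<in> carrier (tens A (Q m))" and f: "f \<in> W m"
  shows "pairing m u f = pairing m u (\<lambda>x\<in>G. pw N * f x) / pw N"
  unfolding pairing_fun_cmult[OF u f pw_OK] by simp

text \<open>A system is determined by its pairings with \<open>W m\<close>, and up to a power of \<open>p\<close> functions in \<open>W m\<close> are
  locally polynomial.\<close>

lemma mu_inj:
  assumes s: "s \<in> proj_limit A d e" "s' \<in> proj_limit A d e" and eq: "mu s = mu s'"
  shows "s = s'"
proof
  fix m
  show "s m = s' m"
  proof (rule pairing_inj[OF proj_in[OF s(1)] proj_in[OF s(2)]])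
    fix f assume f: "f \<in> W m"
    obtain N where N: "(\<lambda>x\<in>G. pw N * f x) \<in> C_fun A d e" using W_scale[of m] f by auto
    have "(\<lambda>x\<in>G. pw N * f x) \<in> W m" by (rule fmodD(4)[OF fmod_W pw_OK f])
    then have "pairing m (s m) (\<lambda>x\<in>G. pw N * f x) = pairing m (s' m) (\<lambda>x\<in>G. pw N * f x)"
      using mu_eq[OF s(1) N] mu_eq[OF s(2) N] eq by simp
    then show "pairing m (s m) f = pairing m (s' m) f"
      using pairing_scaled[OF proj_in[OF s(1)] f, of N] pairing_scaled[OF proj_in[OF s(2)] f, of N] by simp
  qed
qed

end

locale pdatum_deh = pdatum_de A d e for A :: "('c::{alg_closed_field, field_char_0, complete_space}, 'k::finite, 'g) datum" and d e +
  fixes h :: "'k \<Rightarrow> real"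
  assumes h_val: "\<forall>i. ereal (h i) \<in> ordp A ` (val_ring A - {0})"
begin

definition "pp m = p_power A (inner_k h m)"

text \<open>An element with the required valuation exists since each \<open>h i\<close> is the valuation of an element of the
  ring of integers.\<close>

lemma pp_props: "pp m \<in> K" "ordp A (pp m) = ereal (inner_k h m)"
proof -
  have "\<forall>i. \<exists>c. c \<in> K \<and> ordp A c = ereal (h i)"
  proof
    fix i
    obtain c where "c \<in> OK - {0}" "ereal (h i) = ordp A c" using h_val[rule_format, of i] by (rule imageE)
    then show "\<exists>c. c \<in> K \<and> ordp A c = ereal (h i)" using OK_K by (intro exI[of _ c]) auto
  qed
  from choice[OF this] obtain c where c: "\<forall>i. c i \<in> K \<and> ordp A (c i) = ereal (h i)" ..
  let ?x = "\<Prod>i\<in>UNIV. c i ^ m i"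
  have "?x \<in> K" using c by (auto intro!: K_prod K_power)
  moreover have "ordp A ?x = ereal (inner_k h m)"
    using c by (simp add: ord_prod ord_power inner_k_def mult.commute)
  ultimately have "\<exists>x. x \<in> K \<and> ordp A x = ereal (inner_k h m)" by blast
  from someI_ex[OF this] show "pp m \<in> K" "ordp A (pp m) = ereal (inner_k h m)"
    unfolding pp_def p_power_def by auto
qed

lemma pp_nz [simp]: "pp m \<noteq> 0" using pp_props(2)[of m] by auto

lemma inner_split: "n \<in> dbox \<Longrightarrow> inner_k (\<lambda>j. h j - real_of_int (wt n j - d j)) m = inner_k h m - real (pair n m)"
  by (simp add: inner_k_def wt_def pair_def left_diff_distrib sum_subtractf)

text \<open>Only bounds by real numbers occur, which avoids computing with the infimum.\<close>

lemma v_adm_ge_iff: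
  "ereal C0 \<le> v_adm A d e h \<mu> \<longleftrightarrow> (\<forall>m. \<forall>a\<in>G. \<forall>n\<in>dbox. ereal (C0 - inner_k h m + real (pair n m)) \<le> ordp A (\<mu> (tst a m n)))"
proof -
  have *: "ereal C0 \<le> y + ereal (inner_k (\<lambda>j. h j - real_of_int (wt n j - d j)) m) \<longleftrightarrow>
    ereal (C0 - inner_k h m + real (pair n m)) \<le> y" if "n \<in> dbox" for n m y
    unfolding inner_split[OF that] by (cases y) auto
  have "ereal C0 \<le> v_adm A d e h \<mu> \<longleftrightarrow> (\<forall>a\<in>G. \<forall>m. \<forall>n\<in>dbox. ereal C0 \<le> ordp A (\<mu> (tst a m n)) + ereal (inner_k (\<lambda>j. h j - real_of_int (wt n j - d j)) m))"
    unfolding v_adm_def le_INF_iff weights_dbox by auto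
  then show ?thesis using * by auto
qed

lemma rescaled_PR: "s \<in> proj_limit A d e \<Longrightarrow> f \<in> W m \<Longrightarrow> pairing m (rescaled A d e h s m) f = pp m * pairing m (s m) f"
  unfolding rescaled_def pp_def[symmetric] by (rule pairing_tscale[OF proj_in _ pp_props(1)])

text \<open>If the rescaled system is \<open>c\<close> times an integral one, then on a test function the distribution has at
  least the valuation of \<open>c\<close> plus that of the test function.\<close>

lemma v_adm_mu_ge:
  assumes s: "s \<in> proj_limit A d e" and c: "c \<in> K" and y: "\<And>m. y m \<in> carrier (Q m)"
    and r: "\<And>m. rescaled A d e h s m = ptens A (Q m) (y m) c" and C0: "ereal C0 \<le> ordp A c"
  shows "ereal C0 \<le> v_adm A d e h (mu s)"
  unfolding v_adm_ge_iff
proof (intro allI ballI)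
  fix m a n assume a: "a \<in> G" and n: "n \<in> dbox"
  obtain l where l: "l \<in> Lam" "y m = cl m l" using Q_rep[OF y] by blast
  let ?t = "tst a m n"
  have t: "?t \<in> C_fun A d e" "?t \<in> W m" using tst_C_fun[OF a n] tst_W[OF a n] by auto
  have "pp m * mu s ?t = c * l ?t"
    using rescaled_PR[OF s t(2)] unfolding r l(2) pairing_pt[OF l(1) c t(2)] mu_eq[OF s t] by simp
  then have o: "ereal (inner_k h m) + ordp A (mu s ?t) = ordp A c + ordp A (l ?t)"
    using ord_mult[of "pp m" "mu s ?t"] ord_mult[of c "l ?t"] pp_props(2) by simp
  have "sm (pair n m) (l ?t)" by (rule Fn_sm[OF l(1) W_cts[OF t(2)] tst_sm[OF a]])
  then have "ereal C0 + ereal (real (pair n m)) \<le> ordp A c + ordp A (l ?t)"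
    using C0 unfolding sm_def by (intro add_mono)
  then show "ereal (C0 - inner_k h m + real (pair n m)) \<le> ordp A (mu s ?t)"
    unfolding o[symmetric] by (cases "ordp A (mu s ?t)") auto
qed

text \<open>An element of the base change of the product is a pure tensor: one denominator serves all levels.\<close>

lemma I_set_rep:
  assumes s: "s \<in> I_set A d e h"
  obtains y c where "\<And>m. y m \<in> carrier (Q m)" "c \<in> K" "c \<noteq> 0" "\<And>m. rescaled A d e h s m = ptens A (Q m) (y m) c"
proof -
  have P: "omod (product_module Q)" by (rule product_omod) (rule Q_omod)
  obtain t where t: "t \<in> carrier (tens A (product_module Q))"
    "rescaled A d e h s = (\<lambda>m. tmap A (product_module Q) (Q m) (\<lambda>y. y m) t)" using s by (auto simp: I_set_def)
  obtain y c where y: "y \<in> carrier (product_module Q)" "c \<in> K" "c \<noteq> 0" "t = ptens A (product_module Q) y c"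
    using tens_pureE[OF P t(1)] by metis
  have "tmap A (product_module Q) (Q m) (\<lambda>y. y m) (ptens A (product_module Q) y c) = ptens A (Q m) (y m) c" for m
    by (rule tmap_props(2)[OF P Q_omod]) (use y in \<open>auto simp: product_module_def\<close>)
  then show ?thesis using that[of y c] y t(2) by (auto simp: product_module_def)
qed

lemma mu_D:
  assumes s: "s \<in> I_set A d e h"
  shows "mu s \<in> D_set A d e h"
proof -
  have sp: "s \<in> proj_limit A d e" using s by (simp add: I_set_def)
  obtain y c where y: "\<And>m. y m \<in> carrier (Q m)" "c \<in> K" "c \<noteq> 0" "\<And>m. rescaled A d e h s m = ptens A (Q m) (y m) c"
    using I_set_rep[OF s] by metis
  obtain r where r: "ordp A c = ereal r" using ord_finite[OF y(3)] by blast
  have "ereal r \<le> v_adm A d e h (mu s)" by (rule v_adm_mu_ge[OF sp y(2,1,4)]) (simp add: r)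
  then show ?thesis using mu_in[OF sp] by (auto simp: D_set_def less_le_trans[of "-\<infinity>" "ereal r"])
qed

lemma mu_I0:
  assumes s: "s \<in> I0_set A d e h"
  shows "0 \<le> v_adm A d e h (mu s)"
proof -
  have sp: "s \<in> proj_limit A d e" using s by (simp add: I_set_def I0_set_def)
  obtain y where "y \<in> carrier (product_module Q)" "rescaled A d e h s = (\<lambda>m. ptens A (Q m) (y m) 1)"
    using s by (auto simp: I0_set_def)
  then have "ereal 0 \<le> v_adm A d e h (mu s)"
    by (intro v_adm_mu_ge[OF sp, of 1 y]) (auto simp: product_module_def)
  then show ?thesis by (simp add: zero_ereal_def)
qed

text \<open>At each level the values of the distribution on the basis of \<open>W m\<close> are taken as the weights of a
  combination of Dirac measures at the points \<open>\<gamma>\<^sup>r\<close>. The bound on the distribution makes them integral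
  after multiplication with \<open>p\<close> to the power \<open>N0 + \<langle>h, m\<rangle>\<close>, with \<open>N0\<close> independent of \<open>m\<close>;
  if the bound is the constant of the theorem, \<open>N0 = 0\<close> is possible.\<close>

lemma mu_surj:
  assumes mu: "\<mu> \<in> Fn (C_fun A d e) K" and v: "ereal C0 \<le> v_adm A d e h \<mu>" and N0: "(\<Sum>i\<in>UNIV. cc i) - C0 \<le> real N0"
  shows "\<exists>s\<in>I_set A d e h. mu s = \<mu> \<and> (N0 = 0 \<longrightarrow> s \<in> I0_set A d e h)"
proof -
  have "\<forall>m. \<exists>mE. (\<forall>r\<in>Ebox m. mE r \<in> K \<and> ereal (C0 - inner_k h m - (\<Sum>i\<in>UNIV. cc i)) \<le> ordp A (mE r)) \<and>
    (\<forall>f\<in>C_fun A d e. f \<in> W m \<longrightarrow> \<mu> f = (\<Sum>r\<in>Ebox m. f (gpow r) * mE r))"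
  proof
    fix m
    obtain mE where mE: "\<forall>r\<in>Ebox m. mE r \<in> K \<and>
      (\<forall>C0. (\<forall>a\<in>G. \<forall>n\<in>dbox. ereal (C0 + real (pair n m)) \<le> ordp A (\<mu> (tst a m n))) \<longrightarrow> ereal (C0 - (\<Sum>i\<in>UNIV. cc i)) \<le> ordp A (mE r))"
      "\<forall>f\<in>C_fun A d e. f \<in> W m \<longrightarrow> \<mu> f = (\<Sum>r\<in>Ebox m. f (gpow r) * mE r)" using mu_W_values[OF mu, of m] by blast
    have "\<forall>a\<in>G. \<forall>n\<in>dbox. ereal (C0 - inner_k h m + real (pair n m)) \<le> ordp A (\<mu> (tst a m n))"
      using v unfolding v_adm_ge_iff by simp
    then show "\<exists>mE. (\<forall>r\<in>Ebox m. mE r \<in> K \<and> ereal (C0 - inner_k h m - (\<Sum>i\<in>UNIV. cc i)) \<le> ordp A (mE r)) \<and>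
      (\<forall>f\<in>C_fun A d e. f \<in> W m \<longrightarrow> \<mu> f = (\<Sum>r\<in>Ebox m. f (gpow r) * mE r))"
      using mE by (intro exI[of _ mE]) simp
  qed
  from choice[OF this] obtain mE where mE0: "\<forall>m. (\<forall>r\<in>Ebox m. mE m r \<in> K \<and> ereal (C0 - inner_k h m - (\<Sum>i\<in>UNIV. cc i)) \<le> ordp A (mE m r)) \<and>
    (\<forall>f\<in>C_fun A d e. f \<in> W m \<longrightarrow> \<mu> f = (\<Sum>r\<in>Ebox m. f (gpow r) * mE m r))" ..
  then have mE: "\<And>m r. r \<in> Ebox m \<Longrightarrow> mE m r \<in> K"
    "\<And>m r. r \<in> Ebox m \<Longrightarrow> ereal (C0 - inner_k h m - (\<Sum>i\<in>UNIV. cc i)) \<le> ordp A (mE m r)"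
    "\<And>m f. f \<in> C_fun A d e \<Longrightarrow> f \<in> W m \<Longrightarrow> \<mu> f = (\<Sum>r\<in>Ebox m. f (gpow r) * mE m r)" by auto
  \<comment> \<open>integral weights; the denominator is put back in \<open>ic\<close>\<close>
  define co where "co m r = (if r \<in> Ebox m then pw N0 * pp m * mE m r else 0)" for m r
  have coO: "co m r \<in> OK" for m r
  proof (cases "r \<in> Ebox m")
    case True
    have "ereal 0 \<le> ordp A (pw N0 * pp m * mE m r)"
      using mE(2)[OF True] N0 by (cases "ordp A (mE m r)") (auto simp: ord_mult ord_p_pow pp_props)
    then show ?thesis using True by (simp add: co_def OK_iff sm_def K_mult pp_props mE(1))
  qed (simp add: co_def)
  define l where "l m = (\<lambda>f\<in>cts A. \<Sum>r\<in>Ebox m. co m r * f (gpow r))" for m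
  have lL: "l m \<in> Lam" for m
    unfolding Fn_iff
  proof (intro conjI ballI)
    fix f assume f: "f \<in> cts A"
    then show "l m f \<in> OK" unfolding l_def by (simp, intro OK_sum OK_mult[OF coO cts_OK[OF f gpow_in]])
  qed (auto simp: l_def cts_add cts_cmult sum.distrib sum_distrib_left algebra_simps)
  define ic where "ic m = 1 / (pw N0 * pp m)" for m
  have icK: "ic m \<in> K" for m unfolding ic_def by (intro K_divide K_mult pp_props) auto
  define s where "s m = ptens A (Q m) (cl m (l m)) (ic m)" for m
  have s_in: "s m \<in> carrier (tens A (Q m))" for m unfolding s_def by (rule QK_in[OF lL icK])
  have PRs: "pairing m (s m) f = (\<Sum>r\<in>Ebox m. f (gpow r) * mE m r)" if f: "f \<in> W m" for m f
    unfolding s_def pairing_pt[OF lL icK f]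
    using W_cts[OF f] by (simp add: l_def ic_def co_def sum_distrib_left field_simps)
  have PRmu: "pairing m (s m) f = \<mu> f" if "f \<in> C_fun A d e" "f \<in> W m" for m f
    using PRs[OF that(2)] mE(3)[OF that] by simp
  have proj: "s \<in> proj_limit A d e"
    unfolding proj_limit_def
  proof (intro CollectI conjI allI impI)
    fix m m' :: "'k \<Rightarrow> nat" assume le: "m \<le> m'"
    show "tmap A (Q m') (Q m) (\<lambda>X. Omega A d e m <+>\<^bsub>Iwasawa A\<^esub> X) (s m') = s m"
    proof (rule pairing_inj[OF tmap_trans_in[OF le s_in] s_in])
      fix f assume f: "f \<in> W m"
      have f': "f \<in> W m'" using f W_mono[OF le] by auto
      obtain N where N: "(\<lambda>x\<in>G. pw N * f x) \<in> C_fun A d e" using W_scale[of m] f by auto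
      have fw: "(\<lambda>x\<in>G. pw N * f x) \<in> W m" "(\<lambda>x\<in>G. pw N * f x) \<in> W m'"
        by (rule fmodD(4)[OF fmod_W pw_OK f], rule fmodD(4)[OF fmod_W pw_OK f'])
      have "pairing m (tmap A (Q m') (Q m) (trm m) (s m')) f = pairing m' (s m') f" by (rule pairing_tmap[OF le s_in f])
      also have "\<dots> = pairing m (s m) f"
        using pairing_scaled[OF s_in f, of N] pairing_scaled[OF s_in f', of N] PRmu[OF N fw(1)] PRmu[OF N fw(2)] by simp
      finally show "pairing m (tmap A (Q m') (Q m) (trm m) (s m')) f = pairing m (s m) f" .
    qed
  qed (rule s_in)
  have mus: "mu s = \<mu>"
  proof (rule extensionalityI[of _ "C_fun A d e"])
    fix g assume g: "g \<in> C_fun A d e"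
    show "mu s g = \<mu> g" unfolding mu_eq[OF proj g lev_W[OF g]] by (rule PRmu[OF g lev_W[OF g]])
  qed (use mu_in[OF proj] mu Fn_ext in auto)
  have resc: "rescaled A d e h s m = ptens A (Q m) (cl m (l m)) (1 / pw N0)" for m
    unfolding rescaled_def pp_def[symmetric] s_def tscale_pt[OF Q_omod pp_props(1) cl_in[OF lL] icK] by (simp add: ic_def)
  have P: "omod (product_module Q)" by (rule product_omod) (rule Q_omod)
  let ?y = "\<lambda>m. cl m (l m)"
  have y: "?y \<in> carrier (product_module Q)" by (simp add: product_module_def cl_in lL)
  have iK: "1 / pw N0 \<in> K" by (intro K_divide) auto
  have tm: "tmap A (product_module Q) (Q m) (\<lambda>y. y m) (ptens A (product_module Q) ?y (1 / pw N0)) = ptens A (Q m) (?y m) (1 / pw N0)" for m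
    by (rule tmap_props(2)[OF P Q_omod]) (use y iK in \<open>auto simp: product_module_def\<close>)
  have sI: "s \<in> I_set A d e h"
    unfolding I_set_def
  proof (intro CollectI conjI bexI)
    show "ptens A (product_module Q) ?y (1 / pw N0) \<in> carrier (tens A (product_module Q))" by (rule pt_in[OF y iK])
    show "rescaled A d e h s = (\<lambda>m. tmap A (product_module Q) (Q m) (\<lambda>y. y m) (ptens A (product_module Q) ?y (1 / pw N0)))"
      unfolding tm by (rule ext) (rule resc)
  qed (rule proj)
  have "s \<in> I0_set A d e h" if "N0 = 0"
    unfolding I0_set_def
  proof (intro CollectI conjI bexI[OF _ y])
    show "rescaled A d e h s = (\<lambda>m. ptens A (Q m) (?y m) 1)"
      by (rule ext) (use resc that in simp)
  qed (rule sI)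
  then show ?thesis using sI mus by blast
qed

text \<open>A distribution of finite valuation satisfies the hypothesis of \<open>mu_surj\<close> for some \<open>N0\<close>.\<close>

lemma mu_bij: "bij_betw mu (I_set A d e h) (D_set A d e h)"
  unfolding bij_betw_def
proof
  show "inj_on mu (I_set A d e h)" by (rule inj_onI) (auto intro: mu_inj simp: I_set_def)
  show "mu ` I_set A d e h = D_set A d e h"
  proof
    show "mu ` I_set A d e h \<subseteq> D_set A d e h" using mu_D by blast
    show "D_set A d e h \<subseteq> mu ` I_set A d e h"
    proof
      fix \<mu> assume m: "\<mu> \<in> D_set A d e h"
      then have mu: "\<mu> \<in> Fn (C_fun A d e) K" and v: "v_adm A d e h \<mu> > - \<infinity>" by (auto simp: D_set_def)
      obtain C0 where C0: "ereal C0 \<le> v_adm A d e h \<mu>" using v by (cases "v_adm A d e h \<mu>") auto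
      obtain N0 where N0: "(\<Sum>i\<in>UNIV. cc i) - C0 \<le> real N0" using real_arch_simple by blast
      show "\<mu> \<in> mu ` I_set A d e h" using mu_surj[OF mu C0 N0] by blast
    qed
  qed
qed

lemma mu_lower: "{\<mu> \<in> D_set A d e h. v_adm A d e h \<mu> \<ge> c_const A d e} \<subseteq> mu ` I0_set A d e h"
proof
  fix \<mu> assume "\<mu> \<in> {\<mu> \<in> D_set A d e h. v_adm A d e h \<mu> \<ge> c_const A d e}"
  then have mu: "\<mu> \<in> Fn (C_fun A d e) K" and v: "ereal (\<Sum>i\<in>UNIV. cc i) \<le> v_adm A d e h \<mu>"
    by (auto simp: D_set_def c_const_cc)
  show "\<mu> \<in> mu ` I0_set A d e h" using mu_surj[OF mu v, of 0] by auto
qed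

lemma mu_upper: "mu ` I0_set A d e h \<subseteq> {\<mu> \<in> D_set A d e h. v_adm A d e h \<mu> \<ge> 0}"
  using mu_I0 mu_D by (auto simp: I0_set_def)

end

section \<open>Linearity over the Iwasawa algebra\<close>

context pdatum_deh
begin

interpretation Iw: ring "Iwasawa A" by (rule Iw_ring)

text \<open>The minimum of two lower bounds is a lower bound for the sum.\<close>

lemma D_add:
  assumes "\<mu> \<in> D_set A d e h" "\<nu> \<in> D_set A d e h"
  shows "(\<lambda>f\<in>C_fun A d e. \<mu> f + \<nu> f) \<in> D_set A d e h"
proof -
  have mu: "\<mu> \<in> Fn (C_fun A d e) K" and nu: "\<nu> \<in> Fn (C_fun A d e) K" and v: "v_adm A d e h \<mu> > - \<infinity>" "v_adm A d e h \<nu> > - \<infinity>"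
    using assms by (auto simp: D_set_def)
  obtain C1 where C1: "ereal C1 \<le> v_adm A d e h \<mu>" using v by (cases "v_adm A d e h \<mu>") auto
  obtain C2 where C2: "ereal C2 \<le> v_adm A d e h \<nu>" using v by (cases "v_adm A d e h \<nu>") auto
  let ?C = "min C1 C2"
  have "ereal ?C \<le> v_adm A d e h (\<lambda>f\<in>C_fun A d e. \<mu> f + \<nu> f)"
    unfolding v_adm_ge_iff
  proof (intro allI ballI)
    fix m a n assume a: "a \<in> G" and n: "n \<in> dbox"
    have "ereal (?C - inner_k h m + real (pair n m)) \<le> ordp A (\<mu> (tst a m n))"
      "ereal (?C - inner_k h m + real (pair n m)) \<le> ordp A (\<nu> (tst a m n))"
      using C1[unfolded v_adm_ge_iff, rule_format, OF a n, of m] C2[unfolded v_adm_ge_iff, rule_format, OF a n, of m]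
      by (auto intro: order_trans[rotated])
    then show "ereal (?C - inner_k h m + real (pair n m)) \<le> ordp A ((\<lambda>f\<in>C_fun A d e. \<mu> f + \<nu> f) (tst a m n))"
      using ord_add[of "\<mu> (tst a m n)" "\<nu> (tst a m n)"] tst_C_fun[OF a n] by (auto simp: min_def split: if_splits intro: order_trans)
  qed
  moreover have "x > - \<infinity>" if "ereal C \<le> x" for x C using that by (cases x) auto
  ultimately have "v_adm A d e h (\<lambda>f\<in>C_fun A d e. \<mu> f + \<nu> f) > - \<infinity>" by blast
  moreover have "(\<lambda>f\<in>C_fun A d e. \<mu> f + \<nu> f) \<in> Fn (C_fun A d e) K"
    using mu nu fmodD[OF fmod_C_fun] by (auto simp: Fn_iff K_add algebra_simps)
  ultimately show ?thesis by (simp add: D_set_def)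
qed

lemma add_system:
  assumes s: "s \<in> proj_limit A d e" "s' \<in> proj_limit A d e"
  shows "(\<lambda>m. s m \<otimes>\<^bsub>tens A (Q m)\<^esub> s' m) \<in> proj_limit A d e"
    "mu (\<lambda>m. s m \<otimes>\<^bsub>tens A (Q m)\<^esub> s' m) = (\<lambda>f\<in>C_fun A d e. mu s f + mu s' f)"
proof -
  let ?t = "\<lambda>m. s m \<otimes>\<^bsub>tens A (Q m)\<^esub> s' m"
  have cl: "?t m \<in> carrier (tens A (Q m))" for m
    using group.is_monoid[OF tens_group[OF Q_omod]] proj_in[OF s(1)] proj_in[OF s(2)] by (intro monoid.m_closed)
  show P: "?t \<in> proj_limit A d e"
    unfolding proj_limit_def
  proof (intro CollectI conjI allI impI)
    fix m m' :: "'k \<Rightarrow> nat" assume le: "m \<le> m'"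
    show "tmap A (Q m') (Q m) (trm m) (?t m') = ?t m"
    proof (rule pairing_inj[OF tmap_trans_in[OF le cl] cl])
      fix f assume f: "f \<in> W m"
      have f': "f \<in> W m'" using f W_mono[OF le] by auto
      show "pairing m (tmap A (Q m') (Q m) (trm m) (?t m')) f = pairing m (?t m) f"
        unfolding pairing_tmap[OF le cl f] pairing_add[OF proj_in[OF s(1)] proj_in[OF s(2)] f] pairing_add[OF proj_in[OF s(1)] proj_in[OF s(2)] f']
        using pairing_level[OF s(1) le f] pairing_level[OF s(2) le f] by simp
    qed
  qed (rule cl)
  show "mu ?t = (\<lambda>f\<in>C_fun A d e. mu s f + mu s' f)"
  proof (rule extensionalityI[of _ "C_fun A d e"])
    fix g assume g: "g \<in> C_fun A d e"
    show "mu ?t g = (\<lambda>f\<in>C_fun A d e. mu s f + mu s' f) g"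
      using mu_eq[OF P g lev_W[OF g]] mu_eq[OF s(1) g lev_W[OF g]] mu_eq[OF s(2) g lev_W[OF g]]
        pairing_add[OF proj_in[OF s(1)] proj_in[OF s(2)] lev_W[OF g]] g by simp
  qed (simp_all add: mu_def)
qed

abbreviation "actQ m \<equiv> (\<lambda>l X. (Omega A d e m +>\<^bsub>Iwasawa A\<^esub> l) \<otimes>\<^bsub>Q m\<^esub> X)"

lemma Lam_facts:
  "l \<in> Lam \<Longrightarrow> k \<in> Lam \<Longrightarrow> l \<otimes>\<^bsub>Iwasawa A\<^esub> k \<in> Lam"
  "l \<in> Lam \<Longrightarrow> k \<in> Lam \<Longrightarrow> l \<oplus>\<^bsub>Iwasawa A\<^esub> k \<in> Lam"
  "c \<in> OK \<Longrightarrow> k \<in> Lam \<Longrightarrow> c \<odot>\<^bsub>Iwasawa A\<^esub> k \<in> Lam"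
  using Iw_mult_in Iw_add_in Iw_smult_in by auto

lemma smult_assoc:
  assumes "a \<in> OK" "l \<in> Lam" "k \<in> Lam"
  shows "(a \<odot>\<^bsub>Iwasawa A\<^esub> l) \<otimes>\<^bsub>Iwasawa A\<^esub> k = a \<odot>\<^bsub>Iwasawa A\<^esub> (l \<otimes>\<^bsub>Iwasawa A\<^esub> k)"
    "l \<otimes>\<^bsub>Iwasawa A\<^esub> (a \<odot>\<^bsub>Iwasawa A\<^esub> k) = a \<odot>\<^bsub>Iwasawa A\<^esub> (l \<otimes>\<^bsub>Iwasawa A\<^esub> k)"
proof -
  have "avg (\<lambda>f\<in>cts A. a * l f) f = (\<lambda>y\<in>G. a * avg l f y)" if "f \<in> cts A" for f
    using that unfolding avg_def by (intro restrict_ext) (simp add: gtr_cts)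
  then show "(a \<odot>\<^bsub>Iwasawa A\<^esub> l) \<otimes>\<^bsub>Iwasawa A\<^esub> k = a \<odot>\<^bsub>Iwasawa A\<^esub> (l \<otimes>\<^bsub>Iwasawa A\<^esub> k)"
    using Fn_cmult[OF assms(3,1)] avg_cts[OF assms(2)] by (simp add: convolution_avg) (rule restrict_ext, simp)
  show "l \<otimes>\<^bsub>Iwasawa A\<^esub> (a \<odot>\<^bsub>Iwasawa A\<^esub> k) = a \<odot>\<^bsub>Iwasawa A\<^esub> (l \<otimes>\<^bsub>Iwasawa A\<^esub> k)"
    using avg_cts[OF assms(2)] by (simp add: convolution_avg) (rule restrict_ext, simp)
qed

lemma bilin_actQ: "bilin (Q m) (actQ m)"
  unfolding bilin_def cl_def[symmetric]
proof (intro conjI ballI)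
  note D = Iw_sel(2-6)
  fix l X assume l: "l \<in> Lam" and "X \<in> carrier (Q m)"
  then obtain k where k: "k \<in> Lam" "X = cl m k" using Q_rep by blast
  note lk = Lam_facts(1,2)[OF l k(1)]
  show "cl m l \<otimes>\<^bsub>Q m\<^esub> X \<in> carrier (Q m)" unfolding k(2) cl_mult[OF l k(1)] by (rule cl_in[OF lk(1)])
  { fix l' assume l': "l' \<in> Lam"
    show "cl m (l \<oplus>\<^bsub>Iwasawa A\<^esub> l') \<otimes>\<^bsub>Q m\<^esub> X = cl m l \<otimes>\<^bsub>Q m\<^esub> X \<oplus>\<^bsub>Q m\<^esub> cl m l' \<otimes>\<^bsub>Q m\<^esub> X"
      unfolding k(2) cl_mult[OF l k(1)] cl_mult[OF l' k(1)] cl_mult[OF Lam_facts(2)[OF l l'] k(1)]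
        cl_add[OF lk(1) Lam_facts(1)[OF l' k(1)]]
      using Iw.l_distr[of l l' k] l l' k(1) by (simp del: D) }
  { fix Y assume "Y \<in> carrier (Q m)"
    then obtain k' where k': "k' \<in> Lam" "Y = cl m k'" using Q_rep by blast
    show "cl m l \<otimes>\<^bsub>Q m\<^esub> (X \<oplus>\<^bsub>Q m\<^esub> Y) = cl m l \<otimes>\<^bsub>Q m\<^esub> X \<oplus>\<^bsub>Q m\<^esub> cl m l \<otimes>\<^bsub>Q m\<^esub> Y"
      unfolding k(2) k'(2) cl_mult[OF l k(1)] cl_mult[OF l k'(1)] cl_add[OF k(1) k'(1)]
        cl_mult[OF l Lam_facts(2)[OF k(1) k'(1)]] cl_add[OF lk(1) Lam_facts(1)[OF l k'(1)]]
      using Iw.r_distr[of k k' l] l k' k(1) by (simp del: D) }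
  fix a assume a: "a \<in> OK"
  show "cl m (a \<odot>\<^bsub>Iwasawa A\<^esub> l) \<otimes>\<^bsub>Q m\<^esub> X = a \<odot>\<^bsub>Q m\<^esub> (cl m l \<otimes>\<^bsub>Q m\<^esub> X)"
    unfolding k(2) cl_mult[OF l k(1)] cl_mult[OF Lam_facts(3)[OF a l] k(1)] cl_smult[OF a lk(1)] smult_assoc(1)[OF a l k(1)] ..
  show "cl m l \<otimes>\<^bsub>Q m\<^esub> (a \<odot>\<^bsub>Q m\<^esub> X) = a \<odot>\<^bsub>Q m\<^esub> (cl m l \<otimes>\<^bsub>Q m\<^esub> X)"
    unfolding k(2) cl_mult[OF l k(1)] cl_smult[OF a k(1)] cl_mult[OF l Lam_facts(3)[OF a k(1)]] cl_smult[OF a lk(1)] smult_assoc(2)[OF a l k(1)] ..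
qed

lemma act_pt:
  assumes l: "l \<in> Lam" and a: "a \<in> K" and k: "k \<in> Lam" and c: "c \<in> K"
  shows "taction A (Q m) (actQ m) (ptens A (Iwasawa A) l a) (ptens A (Q m) (cl m k) c)
    = ptens A (Q m) (cl m (l \<otimes>\<^bsub>Iwasawa A\<^esub> k)) (a * c)"
  using taction_pt[OF Q_omod bilin_actQ l a cl_in[OF k] c] cl_mult[OF l k] unfolding cl_def by simp

text \<open>Each element of \<open>O[[\<Gamma>]] \<otimes> K\<close> is a pure tensor \<open>l \<otimes> a\<close>. It acts on level \<open>m\<close> by multiplication, hence on
  functions by \<open>avg l\<close> followed by \<open>a\<close>, which is the action on distributions.\<close>

lemma smult_system:
  assumes s: "s \<in> I_set A d e h" and l: "l \<in> Lam" and a: "a \<in> K"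
  shows "(\<lambda>m. taction A (Q m) (actQ m) (ptens A (Iwasawa A) l a) (s m)) \<in> I_set A d e h"
    "mu (\<lambda>m. taction A (Q m) (actQ m) (ptens A (Iwasawa A) l a) (s m)) = (\<lambda>f\<in>C_fun A d e. a * convolution A (C_fun A d e) l (mu s) f)"
proof -
  let ?T = "\<lambda>m. taction A (Q m) (actQ m) (ptens A (Iwasawa A) l a)"
  let ?t = "\<lambda>m. ?T m (s m)"
  have sp: "s \<in> proj_limit A d e" using s by (simp add: I_set_def)
  have cl: "?t m \<in> carrier (tens A (Q m))" for m
  proof -
    obtain k c where k: "k \<in> Lam" "c \<in> K" "s m = ptens A (Q m) (cl m k) c" using QK_rep[OF proj_in[OF sp]] by metis
    show ?thesis unfolding k(3) act_pt[OF l a k(1,2)] by (rule QK_in[OF Lam_facts(1)[OF l k(1)] K_mult[OF a k(2)]])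
  qed
  have P: "?t \<in> proj_limit A d e"
    unfolding proj_limit_def
  proof (intro CollectI conjI allI impI)
    fix m m' :: "'k \<Rightarrow> nat" assume le: "m \<le> m'"
    obtain k c where k: "k \<in> Lam" "c \<in> K" "s m' = ptens A (Q m') (cl m' k) c" using QK_rep[OF proj_in[OF sp]] by metis
    have "s m = tmap A (Q m') (Q m) (trm m) (s m')" using sp le by (simp add: proj_limit_def)
    then have sm: "s m = ptens A (Q m) (cl m k) c" unfolding k(3) tmap_trans_pt[OF le k(1,2)] .
    show "tmap A (Q m') (Q m) (trm m) (?t m') = ?t m"
      unfolding k(3) sm act_pt[OF l a k(1,2)] by (rule tmap_trans_pt[OF le Lam_facts(1)[OF l k(1)] K_mult[OF a k(2)]])
  qed (rule cl)
  obtain y c where y: "\<And>m. y m \<in> carrier (Q m)" "c \<in> K" "c \<noteq> 0" "\<And>m. rescaled A d e h s m = ptens A (Q m) (y m) c"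
    using I_set_rep[OF s] by metis
  let ?y = "\<lambda>m. cl m l \<otimes>\<^bsub>Q m\<^esub> y m"
  have yin: "?y m \<in> carrier (Q m)" for m
  proof -
    obtain k where k: "k \<in> Lam" "y m = cl m k" using Q_rep[OF y(1)] by blast
    show ?thesis unfolding k(2) cl_mult[OF l k(1)] by (rule cl_in[OF Lam_facts(1)[OF l k(1)]])
  qed
  have resc: "rescaled A d e h ?t m = ptens A (Q m) (?y m) (a * c)" for m
  proof -
    obtain k b where k: "k \<in> Lam" "b \<in> K" "s m = ptens A (Q m) (cl m k) b" using QK_rep[OF proj_in[OF sp]] by metis
    note lk = Lam_facts(1)[OF l k(1)]
    have 1: "rescaled A d e h s m = ptens A (Q m) (cl m k) (pp m * b)"
      unfolding rescaled_def pp_def[symmetric] k(3) by (rule tscale_pt[OF Q_omod pp_props(1) cl_in[OF k(1)] k(2)])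
    have "rescaled A d e h ?t m = ptens A (Q m) (cl m (l \<otimes>\<^bsub>Iwasawa A\<^esub> k)) (pp m * (a * b))"
      unfolding rescaled_def pp_def[symmetric] k(3) act_pt[OF l a k(1,2)]
      by (rule tscale_pt[OF Q_omod pp_props(1) cl_in[OF lk] K_mult[OF a k(2)]])
    also have "\<dots> = ?T m (rescaled A d e h s m)"
      unfolding 1 act_pt[OF l a k(1) K_mult[OF pp_props(1) k(2)]] by (simp only: mult.left_commute)
    also have "\<dots> = ptens A (Q m) (?y m) (a * c)"
      unfolding y(4) using taction_pt[OF Q_omod bilin_actQ l a y(1,2)] unfolding cl_def by simp
    finally show ?thesis .
  qed
  have PM: "omod (product_module Q)" by (rule product_omod) (rule Q_omod)
  have yp: "?y \<in> carrier (product_module Q)" using yin by (simp add: product_module_def)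
  have ac: "a * c \<in> K" by (rule K_mult[OF a y(2)])
  have tm: "tmap A (product_module Q) (Q m) (\<lambda>y. y m) (ptens A (product_module Q) ?y (a * c)) = ptens A (Q m) (?y m) (a * c)" for m
    by (rule tmap_props(2)[OF PM Q_omod _ _ _ yp ac]) (auto simp: product_module_def)
  show "?t \<in> I_set A d e h"
    unfolding I_set_def
  proof (intro CollectI conjI bexI)
    show "ptens A (product_module Q) ?y (a * c) \<in> carrier (tens A (product_module Q))" by (rule pt_in[OF yp ac])
    show "rescaled A d e h ?t = (\<lambda>m. tmap A (product_module Q) (Q m) (\<lambda>y. y m) (ptens A (product_module Q) ?y (a * c)))"
      unfolding tm by (rule ext) (rule resc)
  qed (rule P)
  show "mu ?t = (\<lambda>f\<in>C_fun A d e. a * convolution A (C_fun A d e) l (mu s) f)"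
  proof (rule extensionalityI[of _ "C_fun A d e"])
    fix g assume g: "g \<in> C_fun A d e"
    let ?m = "\<lambda>_. lev g"
    note gW = lev_W[OF g]
    have ag: "avg l g \<in> C_fun A d e" "avg l g \<in> W ?m" by (rule avg_C_fun[OF l g], rule avg_W[OF l gW])
    obtain k c where k: "k \<in> Lam" "c \<in> K" "s ?m = ptens A (Q ?m) (cl ?m k) c" using QK_rep[OF proj_in[OF sp]] by metis
    have "mu ?t g = (a * c) * (l \<otimes>\<^bsub>Iwasawa A\<^esub> k) g"
      unfolding mu_eq[OF P g gW] k(3) act_pt[OF l a k(1,2)] by (rule pairing_pt[OF Lam_facts(1)[OF l k(1)] K_mult[OF a k(2)] gW])
    also have "(l \<otimes>\<^bsub>Iwasawa A\<^esub> k) g = k (avg l g)" using W_cts[OF gW] by (simp add: convolution_avg)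
    also have "(a * c) * k (avg l g) = a * mu s (avg l g)"
      unfolding mu_eq[OF sp ag] k(3) pairing_pt[OF k(1,2) ag(2)] by simp
    finally show "mu ?t g = (\<lambda>f\<in>C_fun A d e. a * convolution A (C_fun A d e) l (mu s) f) g"
      using g by (simp add: convolution_avg)
  qed (simp_all add: mu_def)
qed

lemma CK_module: "module (scalars OK) (functionals A (C_fun A d e) K)"
  by (rule functionals_module[OF fmod_C_fun]) (auto intro: K_add K_mult OK_K)

lemma CK_comm_group: "comm_group (add_monoid (functionals A (C_fun A d e) K))"
proof -
  interpret M: module "scalars OK" "functionals A (C_fun A d e) K" by (rule CK_module)
  show ?thesis by (rule M.M.a_comm_group)
qed

lemma D_action_pt:
  assumes mu: "\<mu> \<in> Fn (C_fun A d e) K" and l: "l \<in> Lam" and a: "a \<in> K"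
  shows "tlift A (Iwasawa A) (add_monoid (functionals A (C_fun A d e) K))
        (\<lambda>l c. \<lambda>f\<in>C_fun A d e. c * convolution A (C_fun A d e) l \<mu> f) (ptens A (Iwasawa A) l a)
     = (\<lambda>f\<in>C_fun A d e. a * convolution A (C_fun A d e) l \<mu> f)"
proof -
  have conv: "convolution A (C_fun A d e) l \<mu> \<in> Fn (C_fun A d e) K" if "l \<in> Lam" for l
    by (rule conv_in[OF that fmod_C_fun C_fun_cts mu avg_C_fun[OF that]])
  have sc: "(\<lambda>f\<in>C_fun A d e. c * \<nu> f) \<in> Fn (C_fun A d e) K" if "\<nu> \<in> Fn (C_fun A d e) K" "c \<in> K" for c \<nu>
    using that fmodD[OF fmod_C_fun] by (auto simp: Fn_iff K_mult algebra_simps)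
  have av1: "avg (\<lambda>f\<in>cts A. l f + l' f) f = (\<lambda>y\<in>G. avg l f y + avg l' f y)" if "f \<in> cts A" for l l' f
    using that unfolding avg_def by (intro restrict_ext) (simp add: gtr_cts)
  have av2: "avg (\<lambda>f\<in>cts A. c * l f) f = (\<lambda>y\<in>G. c * avg l f y)" if "f \<in> cts A" for l c f
    using that unfolding avg_def by (intro restrict_ext) (simp add: gtr_cts)
  have "bal (Iwasawa A) (add_monoid (functionals A (C_fun A d e) K)) (\<lambda>l c. \<lambda>f\<in>C_fun A d e. c * convolution A (C_fun A d e) l \<mu> f)"
  proof (rule balI)
    fix l c assume "l \<in> carrier (Iwasawa A)" "c \<in> K"
    then show "(\<lambda>f\<in>C_fun A d e. c * convolution A (C_fun A d e) l \<mu> f) \<in> carrier (add_monoid (functionals A (C_fun A d e) K))"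
      using sc conv by simp
  next
    fix l l' c assume "l \<in> carrier (Iwasawa A)" "l' \<in> carrier (Iwasawa A)" "c \<in> K"
    then have *: "l \<in> Lam" "l' \<in> Lam" by auto
    show "(\<lambda>f\<in>C_fun A d e. c * convolution A (C_fun A d e) (l \<oplus>\<^bsub>Iwasawa A\<^esub> l') \<mu> f) =
      (\<lambda>f\<in>C_fun A d e. c * convolution A (C_fun A d e) l \<mu> f) \<otimes>\<^bsub>add_monoid (functionals A (C_fun A d e) K)\<^esub>
      (\<lambda>f\<in>C_fun A d e. c * convolution A (C_fun A d e) l' \<mu> f)"
      using Fn_add[OF mu avg_C_fun[OF *(1)] avg_C_fun[OF *(2)]] subsetD[OF C_fun_cts]
      by (simp add: convolution_avg av1) (rule restrict_ext, simp add: distrib_left av1)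
  next
    fix l c c' show "(\<lambda>f\<in>C_fun A d e. (c + c') * convolution A (C_fun A d e) l \<mu> f) =
      (\<lambda>f\<in>C_fun A d e. c * convolution A (C_fun A d e) l \<mu> f) \<otimes>\<^bsub>add_monoid (functionals A (C_fun A d e) K)\<^esub>
      (\<lambda>f\<in>C_fun A d e. c' * convolution A (C_fun A d e) l \<mu> f)"
      by (simp add: distrib_right) (rule restrict_ext, simp)
  next
    fix r l c assume "r \<in> OK" "l \<in> carrier (Iwasawa A)"
    then have *: "r \<in> OK" "l \<in> Lam" by auto
    show "(\<lambda>f\<in>C_fun A d e. c * convolution A (C_fun A d e) (r \<odot>\<^bsub>Iwasawa A\<^esub> l) \<mu> f) =
      (\<lambda>f\<in>C_fun A d e. r * c * convolution A (C_fun A d e) l \<mu> f)"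
      using Fn_cmult[OF mu *(1) avg_C_fun[OF *(2)]] subsetD[OF C_fun_cts]
      by (simp add: convolution_avg) (rule restrict_ext, simp add: av2)
  qed
  from tlift_props(2)[OF Iw_omod CK_comm_group this, of l a] show ?thesis using l a by simp
qed

definition "Psi = restrict mu (I_set A d e h)"

lemma Psi_iso: "Psi \<in> module_iso (IwasawaK A) (I_module A d e h) (D_module A d e h)"
  unfolding module_iso_def
proof (intro CollectI conjI ballI)
  have cI: "carrier (I_module A d e h) = I_set A d e h" and cD: "carrier (D_module A d e h) = D_set A d e h"
    by (auto simp: I_module_def D_module_def)
  show "Psi \<in> carrier (I_module A d e h) \<rightarrow>\<^sub>E carrier (D_module A d e h)"
    unfolding cI cD Psi_def using mu_D by auto
  show "bij_betw Psi (carrier (I_module A d e h)) (carrier (D_module A d e h))"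
    unfolding cI cD Psi_def using mu_bij by (simp add: bij_betw_cong[of "I_set A d e h" "restrict mu (I_set A d e h)" mu])
  fix s assume "s \<in> carrier (I_module A d e h)"
  then have s: "s \<in> I_set A d e h" by (simp only: cI)
  have sp: "s \<in> proj_limit A d e" using s by (simp add: I_set_def)
  { fix s' assume "s' \<in> carrier (I_module A d e h)"
    then have s': "s' \<in> I_set A d e h" by (simp only: cI)
    have sp': "s' \<in> proj_limit A d e" using s' by (simp add: I_set_def)
    note t = add_system[OF sp sp']
    have "(\<lambda>f\<in>C_fun A d e. mu s f + mu s' f) \<in> mu ` I_set A d e h"
      unfolding bij_betw_imp_surj_on[OF mu_bij] by (rule D_add[OF mu_D[OF s] mu_D[OF s']])
    then obtain s'' where s'': "(\<lambda>f\<in>C_fun A d e. mu s f + mu s' f) = mu s''" "s'' \<in> I_set A d e h" by (rule imageE)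
    have "s'' = (\<lambda>m. s m \<otimes>\<^bsub>tens A (Q m)\<^esub> s' m)"
      by (rule mu_inj[OF _ t(1)]) (use s'' t(2) in \<open>auto simp: I_set_def\<close>)
    then have "(\<lambda>m. s m \<otimes>\<^bsub>tens A (Q m)\<^esub> s' m) \<in> I_set A d e h" using s'' by simp
    then show "Psi (s \<oplus>\<^bsub>I_module A d e h\<^esub> s') = Psi s \<oplus>\<^bsub>D_module A d e h\<^esub> Psi s'"
      using s s' t(2) by (simp add: Psi_def I_module_def D_module_def) }
  fix t assume "t \<in> carrier (IwasawaK A)"
  then have "t \<in> carrier (tens A (Iwasawa A))" by (simp add: IwasawaK_def)
  then obtain l a where l: "l \<in> Lam" "a \<in> K" "t = ptens A (Iwasawa A) l a"
    using tens_pureE[OF Iw_omod] by (metis Iw_sel(1))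
  show "Psi (t \<odot>\<^bsub>I_module A d e h\<^esub> s) = t \<odot>\<^bsub>D_module A d e h\<^esub> Psi s"
    using smult_system[OF s l(1,2)] D_action_pt[OF mu_in[OF sp] l(1,2)] s
    by (simp add: Psi_def I_module_def D_module_def l(3))
qed

end

section \<open>Algebraic dependence, roots of unity and finite order characters\<close>

text \<open>Gaussian elimination, one coordinate at a time: more vectors than coordinates are dependent.\<close>

lemma linear_dependence:
  assumes F: "subfield F (scalars (UNIV :: 'c::field set))"
    and J: "finite J" and T: "finite T" "card J < card T" and a: "\<And>t j. t \<in> T \<Longrightarrow> j \<in> J \<Longrightarrow> a t j \<in> F"
  shows "\<exists>b. (\<forall>t. b t \<in> F) \<and> (\<exists>t\<in>T. b t \<noteq> 0) \<and> (\<forall>j\<in>J. (\<Sum>t\<in>T. b t * a t j) = 0)"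
  using J T a
proof (induction J arbitrary: T a rule: finite_induct)
  case empty
  have "T \<noteq> {}" using empty.prems by auto
  then show ?case using subfield_scalars_closed(2)[OF F] by (intro exI[of _ "\<lambda>_. 1"]) auto
next
  case (insert j J)
  note c = subfield_scalars_closed[OF F]
  have cd: "x - y \<in> F" if "x \<in> F" "y \<in> F" for x y using c(3)[OF that(1) c(5)[OF that(2)]] by simp
  have cv: "x / y \<in> F" if "x \<in> F" "y \<in> F" for x y using c(4)[OF that(1) c(6)[OF that(2)]] by (simp add: divide_inverse)
  have csum: "sum f S \<in> F" if "\<And>s. s \<in> S \<Longrightarrow> f s \<in> F" for f and S :: "'b set"
    using that by (induction S rule: infinite_finite_induct) (auto intro: c)
  have ai: "\<And>t i. t \<in> T \<Longrightarrow> i \<in> insert j J \<Longrightarrow> a t i \<in> F" by (rule insert.prems(3))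
  show ?case
  proof (cases "\<forall>t\<in>T. a t j = 0")
    case True
    have "card J < card T" using insert.prems(2) insert.hyps by simp
    then obtain b where b: "\<forall>t. b t \<in> F" "\<exists>t\<in>T. b t \<noteq> 0" "\<forall>i\<in>J. (\<Sum>t\<in>T. b t * a t i) = 0"
      using insert.IH[of T a] insert.prems(1) ai by auto
    have "(\<Sum>t\<in>T. b t * a t j) = 0" using True by (intro sum.neutral) auto
    then show ?thesis using b by (intro exI[of _ b]) auto
  next
    case False
    then obtain s where s: "s \<in> T" "a s j \<noteq> 0" by auto
    let ?T = "T - {s}"
    \<comment> \<open>eliminate the coordinate \<open>j\<close> with the pivot \<open>s\<close>\<close>
    let ?a = "\<lambda>t i. a t i - a t j / a s j * a s i"
    have fT: "finite ?T" using insert.prems(1) by simp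
    have cT: "card J < card ?T" using insert.prems(1,2) insert.hyps s by simp
    have aF: "?a t i \<in> F" if "t \<in> ?T" "i \<in> J" for t i
      using that s(1) by (intro cd cv c(4) ai) auto
    obtain b where b: "\<forall>t. b t \<in> F" "\<exists>t\<in>?T. b t \<noteq> 0" "\<forall>i\<in>J. (\<Sum>t\<in>?T. b t * ?a t i) = 0"
      using insert.IH[of ?T ?a, OF fT cT aF] by blast
    let ?v = "\<Sum>t\<in>?T. b t * a t j"
    define b' where "b' = b(s := - (?v / a s j))"
    have b'F: "b' t \<in> F" for t
    proof -
      have "?v \<in> F" using b(1) by (intro csum c(4) ai) auto
      then have "?v / a s j \<in> F" using s(1) by (intro cv ai) auto
      then show ?thesis unfolding b'_def using b(1) c(5) by simp
    qed
    have split: "(\<Sum>t\<in>T. b' t * a t i) = - (?v / a s j) * a s i + (\<Sum>t\<in>?T. b t * a t i)" for i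
    proof -
      have "(\<Sum>t\<in>T. b' t * a t i) = b' s * a s i + (\<Sum>t\<in>?T. b' t * a t i)"
        by (rule sum.remove[OF insert.prems(1) s(1)])
      also have "(\<Sum>t\<in>?T. b' t * a t i) = (\<Sum>t\<in>?T. b t * a t i)" by (rule sum.cong) (auto simp: b'_def)
      finally show ?thesis by (simp add: b'_def)
    qed
    have z: "(\<Sum>t\<in>T. b' t * a t i) = 0" if i: "i \<in> insert j J" for i
    proof (cases "i = j")
      case True
      show ?thesis unfolding split True using s(2) by simp
    next
      case False
      then have "(\<Sum>t\<in>?T. b t * ?a t i) = 0" using i b(3) by simp
      moreover have "(\<Sum>t\<in>?T. b t * ?a t i) = (\<Sum>t\<in>?T. b t * a t i) - ?v / a s j * a s i"
        by (simp add: algebra_simps sum_subtractf sum_distrib_left sum_distrib_right sum_divide_distrib)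
      ultimately show ?thesis unfolding split by simp
    qed
    have "\<exists>t\<in>T. b' t \<noteq> 0" using b(2) by (auto simp: b'_def)
    then show ?thesis using b'F z by (intro exI[of _ b']) auto
  qed
qed

text \<open>If all powers of \<open>x\<close> lie in the span over \<open>F\<close> of finitely many elements, then finitely many powers are
  dependent over \<open>F\<close>, and a linear dependence is a polynomial equation.\<close>

lemma alg_closure_by_powers:
  assumes F: "subfield F (scalars (UNIV :: 'c::field set))" and J: "finite J"
    and x: "\<And>t::nat. \<exists>a. (\<forall>j. a j \<in> F) \<and> x ^ t = (\<Sum>j\<in>J. v j * a j)"
  shows "x \<in> alg_closure_of F"
proof -
  obtain a where a: "\<forall>t::nat. (\<forall>j. a t j \<in> F) \<and> x ^ t = (\<Sum>j\<in>J. v j * a t j)"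
    using choice[of "\<lambda>t a. (\<forall>j. a j \<in> F) \<and> x ^ t = (\<Sum>j\<in>J. v j * a j)"] x by blast
  let ?T = "{..card J}"
  obtain b where b: "\<forall>t. b t \<in> F" "\<exists>t\<in>?T. b t \<noteq> 0" "\<forall>j\<in>J. (\<Sum>t\<in>?T. b t * a t j) = 0"
    using linear_dependence[OF F J, of ?T a] a by auto
  define f where "f = (\<Sum>t\<in>?T. Polynomial.monom (b t) t)"
  have cf: "poly.coeff f i = (if i \<in> ?T then b i else 0)" for i
  proof -
    have "poly.coeff f i = (\<Sum>t\<in>?T. if t = i then b t else 0)" by (simp add: f_def coeff_sum)
    then show ?thesis by simp
  qed
  have "poly f x = (\<Sum>t\<in>?T. b t * x ^ t)" by (simp add: f_def poly_sum poly_monom)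
  also have "\<dots> = (\<Sum>t\<in>?T. \<Sum>j\<in>J. v j * (b t * a t j))"
  proof (rule sum.cong[OF refl])
    fix t
    have "x ^ t = (\<Sum>j\<in>J. v j * a t j)" using a by blast
    then show "b t * x ^ t = (\<Sum>j\<in>J. v j * (b t * a t j))" by (simp add: sum_distrib_left mult_ac)
  qed
  also have "\<dots> = (\<Sum>j\<in>J. v j * (\<Sum>t\<in>?T. b t * a t j))" by (subst sum.swap) (simp add: sum_distrib_left)
  also have "\<dots> = 0" using b(3) by (intro sum.neutral) auto
  finally have "poly f x = 0" .
  moreover have "f \<noteq> 0" using b(2) cf by (metis coeff_0)
  moreover have "poly.coeff f i \<in> F" for i using b(1) cf subfield_scalars_closed(1)[OF F] by simp
  ultimately show ?thesis unfolding alg_closure_of_def by blast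
qed

text \<open>A root \<open>w\<close> of \<open>1 + X + \<dots> + X\<^bsup>p - 1\<^esup>\<close> is different from \<open>1\<close> in characteristic zero, and a
  \<open>p\<^bsup>N - 1\<^esup>\<close>-th root of \<open>w\<close> has exact order \<open>p\<^sup>N\<close>.\<close>

lemma primitive_root:
  assumes p: "prime (p::nat)"
  shows "\<exists>\<zeta>::'c::{alg_closed_field, field_char_0}. \<zeta> ^ (p ^ N) = 1 \<and> inj_on (\<lambda>a. \<zeta> ^ a) {..<p ^ N}"
proof (cases N)
  case 0
  then show ?thesis by (intro exI[of _ 1]) (auto simp: inj_on_def)
next
  case (Suc M)
  have p2: "p \<ge> 2" using p by (simp add: prime_ge_2_nat)
  let ?f = "\<Sum>t<p. Polynomial.monom (1::'c) t"
  have cf: "poly.coeff ?f i = (if i < p then 1 else 0)" for i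
    by (simp add: coeff_sum)
  have "Polynomial.degree ?f > 0"
  proof -
    have "poly.coeff ?f 1 \<noteq> 0" using cf[of 1] p2 by simp
    then have "1 \<le> Polynomial.degree ?f" by (rule le_degree)
    then show ?thesis by simp
  qed
  then obtain w where "poly ?f w = 0" using alg_closed_imp_poly_has_root by blast
  then have w0: "(\<Sum>t<p. w ^ t) = 0" by (simp add: poly_sum poly_monom)
  have w1: "w \<noteq> 1" using w0 p2 by auto
  have wp: "w ^ p = 1"
  proof -
    have "w ^ p - 1 = (w - 1) * (\<Sum>t<p. w ^ t)" by (rule power_diff_1_eq)
    then show ?thesis unfolding w0 by simp
  qed
  have "p ^ M > 0" using p2 by simp
  then obtain z where z: "z ^ (p ^ M) = w" using nth_root_exists by blast
  have zN: "z ^ (p ^ N) = 1" using z wp by (simp add: Suc power_mult mult.commute[of p])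
  have no: "z ^ j \<noteq> 1" if j: "0 < j" "j < p ^ N" for j
  proof
    assume zj: "z ^ j = 1"
    obtain x y where xy: "j * x = p ^ N * y + gcd j (p ^ N)" using bezout_nat[of j "p ^ N"] j by auto
    have "z ^ (j * x) = z ^ (p ^ N * y + gcd j (p ^ N))" by (simp only: xy)
    then have g: "z ^ gcd j (p ^ N) = 1" using zj zN by (simp add: power_add power_mult)
    obtain k where k: "gcd j (p ^ N) = p ^ k" using divides_primepow_nat[OF p] by (metis gcd_dvd2)
    have "p ^ k \<le> j" using k j(1) by (metis dvd_imp_le gcd_dvd1)
    then have "p ^ k < p ^ N" using j by simp
    then have "k < N" using p2 by (simp add: power_strict_increasing_iff)
    then have "p ^ M = p ^ k * p ^ (M - k)" using Suc by (simp flip: power_add)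
    then have "z ^ (p ^ M) = (z ^ (p ^ k)) ^ (p ^ (M - k))" by (simp only: power_mult)
    then show False using g k z w1 by simp
  qed
  have znz: "z \<noteq> 0" using zN p2 by (metis power_0_left power_eq_0_iff zero_neq_one less_irrefl not_numeral_le_zero)
  have "inj_on (\<lambda>a. z ^ a) {..<p ^ N}"
  proof (rule linorder_inj_onI)
    fix a b assume ab: "a < b" "a \<in> {..<p ^ N}" "b \<in> {..<p ^ N}"
    have "z ^ b = z ^ a * z ^ (b - a)" using ab by (simp flip: power_add)
    then show "z ^ a \<noteq> z ^ b" using no[of "b - a"] ab znz by auto
  qed auto
  then show ?thesis using zN by blast
qed

context pdatum
begin

lemma root_of_unity_alg: "n > 0 \<Longrightarrow> z ^ n = 1 \<Longrightarrow> z \<in> alg_closure_of K"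
proof -
  assume n: "n > 0" "z ^ n = 1"
  let ?f = "Polynomial.monom 1 n - 1 :: 'c poly"
  have "poly.coeff ?f n \<noteq> 0" using n by (simp add: coeff_1)
  then have "?f \<noteq> 0" by (metis coeff_0)
  moreover have "poly.coeff ?f i \<in> K" for i by (auto simp: coeff_1 intro!: K_diff K_minus)
  moreover have "poly ?f z = 0" using n by (simp add: poly_monom)
  ultimately show ?thesis unfolding alg_closure_of_def by blast
qed

lemma root_of_unity_sm: "n > 0 \<Longrightarrow> z ^ n = 1 \<Longrightarrow> sm 0 z"
proof -
  assume n: "n > 0" "z ^ n = 1"
  then have nz: "z \<noteq> 0" by (metis power_0_left zero_neq_one less_irrefl)
  obtain r where r: "ordp A z = ereal r" using ord_finite[OF nz] by auto
  have "ordp A (z ^ n) = ereal (real n * r)" using ord_power[OF r, of n] by simp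
  moreover have "ordp A (z ^ n) = 0" using n ord_one by simp
  ultimately have "r = 0" using n by (simp add: zero_ereal_def)
  then show ?thesis using r by (simp add: sm_def)
qed

lemma res_pow_p: "x \<in> cG i \<Longrightarrow> res i M (x [^]\<^bsub>Gam A i\<^esub> (prm A ^ M)) = 0"
proof -
  assume x: "x \<in> cG i"
  let ?g = "gam A i [^]\<^bsub>Gam A i\<^esub> res i M x"
  have "near i M (x [^]\<^bsub>Gam A i\<^esub> (prm A ^ M)) (?g [^]\<^bsub>Gam A i\<^esub> (prm A ^ M))"
    using x near_res[OF x] by (intro near_pow) auto
  moreover have "?g [^]\<^bsub>Gam A i\<^esub> (prm A ^ M) = gam A i [^]\<^bsub>Gam A i\<^esub> (res i M x * prm A ^ M)"
    using group_Gam by (simp add: group.is_monoid monoid.nat_pow_pow)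
  ultimately show ?thesis using near_gam_res[of "x [^]\<^bsub>Gam A i\<^esub> (prm A ^ M)" i M "res i M x * prm A ^ M"] x by simp
qed

lemma foc:
  assumes f: "finite_order_character A i \<phi>"
  shows "x \<in> cG i \<Longrightarrow> y \<in> cG i \<Longrightarrow> \<phi> (x \<otimes>\<^bsub>Gam A i\<^esub> y) = \<phi> x * \<phi> y"
    "\<exists>n>0. \<forall>x\<in>cG i. \<phi> x ^ n = 1" "\<phi> \<one>\<^bsub>Gam A i\<^esub> = 1"
    "x \<in> cG i \<Longrightarrow> \<phi> (x [^]\<^bsub>Gam A i\<^esub> (r::nat)) = \<phi> x ^ r"
proof -
  show 1: "\<phi> (x \<otimes>\<^bsub>Gam A i\<^esub> y) = \<phi> x * \<phi> y" if "x \<in> cG i" "y \<in> cG i" for x y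
    using f that by (auto simp: finite_order_character_def hom_def)
  show 2: "\<exists>n>0. \<forall>x\<in>cG i. \<phi> x ^ n = 1" using f by (simp add: finite_order_character_def)
  obtain n where n: "n > 0" "\<forall>x\<in>cG i. \<phi> x ^ n = 1" using 2 by blast
  have "\<phi> \<one>\<^bsub>Gam A i\<^esub> \<noteq> 0" using n by (metis one_in power_0_left less_irrefl zero_neq_one)
  moreover have "\<phi> \<one>\<^bsub>Gam A i\<^esub> = \<phi> \<one>\<^bsub>Gam A i\<^esub> * \<phi> \<one>\<^bsub>Gam A i\<^esub>"
    using 1[OF one_in one_in] group_Gam[of i] by (simp add: group.is_monoid)
  ultimately show 3: "\<phi> \<one>\<^bsub>Gam A i\<^esub> = 1" by simp
  show "\<phi> (x [^]\<^bsub>Gam A i\<^esub> (r::nat)) = \<phi> x ^ r" if x: "x \<in> cG i"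
    by (induction r) (simp_all add: 3 Gam_pow_Suc 1 x)
qed

text \<open>The values are roots of unity of bounded order, and \<open>1\<close> is isolated among these. By continuity the
  character is trivial near the identity, in particular on \<open>p\<^sup>L\<close>-th powers for some \<open>L\<close>.\<close>

lemma foc_level:
  assumes f: "finite_order_character A i \<phi>"
  shows "\<exists>L. \<forall>x\<in>cG i. \<phi> (x [^]\<^bsub>Gam A i\<^esub> (prm A ^ L)) = 1"
proof -
  obtain n where n: "n > 0" "\<forall>x\<in>cG i. \<phi> x ^ n = 1" using foc(2)[OF f] by blast
  \<comment> \<open>a neighbourhood of \<open>1\<close> without further roots of unity of order dividing
    \<open>n\<close>\<close>
  let ?V = "- ({z::'c. z ^ n = 1} - {1})"
  have "Polynomial.monom 1 n - 1 \<noteq> (0 :: 'c poly)"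
  proof
    assume "Polynomial.monom 1 n - 1 = (0 :: 'c poly)"
    then have "poly.coeff (Polynomial.monom 1 n - 1 :: 'c poly) n = 0" by simp
    then show False using n(1) by (simp add: coeff_1)
  qed
  from poly_roots_finite[OF this] have "finite {z::'c. z ^ n = 1}" by (simp add: poly_monom)
  then have "finite ({z::'c. z ^ n = 1} - {1})" by (rule finite_Diff)
  then have "open ?V" by (intro open_Compl finite_imp_closed)
  then have o: "openin (Gtop A i) {x \<in> topspace (Gtop A i). \<phi> x \<in> ?V}"
    using f by (intro openin_continuous_map_preimage[where Y = euclidean]) (auto simp: finite_order_character_def)
  have "\<one>\<^bsub>Gam A i\<^esub> \<in> {x \<in> topspace (Gtop A i). \<phi> x \<in> ?V}" using foc(3)[OF f] by (simp add: topspace_Gtop)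
  from nbhd_near[OF o this] obtain L where L: "\<forall>y\<in>cG i. near i L y \<one>\<^bsub>Gam A i\<^esub> \<longrightarrow> \<phi> y \<in> ?V" by auto
  have "\<phi> (x [^]\<^bsub>Gam A i\<^esub> (prm A ^ L)) = 1" if x: "x \<in> cG i" for x
  proof -
    let ?y = "x [^]\<^bsub>Gam A i\<^esub> (prm A ^ L)"
    have y: "?y \<in> cG i" using x by simp
    have "near i L ?y \<one>\<^bsub>Gam A i\<^esub>" using near_iff_res[OF y one_in] res_pow_p[OF x] by simp
    then have "\<phi> ?y \<in> ?V" using L y by blast
    moreover have "\<phi> ?y ^ n = 1" using n(2) y by blast
    ultimately show ?thesis by blast
  qed
  then show ?thesis by blast
qed

text \<open>Elements with the same residue differ by a \<open>p\<^sup>M\<close>-th power.\<close>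

lemma foc_const:
  assumes f: "finite_order_character A i (\<phi> i)" and M: "char_level A \<phi> i \<le> M"
    and xy: "x \<in> cG i" "y \<in> cG i" "res i M x = res i M y"
  shows "\<phi> i x = \<phi> i y"
proof -
  interpret group "Gam A i" by (rule group_Gam)
  let ?L = "char_level A \<phi> i"
  have L: "\<forall>x\<in>cG i. \<phi> i (x [^]\<^bsub>Gam A i\<^esub> (prm A ^ ?L)) = 1"
    unfolding char_level_def by (rule LeastI_ex[OF foc_level[OF f]])
  let ?z = "inv\<^bsub>Gam A i\<^esub> y \<otimes>\<^bsub>Gam A i\<^esub> x"
  have z: "?z \<in> cG i" using xy by simp
  have x: "x = y \<otimes>\<^bsub>Gam A i\<^esub> ?z" using xy by (simp add: m_assoc[symmetric])
  have "res i M x = (res i M y + res i M ?z) mod prm A ^ M" using res_mult[OF xy(2) z, of M] x by simp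
  then have "(res i M y + res i M ?z) mod prm A ^ M = res i M y mod prm A ^ M" using xy(3) by simp
  then have "res i M ?z = 0"
  proof -
    assume e: "(res i M y + res i M ?z) mod prm A ^ M = res i M y mod prm A ^ M"
    have "prm A ^ M dvd res i M ?z" using e by (metis mod_eq_dvd_iff_nat diff_add_inverse le_add1)
    then show ?thesis using res_less[of i M ?z] by (metis dvd_imp_le not_le gr0I)
  qed
  then obtain g where g: "g \<in> cG i" "?z = g [^]\<^bsub>Gam A i\<^esub> (prm A ^ M)" using power_of_res_zero[OF z] by blast
  have "g [^]\<^bsub>Gam A i\<^esub> (prm A ^ M) = (g [^]\<^bsub>Gam A i\<^esub> (prm A ^ ?L)) [^]\<^bsub>Gam A i\<^esub> (prm A ^ (M - ?L))"
    using g M by (simp add: nat_pow_pow flip: power_add)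
  then have "\<phi> i ?z = 1" using g L foc(4)[OF f] by simp
  then show ?thesis using x foc(1)[OF f xy(2) z] by simp
qed

end

section \<open>Arithmetic points\<close>

text \<open>An arithmetic character together with a level \<open>m\<close> at which its finite order part is constant on
  residue classes. The level is a parameter since the same character is needed at its own level and
  at larger ones.\<close>

locale pdatum_char = pdatum_de A d e for A :: "('c::{alg_closed_field, field_char_0, complete_space}, 'k::finite, 'g) datum" and d e +
  fixes w :: "'k \<Rightarrow> int" and \<phi> :: "'k \<Rightarrow> 'g \<Rightarrow> 'c" and m :: "'k \<Rightarrow> nat"
  assumes w_range: "w \<in> {d..e}" and foc_phi: "\<forall>i. finite_order_character A i (\<phi> i)"
    and level: "char_level A \<phi> \<le> m"
begin

text \<open>The value of the finite order part on the residue class of \<open>r\<close>.\<close>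

definition "ph r = (\<Prod>i\<in>UNIV. \<phi> i (gam A i) ^ (r i :: nat))"

text \<open>The homomorphism attached to the character, as a finite sum of values on cut-off characters.\<close>

definition "kap l = (\<Sum>r\<in>Rm m. ph r * l (bas m r w))"
definition "radd s t = (\<lambda>i. (s i + t i) mod prm A ^ m i)"

lemma foc_i: "finite_order_character A i (\<phi> i)" using foc_phi by blast

lemma w_wt: "\<exists>n\<in>dbox. w = wt n"
  using w_range unfolding weights_dbox by blast

lemma bas_w: "bas m r w \<in> C_fun A d e" "bas m r w \<in> W m" "bas m r w \<in> cts A"
proof -
  obtain n where n: "n \<in> dbox" "w = wt n" using w_wt by blast
  show "bas m r w \<in> C_fun A d e" using bas_C_fun[OF n(1)] n(2) by simp
  show "bas m r w \<in> W m" using bas_W[OF n(1)] n(2) by simp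
qed (rule bas_cts)

lemma ph_root: "\<exists>n>0. \<forall>r. ph r ^ n = 1"
proof -
  have "\<forall>i. \<exists>n>0. \<forall>x\<in>cG i. \<phi> i x ^ n = 1" using foc(2)[OF foc_i] by blast
  then obtain n where n: "\<forall>i. n i > 0 \<and> (\<forall>x\<in>cG i. \<phi> i x ^ n i = 1)"
    using choice[of "\<lambda>i n. n > 0 \<and> (\<forall>x\<in>cG i. \<phi> i x ^ n = 1)"] by blast
  let ?N = "\<Prod>i\<in>UNIV. n i"
  have one: "\<phi> i (gam A i) ^ ?N = 1" for i
  proof -
    have "n i dvd ?N" by (rule dvd_prodI) auto
    then obtain q where "?N = n i * q" ..
    moreover have "\<phi> i (gam A i) ^ n i = 1" using n gam_in by blast
    ultimately show ?thesis by (simp only: power_mult power_one)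
  qed
  have "ph r ^ ?N = 1" for r
  proof -
    have "ph r ^ ?N = (\<Prod>i\<in>UNIV. (\<phi> i (gam A i) ^ ?N) ^ r i)"
      unfolding ph_def prod_power_distrib by (simp only: power_mult[symmetric] mult.commute)
    then show ?thesis by (simp only: one power_one prod.neutral_const)
  qed
  moreover have "?N > 0" using n by (intro prod_pos) auto
  ultimately show ?thesis by blast
qed

lemma ph_alg: "ph r \<in> alg_closure_of K" and ph_sm: "sm 0 (ph r)"
  using ph_root root_of_unity_alg root_of_unity_sm by blast+

lemma phi_gam: "\<phi> i (gam A i) ^ (a mod prm A ^ m i) = \<phi> i (gam A i) ^ a"
proof -
  have L: "char_level A \<phi> i \<le> m i" using level by (simp add: le_fun_def)
  have "\<phi> i (gam A i [^]\<^bsub>Gam A i\<^esub> (a mod prm A ^ m i)) = \<phi> i (gam A i [^]\<^bsub>Gam A i\<^esub> a)"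
    by (rule foc_const[OF foc_i L]) auto
  then show ?thesis by (simp add: foc(4)[OF foc_i])
qed

lemma ph_radd: "ph (radd s t) = ph s * ph t"
  by (simp add: ph_def radd_def phi_gam power_add prod.distrib)

lemma phi_res: "x \<in> cG i \<Longrightarrow> \<phi> i x = \<phi> i (gam A i) ^ res i (m i) x"
proof -
  assume x: "x \<in> cG i"
  have L: "char_level A \<phi> i \<le> m i" using level by (simp add: le_fun_def)
  have "\<phi> i x = \<phi> i (gam A i [^]\<^bsub>Gam A i\<^esub> res i (m i) x)"
    by (rule foc_const[OF foc_i L]) (use x in auto)
  then show ?thesis by (simp add: foc(4)[OF foc_i])
qed

lemma char_fun_ph: "char_fun A w \<phi> = (\<lambda>x\<in>G. ph (rs m x) * wmon w x)"
proof (rule ext)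
  fix x show "char_fun A w \<phi> x = (\<lambda>x\<in>G. ph (rs m x) * wmon w x) x"
  proof (cases "x \<in> G")
    case True
    then have "\<phi> i (x i) = \<phi> i (gam A i) ^ rs m x i" for i unfolding rs_def by (intro phi_res G_in)
    then show ?thesis using True by (simp add: char_fun_def ph_def wmon_def prod.distrib mult.commute)
  qed (simp add: char_fun_def)
qed

lemma sum_bas: "x \<in> G \<Longrightarrow> (\<Sum>r\<in>Rm m. f r * bas m r w x) = f (rs m x) * wmon w x"
proof -
  assume x: "x \<in> G"
  have "(\<Sum>r\<in>Rm m. f r * bas m r w x) = (\<Sum>r\<in>Rm m. if rs m x = r then f r * wmon w x else 0)"
    using x by (intro sum.cong) (auto simp: bas_def)
  then show ?thesis by simp
qed

text \<open>The coefficients are roots of unity, which need not lie in \<open>K\<close>; this is why integrals have to be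
  extended linearly.\<close>

lemma char_fun_bas: "char_fun A w \<phi> = (\<lambda>x\<in>G. \<Sum>r\<in>Rm m. ph r * bas m r w x)"
  unfolding char_fun_ph by (rule restrict_ext) (simp add: sum_bas)

lemma radd_Rm: "radd s t \<in> Rm m" using p_gt_1 by (simp add: radd_def Rm_def)

lemma rs_mult: "x \<in> G \<Longrightarrow> y \<in> G \<Longrightarrow> rs m (x \<otimes>\<^bsub>Gprod A\<^esub> y) = radd (rs m x) (rs m y)"
  by (simp add: rs_def radd_def Gmult res_mult G_in)

lemma gtr_bas: "y \<in> G \<Longrightarrow> gtr (bas m r w) y = (\<lambda>x\<in>G. \<Sum>s\<in>Rm m. (if radd s (rs m y) = r then wmon w y else 0) * bas m s w x)"
proof (unfold gtr_def, rule restrict_ext)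
  fix x assume y: "y \<in> G" and x: "x \<in> G"
  show "bas m r w (x \<otimes>\<^bsub>Gprod A\<^esub> y) = (\<Sum>s\<in>Rm m. (if radd s (rs m y) = r then wmon w y else 0) * bas m s w x)"
    unfolding sum_bas[OF x] using x y by (simp add: bas_def rs_mult mon_mult)
qed

text \<open>A translate of a cut-off character is again a combination of cut-off characters, with the residue
  classes shifted.\<close>

lemma avg_bas:
  assumes l: "l \<in> Lam"
  shows "avg l (bas m r w) = (\<lambda>y\<in>G. \<Sum>st\<in>Rm m \<times> Rm m.
     (if radd (fst st) (snd st) = r then l (bas m (fst st) w) else 0) * bas m (snd st) w y)"
proof (unfold avg_def, rule restrict_ext)
  fix y assume y: "y \<in> G"
  have OKm: "wmon w y \<in> OK" using mon_OK[OF y] .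
  have "l (gtr (bas m r w) y) = (\<Sum>s\<in>Rm m. (if radd s (rs m y) = r then wmon w y else 0) * l (bas m s w))"
    unfolding gtr_bas[OF y] by (rule Fn_sum[OF fmod_cts l]) (use OKm bas_w in auto)
  also have "\<dots> = (\<Sum>s\<in>Rm m. \<Sum>t\<in>Rm m. (if radd s t = r then l (bas m s w) else 0) * bas m t w y)"
    unfolding sum_bas[OF y] by (rule sum.cong) auto
  also have "\<dots> = (\<Sum>st\<in>Rm m \<times> Rm m. (if radd (fst st) (snd st) = r then l (bas m (fst st) w) else 0) * bas m (snd st) w y)"
    by (simp add: sum.cartesian_product case_prod_beta)
  finally show "l (gtr (bas m r w) y) = (\<Sum>st\<in>Rm m \<times> Rm m. (if radd (fst st) (snd st) = r then l (bas m (fst st) w) else 0) * bas m (snd st) w y)" .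
qed

text \<open>Both sides are double sums over residue classes; they agree as \<open>ph\<close> is multiplicative.\<close>

lemma kap_conv:
  assumes l: "l \<in> Lam" and k: "k \<in> Lam"
  shows "kap (l \<otimes>\<^bsub>Iwasawa A\<^esub> k) = kap l * kap k"
proof -
  let ?P = "Rm m \<times> Rm m"
  have c: "(if radd (fst st) (snd st) = r then l (bas m (fst st) w) else 0) \<in> OK" for st r
    using Fn_in[OF l bas_w(3)] by simp
  have v: "(l \<otimes>\<^bsub>Iwasawa A\<^esub> k) (bas m r w) = (\<Sum>st\<in>?P. (if radd (fst st) (snd st) = r then l (bas m (fst st) w) else 0) * k (bas m (snd st) w))" for r
  proof -
    have "(l \<otimes>\<^bsub>Iwasawa A\<^esub> k) (bas m r w) = k (avg l (bas m r w))" using bas_w(3) by (simp add: convolution_avg)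
    also have "\<dots> = (\<Sum>st\<in>?P. (if radd (fst st) (snd st) = r then l (bas m (fst st) w) else 0) * k (bas m (snd st) w))"
      unfolding avg_bas[OF l] by (rule Fn_sum[OF fmod_cts k]) (use c bas_w(3) in auto)
    finally show ?thesis .
  qed
  have "kap (l \<otimes>\<^bsub>Iwasawa A\<^esub> k) = (\<Sum>st\<in>?P. \<Sum>r\<in>Rm m. ph r * ((if radd (fst st) (snd st) = r then l (bas m (fst st) w) else 0) * k (bas m (snd st) w)))"
    unfolding kap_def v sum_distrib_left by (rule sum.swap)
  also have "\<dots> = (\<Sum>st\<in>?P. ph (radd (fst st) (snd st)) * (l (bas m (fst st) w) * k (bas m (snd st) w)))"
  proof (rule sum.cong[OF refl])
    fix st
    have "(\<Sum>r\<in>Rm m. ph r * ((if radd (fst st) (snd st) = r then l (bas m (fst st) w) else 0) * k (bas m (snd st) w)))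
       = (\<Sum>r\<in>Rm m. if radd (fst st) (snd st) = r then ph r * (l (bas m (fst st) w) * k (bas m (snd st) w)) else 0)"
      by (rule sum.cong) auto
    then show "(\<Sum>r\<in>Rm m. ph r * ((if radd (fst st) (snd st) = r then l (bas m (fst st) w) else 0) * k (bas m (snd st) w)))
       = ph (radd (fst st) (snd st)) * (l (bas m (fst st) w) * k (bas m (snd st) w))"
      using radd_Rm by simp
  qed
  also have "\<dots> = (\<Sum>s\<in>Rm m. \<Sum>t\<in>Rm m. (ph s * l (bas m s w)) * (ph t * k (bas m t w)))"
    by (simp add: sum.cartesian_product case_prod_beta ph_radd mult_ac)
  also have "\<dots> = kap l * kap k" by (simp add: kap_def sum_product)
  finally show ?thesis .
qed

lemma kap_add: "l \<in> Lam \<Longrightarrow> k \<in> Lam \<Longrightarrow> kap (l \<oplus>\<^bsub>Iwasawa A\<^esub> k) = kap l + kap k"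
  by (simp add: kap_def bas_w(3) distrib_left sum.distrib)

lemma kap_smult: "kap (c \<odot>\<^bsub>Iwasawa A\<^esub> l) = c * kap l"
  by (simp add: kap_def bas_w(3) sum_distrib_left mult_ac)

lemma kap_dirac: "x \<in> G \<Longrightarrow> kap (dirac A x) = char_fun A w \<phi> x"
  unfolding char_fun_bas by (simp add: kap_def dirac_apply bas_w(3))

lemma kap_one: "kap \<one>\<^bsub>Iwasawa A\<^esub> = 1"
proof -
  have "char_fun A w \<phi> \<one>\<^bsub>Gprod A\<^esub> = 1"
    using G_one_in foc(3)[OF foc_i] chi_one unfolding char_fun_def by (simp add: Gone)
  then show ?thesis using kap_dirac[OF G_one_in] by simp
qed

text \<open>The powers of \<open>kap l\<close> are values of \<open>kap\<close>, so they lie in the span over \<open>K\<close> of the finitely many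
  numbers \<open>ph r\<close>.\<close>

lemma kap_alg:
  assumes l: "l \<in> Lam"
  shows "kap l \<in> alg_closure_of K"
proof (rule alg_closure_by_powers[OF subfield_K finite_Rm[of m]])
  fix t :: nat
  have "\<exists>k\<in>Lam. kap k = kap l ^ t"
  proof (induction t)
    case 0
    show ?case using kap_one dirac_in[OF G_one_in] by (intro bexI[of _ "\<one>\<^bsub>Iwasawa A\<^esub>"]) auto
  next
    case (Suc t)
    then obtain k where k: "k \<in> Lam" "kap k = kap l ^ t" by blast
    have "l \<otimes>\<^bsub>Iwasawa A\<^esub> k \<in> Lam" using Iw_mult_in[OF l k(1)] by simp
    moreover have "kap (l \<otimes>\<^bsub>Iwasawa A\<^esub> k) = kap l ^ Suc t" unfolding kap_conv[OF l k(1)] k(2) by simp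
    ultimately show ?case by blast
  qed
  then obtain k where k: "k \<in> Lam" "kap k = kap l ^ t" by blast
  have "k (bas m r w) \<in> K" for r using Fn_in[OF k(1) bas_w(3)] by (rule OK_K)
  then show "\<exists>a. (\<forall>r. a r \<in> K) \<and> kap l ^ t = (\<Sum>r\<in>Rm m. ph r * a r)"
    using k(2)[unfolded kap_def[of k]] by (intro exI[of _ "\<lambda>r. k (bas m r w)"]) auto
qed

lemma proj_continuous: "f \<in> cts A \<Longrightarrow> continuous_map (Iwasawa_top A) euclidean (\<lambda>l. l f)"
  unfolding Iwasawa_top_def
  by (intro continuous_map_from_subtopology continuous_map_product_projection)

text \<open>A finite combination of coordinate functions for the topology of pointwise convergence.\<close>

lemma kap_continuous: "continuous_map (Iwasawa_top A) euclidean kap"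
  unfolding continuous_map_def
proof (intro conjI allI impI)
  show "kap \<in> topspace (Iwasawa_top A) \<rightarrow> topspace euclidean" by simp
  fix V :: "'c set" assume "openin euclidean V"
  then have V: "\<forall>x\<in>V. \<exists>N. \<forall>y. sm N (y - x) \<longrightarrow> y \<in> V" by (simp add: open_iff_sm)
  show "openin (Iwasawa_top A) {l \<in> topspace (Iwasawa_top A). kap l \<in> V}"
  proof (subst openin_subopen, rule ballI)
    fix l assume "l \<in> {l \<in> topspace (Iwasawa_top A). kap l \<in> V}"
    then have l: "l \<in> topspace (Iwasawa_top A)" "kap l \<in> V" by auto
    obtain N where N: "\<forall>y. sm N (y - kap l) \<longrightarrow> y \<in> V" using V l by blast
    define U where "U r = {k \<in> topspace (Iwasawa_top A). k (bas m r w) \<in> {z. sm N (z - l (bas m r w))}}" for r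
    define T where "T = topspace (Iwasawa_top A) \<inter> (\<Inter>r\<in>Rm m. U r)"
    have oU: "openin (Iwasawa_top A) (U r)" for r
      unfolding U_def by (rule openin_continuous_map_preimage[OF proj_continuous[OF bas_w(3)]]) (simp add: open_sm)
    have oT: "openin (Iwasawa_top A) T"
    proof -
      have "openin (Iwasawa_top A) (topspace (Iwasawa_top A) \<inter> (\<Inter>r\<in>I. U r))" if "finite I" for I
        using that
      proof (induction I rule: finite_induct)
        case (insert r I)
        have "topspace (Iwasawa_top A) \<inter> (\<Inter>r\<in>insert r I. U r) = U r \<inter> (topspace (Iwasawa_top A) \<inter> (\<Inter>r\<in>I. U r))" by auto
        then show ?case using openin_Int[OF oU insert.IH] by simp
      qed simp
      then show ?thesis unfolding T_def by simp
    qed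
    have lT: "l \<in> T" using l(1) by (auto simp: T_def U_def)
    have sub: "kap k \<in> V" if k: "k \<in> T" for k
    proof -
      have "sm N (k (bas m r w) - l (bas m r w))" if "r \<in> Rm m" for r using k that by (auto simp: T_def U_def)
      then have "sm N (\<Sum>r\<in>Rm m. ph r * (k (bas m r w) - l (bas m r w)))"
        by (intro sm_sum sm_mult2 ph_sm)
      then have "sm N (kap k - kap l)" by (simp add: kap_def right_diff_distrib sum_subtractf)
      then show ?thesis using N by blast
    qed
    show "\<exists>T. openin (Iwasawa_top A) T \<and> l \<in> T \<and> T \<subseteq> {l \<in> topspace (Iwasawa_top A). kap l \<in> V}"
      using oT lT sub by (intro exI[of _ T]) (auto simp: T_def)
  qed
qed

lemma kap_arith: "arith_point A d e kap w \<phi>"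
  unfolding arith_point_def
proof (intro conjI ballI)
  show "kap \<in> ring_hom (Iwasawa A) (scalars (alg_closure_of K))"
  proof (rule ring_hom_memI)
    show "kap l \<in> carrier (scalars (alg_closure_of K))" if "l \<in> carrier (Iwasawa A)" for l
      using kap_alg that by simp
    show "kap (l \<otimes>\<^bsub>Iwasawa A\<^esub> k) = kap l \<otimes>\<^bsub>scalars (alg_closure_of K)\<^esub> kap k" if "l \<in> carrier (Iwasawa A)" "k \<in> carrier (Iwasawa A)" for l k
      using kap_conv[of l k] that by simp
    show "kap (l \<oplus>\<^bsub>Iwasawa A\<^esub> k) = kap l \<oplus>\<^bsub>scalars (alg_closure_of K)\<^esub> kap k" if "l \<in> carrier (Iwasawa A)" "k \<in> carrier (Iwasawa A)" for l k
      using kap_add[of l k] that by simp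
    show "kap \<one>\<^bsub>Iwasawa A\<^esub> = \<one>\<^bsub>scalars (alg_closure_of K)\<^esub>" using kap_one by simp
  qed
qed (use kap_smult kap_continuous w_range foc_phi kap_dirac in auto)

lemma arith_point_add:
  assumes "arith_point A d e \<kappa> w \<phi>" "l \<in> Lam" "k \<in> Lam"
  shows "\<kappa> (l \<oplus>\<^bsub>Iwasawa A\<^esub> k) = \<kappa> l + \<kappa> k"
  using assms unfolding arith_point_def ring_hom_def by simp

lemma dirac_comb:
  assumes ar: "arith_point A d e \<kappa> w \<phi>" and I: "finite I" and c: "\<And>r. r \<in> I \<Longrightarrow> c r \<in> OK" and g: "\<And>r. r \<in> I \<Longrightarrow> g r \<in> G"
  shows "(\<lambda>f\<in>cts A. \<Sum>r\<in>I. c r * f (g r)) \<in> Lam \<and> \<kappa> (\<lambda>f\<in>cts A. \<Sum>r\<in>I. c r * f (g r)) = (\<Sum>r\<in>I. c r * char_fun A w \<phi> (g r))"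
  using I c g
proof (induction I rule: finite_induct)
  case empty
  have z: "(\<lambda>f\<in>cts A. 0) \<in> Lam" using omod_facts(3)[OF Iw_omod] by simp
  from arith_point_add[OF ar z z] have "\<kappa> (\<lambda>f\<in>cts A. 0) = \<kappa> (\<lambda>f\<in>cts A. 0) + \<kappa> (\<lambda>f\<in>cts A. 0)"
    by (simp cong: restrict_cong)
  then have "\<kappa> (\<lambda>f\<in>cts A. 0) = 0" by simp
  then show ?case unfolding sum.empty using z by (intro conjI)
next
  case (insert r I)
  let ?l = "\<lambda>f\<in>cts A. \<Sum>r\<in>I. c r * f (g r)"
  let ?k = "c r \<odot>\<^bsub>Iwasawa A\<^esub> dirac A (g r)"
  have l: "?l \<in> Lam" "\<kappa> ?l = (\<Sum>r\<in>I. c r * char_fun A w \<phi> (g r))"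
    using conjunct1[OF insert.IH] conjunct2[OF insert.IH] insert.prems by blast+
  have dr: "dirac A (g r) \<in> Lam" using insert.prems by (intro dirac_in) auto
  have cr: "c r \<in> OK" using insert.prems by auto
  have k: "?k \<in> Lam" using omod_facts(2)[OF Iw_omod, of "c r" "dirac A (g r)"] dr cr by simp
  have "\<kappa> ?k = c r * \<kappa> (dirac A (g r))" using ar cr dr unfolding arith_point_def by simp
  then have kk: "\<kappa> ?k = c r * char_fun A w \<phi> (g r)" using ar insert.prems unfolding arith_point_def by simp
  have eq: "(\<lambda>f\<in>cts A. \<Sum>r\<in>insert r I. c r * f (g r)) = ?k \<oplus>\<^bsub>Iwasawa A\<^esub> ?l"
    using insert.hyps by (auto simp: dirac_apply intro!: restrict_ext)
  have "\<kappa> (?k \<oplus>\<^bsub>Iwasawa A\<^esub> ?l) = \<kappa> ?k + \<kappa> ?l"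
    by (rule arith_point_add[OF ar k l(1)])
  moreover have "?k \<oplus>\<^bsub>Iwasawa A\<^esub> ?l \<in> Lam" using omod_facts(1)[OF Iw_omod, of ?k ?l] k l(1) by (simp only: Iw_sel(1))
  ultimately show ?case unfolding eq unfolding kk l(2) sum.insert[OF insert.hyps(1,2)] by (intro conjI)
qed

text \<open>The measure \<open>l\<close> is the limit of its discretisations at level \<open>M\<close>, which have mass \<open>l(1_r)\<close> at
  \<open>\<gamma>\<^sup>r\<close>: integrating \<open>f\<close> against them is integrating a step function that tends uniformly to \<open>f\<close>.\<close>

lemma dirac_dense:
  assumes l: "l \<in> Lam"
  shows "limitin (Iwasawa_top A) (\<lambda>M. \<lambda>f\<in>cts A. \<Sum>r\<in>Rm (\<lambda>_. M). l (bas (\<lambda>_. M) r (\<lambda>_. 0)) * f (gpow r)) l sequentially"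
proof -
  let ?b = "\<lambda>M r. bas (\<lambda>_. M) r (\<lambda>_. 0)"
  let ?L = "\<lambda>M. \<lambda>f\<in>cts A. \<Sum>r\<in>Rm (\<lambda>_. M). l (?b M r) * f (gpow r)"
  have wm: "wmon (\<lambda>_. 0) x = 1" for x by (simp add: wmon_def)
  have in': "?L M \<in> Lam" for M
    by (rule conjunct1[OF dirac_comb[OF kap_arith finite_Rm]]) (auto intro: Fn_in[OF l bas_cts])
  have conv: "(\<lambda>M. ?L M f) \<longlonglongrightarrow> l f" if f: "f \<in> cts A" for f
    unfolding tendsto_iff_sm
  proof
    fix N
    obtain M0 where M0: "\<forall>x\<in>G. \<forall>y\<in>G. gnear (\<lambda>_. M0) x y \<longrightarrow> sm N (f x - f y)"
      using cts_uc[OF f] unfolding uc_def by blast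
    have "sm N (?L M f - l f)" if M: "M0 \<le> M" for M
    proof -
      let ?h = "\<lambda>x\<in>G. \<Sum>r\<in>Rm (\<lambda>_. M). f (gpow r) * ?b M r x"
      have fO: "f (gpow r) \<in> OK" for r using cts_OK[OF f] by simp
      have h: "?h \<in> cts A" by (rule fmod_sum[OF fmod_cts]) (use fO bas_cts in auto)
      have "?L M f = l ?h"
        using f by (subst Fn_sum[OF fmod_cts l]) (auto simp: fO bas_cts mult.commute)
      then have "?L M f - l f = l (\<lambda>x\<in>G. ?h x - f x)" using Fn_diff[OF fmod_cts l h f] by simp
      moreover have "sm N (l (\<lambda>x\<in>G. ?h x - f x))"
      proof (rule Fn_sm[OF l cts_diff[OF h f]])
        fix x assume x: "x \<in> G"
        have "?h x = (\<Sum>r\<in>Rm (\<lambda>_. M). if rs (\<lambda>_. M) x = r then f (gpow r) else 0)"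
          unfolding restrict_apply'[OF x] using x by (intro sum.cong) (auto simp: bas_def wm)
        then have "?h x = f (gpow (rs (\<lambda>_. M) x))" by simp
        moreover have "gnear (\<lambda>_. M0) (gpow (rs (\<lambda>_. M) x)) x"
          using gnear_mono[OF gnear_sym[OF gnear_rs[OF x, of "\<lambda>_. M"]], of "\<lambda>_. M0"] M by (simp add: le_fun_def)
        ultimately show "sm N ((\<lambda>x\<in>G. ?h x - f x) x)" using M0 x by simp
      qed
      ultimately show ?thesis by simp
    qed
    then show "\<forall>\<^sub>F M in sequentially. sm N (?L M f - l f)"
      unfolding eventually_sequentially by blast
  qed
  show ?thesis unfolding Iwasawa_top_def limitin_subtopology
  proof (intro conjI)
    show "l \<in> carrier (Iwasawa A)" "\<forall>\<^sub>F M in sequentially. ?L M \<in> carrier (Iwasawa A)" using l in' by auto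
    show "limitin (product_topology (\<lambda>_. euclidean) (cts A)) ?L l sequentially"
      unfolding limitin_componentwise limitin_canonical_iff
      using Fn_ext[OF l] conv by auto
  qed
qed

text \<open>Both sides are continuous and linear and agree on Dirac measures.\<close>

lemma arith_point_unique:
  assumes ar: "arith_point A d e \<kappa> w \<phi>" and l: "l \<in> Lam"
  shows "\<kappa> l = kap l"
proof -
  let ?L = "\<lambda>M. \<lambda>f\<in>cts A. \<Sum>r\<in>Rm (\<lambda>_. M). l (bas (\<lambda>_. M) r (\<lambda>_. 0)) * f (gpow r)"
  have eq: "\<kappa> (?L M) = kap (?L M)" for M
    using dirac_comb[OF ar finite_Rm, of "\<lambda>_. M" "\<lambda>r. l (bas (\<lambda>_. M) r (\<lambda>_. 0))" gpow]
      dirac_comb[OF kap_arith finite_Rm, of "\<lambda>_. M" "\<lambda>r. l (bas (\<lambda>_. M) r (\<lambda>_. 0))" gpow]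
      Fn_in[OF l bas_cts] by simp
  have c1: "continuous_map (Iwasawa_top A) euclidean \<kappa>" using ar unfolding arith_point_def by blast
  have t1: "(\<kappa> \<circ> ?L) \<longlonglongrightarrow> \<kappa> l"
    using continuous_map_limit[OF c1 dirac_dense[OF l]] unfolding limitin_canonical_iff .
  have t2: "(kap \<circ> ?L) \<longlonglongrightarrow> kap l"
    using continuous_map_limit[OF kap_continuous dirac_dense[OF l]] unfolding limitin_canonical_iff .
  have "\<kappa> \<circ> ?L = kap \<circ> ?L" by (rule ext) (simp only: o_apply eq)
  from LIMSEQ_unique[OF t1[unfolded this] t2] show ?thesis .
qed

text \<open>The expansion of the character is not unique, so independence of the choice must be shown. At a level
  \<open>M\<close> common to all functions involved, the distribution is a fixed combination of evaluations at
  points, and the value of the combination depends only on the represented function.\<close>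

lemma integral_char:
  assumes mu: "\<mu> \<in> Fn (C_fun A d e) K"
  shows "integral_ext A d e \<mu> (char_fun A w \<phi>) = (\<Sum>r\<in>Rm m. ph r * \<mu> (bas m r w))"
  unfolding integral_ext_def
proof (rule the_equality)
  obtain b where b: "bij_betw b {0..<card (Rm m)} (Rm m)" using ex_bij_betw_nat_finite[OF finite_Rm] by blast
  have b': "bij_betw b {..<card (Rm m)} (Rm m)" using b by (simp add: atLeast0LessThan)
  have re: "(\<Sum>j<card (Rm m). F (b j)) = (\<Sum>r\<in>Rm m. F r)" for F :: "_ \<Rightarrow> 'c"
    by (rule sum.reindex_bij_betw[OF b'])
  show "\<exists>(n::nat) c g. (\<forall>j<n. c j \<in> alg_closure_of K \<and> g j \<in> C_fun A d e) \<and>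
        char_fun A w \<phi> = (\<lambda>x\<in>G. \<Sum>j<n. c j * g j x) \<and> (\<Sum>r\<in>Rm m. ph r * \<mu> (bas m r w)) = (\<Sum>j<n. c j * \<mu> (g j))"
  proof (intro exI conjI)
    show "\<forall>j<card (Rm m). ph (b j) \<in> alg_closure_of K \<and> bas m (b j) w \<in> C_fun A d e"
      using ph_alg bas_w(1) by simp
    show "char_fun A w \<phi> = (\<lambda>x\<in>G. \<Sum>j<card (Rm m). ph (b j) * bas m (b j) w x)"
      unfolding char_fun_bas by (rule restrict_ext) (rule re[symmetric])
    show "(\<Sum>r\<in>Rm m. ph r * \<mu> (bas m r w)) = (\<Sum>j<card (Rm m). ph (b j) * \<mu> (bas m (b j) w))"
      by (rule re[symmetric])
  qed
next
  fix v assume "\<exists>(n::nat) c g. (\<forall>j<n. c j \<in> alg_closure_of K \<and> g j \<in> C_fun A d e) \<and>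
        char_fun A w \<phi> = (\<lambda>x\<in>G. \<Sum>j<n. c j * g j x) \<and> v = (\<Sum>j<n. c j * \<mu> (g j))"
  then obtain n :: nat and c g where g: "\<forall>j<n. g j \<in> C_fun A d e" and f: "char_fun A w \<phi> = (\<lambda>x\<in>G. \<Sum>j<n. c j * g j x)"
    and v: "v = (\<Sum>j<n. c j * \<mu> (g j))" by blast
  have "\<forall>j. \<exists>N. j < n \<longrightarrow> g j \<in> W (\<lambda>_. N)" using C_fun_W_level g by blast
  then obtain N where N: "\<forall>j. j < n \<longrightarrow> g j \<in> W (\<lambda>_. N j)" using choice[of "\<lambda>j N. j < n \<longrightarrow> g j \<in> W (\<lambda>_. N)"] by blast
  \<comment> \<open>a level common to the functions of the given expansion and to the cut-off characters\<close>
  define M where "M = (\<lambda>i. m i + (\<Sum>j<n. N j))"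
  have gM: "g j \<in> W M" if "j < n" for j
  proof -
    have "N j \<le> (\<Sum>j<n. N j)" by (rule member_le_sum) (use that in auto)
    then have "(\<lambda>_. N j) \<le> M" by (simp add: M_def le_fun_def trans_le_add2)
    then show ?thesis using W_mono N that by blast
  qed
  have "m \<le> M" by (simp add: M_def le_fun_def)
  then have bM: "bas m r w \<in> W M" for r using W_mono bas_w(2) by blast
  obtain mE where mE: "\<forall>f\<in>C_fun A d e. f \<in> W M \<longrightarrow> \<mu> f = (\<Sum>r\<in>Ebox M. f (gpow r) * mE r)"
    using mu_W_values[OF mu, of M] by blast
  have gen: "(\<Sum>j\<in>J. a j * \<mu> (q j)) = (\<Sum>s\<in>Ebox M. (\<Sum>j\<in>J. a j * q j (gpow s)) * mE s)"
    if "\<And>j. j \<in> J \<Longrightarrow> q j \<in> C_fun A d e" "\<And>j. j \<in> J \<Longrightarrow> q j \<in> W M" for J :: "'j set" and a q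
  proof -
    have "(\<Sum>j\<in>J. a j * \<mu> (q j)) = (\<Sum>j\<in>J. \<Sum>s\<in>Ebox M. a j * q j (gpow s) * mE s)"
      by (rule sum.cong) (use mE that in \<open>auto simp: sum_distrib_left mult_ac\<close>)
    also have "\<dots> = (\<Sum>s\<in>Ebox M. \<Sum>j\<in>J. a j * q j (gpow s) * mE s)" by (rule sum.swap)
    finally show ?thesis by (simp add: sum_distrib_right)
  qed
  have "(\<Sum>j<n. c j * g j (gpow s)) = (\<Sum>r\<in>Rm m. ph r * bas m r w (gpow s))" for s
    using fun_cong[OF f, of "gpow s"] unfolding char_fun_bas by simp
  then show "v = (\<Sum>r\<in>Rm m. ph r * \<mu> (bas m r w))"
    unfolding v using gen[of "{..<n}" g c] gen[of "Rm m" "\<lambda>r. bas m r w" ph] g gM bas_w(1) bM by simp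
qed

lemma point_ext_pt:
  assumes ar: "arith_point A d e \<kappa> w \<phi>" and l: "l \<in> Lam" and c: "c \<in> K"
  shows "point_ext A \<kappa> (ptens A (Iwasawa A) l c) = c * kap l"
proof -
  have "bal (Iwasawa A) H0 (\<lambda>l c. c * \<kappa> l)"
  proof (rule balI)
    fix x y c assume xy: "x \<in> carrier (Iwasawa A)" "y \<in> carrier (Iwasawa A)"
    then have "\<kappa> (x \<oplus>\<^bsub>Iwasawa A\<^esub> y) = \<kappa> x + \<kappa> y" using ar unfolding arith_point_def ring_hom_def by simp
    then show "c * \<kappa> (x \<oplus>\<^bsub>Iwasawa A\<^esub> y) = (c * \<kappa> x) \<otimes>\<^bsub>H0\<^esub> (c * \<kappa> y)" by (simp only: H0_sel distrib_left)
  next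
    fix a x c assume "a \<in> OK" "x \<in> carrier (Iwasawa A)"
    then have "\<kappa> (a \<odot>\<^bsub>Iwasawa A\<^esub> x) = a * \<kappa> x" using ar unfolding arith_point_def by blast
    then show "c * \<kappa> (a \<odot>\<^bsub>Iwasawa A\<^esub> x) = (a * c) * \<kappa> x" by (simp only: mult_ac)
  qed (simp_all add: distrib_right)
  from tlift_props(2)[OF Iw_omod H0_comm_group this, of l c] l c
  have "point_ext A \<kappa> (ptens A (Iwasawa A) l c) = c * \<kappa> l" unfolding point_ext_def by simp
  then show ?thesis using arith_point_unique[OF ar l] by simp
qed

end

section \<open>Interpolation determines the distribution\<close>

context pdatum_de
begin

lemma tmap_cl:
  assumes l: "l \<in> Lam" and c: "c \<in> K"
  shows "tmap A (Iwasawa A) (Q m) (\<lambda>l. Omega A d e m +>\<^bsub>Iwasawa A\<^esub> l) (ptens A (Iwasawa A) l c) = ptens A (Q m) (cl m l) c"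
proof -
  have "tmap A (Iwasawa A) (Q m) (cl m) (ptens A (Iwasawa A) l c) = ptens A (Q m) (cl m l) c"
    by (rule tmap_props(2)[OF Iw_omod Q_omod])
      (use l c cl_in cl_add cl_smult in \<open>simp_all add: Iw_sel(1) del: Iw_sel(4,5)\<close>)
  then show ?thesis unfolding cl_def .
qed

text \<open>On a lift \<open>l \<otimes> c\<close> of \<open>s\<close> at the level of the character, both sides are \<open>c\<close> times the sum defining \<open>kap l\<close>.\<close>

lemma interpolates_mu:
  assumes s: "s \<in> proj_limit A d e"
  shows "interpolates A d e s (mu s)"
  unfolding interpolates_def
proof (intro allI impI ballI)
  fix \<kappa> w \<phi> t
  let ?L = "char_level A \<phi>"
  assume ar: "arith_point A d e \<kappa> w \<phi>" and t: "t \<in> carrier (tens A (Iwasawa A))"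
    and lift: "tmap A (Iwasawa A) (Q ?L) (\<lambda>l. Omega A d e ?L +>\<^bsub>Iwasawa A\<^esub> l) t = s ?L"
  interpret C: pdatum_char A d e w \<phi> ?L
    using ar by unfold_locales (auto simp: arith_point_def)
  obtain l c where lc: "l \<in> Lam" "c \<in> K" "t = ptens A (Iwasawa A) l c"
    using tens_pureE[OF Iw_omod t] by (metis Iw_sel(1))
  have sL: "s ?L = ptens A (Q ?L) (cl ?L l) c" using lift tmap_cl[OF lc(1,2)] lc(3) by simp
  have "mu s (bas ?L r w) = c * l (bas ?L r w)" for r
    using mu_eq[OF s C.bas_w(1,2)] pairing_pt[OF lc(1,2) C.bas_w(2)] sL by simp
  then show "point_ext A \<kappa> t = integral_ext A d e (mu s) (char_fun A w \<phi>)"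
    unfolding C.integral_char[OF mu_in[OF s]] lc(3) C.point_ext_pt[OF ar lc(1,2)] C.kap_def
    by (simp add: sum_distrib_left mult_ac)
qed

end

text \<open>The interpolation formula at the level of the character fixes the integral of the character, because
  lifts and the arithmetic point exist; by \<open>integral_char\<close> this integral can be computed at any larger
  level.\<close>

lemma (in pdatum_char) interpolates_determines:
  assumes s: "s \<in> proj_limit A d e" and mu: "\<mu> \<in> Fn (C_fun A d e) K" and ip: "interpolates A d e s \<mu>"
  shows "(\<Sum>r\<in>Rm m. ph r * \<mu> (bas m r w)) = (\<Sum>r\<in>Rm m. ph r * mu s (bas m r w))"
proof -
  let ?L = "char_level A \<phi>"
  interpret C: pdatum_char A d e w \<phi> ?L
    using w_range foc_phi by unfold_locales auto
  obtain l c where lc: "l \<in> Lam" "c \<in> K" "s ?L = ptens A (Q ?L) (cl ?L l) c"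
    using QK_rep[OF proj_in[OF s]] by metis
  let ?t = "ptens A (Iwasawa A) l c"
  have t: "?t \<in> carrier (tens A (Iwasawa A))" using lc pt_in[where M = "Iwasawa A"] by simp
  have lift: "tmap A (Iwasawa A) (Q ?L) (\<lambda>l. Omega A d e ?L +>\<^bsub>Iwasawa A\<^esub> l) ?t = s ?L"
    using tmap_cl[OF lc(1,2)] lc(3) by simp
  have "integral_ext A d e \<nu> (char_fun A w \<phi>) = point_ext A C.kap ?t" if "interpolates A d e s \<nu>" for \<nu>
    using that C.kap_arith t lift unfolding interpolates_def by metis
  then have "integral_ext A d e \<mu> (char_fun A w \<phi>) = integral_ext A d e (mu s) (char_fun A w \<phi>)"
    using ip interpolates_mu[OF s] by simp
  then show ?thesis unfolding integral_char[OF mu] integral_char[OF mu_in[OF s]] .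
qed

text \<open>Orthogonality of the characters \<open>r \<mapsto> \<zeta>\<^bsup>\<langle>t, r\<rangle>\<^esup>\<close> of \<open>(\<int>/q)\<^sup>k\<close>.\<close>

lemma fourier_inversion:
  fixes \<delta> :: "('k::finite \<Rightarrow> nat) \<Rightarrow> 'c::field_char_0"
  assumes z: "\<zeta> ^ q = 1" "inj_on (\<lambda>a. \<zeta> ^ a) {..<q}" and q: "q > 0"
    and S: "\<And>t. (\<Sum>r\<in>{r. \<forall>i. r i < q}. (\<Prod>i\<in>UNIV. (\<zeta> ^ t i) ^ r i) * \<delta> r) = 0"
    and r0: "\<forall>i. r0 i < q"
  shows "\<delta> r0 = 0"
proof -
  let ?R = "{r :: 'k \<Rightarrow> nat. \<forall>i. r i < q}"
  have RP: "?R = PiE UNIV (\<lambda>_. {..<q})" by auto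
  have fR: "finite ?R" unfolding RP by (rule finite_PiE) auto
  have znz: "\<zeta> \<noteq> 0" using z(1) q by (metis power_0_left zero_neq_one less_irrefl)
  let ?y = "\<lambda>a b. \<zeta> ^ a / \<zeta> ^ b"
  have geo: "(\<Sum>t<q. ?y a b ^ t) = (if a = b then of_nat q else 0)" if "a < q" "b < q" for a b
  proof (cases "a = b")
    case True
    then show ?thesis using znz by simp
  next
    case False
    then have ne: "?y a b \<noteq> 1" using inj_onD[OF z(2), of a b] that znz by auto
    have "?y a b ^ q = 1"
    proof -
      have "(\<zeta> ^ a) ^ q = (\<zeta> ^ q) ^ a" for a by (simp only: power_mult[symmetric] mult.commute)
      then show ?thesis using z(1) by (simp add: power_divide)
    qed
    then have "(?y a b - 1) * (\<Sum>t<q. ?y a b ^ t) = 0" using power_diff_1_eq[of "?y a b" q] by simp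
    moreover have "?y a b - 1 \<noteq> 0" using ne by (simp only: right_minus_eq not_False_eq_True)
    ultimately have "(\<Sum>t<q. ?y a b ^ t) = 0" unfolding mult_eq_0_iff by blast
    then show ?thesis using False by (simp only: if_False)
  qed
  have orth: "(\<Sum>t\<in>?R. \<Prod>i\<in>UNIV. ?y (r i) (r0 i) ^ t i) = (if r = r0 then of_nat q ^ CARD('k) else 0)" if r: "r \<in> ?R" for r
  proof -
    have "(\<Sum>t\<in>?R. \<Prod>i\<in>UNIV. ?y (r i) (r0 i) ^ t i) = (\<Prod>i\<in>UNIV. \<Sum>t<q. ?y (r i) (r0 i) ^ t)"
      unfolding RP by (rule prod_sum_PiE[symmetric]) auto
    also have "\<dots> = (\<Prod>i\<in>UNIV. if r i = r0 i then of_nat q else 0)"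
      using r r0 by (intro prod.cong geo) auto
    also have "\<dots> = (if r = r0 then of_nat q ^ CARD('k) else 0)" by (auto simp: fun_eq_iff)
    finally show ?thesis .
  qed
  have "0 = (\<Sum>t\<in>?R. (\<Prod>i\<in>UNIV. (1 / \<zeta> ^ r0 i) ^ t i) * (\<Sum>r\<in>?R. (\<Prod>i\<in>UNIV. (\<zeta> ^ t i) ^ r i) * \<delta> r))"
    by (simp only: S mult_zero_right sum.neutral_const)
  also have "\<dots> = (\<Sum>t\<in>?R. \<Sum>r\<in>?R. (\<Prod>i\<in>UNIV. ?y (r i) (r0 i) ^ t i) * \<delta> r)"
  proof (rule sum.cong[OF refl])
    fix t
    have "(1 / \<zeta> ^ r0 i) ^ t i * (\<zeta> ^ t i) ^ r i = ?y (r i) (r0 i) ^ t i" for r i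
    proof -
      have "(\<zeta> ^ t i) ^ r i = (\<zeta> ^ r i) ^ t i" by (simp only: power_mult[symmetric] mult.commute)
      then show ?thesis by (simp add: power_divide)
    qed
    then show "(\<Prod>i\<in>UNIV. (1 / \<zeta> ^ r0 i) ^ t i) * (\<Sum>r\<in>?R. (\<Prod>i\<in>UNIV. (\<zeta> ^ t i) ^ r i) * \<delta> r)
        = (\<Sum>r\<in>?R. (\<Prod>i\<in>UNIV. ?y (r i) (r0 i) ^ t i) * \<delta> r)"
      by (simp only: sum_distrib_left mult.assoc[symmetric] prod.distrib[symmetric])
  qed
  also have "\<dots> = (\<Sum>r\<in>?R. (\<Sum>t\<in>?R. \<Prod>i\<in>UNIV. ?y (r i) (r0 i) ^ t i) * \<delta> r)"
    by (subst sum.swap) (simp only: sum_distrib_right)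
  also have "\<dots> = (\<Sum>r\<in>?R. if r = r0 then of_nat q ^ CARD('k) * \<delta> r else 0)"
    by (rule sum.cong[OF refl]) (use orth in auto)
  also have "\<dots> = of_nat q ^ CARD('k) * \<delta> r0" using fR r0 by (simp only: sum.delta) auto
  finally show ?thesis using q by simp
qed

context pdatum_de
begin

text \<open>Locally constant, as it factors through the residue modulo \<open>p\<^sup>N\<close>.\<close>

lemma root_character:
  assumes z: "\<zeta> ^ (prm A ^ N) = (1::'c)"
  shows "finite_order_character A i (\<lambda>x. \<zeta> ^ (t * res i N x))"
  unfolding finite_order_character_def
proof (intro conjI)
  have red: "\<zeta> ^ (t * (a mod prm A ^ N)) = \<zeta> ^ (t * a)" for a
  proof -
    have "\<zeta> ^ a = \<zeta> ^ (prm A ^ N * (a div prm A ^ N) + a mod prm A ^ N)" by simp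
    then have "\<zeta> ^ a = \<zeta> ^ (a mod prm A ^ N)" unfolding power_add power_mult z by simp
    then show ?thesis by (metis mult.commute power_mult)
  qed
  show "(\<lambda>x. \<zeta> ^ (t * res i N x)) \<in> hom (Gam A i) (scalars UNIV)"
    by (rule homI) (simp_all add: res_mult red distrib_left power_add)
  show "continuous_map (Gtop A i) euclidean (\<lambda>x. \<zeta> ^ (t * res i N x))"
    unfolding continuous_map_def
  proof (intro conjI allI impI)
    fix V :: "'c set"
    show "openin (Gtop A i) {x \<in> topspace (Gtop A i). \<zeta> ^ (t * res i N x) \<in> V}"
    proof (subst openin_subopen, rule ballI)
      fix x assume x: "x \<in> {x \<in> topspace (Gtop A i). \<zeta> ^ (t * res i N x) \<in> V}"
      then have xG: "x \<in> cG i" by (simp add: topspace_Gtop)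
      show "\<exists>T. openin (Gtop A i) T \<and> x \<in> T \<and> T \<subseteq> {x \<in> topspace (Gtop A i). \<zeta> ^ (t * res i N x) \<in> V}"
      proof (intro exI conjI)
        show "openin (Gtop A i) {y \<in> cG i. near i N y x}" by (rule near_open[OF xG])
        show "x \<in> {y \<in> cG i. near i N y x}" using xG by simp
        show "{y \<in> cG i. near i N y x} \<subseteq> {x \<in> topspace (Gtop A i). \<zeta> ^ (t * res i N x) \<in> V}"
          using x xG near_iff_res[of _ i x N] by (auto simp: topspace_Gtop)
      qed
    qed
  qed simp
  have "(\<zeta> ^ (t * a)) ^ (prm A ^ N) = 1" for a
  proof -
    have "(\<zeta> ^ (t * a)) ^ (prm A ^ N) = (\<zeta> ^ (prm A ^ N)) ^ (t * a)" by (simp only: power_mult[symmetric] mult.commute)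
    then show ?thesis using z by simp
  qed
  then show "\<exists>n>0. \<forall>x\<in>cG i. (\<zeta> ^ (t * res i N x)) ^ n = 1" using p_gt_1 by (intro exI[of _ "prm A ^ N"]) simp
qed

text \<open>For each weight and each level \<open>N\<close> all finite order characters that factor through level \<open>N\<close> are
  available. Fourier inversion recovers the values on the cut-off characters from the integrals, and the
  cut-off characters generate the locally polynomial functions.\<close>

lemma interpolates_unique:
  assumes s: "s \<in> proj_limit A d e" and mu: "\<mu> \<in> Fn (C_fun A d e) K" and ip: "interpolates A d e s \<mu>"
  shows "\<mu> = mu s"
proof -
  note nu = mu_in[OF s]
  have eq: "\<mu> (bas (\<lambda>_. N) r0 (wt n)) = mu s (bas (\<lambda>_. N) r0 (wt n))" if n: "n \<in> dbox" and r0: "r0 \<in> Rm (\<lambda>_. N)" for N r0 n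
  proof -
    let ?m = "\<lambda>_::'k. N"
    let ?q = "prm A ^ N"
    obtain \<zeta> :: 'c where z: "\<zeta> ^ ?q = 1" "inj_on (\<lambda>a. \<zeta> ^ a) {..<?q}"
      using primitive_root[OF prime_p, of N] by blast
    have q: "?q > 0" using p_gt_1 by simp
    let ?\<delta> = "\<lambda>r. \<mu> (bas ?m r (wt n)) - mu s (bas ?m r (wt n))"
    have RR: "Rm ?m = {r. \<forall>i. r i < ?q}" by (simp add: Rm_def)
    have "(\<Sum>r\<in>Rm ?m. (\<Prod>i\<in>UNIV. (\<zeta> ^ t i) ^ r i) * ?\<delta> r) = 0" for t
    proof -
      let ?\<phi> = "\<lambda>i x. \<zeta> ^ (t i * res i N x)"
      interpret C: pdatum_char A d e "wt n" ?\<phi> ?m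
      proof
        show "wt n \<in> {d..e}" using n weights_dbox by blast
        show "\<forall>i. finite_order_character A i (?\<phi> i)" using root_character[OF z(1)] by blast
        show "char_level A ?\<phi> \<le> ?m"
        proof (rule le_funI)
          fix i show "char_level A ?\<phi> i \<le> N"
            unfolding char_level_def by (rule Least_le) (simp add: res_pow_p)
        qed
      qed
      have ph: "C.ph r = (\<Prod>i\<in>UNIV. (\<zeta> ^ t i) ^ r i)" for r
      proof -
        have "?\<phi> i (gam A i) ^ a = (\<zeta> ^ t i) ^ a" for i a
        proof -
          have "?\<phi> i (gam A i [^]\<^bsub>Gam A i\<^esub> (1::nat)) = \<zeta> ^ (t i * (1 mod ?q))" by (simp only: res_gam)
          moreover have "gam A i [^]\<^bsub>Gam A i\<^esub> (1::nat) = gam A i"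
            using group_Gam by (simp add: group.is_monoid monoid.nat_pow_eone)
          ultimately have e: "?\<phi> i (gam A i) = \<zeta> ^ (t i * (1 mod ?q))" by simp
          show ?thesis
          proof (cases N)
            case 0
            then show ?thesis using z(1) e by simp
          next
            case (Suc M)
            then have "1 < ?q" using p_gt_1 by (intro one_less_power) auto
            then have "\<zeta> ^ (t i * (1 mod ?q)) = \<zeta> ^ t i" by (simp only: mod_less mult_1_right)
            then show ?thesis unfolding e by simp
          qed
        qed
        then show ?thesis unfolding C.ph_def by simp
      qed
      show ?thesis using C.interpolates_determines[OF s mu ip] unfolding ph
        by (simp add: right_diff_distrib sum_subtractf)
    qed
    then have "\<And>t. (\<Sum>r\<in>{r. \<forall>i. r i < ?q}. (\<Prod>i\<in>UNIV. (\<zeta> ^ t i) ^ r i) * ?\<delta> r) = 0" unfolding RR .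
    moreover have "\<forall>i. r0 i < ?q" using r0 unfolding RR by simp
    ultimately have "?\<delta> r0 = 0" by (rule fourier_inversion[OF z q, where \<delta> = ?\<delta>])
    then show ?thesis by simp
  qed
  show ?thesis
  proof (rule extensionalityI[OF Fn_ext[OF mu] Fn_ext[OF nu]])
    fix f assume f: "f \<in> C_fun A d e"
    from C_fun_expand[OF f] obtain M0 where M0: "\<forall>m. (\<forall>i. M0 \<le> m i) \<longrightarrow> (\<exists>c. (\<forall>r n. c r n \<in> OK) \<and>
      f = (\<lambda>x\<in>G. \<Sum>rn\<in>Rm m \<times> dbox. c (fst rn) (snd rn) * bas m (fst rn) (wt (snd rn)) x))" ..
    let ?m = "\<lambda>_::'k. M0"
    obtain c where c: "\<forall>r n. c r n \<in> OK" and fe: "f = (\<lambda>x\<in>G. \<Sum>rn\<in>Rm ?m \<times> dbox. c (fst rn) (snd rn) * bas ?m (fst rn) (wt (snd rn)) x)"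
      using M0[rule_format, of ?m] by auto
    have val: "\<nu> f = (\<Sum>rn\<in>Rm ?m \<times> dbox. c (fst rn) (snd rn) * \<nu> (bas ?m (fst rn) (wt (snd rn))))" if "\<nu> \<in> Fn (C_fun A d e) K" for \<nu>
      unfolding fe by (rule Fn_sum[OF fmod_C_fun that]) (use c bas_C_fun in auto)
    show "\<mu> f = mu s f" unfolding val[OF mu] val[OF nu]
      by (rule sum.cong[OF refl]) (use eq in auto)
  qed
qed

end

theorem theoremD:
  fixes A :: "('c::{alg_closed_field, field_char_0, complete_space}, 'k::finite, 'g) datum"
    and h :: "'k \<Rightarrow> real" and d e :: "'k \<Rightarrow> int"
  assumes "is_datum A"
    and "\<forall>i. ereal (h i) \<in> ordp A ` (val_ring A - {0})"
    and "d \<le> e"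
  shows "(\<exists>!\<Psi>. \<Psi> \<in> interpolating_isos A d e h) \<and>
    (\<forall>\<Psi> \<in> interpolating_isos A d e h.
      (\<forall>s \<in> I_set A d e h. \<forall>\<mu> \<in> D_set A d e h. interpolates A d e s \<mu> \<longrightarrow> \<mu> = \<Psi> s) \<and>
      {\<mu> \<in> D_set A d e h. v_adm A d e h \<mu> \<ge> c_const A d e} \<subseteq> \<Psi> ` I0_set A d e h \<and>
      \<Psi> ` I0_set A d e h \<subseteq> {\<mu> \<in> D_set A d e h. v_adm A d e h \<mu> \<ge> 0})"
proof -
  interpret pdatum_deh A d e h using assms by unfold_locales auto
  have PL: "s \<in> proj_limit A d e" if "s \<in> I_set A d e h" for s using that by (simp add: I_set_def)
  have uniq: "\<mu> = mu s" if "s \<in> I_set A d e h" "\<mu> \<in> D_set A d e h" "interpolates A d e s \<mu>" for s \<mu>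
    using interpolates_unique[OF PL[OF that(1)] _ that(3)] that(2) by (simp add: D_set_def)
  have Psi: "Psi \<in> interpolating_isos A d e h"
    unfolding interpolating_isos_def using Psi_iso interpolates_mu[OF PL] by (simp add: Psi_def)
  have only: "\<Psi> = Psi" if P: "\<Psi> \<in> interpolating_isos A d e h" for \<Psi>
  proof -
    have PiE: "\<Psi> \<in> I_set A d e h \<rightarrow>\<^sub>E D_set A d e h" and ip: "\<forall>s\<in>I_set A d e h. interpolates A d e s (\<Psi> s)"
      using P by (simp_all add: interpolating_isos_def module_iso_def I_module_def D_module_def)
    show ?thesis
    proof (rule extensionalityI)
      show "\<Psi> \<in> extensional (I_set A d e h)" using PiE by (simp add: PiE_def)
      show "Psi \<in> extensional (I_set A d e h)" by (simp add: Psi_def)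
      fix s assume s: "s \<in> I_set A d e h"
      show "\<Psi> s = Psi s" using uniq[OF s PiE_mem[OF PiE s]] ip s by (simp add: Psi_def)
    qed
  qed
  have img: "Psi ` I0_set A d e h = mu ` I0_set A d e h"
    by (rule image_cong) (auto simp: Psi_def I0_set_def)
  show ?thesis
  proof (intro conjI ballI)
    show "\<exists>!\<Psi>. \<Psi> \<in> interpolating_isos A d e h" using Psi only by blast
    fix \<Psi> assume "\<Psi> \<in> interpolating_isos A d e h"
    then have P: "\<Psi> = Psi" by (rule only)
    show "interpolates A d e s \<mu> \<longrightarrow> \<mu> = \<Psi> s" if "s \<in> I_set A d e h" "\<mu> \<in> D_set A d e h" for s \<mu>
      using uniq[OF that] that(1) unfolding P by (simp add: Psi_def)
    show "{\<mu> \<in> D_set A d e h. v_adm A d e h \<mu> \<ge> c_const A d e} \<subseteq> \<Psi> ` I0_set A d e h"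
      unfolding P img by (rule mu_lower)
    show "\<Psi> ` I0_set A d e h \<subseteq> {\<mu> \<in> D_set A d e h. v_adm A d e h \<mu> \<ge> 0}"
      unfolding P img by (rule mu_upper)
  qed
qed

end
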